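(* Let $K,L\subsetneqq H^2$ be closed convex sets with interior points. Suppose that, if all connected components of the boundaries of both $K$ and $L$ are straight lines, then the numbers of these connected components are finite. Then the following statements are equivalent. (1) For all orientation preserving congruences $\varphi,\psi:H^2\to H^2$ for which $\mathrm{int}\,((\varphi K)\cap(\psi L))\neq\emptyset$, the set $(\varphi K)\cap(\psi L)$ is centrally symmetric. (2) $K$ and $L$ are two congruent circles.
   Context: $H^2$ is the hyperbolic plane of curvature $-1$. A congruence is an isometry of $H^2$ onto itself. A set is centrally symmetric if it is invariant under the point reflection (rotation by angle $\pi$) about some point of $H^2$. When $K$ or $L$ is said to be a circle, the closed disc (closed metric ball of positive radius) is meant. *)

theory Defs
  imports "HOL-Analysis.Analysis"
begin

text \<open>
  The hyperbolic plane of curvature \<open>-1\<close> in the Poincare disc model, i.e. the open unit disc with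
  the Riemannian metric \<open>4 \<bar>dz\<bar>\<^sup>2 / (1 - \<bar>z\<bar>\<^sup>2)\<^sup>2\<close>. It is made a type of class
  \<^class>\<open>metric_space\<close>, so that \<^const>\<open>closed\<close>, \<^const>\<open>interior\<close>, \<^const>\<open>frontier\<close>,
  \<^const>\<open>components\<close> and \<^const>\<open>cball\<close> refer to the hyperbolic metric.
\<close>

typedef hyp_plane = "ball (0::complex) 1"
  morphisms to_disc of_disc
  by (rule exI[of _ 0]) simp

definition hyp_cosh :: "complex \<Rightarrow> complex \<Rightarrow> real" where
  "hyp_cosh z w = 1 + 2 * (cmod (z - w))\<^sup>2 / ((1 - (cmod z)\<^sup>2) * (1 - (cmod w)\<^sup>2))"

text \<open>
  Hyperboloid coordinates, used for the triangle inequality: \<open>hyp_cosh z w\<close> is minus the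
  Lorentz product of the images of \<open>z\<close> and \<open>w\<close> on the hyperboloid.
\<close>

definition lor :: "complex \<Rightarrow> real \<times> real \<times> real" where
  "lor z = ((1 + (cmod z)\<^sup>2) / (1 - (cmod z)\<^sup>2), 2 * Re z / (1 - (cmod z)\<^sup>2), 2 * Im z / (1 - (cmod z)\<^sup>2))"

lemma disc_pos: "z \<in> ball (0::complex) 1 \<Longrightarrow> 0 < 1 - (cmod z)\<^sup>2"
  by (simp add: power_less_one_iff abs_square_less_1)

lemma hyp_cosh_lor:
  assumes "z \<in> ball 0 1" "w \<in> ball 0 1" "lor z = (a, b, c)" "lor w = (a', b', c')"
  shows "hyp_cosh z w = a * a' - b * b' - c * c'"
proof -
  have p: "0 < 1 - (cmod z)\<^sup>2" "0 < 1 - (cmod w)\<^sup>2"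
    using assms disc_pos by auto
  have e: "(1 - (cmod z)\<^sup>2) * (1 - (cmod w)\<^sup>2) + 2 * (cmod (z - w))\<^sup>2 =
      (1 + (cmod z)\<^sup>2) * (1 + (cmod w)\<^sup>2) - 2 * Re z * (2 * Re w) - 2 * Im z * (2 * Im w)"
    unfolding cmod_power2 by (simp add: power2_eq_square algebra_simps)
  have "hyp_cosh z w = ((1 - (cmod z)\<^sup>2) * (1 - (cmod w)\<^sup>2) + 2 * (cmod (z - w))\<^sup>2) /
      ((1 - (cmod z)\<^sup>2) * (1 - (cmod w)\<^sup>2))"
    unfolding hyp_cosh_def using p by (simp add: add_divide_distrib)
  also have "\<dots> = a * a' - b * b' - c * c'"
    unfolding e using assms(3,4) by (auto simp: lor_def diff_divide_distrib)
  finally show ?thesis .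
qed

lemma lor_norm:
  assumes "z \<in> ball 0 1" "lor z = (a, b, c)"
  shows "a\<^sup>2 - b\<^sup>2 - c\<^sup>2 = 1"
proof -
  have "hyp_cosh z z = 1" by (simp add: hyp_cosh_def)
  with hyp_cosh_lor[OF assms(1,1) assms(2,2)] show ?thesis
    by (simp add: power2_eq_square)
qed

lemma hyp_cosh_ge_1: "z \<in> ball 0 1 \<Longrightarrow> w \<in> ball 0 1 \<Longrightarrow> 1 \<le> hyp_cosh z w"
  using disc_pos[of z] disc_pos[of w] by (simp add: hyp_cosh_def)

lemma lor_gram:
  fixes a b c :: real
  assumes "a\<^sup>2 - b\<^sup>2 - c\<^sup>2 = 1" "a'\<^sup>2 - b'\<^sup>2 - c'\<^sup>2 = 1" "a''\<^sup>2 - b''\<^sup>2 - c''\<^sup>2 = 1"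
    and "A = a * a' - b * b' - c * c'" "B = a' * a'' - b' * b'' - c' * c''"
      "C = a * a'' - b * b'' - c * c''"
  shows "1 - A\<^sup>2 - B\<^sup>2 - C\<^sup>2 + 2 * A * B * C =
    (a * (b' * c'' - b'' * c') - b * (a' * c'' - a'' * c') + c * (a' * b'' - a'' * b'))\<^sup>2"
proof -
  define P where "P = a\<^sup>2 - b\<^sup>2 - c\<^sup>2"
  define Q where "Q = a'\<^sup>2 - b'\<^sup>2 - c'\<^sup>2"
  define R where "R = a''\<^sup>2 - b''\<^sup>2 - c''\<^sup>2"
  have "P * Q * R - A\<^sup>2 * R - B\<^sup>2 * P - C\<^sup>2 * Q + 2 * A * B * C =
    (a * (b' * c'' - b'' * c') - b * (a' * c'' - a'' * c') + c * (a' * b'' - a'' * b'))\<^sup>2"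
    unfolding P_def Q_def R_def assms(4-6) by algebra
  moreover have "P = 1" "Q = 1" "R = 1" using assms(1-3) by (auto simp: P_def Q_def R_def)
  ultimately show ?thesis by simp
qed

lemma hyp_triangle:
  assumes "x \<in> ball 0 1" "y \<in> ball 0 1" "z \<in> ball 0 1"
  shows "arcosh (hyp_cosh x z) \<le> arcosh (hyp_cosh x y) + arcosh (hyp_cosh y z)"
proof -
  define A B C where "A = hyp_cosh x y" and "B = hyp_cosh y z" and "C = hyp_cosh x z"
  have ge: "1 \<le> A" "1 \<le> B" "1 \<le> C"
    using assms by (auto simp: A_def B_def C_def intro!: hyp_cosh_ge_1)
  obtain a b c a' b' c' a'' b'' c'' where
    l: "lor x = (a, b, c)" "lor y = (a', b', c')" "lor z = (a'', b'', c'')"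
    by (meson prod_cases3)
  have "0 \<le> 1 - A\<^sup>2 - B\<^sup>2 - C\<^sup>2 + 2 * A * B * C"
    using lor_gram[OF lor_norm[OF assms(1) l(1)] lor_norm[OF assms(2) l(2)] lor_norm[OF assms(3) l(3)]
        hyp_cosh_lor[OF assms(1,2) l(1,2)] hyp_cosh_lor[OF assms(2,3) l(2,3)]
        hyp_cosh_lor[OF assms(1,3) l(1,3)]]
    unfolding A_def B_def C_def by simp
  then have "(C - A * B)\<^sup>2 \<le> (A\<^sup>2 - 1) * (B\<^sup>2 - 1)"
    by (simp add: power2_eq_square algebra_simps)
  then have "\<bar>C - A * B\<bar> \<le> sqrt ((A\<^sup>2 - 1) * (B\<^sup>2 - 1))"
    by (metis real_sqrt_abs real_sqrt_le_mono)
  then have "C \<le> A * B + sqrt (A\<^sup>2 - 1) * sqrt (B\<^sup>2 - 1)"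
    by (simp add: real_sqrt_mult)
  also have "\<dots> = cosh (arcosh A + arcosh B)"
    using ge by (simp add: cosh_add sinh_arcosh_real)
  finally have "C \<le> cosh (arcosh A + arcosh B)" .
  then have "cosh (arcosh C) \<le> cosh (arcosh A + arcosh B)"
    using ge by simp
  then have "arcosh C \<le> arcosh A + arcosh B"
    using ge by (subst (asm) cosh_real_nonneg_le_iff) auto
  then show ?thesis unfolding A_def B_def C_def .
qed

instantiation hyp_plane :: metric_space
begin

definition dist_hyp_plane_def:
  "dist x y = arcosh (1 + 2 * (cmod (to_disc x - to_disc y))\<^sup>2 /
     ((1 - (cmod (to_disc x))\<^sup>2) * (1 - (cmod (to_disc y))\<^sup>2)))"

definition uniformity_hyp_plane_def:
  "(uniformity :: (hyp_plane \<times> hyp_plane) filter) = (INF e\<in>{0<..}. principal {(x, y). dist x y < e})"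

definition open_hyp_plane_def:
  "open (U :: hyp_plane set) \<longleftrightarrow>
    (\<forall>x\<in>U. eventually (\<lambda>(x', y). x' = x \<longrightarrow> y \<in> U) uniformity)"

instance
proof
  fix x y z :: hyp_plane
  have d: "dist u v = arcosh (hyp_cosh (to_disc u) (to_disc v))" for u v :: hyp_plane
    by (simp add: dist_hyp_plane_def hyp_cosh_def)
  have pos: "0 < 1 - (cmod (to_disc u))\<^sup>2" for u
    using to_disc[of u] by (rule disc_pos)
  show "dist x y = 0 \<longleftrightarrow> x = y"
  proof
    assume "dist x y = 0"
    then have "hyp_cosh (to_disc x) (to_disc y) = 1"
      using arcosh_eq_0_iff_real[OF hyp_cosh_ge_1[OF to_disc to_disc]] by (simp add: d)
    then show "x = y"
      using pos[of x] pos[of y] by (auto simp: hyp_cosh_def to_disc_inject)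
  qed (simp add: dist_hyp_plane_def)
  have "dist x y \<le> dist x z + dist z y"
    unfolding d by (intro hyp_triangle to_disc)
  moreover have "dist z y = dist y z"
    by (simp add: dist_hyp_plane_def norm_minus_commute mult.commute)
  ultimately show "dist x y \<le> dist x z + dist y z" by simp
qed (simp_all add: uniformity_hyp_plane_def open_hyp_plane_def)

end

definition congruence :: "(hyp_plane \<Rightarrow> hyp_plane) \<Rightarrow> bool" where
  "congruence f \<longleftrightarrow> surj f \<and> (\<forall>x y. dist (f x) (f y) = dist x y)"

text \<open>
  The disc coordinate is a global chart, and \<open>Im (cnj (D 1) * D \<i>)\<close> is the determinant of the
  real-linear map \<open>D\<close> with respect to the basis \<open>1, \<i>\<close>.
\<close>

definition orientation_preserving :: "(hyp_plane \<Rightarrow> hyp_plane) \<Rightarrow> bool" where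
  "orientation_preserving f \<longleftrightarrow>
    (\<forall>x. \<exists>D. ((\<lambda>z. to_disc (f (of_disc z))) has_derivative D) (at (to_disc x)) \<and>
      0 < Im (cnj (D 1) * D \<i>))"

definition hyp_segment :: "hyp_plane \<Rightarrow> hyp_plane \<Rightarrow> hyp_plane set" where
  "hyp_segment x y = {z. dist x z + dist z y = dist x y}"

definition hyp_convex :: "hyp_plane set \<Rightarrow> bool" where
  "hyp_convex S \<longleftrightarrow> (\<forall>x\<in>S. \<forall>y\<in>S. hyp_segment x y \<subseteq> S)"

definition straight_line :: "hyp_plane set \<Rightarrow> bool" where
  "straight_line S \<longleftrightarrow>
    (\<exists>\<gamma> :: real \<Rightarrow> hyp_plane. (\<forall>s t. dist (\<gamma> s) (\<gamma> t) = \<bar>s - t\<bar>) \<and> S = range \<gamma>)"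

text \<open>
  The point reflection about \<open>c\<close> sends each \<open>x\<close> to the point \<open>y\<close> such that \<open>c\<close> is the midpoint
  of \<open>x\<close> and \<open>y\<close>; this determines \<open>y\<close>, since geodesics extend uniquely.
\<close>

definition point_reflection :: "hyp_plane \<Rightarrow> (hyp_plane \<Rightarrow> hyp_plane) \<Rightarrow> bool" where
  "point_reflection c f \<longleftrightarrow> (\<forall>x. dist c (f x) = dist c x \<and> dist x (f x) = 2 * dist c x)"

definition centrally_symmetric :: "hyp_plane set \<Rightarrow> bool" where
  "centrally_symmetric S \<longleftrightarrow> (\<exists>c f. point_reflection c f \<and> f ` S = S)"

definition hyp_disc :: "hyp_plane set \<Rightarrow> bool" where
  "hyp_disc S \<longleftrightarrow> (\<exists>c r. 0 < r \<and> S = cball c r)"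

definition hyp_congruent :: "hyp_plane set \<Rightarrow> hyp_plane set \<Rightarrow> bool" where
  "hyp_congruent S T \<longleftrightarrow> (\<exists>f. congruence f \<and> f ` S = T)"

end

theory Submission
  imports Defs
begin

text \<open>
  Work on the hyperboloid, where the point reflection about \<open>c\<close> is \<open>X \<mapsto> 2 \<langle>X, c\<rangle> c - X\<close> and the
  Klein chart turns hyperbolic convexity into Euclidean convexity.

  A corner of \<open>K\<close> cut off by a smooth boundary point of \<open>L\<close> would give an intersection that is nearly a
  triangle and hence not centrally symmetric, so both boundaries are smooth. If equally long small
  chords of \<open>K\<close> and \<open>L\<close> are glued together with the caps on opposite sides, then the intersection has
  its centre at the common midpoint, and therefore the two caps are congruent. Comparing caps along
  the boundary shows that the boundary is invariant under a one-parameter group near each point, i.e. it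
  is locally a plane section \<open>\<langle>X, N\<rangle> = t\<close> of the hyperboloid, with the same data for \<open>K\<close> and \<open>L\<close>;
  by connectedness the whole plane section belongs to the boundary.

  If \<open>N\<close> is timelike, the bodies are congruent circles. In the remaining cases place the
  bodies so that they share an ideal point \<open>E\<close>. Its mirror image about the centre of the intersection is
  an ideal point of the intersection as well, and this is contradictory for horocycles and for proper
  equidistant curves. For straight lines one moves \<open>L\<close> by a parabolic isometry fixing \<open>E\<close>, so that
  the intersection lies between two lines through \<open>E\<close>; it then contains a third line through \<open>E\<close> strictly in
  between. As the boundaries have finitely many components, a thin strip between lines through \<open>E\<close> is thus
  contained in both bodies, and the intersection is the region between two asymptotic lines, which has no
  centre of symmetry.
\<close>

section \<open>The hyperboloid model\<close>

text \<open>The invariance of an arc is obtained from single isometries that push a chord a little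
  along itself: every map in \<open>SO\<close> has a fixed vector, so the orbit of an end point lies
  in a plane, and letting the step tend to 0, with normals kept on the unit sphere, yields a plane
  containing the arc. Caps can be compared only between \<open>K\<close> and \<open>L\<close>; two
  chords of \<open>K\<close> are therefore compared through a chord of \<open>L\<close> of the same
  length. The centre of two glued caps is computable because both caps lie in the disc whose
  diameter is the chord; this is why boundaries are first shown to be smooth and then written as
  graphs of slope at most 1/2. A plane section is recorded as \<open>lp (lift z) N = t\<close>:
  isometries act linearly on \<open>N\<close>, and the sign of \<open>lp N N\<close> tells circles,
  horocycles and equidistant curves apart, straight lines being the equidistant curves with
  \<open>t = 0\<close>. Condition (1) is exploited for Moebius maps with explicit coefficients; in
  the converse direction arbitrary congruences are handled because they map discs to discs.\<close>

type_synonym vec = "real \<times> complex"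

text \<open>Signature (+, -, -): points of the plane are future vectors of square 1, null vectors
  are ideal points, and vectors of negative square are normals of lines.\<close>

definition lp :: "vec \<Rightarrow> vec \<Rightarrow> real" where
  "lp X Y = fst X * fst Y - snd X \<bullet> snd Y"

definition future :: "vec \<Rightarrow> bool" where
  "future X \<longleftrightarrow> cmod (snd X) < fst X"

definition lift :: "hyp_plane \<Rightarrow> vec" where
  "lift x = ((1 + (cmod (to_disc x))\<^sup>2) / (1 - (cmod (to_disc x))\<^sup>2),
             (2 / (1 - (cmod (to_disc x))\<^sup>2)) *\<^sub>R to_disc x)"

text \<open>Meaningful on the whole future cone: the vector is scaled to the hyperboloid and
  projected stereographically, so linear combinations of lifts can be used without
  normalisation.\<close>

definition pt :: "vec \<Rightarrow> hyp_plane" where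
  "pt X = of_disc (snd X /\<^sub>R (fst X + sqrt (lp X X)))"

lemma lp_commute: "lp X Y = lp Y X"
  by (simp add: lp_def inner_commute mult.commute)

lemma lp_add [simp]: "lp (X + Y) Z = lp X Z + lp Y Z" "lp Z (X + Y) = lp Z X + lp Z Y"
  by (simp_all add: lp_def inner_add_left inner_add_right algebra_simps)

lemma lp_diff [simp]: "lp (X - Y) Z = lp X Z - lp Y Z" "lp Z (X - Y) = lp Z X - lp Z Y"
  by (simp_all add: lp_def inner_diff_left inner_diff_right algebra_simps)

lemma lp_scaleR [simp]: "lp (c *\<^sub>R X) Z = c * lp X Z" "lp Z (c *\<^sub>R X) = c * lp Z X"
  by (simp_all add: lp_def algebra_simps)

lemma lp_minus [simp]: "lp (- X) Z = - lp X Z" "lp Z (- X) = - lp Z X"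
  by (simp_all add: lp_def)

lemma lp_zero [simp]: "lp 0 Z = 0" "lp Z 0 = 0"
  by (simp_all add: lp_def)

lemma lp_self: "lp X X = (fst X)\<^sup>2 - (cmod (snd X))\<^sup>2"
  by (simp add: lp_def power2_eq_square flip: power2_norm_eq_inner)

lemma continuous_on_lp [continuous_intros]:
  "continuous_on S f \<Longrightarrow> continuous_on S g \<Longrightarrow> continuous_on S (\<lambda>x. lp (f x) (g x))"
  unfolding lp_def by (intro continuous_intros)

lemma tendsto_lp [tendsto_intros]:
  "(f \<longlongrightarrow> a) F \<Longrightarrow> (g \<longlongrightarrow> b) F \<Longrightarrow> ((\<lambda>x. lp (f x) (g x)) \<longlongrightarrow> lp a b) F"
  unfolding lp_def by (intro tendsto_intros)

lemma lp_nondegenerate: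
  assumes "\<And>X. future X \<Longrightarrow> lp X N = 0"
  shows "N = 0"
proof -
  have "fst N = 0" using assms[of "(1, 0)"] by (simp add: lp_def future_def)
  moreover have "snd N = 0"
  proof (rule ccontr)
    assume n: "snd N \<noteq> 0"
    have "lp (2 * cmod (snd N), snd N) N = 0" using n by (intro assms) (simp add: future_def)
    then show False using n \<open>fst N = 0\<close> by (simp add: lp_def)
  qed
  ultimately show ?thesis by (simp add: prod_eq_iff)
qed

lemma future_lp_pos: "future X \<Longrightarrow> 0 < lp X X"
  by (simp add: future_def lp_self power_strict_mono)

lemma future_fst_pos: "future X \<Longrightarrow> 0 < fst X"
  unfolding future_def by (meson le_less_trans norm_ge_zero)

lemma future_scaleR: "future X \<Longrightarrow> 0 < c \<Longrightarrow> future (c *\<^sub>R X)"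
  by (simp add: future_def)

text \<open>\<open>Y\<close> may be null, which covers products of points with ideal points.\<close>

lemma future_lp_pos2:
  assumes "future X" "cmod (snd Y) \<le> fst Y" "Y \<noteq> 0"
  shows "0 < lp X Y"
proof -
  have y: "0 < fst Y" 
    using assms(2,3) by (metis norm_le_zero_iff norm_ge_zero order.trans order_le_less prod_eq_iff zero_prod_def fst_conv snd_conv)
  have "snd X \<bullet> snd Y \<le> cmod (snd X) * cmod (snd Y)" by (rule norm_cauchy_schwarz)
  also have "\<dots> \<le> cmod (snd X) * fst Y" using assms by (intro mult_left_mono) auto
  also have "\<dots> < fst X * fst Y" using assms(1) y by (simp add: future_def)
  finally show ?thesis by (simp add: lp_def)
qed

lemma future_nonzero: "future X \<Longrightarrow> X \<noteq> 0"
  by (auto simp: future_def)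

lemma future_lp_pos': "future X \<Longrightarrow> future Y \<Longrightarrow> 0 < lp X Y"
  by (rule future_lp_pos2) (auto simp: future_def)

lemma future_add:
  assumes "future X" "cmod (snd Y) \<le> fst Y"
  shows "future (X + Y)"
  using assms norm_triangle_ineq[of "snd X" "snd Y"] by (simp add: future_def)

text \<open>A vector of positive square lies in one of the two open cones; its product with a future
  vector tells in which.\<close>

lemma futureI:
  assumes "0 < lp X X" "future Y" "0 \<le> lp X Y"
  shows "future X"
proof -
  have "(cmod (snd X))\<^sup>2 < (fst X)\<^sup>2" using assms(1) by (simp add: lp_self)
  then have "cmod (snd X) < \<bar>fst X\<bar>" by (metis abs_norm_cancel abs_le_square_iff not_le)
  moreover have "0 \<le> fst X"
  proof (rule ccontr)
    assume "\<not> 0 \<le> fst X"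
    then have "future (- X)" using \<open>cmod (snd X) < \<bar>fst X\<bar>\<close> by (simp add: future_def)
    from future_lp_pos'[OF this assms(2)] assms(3) show False by simp
  qed
  ultimately show ?thesis by (simp add: future_def)
qed

section \<open>The disc as the future sheet of the hyperboloid\<close>

lemma to_disc_pos: "0 < 1 - (cmod (to_disc x))\<^sup>2"
  using to_disc[of x] by (rule disc_pos)

lemma lp_lift_self [simp]: "lp (lift x) (lift x) = 1"
proof -
  have "(1 + (cmod (to_disc x))\<^sup>2)\<^sup>2 - (2 * cmod (to_disc x))\<^sup>2 = (1 - (cmod (to_disc x))\<^sup>2)\<^sup>2"
    by (simp add: power2_eq_square algebra_simps)
  then show ?thesis using to_disc_pos[of x]
    by (simp add: lp_self lift_def power_divide power_mult_distrib diff_divide_distrib[symmetric])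
qed

lemma future_lift [simp]: "future (lift x)"
proof -
  have "0 < (1 - cmod (to_disc x))\<^sup>2" using to_disc[of x] by auto
  then have "2 * cmod (to_disc x) < 1 + (cmod (to_disc x))\<^sup>2"
    by (simp add: power2_eq_square algebra_simps)
  then show ?thesis using to_disc_pos[of x]
    by (simp add: future_def lift_def divide_strict_right_mono)
qed

lemma fst_lift_pos [simp]: "0 < fst (lift x)" by (rule future_fst_pos) simp

lemma lift_nonzero [simp]: "lift x \<noteq> 0" by (rule future_nonzero) simp

lemma lp_lift_cosh: "lp (lift x) (lift y) = hyp_cosh (to_disc x) (to_disc y)"
proof -
  have "hyp_cosh (to_disc x) (to_disc y) =
     (1 + (cmod (to_disc x))\<^sup>2) / (1 - (cmod (to_disc x))\<^sup>2) * ((1 + (cmod (to_disc y))\<^sup>2) / (1 - (cmod (to_disc y))\<^sup>2))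
     - 2 * Re (to_disc x) / (1 - (cmod (to_disc x))\<^sup>2) * (2 * Re (to_disc y) / (1 - (cmod (to_disc y))\<^sup>2))
     - 2 * Im (to_disc x) / (1 - (cmod (to_disc x))\<^sup>2) * (2 * Im (to_disc y) / (1 - (cmod (to_disc y))\<^sup>2))"
    by (rule hyp_cosh_lor[OF to_disc to_disc]) (simp_all add: lor_def)
  then show ?thesis by (simp add: lp_def lift_def inner_complex_def field_simps)
qed

lemma dist_eq_arcosh: "dist x y = arcosh (lp (lift x) (lift y))"
  by (simp add: dist_hyp_plane_def lp_lift_cosh hyp_cosh_def)

lemma lp_lift_ge_1: "1 \<le> lp (lift x) (lift y)"
  unfolding lp_lift_cosh by (intro hyp_cosh_ge_1 to_disc)

lemma cosh_dist: "cosh (dist x y) = lp (lift x) (lift y)"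
  by (simp add: dist_eq_arcosh lp_lift_ge_1)

lemma lp_lift_eq_1: "lp (lift x) (lift y) = 1 \<longleftrightarrow> x = y"
  using cosh_dist[of x y] cosh_real_one_iff[of "dist x y"] by auto

lemma lift_inj: "lift x = lift y \<longleftrightarrow> x = y"
  by (metis lp_lift_eq_1 lp_lift_self)

lemma lp_lift_gt_1: "x \<noteq> y \<Longrightarrow> 1 < lp (lift x) (lift y)"
  using lp_lift_ge_1[of x y] lp_lift_eq_1[of x y] by linarith

lemma lift_pt:
  assumes "future X"
  shows "lift (pt X) = X /\<^sub>R sqrt (lp X X)"
proof -
  define l where "l = sqrt (lp X X)"
  have l: "0 < l" "l\<^sup>2 = (fst X)\<^sup>2 - (cmod (snd X))\<^sup>2"
    using future_lp_pos[OF assms] by (auto simp: l_def simp flip: lp_self)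
  have x: "0 < fst X" by (rule future_fst_pos[OF assms])
  define z where "z = snd X /\<^sub>R (fst X + l)"
  have "(cmod z)\<^sup>2 = (cmod (snd X))\<^sup>2 / (fst X + l)\<^sup>2"
    using l x by (simp add: z_def power_mult_distrib divide_inverse power_inverse)
  also have "\<dots> = ((fst X - l) * (fst X + l)) / (fst X + l)\<^sup>2"
    using l(2) by (simp add: power2_eq_square algebra_simps)
  finally have z: "(cmod z)\<^sup>2 = (fst X - l) / (fst X + l)"
    using l x by (simp add: power2_eq_square)
  have "(cmod z)\<^sup>2 < 1" unfolding z using l x by (simp add: divide_less_eq)
  then have "z \<in> ball 0 1" by (simp add: abs_square_less_1)
  then have t: "to_disc (pt X) = z"
    by (simp add: pt_def of_disc_inverse z_def l_def)
  have e1: "1 - (cmod z)\<^sup>2 = 2 * l / (fst X + l)" "1 + (cmod z)\<^sup>2 = 2 * fst X / (fst X + l)"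
    unfolding z using l x by (auto simp: field_simps)
  have e0: "0 < l * (l * 2) + l * (fst X * 2)" using l x by (simp add: add_pos_pos)
  have e2: "2 * fst X / (fst X + l) / (2 * l / (fst X + l)) = fst X / l"
    "2 / (2 * l / (fst X + l)) = (fst X + l) / l"
    using l x e0 by (simp_all add: divide_simps algebra_simps)
  have e3: "((fst X + l) / l) *\<^sub>R z = snd X /\<^sub>R l"
    using l x by (simp add: z_def divide_inverse)
  show ?thesis
    unfolding lift_def t e1 e2 e3 by (simp add: prod_eq_iff l_def[symmetric] divide_inverse)
qed

lemma pt_lift [simp]: "pt (lift x) = x"
  using lift_pt[of "lift x"] by (simp add: lift_inj)

lemma lift_pt_unit: "future X \<Longrightarrow> lp X X = 1 \<Longrightarrow> lift (pt X) = X"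
  by (simp add: lift_pt)

lemma pt_scaleR: 
  assumes "future X" "0 < c"
  shows "pt (c *\<^sub>R X) = pt X"
proof -
  have "lift (pt (c *\<^sub>R X)) = lift (pt X)"
    using assms future_lp_pos[OF assms(1)]
    by (simp add: lift_pt future_scaleR real_sqrt_mult field_simps)
  then show ?thesis by (simp add: lift_inj)
qed

lemma lift_pt_pos:
  assumes "future X"
  obtains c where "0 < c" "lift (pt X) = c *\<^sub>R X"
  using lift_pt[OF assms] future_lp_pos[OF assms] 
  by (metis positive_imp_inverse_positive real_sqrt_gt_zero)

section \<open>Convexity\<close>

text \<open>Here \<alpha> and \<beta> are coefficients of a unit vector in the span of two points
  with product \<open>c\<close>. The first two identities give the sinh of its distances from these
  points as \<beta> and \<alpha> times \<open>sqrt (c\<^sup>2 - 1)\<close>; the third is the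
  addition theorem for cosh.\<close>

lemma det_zero_identity:
  fixes \<alpha> \<beta> c :: real
  assumes "\<alpha>\<^sup>2 + \<beta>\<^sup>2 + 2 * \<alpha> * \<beta> * c = 1"
  shows "(\<alpha> + \<beta> * c)\<^sup>2 - 1 = \<beta>\<^sup>2 * (c\<^sup>2 - 1)"
    and "(\<alpha> * c + \<beta>)\<^sup>2 - 1 = \<alpha>\<^sup>2 * (c\<^sup>2 - 1)"
    and "(\<alpha> + \<beta> * c) * (\<alpha> * c + \<beta>) + \<alpha> * \<beta> * (c\<^sup>2 - 1) = c"
proof -
  show "(\<alpha> + \<beta> * c)\<^sup>2 - 1 = \<beta>\<^sup>2 * (c\<^sup>2 - 1)" using assms by algebra
  show "(\<alpha> * c + \<beta>)\<^sup>2 - 1 = \<alpha>\<^sup>2 * (c\<^sup>2 - 1)" using assms by algebra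
  show "(\<alpha> + \<beta> * c) * (\<alpha> * c + \<beta>) + \<alpha> * \<beta> * (c\<^sup>2 - 1) = c" using assms by algebra
qed

text \<open>Links metric convexity with linear algebra: by the addition theorem the distances of a
  nonnegative combination from \<open>x\<close> and \<open>y\<close> add up to the distance between
  \<open>x\<close> and \<open>y\<close>.\<close>

lemma segmentI:
  assumes "lift z = \<alpha> *\<^sub>R lift x + \<beta> *\<^sub>R lift y" "0 \<le> \<alpha>" "0 \<le> \<beta>"
  shows "z \<in> hyp_segment x y"
proof -
  define c where "c = lp (lift x) (lift y)"
  have c: "1 \<le> c" by (simp add: c_def lp_lift_ge_1)
  have a: "lp (lift x) (lift z) = \<alpha> + \<beta> * c" "lp (lift z) (lift y) = \<alpha> * c + \<beta>"
    by (simp_all add: assms(1) c_def)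
  have "1 = lp (lift z) (lift z)" by simp
  also have "\<dots> = \<alpha>\<^sup>2 + \<beta>\<^sup>2 + 2 * \<alpha> * \<beta> * c"
    unfolding assms(1) by (simp add: c_def lp_commute[of "lift y"] power2_eq_square algebra_simps)
  finally have e: "\<alpha>\<^sup>2 + \<beta>\<^sup>2 + 2 * \<alpha> * \<beta> * c = 1" by simp
  have c2: "0 \<le> c\<^sup>2 - 1" using c by (simp add: one_le_power)
  have ge: "1 \<le> \<alpha> + \<beta> * c" "1 \<le> \<alpha> * c + \<beta>"
    using lp_lift_ge_1[of x z] lp_lift_ge_1[of z y] by (simp_all add: a)
  have "sinh (dist x z) = \<beta> * sqrt (c\<^sup>2 - 1)"
    using ge assms(3) det_zero_identity(1)[OF e]
    by (simp add: dist_eq_arcosh a sinh_arcosh_real real_sqrt_mult)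
  moreover have "sinh (dist z y) = \<alpha> * sqrt (c\<^sup>2 - 1)"
    using ge assms(2) det_zero_identity(2)[OF e]
    by (simp add: dist_eq_arcosh a sinh_arcosh_real real_sqrt_mult)
  ultimately have "cosh (dist x z + dist z y) = (\<alpha> + \<beta> * c) * (\<alpha> * c + \<beta>) + \<alpha> * \<beta> * (c\<^sup>2 - 1)"
    using c2 by (simp add: cosh_add cosh_dist a)
  also have "\<dots> = cosh (dist x y)" using det_zero_identity(3)[OF e] by (simp add: cosh_dist c_def)
  finally have "dist x z + dist z y = dist x y"
    using cosh_real_nonneg_less_iff[of "dist x z + dist z y" "dist x y"]
      cosh_real_nonneg_less_iff[of "dist x y" "dist x z + dist z y"]
    by (smt (verit) zero_le_dist)
  then show ?thesis by (simp add: hyp_segment_def)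
qed

lemma hyp_convexD:
  assumes "hyp_convex K" "x \<in> K" "y \<in> K" "0 \<le> \<alpha>" "0 \<le> \<beta>" "lift z = \<alpha> *\<^sub>R lift x + \<beta> *\<^sub>R lift y"
  shows "z \<in> K"
  using assms segmentI unfolding hyp_convex_def by blast

lemma hyp_convex_pt:
  assumes "hyp_convex K" "x \<in> K" "y \<in> K" "0 \<le> \<alpha>" "0 \<le> \<beta>" "0 < \<alpha> + \<beta>"
  shows "pt (\<alpha> *\<^sub>R lift x + \<beta> *\<^sub>R lift y) \<in> K"
proof -
  have "future (\<alpha> *\<^sub>R lift x + \<beta> *\<^sub>R lift y)"
  proof (cases "\<alpha> = 0")
    case True then show ?thesis using assms by (simp add: future_scaleR)
  next
    case False
    then have "future (\<alpha> *\<^sub>R lift x)" using assms by (simp add: future_scaleR)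
    then show ?thesis using assms(5) future_lift[of y, unfolded future_def]
      by (intro future_add) (auto intro!: mult_left_mono)
  qed
  then obtain c where c: "0 < c" "lift (pt (\<alpha> *\<^sub>R lift x + \<beta> *\<^sub>R lift y)) = c *\<^sub>R (\<alpha> *\<^sub>R lift x + \<beta> *\<^sub>R lift y)"
    by (rule lift_pt_pos)
  show ?thesis
    by (rule hyp_convexD[OF assms(1-3), of "c * \<alpha>" "c * \<beta>"])
       (use assms c in \<open>auto simp: scaleR_add_right\<close>)
qed

section \<open>The Klein chart\<close>

definition kl :: "hyp_plane \<Rightarrow> complex" where
  "kl x = snd (lift x) /\<^sub>R fst (lift x)"

definition kp :: "complex \<Rightarrow> hyp_plane" where
  "kp k = pt (1, k)"

lemma norm_kl: "cmod (kl x) < 1"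
  using future_lift[of x] fst_lift_pos[of x]
  by (simp add: kl_def future_def divide_simps del: future_lift fst_lift_pos)

lemma future_klein: "cmod k < 1 \<Longrightarrow> future (1, k)"
  by (simp add: future_def)

lemma lift_kl: "lift x = fst (lift x) *\<^sub>R (1, kl x)"
  using fst_lift_pos[of x] by (auto simp: kl_def prod_eq_iff simp del: fst_lift_pos)

lemma kp_kl [simp]: "kp (kl x) = x"
  by (metis fst_lift_pos future_klein kp_def lift_kl norm_kl pt_lift pt_scaleR)

lemma lift_kp: "cmod k < 1 \<Longrightarrow> lift (kp k) = (1, k) /\<^sub>R sqrt (1 - (cmod k)\<^sup>2)"
  by (simp add: kp_def lift_pt future_klein lp_self)

lemma kl_kp [simp]: "cmod k < 1 \<Longrightarrow> kl (kp k) = k"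
proof -
  assume "cmod k < 1"
  then have "0 < sqrt (1 - (cmod k)\<^sup>2)" by (simp add: abs_square_less_1)
  with \<open>cmod k < 1\<close> show ?thesis by (simp add: kl_def lift_kp)
qed

lemma kl_inj: "kl x = kl y \<longleftrightarrow> x = y"
  by (metis kp_kl)

lemma lp_klein: "lp (1, k) (1, l) = 1 - k \<bullet> l"
  by (simp add: lp_def)

section \<open>Continuity and openness of the charts\<close>

lemma continuous_to_disc: "continuous_on UNIV to_disc"
proof (rule continuous_on_sequentiallyI)
  fix u :: "nat \<Rightarrow> hyp_plane" and a
  assume "u \<longlonglongrightarrow> a"
  then have "(\<lambda>n. dist (u n) a) \<longlonglongrightarrow> 0" using tendsto_dist_iff by blast
  then have "(\<lambda>n. cosh (dist (u n) a)) \<longlonglongrightarrow> cosh 0"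
    by (rule tendsto_cosh)
  then have c: "(\<lambda>n. sqrt (cosh (dist (u n) a) - 1)) \<longlonglongrightarrow> sqrt (cosh 0 - 1)"
    by (intro tendsto_real_sqrt tendsto_diff tendsto_const)
  \<comment> \<open>The denominators in \<open>hyp_cosh\<close> are at most 1, so cosh of the
    distance minus 1 dominates the squared Euclidean distance.\<close>
  have "norm (to_disc (u n) - to_disc a) \<le> sqrt (cosh (dist (u n) a) - 1)" for n
  proof -
    let ?p = "(1 - (cmod (to_disc (u n)))\<^sup>2) * (1 - (cmod (to_disc a))\<^sup>2)"
    have p: "0 < ?p" "?p \<le> 1" using to_disc_pos[of "u n"] to_disc_pos[of a] by (auto intro: mult_le_one)
    have "(cmod (to_disc (u n) - to_disc a))\<^sup>2 \<le> 2 * (cmod (to_disc (u n) - to_disc a))\<^sup>2" by simp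
    also have "\<dots> \<le> 2 * (cmod (to_disc (u n) - to_disc a))\<^sup>2 / ?p"
      using p by (simp add: divide_simps mult_left_le)
    finally show ?thesis
      unfolding cosh_dist lp_lift_cosh hyp_cosh_def by (intro real_le_rsqrt) simp
  qed
  then have "(\<lambda>n. to_disc (u n) - to_disc a) \<longlonglongrightarrow> 0"
    using c by (intro Lim_null_comparison[OF _ c[simplified]]) auto
  then show "(\<lambda>n. to_disc (u n)) \<longlonglongrightarrow> to_disc a" by (rule LIM_zero_cancel)
qed

lemma continuous_lift: "continuous_on UNIV lift"
  unfolding lift_def
  by (intro continuous_intros continuous_to_disc) (use to_disc_pos in \<open>simp_all add: less_imp_neq[THEN not_sym]\<close>)

lemma continuous_on_lift [continuous_intros]: "continuous_on S f \<Longrightarrow> continuous_on S (\<lambda>x. lift (f x))"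
  using continuous_on_compose2[OF continuous_lift] by blast

lemma tendsto_lift [tendsto_intros]: "(f \<longlongrightarrow> a) F \<Longrightarrow> ((\<lambda>x. lift (f x)) \<longlongrightarrow> lift a) F"
  using continuous_lift by (simp add: continuous_on_eq_continuous_at isCont_tendsto_compose)

lemma continuous_on_kl [continuous_intros]: "continuous_on S f \<Longrightarrow> continuous_on S (\<lambda>x. kl (f x))"
  unfolding kl_def by (intro continuous_intros) (auto simp: less_imp_neq[OF fst_lift_pos, THEN not_sym])

lemma tendsto_hyp_plane:
  assumes "((\<lambda>x. lp (lift (f x)) (lift a)) \<longlongrightarrow> 1) F"
  shows "(f \<longlongrightarrow> a) F"
proof -
  have "continuous_on {1..} (arcosh :: real \<Rightarrow> real)" by (rule continuous_on_arcosh) auto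
  then have "((\<lambda>x. arcosh (lp (lift (f x)) (lift a))) \<longlongrightarrow> arcosh 1) F"
    using assms by (rule continuous_on_tendsto_compose) (auto simp: lp_lift_ge_1)
  then have "((\<lambda>x. dist (f x) a) \<longlongrightarrow> 0) F" by (simp add: dist_eq_arcosh)
  then show ?thesis by (rule tendsto_dist_iff[THEN iffD2])
qed

lemma tendsto_pt:
  assumes "(f \<longlongrightarrow> X) F" "future X" "eventually (\<lambda>x. future (f x)) F"
  shows "((\<lambda>x. pt (f x)) \<longlongrightarrow> pt X) F"
proof (rule tendsto_hyp_plane)
  have *: "eventually (\<lambda>x. lp (f x /\<^sub>R sqrt (lp (f x) (f x))) (lift (pt X)) = lp (lift (pt (f x))) (lift (pt X))) F"
    using assms(3) by eventually_elim (simp add: lift_pt)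
  have "((\<lambda>x. lp (f x /\<^sub>R sqrt (lp (f x) (f x))) (lift (pt X))) \<longlongrightarrow> lp (X /\<^sub>R sqrt (lp X X)) (lift (pt X))) F"
    using future_lp_pos[OF assms(2)] by (intro tendsto_intros assms) auto
  also have "lp (X /\<^sub>R sqrt (lp X X)) (lift (pt X)) = 1"
    using assms(2) by (simp flip: lift_pt)
  finally show "((\<lambda>x. lp (lift (pt (f x))) (lift (pt X))) \<longlongrightarrow> 1) F"
    using * by (rule Lim_transform_eventually)
qed

lemma continuous_on_pt [continuous_intros]:
  "continuous_on S f \<Longrightarrow> (\<And>x. x \<in> S \<Longrightarrow> future (f x)) \<Longrightarrow> continuous_on S (\<lambda>x. pt (f x))"
  unfolding continuous_on_def
  by (auto intro!: tendsto_pt simp: eventually_at_filter)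

lemma continuous_on_kp [continuous_intros]:
  "continuous_on S f \<Longrightarrow> (\<And>x. x \<in> S \<Longrightarrow> cmod (f x) < 1) \<Longrightarrow> continuous_on S (\<lambda>x. kp (f x))"
  unfolding kp_def by (intro continuous_intros) (auto intro: future_klein)

lemma kl_homeomorphism: "homeomorphism UNIV (ball 0 1) kl kp"
  by (rule homeomorphismI) (auto intro!: continuous_intros simp: norm_kl)

lemma open_kl_image: "open (kl ` S) \<longleftrightarrow> open S"
proof
  assume "open (kl ` S)"
  then have "open (kl -` (kl ` S))" by (intro open_vimage continuous_intros)
  moreover have "kl -` (kl ` S) = S" by (auto simp: kl_inj)
  ultimately show "open S" by simp
next
  assume "open S"
  then have "openin (top_of_set UNIV) S" by simp
  then have "openin (top_of_set (ball 0 1)) (kl ` S)"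
    using homeomorphism_imp_open_map[OF kl_homeomorphism] by blast
  then show "open (kl ` S)" by (rule openin_open_trans) simp
qed

lemma interior_kl: "x \<in> interior S \<longleftrightarrow> kl x \<in> interior (kl ` S)"
proof
  assume "x \<in> interior S"
  then show "kl x \<in> interior (kl ` S)"
    by (meson image_mono imageI interior_maximal interior_subset open_interior open_kl_image subsetD)
next
  assume "kl x \<in> interior (kl ` S)"
  then have "x \<in> kl -` interior (kl ` S)" by simp
  moreover have "open (kl -` interior (kl ` S))" by (intro open_vimage continuous_intros) auto
  moreover have "kl -` interior (kl ` S) \<subseteq> S" using interior_subset[of "kl ` S"] by (auto simp: kl_inj)
  ultimately show "x \<in> interior S" by (meson interiorI)
qed

text \<open>The chart is a central projection: a convex combination of chart points lifts to a
  nonnegative combination of the lifts, the weights being rescaled by the heights.\<close>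

lemma convex_kl_image:
  assumes "hyp_convex K"
  shows "convex (kl ` K)"
proof (rule convexI)
  fix k l and u v :: real
  assume k: "k \<in> kl ` K" "l \<in> kl ` K" and uv: "0 \<le> u" "0 \<le> v" "u + v = 1"
  obtain x y where xy: "x \<in> K" "y \<in> K" "k = kl x" "l = kl y" using k by auto
  define z where "z = kp (u *\<^sub>R k + v *\<^sub>R l)"
  have "u *\<^sub>R k + v *\<^sub>R l \<in> ball 0 1"
    using convexD[OF convex_ball, of k 0 1 l u v] uv xy norm_kl by auto
  then have n: "cmod (u *\<^sub>R k + v *\<^sub>R l) < 1" by simp
  then have "kl z = u *\<^sub>R k + v *\<^sub>R l" by (simp add: z_def)
  moreover have "z \<in> K"
  proof (rule hyp_convexD[OF assms xy(1,2)])
    define c where "c = fst (lift z)"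
    show "lift z = (c * u / fst (lift x)) *\<^sub>R lift x + (c * v / fst (lift y)) *\<^sub>R lift y"
    proof -
      have "(c * u / fst (lift x)) *\<^sub>R lift x = (c * u) *\<^sub>R (1, k)"
        by (subst (2) lift_kl) (simp add: xy less_imp_neq[OF fst_lift_pos, THEN not_sym])
      moreover have "(c * v / fst (lift y)) *\<^sub>R lift y = (c * v) *\<^sub>R (1, l)"
        by (subst (2) lift_kl) (simp add: xy less_imp_neq[OF fst_lift_pos, THEN not_sym])
      moreover have "lift z = c *\<^sub>R (1, u *\<^sub>R k + v *\<^sub>R l)"
        by (subst lift_kl) (simp add: c_def \<open>kl z = _\<close>)
      ultimately show ?thesis
        using uv(3) by (simp add: scaleR_add_right flip: distrib_left)
    qed
    show "0 \<le> c * u / fst (lift x)" "0 \<le> c * v / fst (lift y)"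
      using uv fst_lift_pos[of z] fst_lift_pos[of x] fst_lift_pos[of y] by (auto simp: c_def less_imp_le)
  qed
  ultimately show "u *\<^sub>R k + v *\<^sub>R l \<in> kl ` K" by (metis imageI)
qed

section \<open>Orientation preserving isometries\<close>

definition det3 :: "vec \<Rightarrow> vec \<Rightarrow> vec \<Rightarrow> real" where
  "det3 X Y Z = fst X * (Re (snd Y) * Im (snd Z) - Im (snd Y) * Re (snd Z))
    - fst Y * (Re (snd X) * Im (snd Z) - Im (snd X) * Re (snd Z))
    + fst Z * (Re (snd X) * Im (snd Y) - Im (snd X) * Re (snd Y))"

text \<open>The action of the Moebius transformation \<open>z \<mapsto> (a z + b) / (cnj b z + cnj a)\<close> on hyperboloid coordinates.\<close>

definition act :: "complex \<Rightarrow> complex \<Rightarrow> vec \<Rightarrow> vec" where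
  "act a b X = (((cmod a)\<^sup>2 + (cmod b)\<^sup>2) * fst X + 2 * Re (a * cnj b * snd X),
     2 * a * b * of_real (fst X) + a\<^sup>2 * snd X + b\<^sup>2 * cnj (snd X))"

text \<open>The image of SU(1,1), i.e. the identity component of the Lorentz group. Describing it by
  coefficients reduces the invariance of \<open>lp\<close> and \<open>det3\<close> to polynomial
  identities and makes the complex derivative of the action explicit.\<close>

definition SO :: "(vec \<Rightarrow> vec) set" where
  "SO = {act a b | a b. (cmod a)\<^sup>2 - (cmod b)\<^sup>2 = 1}"

definition mv :: "(vec \<Rightarrow> vec) \<Rightarrow> hyp_plane \<Rightarrow> hyp_plane" where
  "mv A x = pt (A (lift x))"

lemma act_add: "act a b (X + Y) = act a b X + act a b Y"
  by (simp add: act_def algebra_simps)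

lemma act_scaleR: "act a b (c *\<^sub>R X) = c *\<^sub>R act a b X"
  by (simp add: act_def complex_eq_iff algebra_simps)

lemma linear_act: "linear (act a b)"
  by (rule linearI) (simp_all add: act_add act_scaleR)

text \<open>The product of the matrices with rows \<open>(a, b)\<close>,
  \<open>(cnj b, cnj a)\<close> and \<open>(c, d)\<close>, \<open>(cnj d, cnj c)\<close>;
  \<open>act_norm_mult\<close> is the multiplicativity of their determinants.\<close>

lemma act_act: "act a b (act c d X) = act (a * c + b * cnj d) (a * d + b * cnj c) X"
proof -
  obtain x x1 x2 where X: "X = (x, Complex x1 x2)" by (metis complex.exhaust surj_pair)
  obtain a1 a2 b1 b2 c1 c2 d1 d2 where ab: "a = Complex a1 a2" "b = Complex b1 b2"
    "c = Complex c1 c2" "d = Complex d1 d2" by (metis complex.exhaust)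
  show ?thesis
    unfolding X ab act_def cmod_power2 prod_eq_iff complex_eq_iff
    by (simp add: power2_eq_square algebra_simps)
qed

lemma act_norm_mult:
  "(cmod (a * c + b * cnj d))\<^sup>2 - (cmod (a * d + b * cnj c))\<^sup>2 =
    ((cmod a)\<^sup>2 - (cmod b)\<^sup>2) * ((cmod c)\<^sup>2 - (cmod d)\<^sup>2)"
  unfolding cmod_power2 by (simp add: power2_eq_square algebra_simps)

lemma lp_act: "lp (act a b X) (act a b Y) = ((cmod a)\<^sup>2 - (cmod b)\<^sup>2)\<^sup>2 * lp X Y"
proof -
  obtain x x1 x2 where X: "X = (x, Complex x1 x2)" by (metis complex.exhaust surj_pair)
  obtain y y1 y2 where Y: "Y = (y, Complex y1 y2)" by (metis complex.exhaust surj_pair)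
  obtain a1 a2 b1 b2 where ab: "a = Complex a1 a2" "b = Complex b1 b2" by (metis complex.exhaust)
  show ?thesis
    unfolding X Y ab lp_def act_def cmod_power2
    by (simp add: inner_complex_def power2_eq_square) algebra
qed

lemma det3_linear:
  assumes "linear A"
  shows "det3 (A X) (A Y) (A Z) = det3 X Y Z * det3 (A (1, 0)) (A (0, 1)) (A (0, \<i>))"
proof -
  have e: "A W = fst W *\<^sub>R A (1, 0) + Re (snd W) *\<^sub>R A (0, 1) + Im (snd W) *\<^sub>R A (0, \<i>)" for W
  proof -
    have "W = fst W *\<^sub>R (1, 0) + Re (snd W) *\<^sub>R (0, 1) + Im (snd W) *\<^sub>R (0, \<i>)"
      by (simp add: prod_eq_iff complex_eq_iff)
    then have "A W = A (fst W *\<^sub>R (1, 0) + Re (snd W) *\<^sub>R (0, 1) + Im (snd W) *\<^sub>R (0, \<i>))" by simp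
    then show ?thesis using assms by (simp only: linear_add linear_scale)
  qed
  show ?thesis
    unfolding e[of X] e[of Y] e[of Z] det3_def fst_add snd_add fst_scaleR snd_scaleR
    by (simp, algebra)
qed

lemma det3_act_basis: "det3 (act a b (1, 0)) (act a b (0, 1)) (act a b (0, \<i>)) = ((cmod a)\<^sup>2 - (cmod b)\<^sup>2) ^ 3"
proof -
  obtain a1 a2 b1 b2 where ab: "a = Complex a1 a2" "b = Complex b1 b2" by (metis complex.exhaust)
  show ?thesis
    unfolding ab det3_def act_def cmod_power2
    by (simp add: power2_eq_square power3_eq_cube) algebra
qed

lemma SO_linear: "A \<in> SO \<Longrightarrow> linear A"
  by (auto simp: SO_def linear_act)

lemma SO_lp [simp]: "A \<in> SO \<Longrightarrow> lp (A X) (A Y) = lp X Y"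
  by (auto simp: SO_def lp_act)

lemma SO_det3 [simp]: "A \<in> SO \<Longrightarrow> det3 (A X) (A Y) (A Z) = det3 X Y Z"
  using det3_linear[OF SO_linear, of A X Y Z] by (auto simp: SO_def det3_act_basis)

lemma SO_future:
  assumes "A \<in> SO" "future X"
  shows "future (A X)"
proof -
  obtain a b where A: "A = act a b" and ab: "(cmod a)\<^sup>2 - (cmod b)\<^sup>2 = 1"
    using assms(1) by (auto simp: SO_def)
  have x: "0 < fst X" by (rule future_fst_pos[OF assms(2)])
  have "\<bar>Re (a * cnj b * snd X)\<bar> \<le> cmod a * cmod b * cmod (snd X)"
    by (metis abs_Re_le_cmod complex_mod_cnj norm_mult)
  also have "\<dots> \<le> cmod a * cmod b * fst X"
    using assms(2) by (intro mult_left_mono) (auto simp: future_def)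
  finally have "fst (A X) \<ge> (cmod a - cmod b)\<^sup>2 * fst X"
    by (simp add: A act_def power2_eq_square algebra_simps)
  then have "0 \<le> fst (A X)" using x by (smt (verit) mult_nonneg_nonneg zero_le_power2)
  then have "0 \<le> lp (A X) (1, 0)" by (simp add: lp_def)
  moreover have "0 < lp (A X) (A X)" using assms by (simp add: future_lp_pos)
  moreover have "future (1, 0)" by (simp add: future_def)
  ultimately show ?thesis by (meson futureI)
qed

lemma lift_mv [simp]: "A \<in> SO \<Longrightarrow> lift (mv A x) = A (lift x)"
  by (simp add: mv_def lift_pt_unit SO_future)

lemma SO_comp: "A \<in> SO \<Longrightarrow> B \<in> SO \<Longrightarrow> A \<circ> B \<in> SO"
  unfolding SO_def by (force simp: act_act fun_eq_iff act_norm_mult)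

lemma mv_comp: "A \<in> SO \<Longrightarrow> B \<in> SO \<Longrightarrow> mv (A \<circ> B) = mv A \<circ> mv B"
  by (simp add: fun_eq_iff SO_comp flip: lift_inj)

lemma act_one: "act 1 0 = id"
  by (simp add: fun_eq_iff act_def)

lemma SO_id: "id \<in> SO"
proof -
  have "act 1 0 \<in> SO" unfolding SO_def by (intro CollectI exI[of _ "1::complex"] exI[of _ "0::complex"]) simp
  then show ?thesis by (simp add: act_one)
qed

lemma mv_id [simp]: "mv id = id"
  by (simp add: fun_eq_iff mv_def)

lemma SO_inverse:
  assumes "A \<in> SO"
  obtains B where "B \<in> SO" "A \<circ> B = id" "B \<circ> A = id"
proof -
  obtain a b where A: "A = act a b" and ab: "(cmod a)\<^sup>2 - (cmod b)\<^sup>2 = 1"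
    using assms by (auto simp: SO_def)
  have "a * cnj a - b * cnj b = 1" using ab
    by (metis complex_norm_square of_real_1 of_real_diff)
  then have "act a b \<circ> act (cnj a) (- b) = id" "act (cnj a) (- b) \<circ> act a b = id"
    by (simp_all add: fun_eq_iff act_act mult.commute flip: act_one)
  moreover have "act (cnj a) (- b) \<in> SO" unfolding SO_def
    by (intro CollectI exI[of _ "cnj a"] exI[of _ "- b"]) (use ab in simp)
  ultimately show ?thesis using that A by blast
qed

text \<open>The vector \<open>(Im a, \<i> * b)\<close> encodes the trace-free part of the matrix,
  which commutes with the matrix. It vanishes only for the identity map, where any vector
  serves.\<close>

lemma SO_fixed:
  assumes "A \<in> SO"
  obtains N where "N \<noteq> 0" "A N = N"
proof -
  obtain a b where A: "A = act a b" and ab: "(cmod a)\<^sup>2 - (cmod b)\<^sup>2 = 1"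
    using assms by (auto simp: SO_def)
  show ?thesis
  proof (cases "b = 0 \<and> Im a = 0")
    case True
    then have "A (1, 0) = (1, 0)" using ab by (simp add: A act_def)
    then show ?thesis by (intro that[of "(1, 0)"]) (auto simp: prod_eq_iff)
  next
    case False
    obtain a1 a2 b1 b2 where c: "a = Complex a1 a2" "b = Complex b1 b2" by (metis complex.exhaust)
    have n: "a1\<^sup>2 + a2\<^sup>2 - b1\<^sup>2 - b2\<^sup>2 = 1" using ab by (simp add: c cmod_power2)
    have "A (Im a, \<i> * b) = (Im a, \<i> * b)"
      unfolding A act_def cmod_power2 c prod_eq_iff complex_eq_iff
      apply (simp add: power2_eq_square)
      using n[unfolded power2_eq_square] by algebra
    then show ?thesis using False by (intro that[of "(Im a, \<i> * b)"]) (auto simp: prod_eq_iff)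
  qed
qed

section \<open>Half-turns; transitivity on flags and on pairs of points\<close>

definition hturn :: "hyp_plane \<Rightarrow> vec \<Rightarrow> vec" where
  "hturn c X = (2 * lp X (lift c)) *\<^sub>R lift c - X"

lemma hturn_SO [simp]: "hturn c \<in> SO"
proof -
  obtain t \<zeta>1 \<zeta>2 where c: "lift c = (t, Complex \<zeta>1 \<zeta>2)" by (metis complex.exhaust surj_pair)
  have n: "t\<^sup>2 - \<zeta>1\<^sup>2 - \<zeta>2\<^sup>2 = 1" using lp_lift_self[of c] unfolding c lp_self by (simp add: cmod_power2)
  \<comment> \<open>The half-turn about the origin has coefficients \<i> and 0; conjugating it by
    the translation that takes the origin to \<open>c\<close> gives these.\<close>
  define a b where "a = \<i> * of_real t" and "b = - \<i> * Complex \<zeta>1 \<zeta>2"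
  have "hturn c X = act a b X" for X
  proof -
    obtain x x1 x2 where X: "X = (x, Complex x1 x2)" by (metis complex.exhaust surj_pair)
    show ?thesis
      unfolding hturn_def act_def cmod_power2 X c a_def b_def prod_eq_iff complex_eq_iff lp_def
      apply (simp add: power2_eq_square inner_complex_def)
      using n[unfolded power2_eq_square] by algebra
  qed
  moreover have "(cmod a)\<^sup>2 - (cmod b)\<^sup>2 = 1"
    using n by (simp add: a_def b_def norm_mult cmod_power2)
  ultimately show ?thesis unfolding SO_def by (auto simp: fun_eq_iff)
qed

lemma hturn_hturn [simp]: "hturn c (hturn c X) = X"
  by (simp add: hturn_def algebra_simps)

lemma mv_hturn_hturn [simp]: "mv (hturn c) (mv (hturn c) x) = x"
  by (simp flip: lift_inj)

text \<open>A translation takes the origin to \<open>c\<close>, and a rotation about the origin then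
  adjusts the direction.\<close>

lemma SO_flag:
  assumes "lp n n = -1" "lp (lift c) n = 0"
  obtains A where "A \<in> SO" "A (1, 0) = lift c" "A (0, \<i>) = n"
proof -
  obtain t \<zeta> where c: "lift c = (t, \<zeta>)" by (metis surj_pair)
  have n: "t\<^sup>2 - (cmod \<zeta>)\<^sup>2 = 1" using lp_lift_self[of c] unfolding c lp_self by simp
  have t: "0 < t" using fst_lift_pos[of c] c by simp
  \<comment> \<open>Half-angle formula: \<open>t\<close> is the cosh of the distance of
    \<open>c\<close> from the origin, \<open>s\<close> the cosh of half of it.\<close>
  define s where "s = sqrt ((1 + t) / 2)"
  have s: "0 < s" "s\<^sup>2 = (1 + t) / 2" using t by (auto simp: s_def)
  define b where "b = \<zeta> /\<^sub>R (2 * s)"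
  have "cmod b = cmod \<zeta> / (2 * s)" using s(1) by (simp add: b_def field_simps)
  then have "(cmod b)\<^sup>2 = (cmod \<zeta>)\<^sup>2 / (4 * s\<^sup>2)" by (simp add: power_divide power_mult_distrib)
  also have "(cmod \<zeta>)\<^sup>2 = (t - 1) * (t + 1)" using n by (simp add: power2_eq_square algebra_simps)
  also have "(t - 1) * (t + 1) / (4 * s\<^sup>2) = (t - 1) / 2" using t by (simp add: s(2) field_simps)
  finally have b: "(cmod b)\<^sup>2 = (t - 1) / 2" .
  let ?T = "act (of_real s) b"
  have T: "?T \<in> SO" unfolding SO_def
    by (intro CollectI exI[of _ "complex_of_real s"] exI[of _ b]) (use s b in \<open>simp add: field_simps\<close>)
  have T1: "?T (1, 0) = lift c"
    using s b by (simp add: act_def c field_simps) (simp add: b_def scaleR_conv_of_real field_simps)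
  obtain T' where T': "T' \<in> SO" "?T \<circ> T' = id" "T' \<circ> ?T = id" using SO_inverse[OF T] .
  define u where "u = T' n"
  have un: "?T u = n" using T'(2) unfolding u_def by (metis comp_apply id_apply)
  have u0: "fst u = 0"
  proof -
    have "lp (?T (1, 0)) (?T u) = lp (1, 0) u" by (rule SO_lp[OF T])
    then show ?thesis unfolding un T1 assms(2) by (simp add: lp_def)
  qed
  have "lp u u = -1" using assms(1) T'(1) by (simp add: u_def)
  then have "(cmod (snd u))\<^sup>2 = 1" using u0 by (simp add: lp_self)
  then have u1: "cmod (snd u) = 1" by (simp add: power2_eq_1_iff) (smt (verit) norm_ge_zero)
  \<comment> \<open>\<open>act e 0\<close> multiplies the space part by the square of
    \<open>e\<close>, hence the square root.\<close>
  define e where "e = csqrt (snd u / \<i>)"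
  have e: "e\<^sup>2 = snd u / \<i>" by (simp add: e_def)
  then have "(cmod e)\<^sup>2 = 1" using u1 by (metis norm_divide norm_ii norm_power div_by_1)
  then have e1: "cmod e = 1" by (simp add: power2_eq_1_iff)  (smt (verit) norm_ge_zero)
  let ?R = "act e 0"
  have R: "?R \<in> SO" unfolding SO_def by (intro CollectI exI[of _ e] exI[of _ "0::complex"]) (use e1 in simp)
  have "?R (1, 0) = (1, 0)" "?R (0, \<i>) = u"
    using e1 e u0 by (simp_all add: act_def prod_eq_iff complex_eq_iff)
  then show ?thesis
    using that[of "?T \<circ> ?R"] SO_comp[OF T R] T1 un by simp
qed

lemma SO_flags:
  assumes "lp n n = -1" "lp (lift c) n = 0" "lp n' n' = -1" "lp (lift c') n' = 0"
  obtains A where "A \<in> SO" "A (lift c) = lift c'" "A n = n'"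
proof -
  obtain A where A: "A \<in> SO" "A (1, 0) = lift c" "A (0, \<i>) = n" using SO_flag[OF assms(1,2)] .
  obtain B where B: "B \<in> SO" "B (1, 0) = lift c'" "B (0, \<i>) = n'" using SO_flag[OF assms(3,4)] .
  obtain A' where A': "A' \<in> SO" "A \<circ> A' = id" "A' \<circ> A = id" using SO_inverse[OF A(1)] .
  have "A' (lift c) = (1, 0)" "A' n = (0, \<i>)"
    using A'(3) A(2,3) by (metis comp_apply id_apply)+
  then show ?thesis using that[of "B \<circ> A'"] SO_comp[OF B(1) A'(1)] B by simp
qed

lemma SO_pairs:
  assumes "lp (lift q) (lift q') = lp (lift p) (lift p')"
  obtains A where "A \<in> SO" "mv A q = p" "mv A q' = p'"
proof -
  define P where "P = lp (lift q) (lift q')"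
  show ?thesis
  proof (cases "P = 1")
    case True
    then have "q = q'" "p = p'" using assms by (auto simp: P_def lp_lift_eq_1)
    have "\<exists>n. lp n n = -1 \<and> lp (lift c) n = 0" for c
    proof -
      \<comment> \<open>When both points coincide any direction will do; this is
        \<open>(0, \<i>)\<close> with the time coordinate corrected to make it orthogonal to
        \<open>lift c\<close>.\<close>
      define m where "m = (snd (lift c) \<bullet> \<i> / fst (lift c), \<i>)"
      have "lp (lift c) m = 0" using less_imp_neq[OF fst_lift_pos[of c], THEN not_sym] by (simp add: m_def lp_def del: fst_lift_pos)
      moreover have "lp m m < 0"
      proof -
        have "\<bar>snd (lift c) \<bullet> \<i>\<bar> \<le> cmod (snd (lift c))" using Cauchy_Schwarz_ineq2[of "snd (lift c)" \<i>] by simp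
        also have "\<dots> < fst (lift c)" using future_lift[of c] by (simp only: future_def)
        finally have "\<bar>snd (lift c) \<bullet> \<i> / fst (lift c)\<bar> < 1" using fst_lift_pos[of c] by (simp add: abs_divide)
        then show ?thesis by (simp add: m_def lp_self abs_square_less_1)
      qed
      ultimately show ?thesis
        by (intro exI[of _ "m /\<^sub>R sqrt (- lp m m)"]) (simp add: field_simps)
    qed
    then obtain n n' where "lp n n = -1" "lp (lift q) n = 0" "lp n' n' = -1" "lp (lift p) n' = 0" by metis
    then obtain A where A: "A \<in> SO" "A (lift q) = lift p" using SO_flags by metis
    show ?thesis using that[of A] A \<open>q = q'\<close> \<open>p = p'\<close> by (simp add: mv_def)
  next
    case False
    then have P: "1 < P" using lp_lift_ge_1[of q q'] by (simp add: P_def)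
    then have P2: "0 < P\<^sup>2 - 1" by (simp add: one_less_power)
    \<comment> \<open>The unit tangent vector at \<open>x\<close> pointing towards \<open>y\<close>,
      by Gram-Schmidt.\<close>
    have t: "lp ((lift y - P *\<^sub>R lift x) /\<^sub>R sqrt (P\<^sup>2 - 1)) ((lift y - P *\<^sub>R lift x) /\<^sub>R sqrt (P\<^sup>2 - 1)) = -1
       \<and> lp (lift x) ((lift y - P *\<^sub>R lift x) /\<^sub>R sqrt (P\<^sup>2 - 1)) = 0"
      if "lp (lift x) (lift y) = P" for x y
    proof -
      have "lp (lift y - P *\<^sub>R lift x) (lift y - P *\<^sub>R lift x) = - (P\<^sup>2 - 1)"
        using that lp_commute[of "lift y" "lift x"] by (simp add: power2_eq_square)
      then show ?thesis using that P2 by (simp add: field_simps)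
    qed
    have pq: "lp (lift q) (lift q') = P" "lp (lift p) (lift p') = P" using assms by (simp_all add: P_def)
    obtain A where A: "A \<in> SO" "A (lift q) = lift p"
      and A2: "A ((lift q' - P *\<^sub>R lift q) /\<^sub>R sqrt (P\<^sup>2 - 1)) = (lift p' - P *\<^sub>R lift p) /\<^sub>R sqrt (P\<^sup>2 - 1)"
      using SO_flags t[OF pq(1)] t[OF pq(2)] by metis
    have lin: "linear A" by (rule SO_linear[OF A(1)])
    have "A (lift q' - P *\<^sub>R lift q) = lift p' - P *\<^sub>R lift p"
      using A2 P2 by (simp add: linear_scale[OF lin])
    then have "A (lift q') = lift p'" using A(2) by (simp add: linear_diff[OF lin] linear_scale[OF lin])
    then show ?thesis using that[of A] A by (simp add: mv_def)
  qed
qed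

section \<open>Isometries as congruences\<close>

lemma mv_bij: "A \<in> SO \<Longrightarrow> bij (mv A)"
  by (metis SO_inverse mv_comp mv_id o_bij)

lemma dist_mv [simp]: "A \<in> SO \<Longrightarrow> dist (mv A x) (mv A y) = dist x y"
  by (simp add: dist_eq_arcosh)

lemma congruence_mv: "A \<in> SO \<Longrightarrow> congruence (mv A)"
  by (simp add: congruence_def bij_is_surj mv_bij)

lemma to_disc_eq: "to_disc x = snd (lift x) /\<^sub>R (fst (lift x) + 1)"
proof -
  define r where "r = 1 - (cmod (to_disc x))\<^sup>2"
  have r: "0 < r" using to_disc_pos[of x] by (simp add: r_def)
  then have "fst (lift x) + 1 = 2 / r" by (simp add: lift_def r_def field_simps)
  moreover have "snd (lift x) = (2 / r) *\<^sub>R to_disc x" by (simp add: lift_def r_def)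
  ultimately show ?thesis using r by simp
qed

text \<open>In the disc the map is a Moebius transformation of determinant 1, whose derivative is
  multiplication by the complex number \<open>1 / (d * d)\<close>; such a multiplication has
  positive real determinant.\<close>

lemma orientation_preserving_mv:
  assumes "A \<in> SO"
  shows "orientation_preserving (mv A)"
  unfolding orientation_preserving_def
proof
  fix x
  obtain a b where A: "A = act a b" and ab: "(cmod a)\<^sup>2 - (cmod b)\<^sup>2 = 1"
    using assms by (auto simp: SO_def)
  have abc: "a * cnj a - b * cnj b = 1" using ab
    by (metis complex_norm_square of_real_1 of_real_diff)
  have ba: "cmod b < cmod a" using ab
    by (smt (verit) norm_ge_zero power_mono)
  have nz: "cnj b * z + cnj a \<noteq> 0" if "cmod z < 1" for z
  proof
    assume "cnj b * z + cnj a = 0"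
    then have "cmod (cnj b * z) = cmod (- cnj a)" by (metis add_eq_0_iff2)
    then have "cmod a = cmod b * cmod z" by (simp add: norm_mult)
    also have "\<dots> \<le> cmod b" using that by (simp add: mult_left_le)
    finally show False using ba by simp
  qed
  have eq: "to_disc (mv A (of_disc z)) = (a * z + b) / (cnj b * z + cnj a)" if z: "z \<in> ball 0 1" for z
  proof -
    have cz: "cmod z < 1" using z by simp
    define w where "w = (a * z + b) / (cnj b * z + cnj a)"
    have td: "to_disc (of_disc z) = z" using z by (rule of_disc_inverse)
    define r where "r = 1 - (cmod z)\<^sup>2"
    have r: "0 < r" unfolding r_def by (rule disc_pos[OF z])
    have l: "lift (mv A (of_disc z)) = act a b ((1 + (cmod z)\<^sup>2) / r, (2 / r) *\<^sub>R z)"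
      using assms by (simp add: A[symmetric]) (simp add: lift_def td r_def)
    have f1: "fst (lift (mv A (of_disc z))) + 1 = 2 / r * (cmod (cnj b * z + cnj a))\<^sup>2"
    proof -
      have "((cmod a)\<^sup>2 + (cmod b)\<^sup>2) * (1 + (cmod z)\<^sup>2) + 2 * Re (a * cnj b * (2 * z)) + ((cmod a)\<^sup>2 - (cmod b)\<^sup>2) * r = 2 * (cmod (cnj b * z + cnj a))\<^sup>2"
        unfolding r_def cmod_power2 by (simp add: power2_eq_square algebra_simps)
      then show ?thesis using r unfolding l ab by (simp add: act_def divide_simps scaleR_conv_of_real)
    qed
    have s1: "snd (lift (mv A (of_disc z))) = (2 / r) *\<^sub>R ((a * z + b) * cnj (cnj b * z + cnj a))"
    proof -
      have "2 * a * b * (1 + z * cnj z) + a\<^sup>2 * (2 * z) + b\<^sup>2 * cnj (2 * z) = 2 * ((a * z + b) * cnj (cnj b * z + cnj a))"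
        by (simp add: power2_eq_square algebra_simps)
      then show ?thesis using r unfolding l
        by (simp add: act_def divide_simps scaleR_conv_of_real complex_norm_square[symmetric] mult_ac del: of_real_power)
    qed
    define d where "d = cnj b * z + cnj a"
    have d: "d \<noteq> 0" using nz[OF cz] by (simp add: d_def)
    have "to_disc (mv A (of_disc z)) = ((2 / r) *\<^sub>R ((a * z + b) * cnj d)) /\<^sub>R (2 / r * (cmod d)\<^sup>2)"
      unfolding to_disc_eq f1 s1 d_def ..
    also have "\<dots> = (a * z + b) * cnj d / of_real ((cmod d)\<^sup>2)"
    proof -
      have "((2 / r) *\<^sub>R u) /\<^sub>R (2 / r * q) = u /\<^sub>R q" for u :: complex and q using r by (simp add: inverse_eq_divide)
      then have "((2 / r) *\<^sub>R ((a * z + b) * cnj d)) /\<^sub>R (2 / r * (cmod d)\<^sup>2) = ((a * z + b) * cnj d) /\<^sub>R (cmod d)\<^sup>2" .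
      also have "\<dots> = (a * z + b) * cnj d / of_real ((cmod d)\<^sup>2)"
        by (simp only: scaleR_conv_of_real of_real_inverse divide_inverse mult.commute)
      finally show ?thesis .
    qed
    also have "\<dots> = (a * z + b) / d" using d unfolding complex_norm_square by simp
    finally show ?thesis by (simp add: d_def)
  qed
  define z where "z = to_disc x"
  have z: "z \<in> ball 0 1" unfolding z_def by (rule to_disc)
  define d where "d = cnj b * z + cnj a"
  have d: "d \<noteq> 0" using nz[of z] z by (simp add: d_def)
  have "((\<lambda>z. (a * z + b) / (cnj b * z + cnj a)) has_field_derivative
      (a * d - (a * z + b) * cnj b) / (d * d)) (at z)"
    using d unfolding d_def by (auto intro!: derivative_eq_intros)
  also have "a * d - (a * z + b) * cnj b = 1" using abc by (simp add: d_def algebra_simps)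
  finally have "((\<lambda>z. (a * z + b) / (cnj b * z + cnj a)) has_derivative (*) (1 / (d * d))) (at z)"
    by (simp add: has_field_derivative_def)
  then have "((\<lambda>z. to_disc (mv A (of_disc z))) has_derivative (*) (1 / (d * d))) (at z)"
    by (rule has_derivative_transform_within_open[OF _ open_ball z]) (use eq in auto)
  moreover have "0 < Im (cnj (1 / (d * d) * 1) * (1 / (d * d) * \<i>))"
  proof -
    have "cnj (1 / (d * d) * 1) * (1 / (d * d) * \<i>) = of_real ((cmod (1 / (d * d)))\<^sup>2) * \<i>"
      by (simp only: complex_norm_square) (simp add: mult.commute)
    then show ?thesis using d by simp
  qed
  ultimately show "\<exists>D. ((\<lambda>z. to_disc (mv A (of_disc z))) has_derivative D) (at (to_disc x)) \<and>
      0 < Im (cnj (D 1) * D \<i>)"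
    unfolding z_def by blast
qed

text \<open>The two distance conditions fix the products of \<open>f x\<close> with \<open>c\<close>
  and with \<open>x\<close>; by the formula for cosh of a double argument its product with the
  half-turn image is then 1, so both points coincide.\<close>

lemma point_reflection_hturn: "point_reflection c f \<longleftrightarrow> f = mv (hturn c)"
proof
  assume f: "point_reflection c f"
  show "f = mv (hturn c)"
  proof
    fix x
    let ?a = "lp (lift c) (lift x)"
    have "lp (lift c) (lift (f x)) = ?a" "lp (lift x) (lift (f x)) = cosh (2 * dist c x)"
      using f cosh_dist by (metis point_reflection_def)+
    then have "lp (lift (f x)) (lift (mv (hturn c) x)) = 2 * ?a * ?a - cosh (2 * dist c x)"
      by (simp add: hturn_def lp_commute[of "lift (f x)"] lp_commute[of "lift x" "lift c"])
    also have "\<dots> = 1" by (simp add: cosh_double_cosh cosh_dist power2_eq_square)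
    finally show "f x = mv (hturn c) x" by (rule lp_lift_eq_1[THEN iffD1])
  qed
next
  assume f: "f = mv (hturn c)"
  show "point_reflection c f"
    unfolding point_reflection_def
  proof (intro allI conjI)
    fix x
    show "dist c (f x) = dist c x"
      by (simp add: f dist_eq_arcosh hturn_def lp_commute[of "lift x"])
    have "cosh (dist x (f x)) = cosh (2 * dist c x)"
      by (simp add: f cosh_dist cosh_double_cosh hturn_def lp_commute[of "lift x" "lift c"] power2_eq_square)
    then show "dist x (f x) = 2 * dist c x"
      using cosh_real_nonneg_less_iff[of "dist x (f x)" "2 * dist c x"] cosh_real_nonneg_less_iff[of "2 * dist c x" "dist x (f x)"]
      by (smt (verit) zero_le_dist)
  qed
qed

lemma centrally_symmetric_iff: "centrally_symmetric S \<longleftrightarrow> (\<exists>c. mv (hturn c) ` S = S)"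
  by (simp add: centrally_symmetric_def point_reflection_hturn)

section \<open>Images of sets under isometries\<close>

lemma continuous_mv: "A \<in> SO \<Longrightarrow> continuous_on S (mv A)"
  by (auto simp: continuous_on_iff)

lemma mv_vimage:
  assumes "A \<in> SO"
  obtains B where "B \<in> SO" "\<And>x. mv A (mv B x) = x" "\<And>x. mv B (mv A x) = x" "\<And>S. mv A ` S = mv B -` S"
    "\<And>X. A (B X) = X" "\<And>X. B (A X) = X"
proof -
  obtain B where B: "B \<in> SO" "A \<circ> B = id" "B \<circ> A = id" using SO_inverse[OF assms] .
  have AB: "mv A (mv B x) = x" and BA: "mv B (mv A x) = x" for x
    using B assms by (metis comp_apply id_apply mv_comp mv_id)+
  have "A (B X) = X" "B (A X) = X" for X
    using B by (metis comp_apply id_apply)+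
  moreover have "mv A ` S = mv B -` S" for S
  proof
    show "mv A ` S \<subseteq> mv B -` S" by (simp add: BA image_subset_iff)
    show "mv B -` S \<subseteq> mv A ` S" by (metis AB image_eqI subsetI vimageD)
  qed
  ultimately show ?thesis using that[OF B(1) AB BA] by blast
qed

lemma open_mv: "A \<in> SO \<Longrightarrow> open S \<Longrightarrow> open (mv A ` S)"
  by (metis continuous_mv mv_vimage open_vimage)

lemma closed_mv: "A \<in> SO \<Longrightarrow> closed S \<Longrightarrow> closed (mv A ` S)"
  by (metis continuous_mv mv_vimage closed_vimage)

lemma interior_mv:
  assumes "A \<in> SO"
  shows "interior (mv A ` S) = mv A ` interior S"
proof -
  obtain B where B: "B \<in> SO" "\<And>x. mv A (mv B x) = x" "\<And>x. mv B (mv A x) = x" "\<And>S. mv A ` S = mv B -` S"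
    using mv_vimage[OF assms] by metis
  have "mv A ` interior S \<subseteq> interior (mv A ` S)"
    by (intro interior_maximal image_mono interior_subset open_mv assms open_interior)
  moreover have "mv B ` interior (mv A ` S) \<subseteq> interior S"
  proof (rule interior_maximal)
    show "mv B ` interior (mv A ` S) \<subseteq> S" using interior_subset[of "mv A ` S"] B(3) by auto
    show "open (mv B ` interior (mv A ` S))" by (intro open_mv B open_interior)
  qed
  ultimately show ?thesis using B(2) by (metis image_eqI image_subset_iff subsetI subset_antisym)
qed

lemma frontier_mv: "A \<in> SO \<Longrightarrow> closed S \<Longrightarrow> frontier (mv A ` S) = mv A ` frontier S"
  using bij_is_inj[OF mv_bij, of A]
  by (simp add: frontier_def closed_mv interior_mv image_set_diff)

lemma hyp_convex_mv:
  assumes "A \<in> SO" "hyp_convex S"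
  shows "hyp_convex (mv A ` S)"
  unfolding hyp_convex_def
proof (intro ballI subsetI)
  obtain B where B: "B \<in> SO" "\<And>x. mv A (mv B x) = x" "\<And>x. mv B (mv A x) = x"
    using mv_vimage[OF assms(1)] by metis
  fix x y z assume "x \<in> mv A ` S" "y \<in> mv A ` S" and z: "z \<in> hyp_segment x y"
  then obtain x' y' where xy: "x' \<in> S" "y' \<in> S" "x = mv A x'" "y = mv A y'" by auto
  have "z = mv A (mv B z)" by (simp add: B)
  with z have "mv B z \<in> hyp_segment x' y'"
    unfolding hyp_segment_def xy by (metis (mono_tags, lifting) assms(1) dist_mv mem_Collect_eq)
  then show "z \<in> mv A ` S" using assms(2) xy B(2) unfolding hyp_convex_def by (metis image_eqI subsetD)
qed

text \<open>Condition (1) for Moebius maps, with half-turns as reflections. By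
  \<open>sym_pair_mv\<close> both sets may be moved independently, so each can be brought into its
  own normal position.\<close>

definition sym_pair :: "hyp_plane set \<Rightarrow> hyp_plane set \<Rightarrow> bool" where
  "sym_pair K L \<longleftrightarrow> (\<forall>A\<in>SO. \<forall>B\<in>SO. interior (mv A ` K \<inter> mv B ` L) \<noteq> {} \<longrightarrow>
    (\<exists>c. mv (hturn c) ` (mv A ` K \<inter> mv B ` L) = mv A ` K \<inter> mv B ` L))"

lemma sym_pair_commute: "sym_pair K L \<Longrightarrow> sym_pair L K"
  unfolding sym_pair_def by (metis Int_commute)

lemma sym_pair_mv: "sym_pair K L \<Longrightarrow> A \<in> SO \<Longrightarrow> B \<in> SO \<Longrightarrow> sym_pair (mv A ` K) (mv B ` L)"
  unfolding sym_pair_def by (simp add: image_comp SO_comp flip: mv_comp)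

lemma sym_pairD:
  assumes "sym_pair K L" "A \<in> SO" "interior (K \<inter> mv A ` L) \<noteq> {}"
  obtains c where "\<And>x. x \<in> K \<inter> mv A ` L \<Longrightarrow> mv (hturn c) x \<in> K \<inter> mv A ` L"
proof -
  have "mv id ` K = K" by simp
  then obtain c where "mv (hturn c) ` (K \<inter> mv A ` L) = K \<inter> mv A ` L"
    using assms(1)[unfolded sym_pair_def, rule_format, OF SO_id assms(2)] assms(3) by metis
  then show ?thesis using that by (metis image_eqI)
qed

lemma sym_pairI:
  assumes "\<And>\<phi> \<psi>. congruence \<phi> \<Longrightarrow> orientation_preserving \<phi> \<Longrightarrow> congruence \<psi> \<Longrightarrow> orientation_preserving \<psi> \<Longrightarrow>
      interior (\<phi> ` K \<inter> \<psi> ` L) \<noteq> {} \<Longrightarrow> centrally_symmetric (\<phi> ` K \<inter> \<psi> ` L)"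
  shows "sym_pair K L"
  unfolding sym_pair_def
  using assms by (metis congruence_mv orientation_preserving_mv centrally_symmetric_iff)

definition body :: "hyp_plane set \<Rightarrow> bool" where
  "body K \<longleftrightarrow> K \<noteq> UNIV \<and> closed K \<and> hyp_convex K \<and> interior K \<noteq> {}"

lemma body_mv: "body K \<Longrightarrow> A \<in> SO \<Longrightarrow> body (mv A ` K)"
  unfolding body_def
  by (metis closed_mv hyp_convex_mv interior_mv image_is_empty mv_bij bij_is_inj bij_is_surj inj_image_eq_iff)

section \<open>Support lines\<close>

lemma lp_lift_kl: "lp (lift z) N = fst (lift z) * (fst N - kl z \<bullet> snd N)"
  by (subst lift_kl) (simp add: lp_def algebra_simps)

lemma lp_lift_nonneg_iff: "0 \<le> lp (lift z) N \<longleftrightarrow> kl z \<bullet> snd N \<le> fst N"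
  using fst_lift_pos[of z] by (simp add: lp_lift_kl zero_le_mult_iff del: fst_lift_pos)

text \<open>Lets every support normal be scaled to square -1 and moved by
  \<open>SO_flags\<close>.\<close>

lemma spacelike_if_orthogonal:
  assumes "lp (lift x) N = 0" "N \<noteq> 0"
  shows "lp N N < 0"
proof -
  have e: "fst N = kl x \<bullet> snd N"
    using assms(1) fst_lift_pos[of x] by (simp add: lp_lift_kl del: fst_lift_pos)
  then have n: "snd N \<noteq> 0" using assms(2) by (auto simp: prod_eq_iff)
  have "\<bar>fst N\<bar> \<le> cmod (kl x) * cmod (snd N)" unfolding e by (rule Cauchy_Schwarz_ineq2)
  also have "\<dots> < cmod (snd N)" using n norm_kl[of x] by simp
  finally have "\<bar>fst N\<bar>\<^sup>2 < (cmod (snd N))\<^sup>2" by (intro power_strict_mono) auto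
  then have "(fst N)\<^sup>2 < (cmod (snd N))\<^sup>2" by simp
  then show ?thesis by (simp add: lp_self)
qed

definition supp :: "hyp_plane set \<Rightarrow> hyp_plane \<Rightarrow> vec \<Rightarrow> bool" where
  "supp K x N \<longleftrightarrow> N \<noteq> 0 \<and> lp (lift x) N = 0 \<and> (\<forall>z\<in>K. 0 \<le> lp (lift z) N)"

lemma frontier_subset_body: "body K \<Longrightarrow> x \<in> frontier K \<Longrightarrow> x \<in> K"
  by (auto simp: body_def frontier_def)

lemma body_kl:
  assumes "body K"
  shows "convex (kl ` K)" "interior (kl ` K) \<noteq> {}"
  using assms interior_kl by (auto simp: body_def intro!: convex_kl_image)

lemma supp_exists:
  assumes "body K" "x \<in> frontier K"
  obtains N where "supp K x N"
proof -
  have x: "x \<in> K" "x \<notin> interior K" using assms frontier_subset_body by (auto simp: frontier_def)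
  have "kl x \<notin> rel_interior (kl ` K)"
    using x(2) body_kl(2)[OF assms(1)] by (simp add: rel_interior_nonempty_interior interior_kl)
  then obtain a where a: "a \<noteq> 0" "\<And>y. y \<in> closure (kl ` K) \<Longrightarrow> a \<bullet> kl x \<le> a \<bullet> y"
    using supporting_hyperplane_relative_frontier[OF body_kl(1)[OF assms(1)]] x(1) closure_subset
    by (metis imageI subsetD)
  have "a \<bullet> kl x \<le> a \<bullet> kl z" if "z \<in> K" for z using a(2) that closure_subset by blast
  \<comment> \<open>The Euclidean half-plane of the chart in homogeneous form; the signs compensate
    the minus sign in \<open>lp\<close>.\<close>
  then have "supp K x (- (a \<bullet> kl x), - a)"
    using a(1) unfolding supp_def by (auto simp: lp_lift_kl inner_commute prod_eq_iff less_imp_le)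
  then show ?thesis by (rule that)
qed

lemma supp_mv:
  assumes "A \<in> SO" "supp K x N"
  shows "supp (mv A ` K) (mv A x) (A N)"
proof -
  obtain B where "B \<in> SO" "\<And>X. B (A X) = X" using mv_vimage[OF assms(1)] by metis
  then have "A N \<noteq> 0" using assms linear_0[OF SO_linear] unfolding supp_def by metis
  then show ?thesis using assms by (auto simp: supp_def)
qed

definition smooth_pt :: "hyp_plane set \<Rightarrow> hyp_plane \<Rightarrow> bool" where
  "smooth_pt K x \<longleftrightarrow> x \<in> frontier K \<and> (\<forall>N N'. supp K x N \<longrightarrow> supp K x N' \<longrightarrow> (\<exists>c. N' = c *\<^sub>R N))"

lemma smooth_pt_mv:
  assumes "A \<in> SO" "body K" "smooth_pt K x"
  shows "smooth_pt (mv A ` K) (mv A x)"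
proof -
  obtain B where B: "B \<in> SO" "\<And>x. mv B (mv A x) = x" "\<And>X. B (A X) = X" "\<And>X. A (B X) = X"
    using mv_vimage[OF assms(1)] by metis
  have "mv B ` mv A ` K = K" by (simp add: image_image B)
  then have *: "supp K x (B N)" if "supp (mv A ` K) (mv A x) N" for N
    using supp_mv[OF B(1) that] by (simp add: B)
  have "\<exists>c. N' = c *\<^sub>R N" if N: "supp (mv A ` K) (mv A x) N" "supp (mv A ` K) (mv A x) N'" for N N'
  proof -
    obtain c where "B N' = c *\<^sub>R B N" using assms(3) *[OF N(1)] *[OF N(2)] unfolding smooth_pt_def by blast
    then have "A (B N') = c *\<^sub>R A (B N)" using linear_scale[OF SO_linear[OF assms(1)]] by metis
    then show ?thesis by (auto simp: B)
  qed
  moreover have "mv A x \<in> frontier (mv A ` K)"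
    using assms by (simp add: frontier_mv body_def smooth_pt_def)
  ultimately show ?thesis by (simp add: smooth_pt_def)
qed

section \<open>Convex sets near a boundary point placed at the origin\<close>

abbreviation orig :: hyp_plane where "orig \<equiv> kp 0"

lemma lift_orig [simp]: "lift orig = (1, 0)"
  by (simp add: lift_kp)

lemma kl_orig [simp]: "kl orig = 0" by simp

text \<open>As no line of slope \<eta> or -\<eta> supports \<open>C\<close> at 0, there are points
  of \<open>C\<close> below these lines on the right and on the left. The triangle that they span
  with 0 contains the cone near 0.\<close>

lemma smooth_cone:
  fixes C :: "complex set"
  assumes "convex C" "0 \<in> C" and im: "\<And>k. k \<in> C \<Longrightarrow> 0 \<le> Im k" and k0: "k0 \<in> C" "0 < Im k0"
    and uniq: "\<And>a. a \<noteq> 0 \<Longrightarrow> (\<And>k. k \<in> C \<Longrightarrow> 0 \<le> a \<bullet> k) \<Longrightarrow> Re a = 0" and \<eta>: "0 < \<eta>"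
  obtains \<rho> where "0 < \<rho>" "\<And>k. cmod k < \<rho> \<Longrightarrow> \<eta> * cmod k \<le> Im k \<Longrightarrow> k \<in> C"
proof -
  have ex: "\<exists>k\<in>C. Im k < m * Re k" if "m \<noteq> 0" for m
  proof (rule ccontr)
    assume "\<not> ?thesis"
    then have "0 \<le> Complex (- m) 1 \<bullet> k" if "k \<in> C" for k using that by (auto simp: inner_complex_def not_less)
    then have "Re (Complex (- m) 1) = 0" by (intro uniq) (auto simp: complex_eq_iff)
    then show False using that by simp
  qed
  obtain k1 where k1: "k1 \<in> C" "Im k1 < \<eta> * Re k1" using ex[of \<eta>] \<eta> by auto
  obtain k2 where k2: "k2 \<in> C" "Im k2 < - \<eta> * Re k2" using ex[of "- \<eta>"] \<eta> by auto
  \<comment> \<open>Mixing a little of \<open>k0\<close> into \<open>k1\<close> stays below the line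
    of slope \<eta> but makes the height positive, so that \<open>k3\<close> and \<open>k2\<close>
    become linearly independent.\<close>
  obtain t where t: "0 < t" "t < 1" "t * (Im k0 - \<eta> * Re k0) < (1 - t) * (\<eta> * Re k1 - Im k1)"
  proof -
    define h where "h = \<eta> * Re k1 - Im k1"
    define b where "b = \<bar>Im k0 - \<eta> * Re k0\<bar>"
    have h: "0 < h" using k1 by (simp add: h_def)
    define t where "t = h / (2 * (h + b))"
    have hb: "0 < h + b" using h by (simp add: b_def)
    have t: "0 < t" "t \<le> 1/2" using h hb by (auto simp: t_def b_def field_simps)
    have "t * (Im k0 - \<eta> * Re k0) \<le> t * b" using t by (intro mult_left_mono) (auto simp: b_def)
    moreover have "t * b + t * h = t * (h + b)" by (simp add: algebra_simps)
    moreover have "t * (h + b) = h / 2"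
      using hb by (metis nonzero_mult_divide_mult_cancel_right less_irrefl mult.commute times_divide_eq_left t_def)
    ultimately have "t * (Im k0 - \<eta> * Re k0) < (1 - t) * h" using h by (simp add: algebra_simps)
    then show ?thesis using that[of t] t by (simp add: h_def)
  qed
  define k3 where "k3 = (1 - t) *\<^sub>R k1 + t *\<^sub>R k0"
  have k3: "k3 \<in> C" unfolding k3_def using t k1 k0 assms(1) by (intro convexD) auto
  define a b c d where "a = Re k3" and "b = Im k3" and "c = - Re k2" and "d = Im k2"
  have b: "0 < b" using t k0 im[OF k1(1)] by (simp add: b_def k3_def add_nonneg_pos)
  have ba: "b < \<eta> * a" using t by (simp add: a_def b_def k3_def algebra_simps)
  have d: "0 \<le> d" "d < \<eta> * c" using im[OF k2(1)] k2 by (simp_all add: c_def d_def)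
  have "0 < \<eta> * a" "0 < \<eta> * c" using b ba d by linarith+
  then have ac: "0 < a" "0 < c" using \<eta> by (simp_all add: zero_less_mult_iff)
  define D where "D = a * d + b * c"
  have D: "0 < D" using ac b d by (auto simp: D_def intro!: add_nonneg_pos)
  define \<rho> where "\<rho> = D / (a + b + c + d)"
  have S: "0 < a + b + c + d" using ac b d by simp
  show ?thesis
  proof (rule that[of \<rho>])
    show "0 < \<rho>" using D S by (simp add: \<rho>_def)
    fix k assume k: "cmod k < \<rho>" "\<eta> * cmod k \<le> Im k"
    define x y where "x = Re k" and "y = Im k"
    have xy: "\<bar>x\<bar> \<le> cmod k" "\<bar>y\<bar> \<le> cmod k" by (simp_all add: x_def y_def abs_Re_le_cmod abs_Im_le_cmod)
    have yx: "\<eta> * \<bar>x\<bar> \<le> y" using k(2) mult_left_mono[OF xy(1) less_imp_le[OF \<eta>]] by (simp add: y_def)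
    have y0: "0 \<le> y" using yx \<eta> by (smt (verit) abs_ge_zero mult_nonneg_nonneg)
    \<comment> \<open>Coordinates with respect to \<open>k3\<close> and \<open>k2\<close> by
      Cramer's rule; \<rho> was chosen so that their sum is at most 1.\<close>
    define \<alpha> \<beta> where "\<alpha> = (x * d + y * c) / D" and "\<beta> = (a * y - b * x) / D"
    have "- (x * d) \<le> \<bar>x\<bar> * (\<eta> * c)"
    proof -
      have "- (x * d) \<le> \<bar>x\<bar> * d" using d(1) by (metis abs_le_D2 abs_mult abs_of_nonneg abs_ge_minus_self)
      also have "\<dots> \<le> \<bar>x\<bar> * (\<eta> * c)" using d by (intro mult_left_mono) auto
      finally show ?thesis .
    qed
    also have "\<dots> \<le> y * c" using mult_right_mono[OF yx, of c] ac by (simp add: mult_ac)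
    finally have \<alpha>: "0 \<le> \<alpha>" using D by (simp add: \<alpha>_def)
    have "b * x \<le> (\<eta> * a) * \<bar>x\<bar>"
    proof -
      have "b * x \<le> b * \<bar>x\<bar>" using b by (intro mult_left_mono) auto
      also have "\<dots> \<le> (\<eta> * a) * \<bar>x\<bar>" using ba by (intro mult_right_mono) auto
      finally show ?thesis .
    qed
    also have "\<dots> \<le> a * y" using mult_left_mono[OF yx, of a] ac by (simp add: mult_ac)
    finally have \<beta>: "0 \<le> \<beta>" using D by (simp add: \<beta>_def)
    have "x * d + y * c + (a * y - b * x) \<le> cmod k * d + cmod k * c + (a * cmod k + b * cmod k)"
    proof -
      have "- x \<le> cmod k" "x \<le> cmod k" "y \<le> cmod k" using xy by linarith+
      then have "x * d \<le> cmod k * d" "y * c \<le> cmod k * c" "a * y \<le> a * cmod k" "b * (- x) \<le> b * cmod k"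
        using ac b d by (intro mult_left_mono mult_right_mono; simp)+
      then show ?thesis by simp
    qed
    also have "\<dots> = cmod k * (a + b + c + d)" by (simp add: algebra_simps)
    also have "\<dots> \<le> D" using k(1) S by (simp add: \<rho>_def field_simps)
    finally have le1: "\<alpha> + \<beta> \<le> 1" using D by (simp add: \<alpha>_def \<beta>_def add_divide_distrib[symmetric])
    have k_eq: "k = \<alpha> *\<^sub>R k3 + \<beta> *\<^sub>R k2 + (1 - \<alpha> - \<beta>) *\<^sub>R 0"
    proof -
      have "\<alpha> * a - \<beta> * c = x" "\<alpha> * b + \<beta> * d = y"
        using D by (simp_all add: \<alpha>_def \<beta>_def divide_simps) (simp_all add: D_def algebra_simps)
      then show ?thesis by (simp add: complex_eq_iff x_def y_def a_def b_def c_def d_def)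
    qed
    have "convex hull {k3, k2, 0} \<subseteq> C" using k3 k2 assms(1,2) by (intro hull_minimal) auto
    moreover have "k \<in> convex hull {k3, k2, 0}"
      unfolding convex_hull_3 using k_eq \<alpha> \<beta> le1 by (intro CollectI exI[of _ \<alpha>] exI[of _ \<beta>] exI[of _ "1 - \<alpha> - \<beta>"]) auto
    ultimately show "k \<in> C" by blast
  qed
qed

lemma noncollinear_interior:
  fixes C :: "complex set"
  assumes "convex C" "p \<in> C" "q \<in> C" "r \<in> C" "Im (cnj (q - p) * (r - p)) \<noteq> 0"
  shows "interior C \<noteq> {}"
proof
  assume "interior C = {}"
  then obtain a b where ab: "a \<noteq> 0" "C \<subseteq> {x. a \<bullet> x = b}"
    using empty_interior_subset_hyperplane[OF assms(1)] by metis
  then have "a \<bullet> (q - p) = 0" "a \<bullet> (r - p) = 0" using assms by (auto simp: inner_diff_right)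
  then have e: "Re a * Re (q - p) + Im a * Im (q - p) = 0" "Re a * Re (r - p) + Im a * Im (r - p) = 0"
    by (simp_all add: inner_complex_def)
  define D where "D = Re (q - p) * Im (r - p) - Im (q - p) * Re (r - p)"
  have "Re a * D = 0" "Im a * D = 0" using e unfolding D_def by algebra+
  moreover have "D \<noteq> 0" using assms(5) by (simp add: D_def algebra_simps)
  ultimately show False using ab(1) by (simp add: complex_eq_iff)
qed

text \<open>With two independent support functionals, directions from 0 into \<open>C\<close> are
  measured by the ratio of the first functional to the sum of both. The edges \<open>u1\<close> and
  \<open>u2\<close> of the tangent cone are the directions of smallest and largest ratio; the
  interior of \<open>C\<close> makes these distinct.\<close>

lemma corner_cone:
  fixes C :: "complex set"
  assumes "convex C" "0 \<in> C" "interior C \<noteq> {}"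
    and pos: "\<And>k. k \<in> C \<Longrightarrow> 0 \<le> a1 \<bullet> k" "\<And>k. k \<in> C \<Longrightarrow> 0 \<le> a2 \<bullet> k"
    and ind: "Re a1 * Im a2 - Im a1 * Re a2 \<noteq> 0"
  obtains u1 u2 where "Re u1 * Im u2 - Im u1 * Re u2 \<noteq> 0"
    "\<And>k. k \<in> C \<Longrightarrow> \<exists>\<alpha> \<beta>. 0 \<le> \<alpha> \<and> 0 \<le> \<beta> \<and> k = \<alpha> *\<^sub>R u1 + \<beta> *\<^sub>R u2"
    "\<And>\<alpha> \<beta>. 0 < \<alpha> \<Longrightarrow> 0 < \<beta> \<Longrightarrow> \<exists>t>0. t *\<^sub>R (\<alpha> *\<^sub>R u1 + \<beta> *\<^sub>R u2) \<in> C"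
proof -
  define D where "D = Re a1 * Im a2 - Im a1 * Re a2"
  have D: "D \<noteq> 0" using ind by (simp add: D_def)
  define e1 where "e1 = Complex (Im a2 / D) (- Re a2 / D)"
  define e2 where "e2 = Complex (- Im a1 / D) (Re a1 / D)"
  have k_eq: "k = (a1 \<bullet> k) *\<^sub>R e1 + (a2 \<bullet> k) *\<^sub>R e2" for k
    using D by (simp add: complex_eq_iff inner_complex_def e1_def e2_def divide_simps) (simp add: D_def algebra_simps)
  define r where "r k = (a1 \<bullet> k) / (a1 \<bullet> k + a2 \<bullet> k)" for k
  have s_pos: "0 < a1 \<bullet> k + a2 \<bullet> k" if "k \<in> C" "k \<noteq> 0" for k
  proof (rule ccontr)
    assume "\<not> ?thesis"
    then have "a1 \<bullet> k = 0" "a2 \<bullet> k = 0" using pos[OF that(1)] by linarith+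
    then show False using k_eq[of k] that(2) by simp
  qed
  define R where "R = r ` (C - {0})"
  have r01: "0 \<le> r k" "r k \<le> 1" if "k \<in> C" for k
    using pos[OF that] by (auto simp: r_def divide_le_eq_1)
  have bdd: "bdd_below R" "bdd_above R"
    unfolding R_def using r01 by (auto intro!: bdd_belowI2[of _ 0] bdd_aboveI2[of _ _ 1])
  have ex2: "\<exists>k\<in>C. \<exists>l\<in>C. k \<noteq> 0 \<and> l \<noteq> 0 \<and> r k < r l"
  proof (rule ccontr)
    assume "\<not> ?thesis"
    then have eq: "r k = r l" if "k \<in> C" "l \<in> C" "k \<noteq> 0" "l \<noteq> 0" for k l using that by (meson linorder_neqE_linordered_idom)
    obtain k0 where k0: "k0 \<in> interior C" using assms(3) by auto
    have "\<exists>r0. \<forall>k\<in>C. k \<noteq> 0 \<longrightarrow> r k = r0" using eq by metis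
    then obtain r0 where "\<And>k. k \<in> C \<Longrightarrow> k \<noteq> 0 \<Longrightarrow> r k = r0" by metis
    then have "((1 - r0) *\<^sub>R a1 - r0 *\<^sub>R a2) \<bullet> k = 0" if "k \<in> C" for k
    proof (cases "k = 0")
      case False
      then have "a1 \<bullet> k = r0 * (a1 \<bullet> k + a2 \<bullet> k)"
        using s_pos[OF that False] \<open>\<And>k. k \<in> C \<Longrightarrow> k \<noteq> 0 \<Longrightarrow> r k = r0\<close>[OF that False] by (simp add: r_def field_simps)
      then show ?thesis by (simp add: inner_diff_left algebra_simps)
    qed simp
    then have "C \<subseteq> {k. ((1 - r0) *\<^sub>R a1 - r0 *\<^sub>R a2) \<bullet> k = 0}" by auto
    then have "k0 \<in> interior {k. ((1 - r0) *\<^sub>R a1 - r0 *\<^sub>R a2) \<bullet> k = 0}" using k0 interior_mono by blast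
    moreover have "(1 - r0) *\<^sub>R a1 - r0 *\<^sub>R a2 \<noteq> 0"
    proof
      assume "(1 - r0) *\<^sub>R a1 - r0 *\<^sub>R a2 = 0"
      then have "(1 - r0) * Re a1 = r0 * Re a2" "(1 - r0) * Im a1 = r0 * Im a2" by (simp_all add: complex_eq_iff)
      then have "r0 * D = 0" "(1 - r0) * D = 0" unfolding D_def by algebra+
      then show False using D by auto
    qed
    ultimately show False using interior_hyperplane by blast
  qed
  define r1 r2 where "r1 = Inf R" and "r2 = Sup R"
  have r_in: "r1 \<le> r k \<and> r k \<le> r2" if "k \<in> C" "k \<noteq> 0" for k
    unfolding r1_def r2_def using that bdd by (auto simp: R_def intro!: cInf_lower cSup_upper)
  have R_ne: "R \<noteq> {}" using ex2 by (auto simp: R_def)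
  have r12: "r1 < r2"
  proof -
    obtain k l where "k \<in> C" "l \<in> C" "k \<noteq> 0" "l \<noteq> 0" "r k < r l" using ex2 by blast
    then show ?thesis using r_in[of k] r_in[of l] by linarith
  qed
  define u1 u2 where "u1 = r1 *\<^sub>R e1 + (1 - r1) *\<^sub>R e2" and "u2 = r2 *\<^sub>R e1 + (1 - r2) *\<^sub>R e2"
  have comb: "\<alpha> *\<^sub>R u1 + \<beta> *\<^sub>R u2 = (\<alpha> * r1 + \<beta> * r2) *\<^sub>R e1 + (\<alpha> + \<beta> - (\<alpha> * r1 + \<beta> * r2)) *\<^sub>R e2" for \<alpha> \<beta>
    by (simp add: u1_def u2_def complex_eq_iff algebra_simps)
  show ?thesis
  proof (rule that[of u1 u2])
    have "Re e1 * Im e2 - Im e1 * Re e2 = 1 / D"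
      using D by (simp add: e1_def e2_def divide_simps) (simp add: D_def algebra_simps)
    moreover have "Re u1 * Im u2 - Im u1 * Re u2 = (r1 - r2) * (Re e1 * Im e2 - Im e1 * Re e2)"
      by (simp add: u1_def u2_def algebra_simps)
    ultimately show "Re u1 * Im u2 - Im u1 * Re u2 \<noteq> 0" using r12 D by simp
  next
    fix k assume k: "k \<in> C"
    show "\<exists>\<alpha> \<beta>. 0 \<le> \<alpha> \<and> 0 \<le> \<beta> \<and> k = \<alpha> *\<^sub>R u1 + \<beta> *\<^sub>R u2"
    proof (cases "k = 0")
      case True then show ?thesis by (intro exI[of _ 0]) simp
    next
      case False
      define s \<theta> where "s = a1 \<bullet> k + a2 \<bullet> k" and "\<theta> = (r k - r1) / (r2 - r1)"
      have s: "0 < s" using s_pos[OF k False] by (simp add: s_def)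
      have th: "0 \<le> \<theta>" "\<theta> \<le> 1" using r_in[OF k False] r12 by (auto simp: \<theta>_def)
      have "s * r k = a1 \<bullet> k" using s by (simp add: r_def s_def)
      moreover have "\<theta> * (r2 - r1) = r k - r1" using r12 by (simp add: \<theta>_def)
      then have "(1 - \<theta>) * r1 + \<theta> * r2 = r k" by (simp add: algebra_simps)
      ultimately have "s * (1 - \<theta>) * r1 + s * \<theta> * r2 = a1 \<bullet> k" by (metis distrib_left mult.assoc)
      then have "k = (s * (1 - \<theta>)) *\<^sub>R u1 + (s * \<theta>) *\<^sub>R u2"
        unfolding comb by (subst k_eq) (simp add: s_def algebra_simps)
      then show ?thesis using s th by (intro exI[of _ "s * (1 - \<theta>)"] exI[of _ "s * \<theta>"]) auto
    qed
  next
    fix \<alpha> \<beta> :: real assume ab: "0 < \<alpha>" "0 < \<beta>"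
    define r0 where "r0 = (\<alpha> * r1 + \<beta> * r2) / (\<alpha> + \<beta>)"
    have "\<alpha> * r1 < \<alpha> * r2" "\<beta> * r1 < \<beta> * r2" using ab r12 by auto
    then have r0: "r1 < r0" "r0 < r2" using ab by (auto simp: r0_def field_simps)
    obtain k where k: "k \<in> C" "k \<noteq> 0" "r k < r0"
      using r0(1) cInf_less_iff[OF R_ne bdd(1)] unfolding r1_def R_def by auto
    obtain l where l: "l \<in> C" "l \<noteq> 0" "r0 < r l"
      using r0(2) less_cSup_iff[OF R_ne bdd(2)] unfolding r2_def R_def by auto
    \<comment> \<open>\<psi> is negative at \<open>k\<close> and positive at \<open>l\<close>, so it
      vanishes at a point of the segment between them, which therefore has the prescribed ratio
      \<open>r0\<close>.\<close>
    define \<psi> where "\<psi> m = a1 \<bullet> m - r0 * (a1 \<bullet> m + a2 \<bullet> m)" for m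
    have pk: "\<psi> k < 0" using k s_pos[OF k(1,2)] by (simp add: \<psi>_def r_def field_simps)
    have pl: "0 < \<psi> l" using l s_pos[OF l(1,2)] by (simp add: \<psi>_def r_def field_simps)
    define \<mu> where "\<mu> = \<psi> l / (\<psi> l - \<psi> k)"
    have la: "0 < \<mu>" "\<mu> < 1" using pk pl by (auto simp: \<mu>_def)
    define m where "m = \<mu> *\<^sub>R k + (1 - \<mu>) *\<^sub>R l"
    have m: "m \<in> C" unfolding m_def using la k l assms(1) by (intro convexD) auto
    have "\<psi> m = \<mu> * \<psi> k + (1 - \<mu>) * \<psi> l" by (simp add: m_def \<psi>_def inner_add_right algebra_simps)
    also have "\<dots> = 0" using pk pl by (simp add: \<mu>_def field_simps)
    finally have pm: "a1 \<bullet> m = r0 * (a1 \<bullet> m + a2 \<bullet> m)" by (simp add: \<psi>_def)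
    define s where "s = a1 \<bullet> m + a2 \<bullet> m"
    have "s = \<mu> * (a1 \<bullet> k + a2 \<bullet> k) + (1 - \<mu>) * (a1 \<bullet> l + a2 \<bullet> l)"
      by (simp add: s_def m_def inner_add_right algebra_simps)
    then have s: "0 < s" using s_pos[OF k(1,2)] s_pos[OF l(1,2)] la by (simp add: add_pos_pos)
    have "s / (\<alpha> + \<beta>) * (\<alpha> * r1 + \<beta> * r2) = a1 \<bullet> m" "s / (\<alpha> + \<beta>) * (\<alpha> + \<beta> - (\<alpha> * r1 + \<beta> * r2)) = a2 \<bullet> m"
    proof -
      have "s / (\<alpha> + \<beta>) * (\<alpha> * r1 + \<beta> * r2) = r0 * s" by (simp add: r0_def)
      then show "s / (\<alpha> + \<beta>) * (\<alpha> * r1 + \<beta> * r2) = a1 \<bullet> m" by (metis pm s_def)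
      then show "s / (\<alpha> + \<beta>) * (\<alpha> + \<beta> - (\<alpha> * r1 + \<beta> * r2)) = a2 \<bullet> m"
        using ab by (simp add: right_diff_distrib) (simp add: s_def)
    qed
    then have "(s / (\<alpha> + \<beta>)) *\<^sub>R (\<alpha> *\<^sub>R u1 + \<beta> *\<^sub>R u2) = m"
      unfolding comb by (subst (2) k_eq) (simp add: scaleR_add_right)
    then show "\<exists>t>0. t *\<^sub>R (\<alpha> *\<^sub>R u1 + \<beta> *\<^sub>R u2) \<in> C"
      using s ab m by (intro exI[of _ "s / (\<alpha> + \<beta>)"]) simp
  qed
qed

section \<open>Smooth boundary points\<close>

text \<open>Pairing with \<open>(0, - \<i>)\<close> gives the imaginary part, so \<open>K\<close>
  lies above the real axis. The cone condition is smoothness at the origin in quantitative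
  form.\<close>

definition normal_pos :: "hyp_plane set \<Rightarrow> bool" where
  "normal_pos K \<longleftrightarrow> orig \<in> frontier K \<and> supp K orig (0, - \<i>) \<and>
    (\<forall>\<eta>>0. \<exists>\<rho>>0. \<forall>k. cmod k < \<rho> \<longrightarrow> \<eta> * cmod k \<le> Im k \<longrightarrow> k \<in> kl ` K)"

lemma supp_scaleR: "supp K x N \<Longrightarrow> 0 < c \<Longrightarrow> supp K x (c *\<^sub>R N)"
  by (auto simp: supp_def)

lemma to_orig:
  assumes "body K" "x \<in> frontier K"
  obtains A where "A \<in> SO" "mv A x = orig" "supp (mv A ` K) orig (0, - \<i>)"
proof -
  obtain N where N: "supp K x N" using supp_exists[OF assms] .
  then have l: "lp N N < 0" by (auto simp: supp_def intro: spacelike_if_orthogonal)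
  define n where "n = N /\<^sub>R sqrt (- lp N N)"
  have n: "supp K x n" unfolding n_def using N l by (intro supp_scaleR) auto
  have "lp n n = -1" using l by (simp add: n_def field_simps)
  moreover have "lp (lift x) n = 0" using n by (simp add: supp_def)
  moreover have "lp (0, - \<i>) (0, - \<i>) = -1" "lp (lift orig) (0, - \<i>) = 0" by (simp_all add: lp_def)
  ultimately obtain A where A: "A \<in> SO" "A (lift x) = lift orig" "A n = (0, - \<i>)" using SO_flags by metis
  have x: "mv A x = orig" using A by (simp add: mv_def del: lift_orig)
  show ?thesis using that[OF A(1) x] supp_mv[OF A(1) n] by (simp add: x A(3))
qed

lemma supp_origD: "supp K orig N \<Longrightarrow> fst N = 0 \<and> snd N \<noteq> 0 \<and> (\<forall>k\<in>kl ` K. 0 \<le> - snd N \<bullet> k)"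
  by (auto simp: supp_def lp_lift_nonneg_iff inner_commute prod_eq_iff) (auto simp: lp_def)

lemma supp_origI: "a \<noteq> 0 \<Longrightarrow> (\<And>k. k \<in> kl ` K \<Longrightarrow> 0 \<le> a \<bullet> k) \<Longrightarrow> supp K orig (0, - a)"
  unfolding supp_def by (auto simp: lp_lift_nonneg_iff prod_eq_iff inner_commute[of _ a]) (simp add: lp_def)

lemma orig_in_kl: "orig \<in> K \<Longrightarrow> 0 \<in> kl ` K"
  by (metis imageI kl_orig)

lemma normal_pos_if_smooth:
  assumes "body K" "smooth_pt K orig" "supp K orig (0, - \<i>)"
  shows "normal_pos K"
  unfolding normal_pos_def
proof (intro conjI allI impI assms(3))
  show fr: "orig \<in> frontier K" using assms(2) by (simp add: smooth_pt_def)
  fix \<eta> :: real assume \<eta>: "0 < \<eta>"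
  let ?C = "kl ` K"
  have im: "0 \<le> Im k" if "k \<in> ?C" for k
    using supp_origD[OF assms(3)] that by (auto simp: inner_complex_def)
  obtain k0 where "k0 \<in> interior ?C" using body_kl(2)[OF assms(1)] by blast
  then obtain e where e: "0 < e" "ball k0 e \<subseteq> ?C" by (meson mem_interior)
  have k0: "k0 \<in> ?C" using e by auto
  have "k0 - of_real (e / 2) * \<i> \<in> ?C" using e by (intro subsetD[OF e(2)]) (simp add: dist_norm norm_mult)
  then have "0 < Im k0" using im[of "k0 - of_real (e / 2) * \<i>"] e(1) by simp
  moreover have "Re a = 0" if a: "a \<noteq> 0" "\<And>k. k \<in> ?C \<Longrightarrow> 0 \<le> a \<bullet> k" for a
  proof -
    have "supp K orig (0, - a)" using supp_origI a by blast
    then obtain c where "(0, - a) = c *\<^sub>R (0::real, - \<i>)"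
      using assms(2,3) unfolding smooth_pt_def by metis
    then have "- a = c *\<^sub>R (- \<i>)" by simp
    then have "Re (- a) = 0" by simp
    then show ?thesis by simp
  qed
  moreover have "0 \<in> ?C" using fr frontier_subset_body[OF assms(1)] by (intro orig_in_kl)
  ultimately obtain \<rho> where "0 < \<rho>" "\<And>k. cmod k < \<rho> \<Longrightarrow> \<eta> * cmod k \<le> Im k \<Longrightarrow> k \<in> ?C"
    using smooth_cone[OF body_kl(1)[OF assms(1)], of k0 \<eta>] im k0 \<eta> by metis
  then show "\<exists>\<rho>>0. \<forall>k. cmod k < \<rho> \<longrightarrow> \<eta> * cmod k \<le> Im k \<longrightarrow> k \<in> ?C" by blast
qed

lemma smooth_normalise:
  assumes "body K" "smooth_pt K x"
  obtains A where "A \<in> SO" "mv A x = orig" "normal_pos (mv A ` K)"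
proof -
  have "x \<in> frontier K" using assms(2) by (simp add: smooth_pt_def)
  then obtain A where A: "A \<in> SO" "mv A x = orig" "supp (mv A ` K) orig (0, - \<i>)"
    using to_orig[OF assms(1)] by blast
  moreover have "smooth_pt (mv A ` K) orig" using smooth_pt_mv[OF A(1) assms] by (simp add: A)
  ultimately show ?thesis using that normal_pos_if_smooth body_mv[OF assms(1)] by blast
qed

lemma cross_nonzero:
  fixes a b :: complex
  assumes "a \<noteq> 0" "\<And>c. b \<noteq> c *\<^sub>R a"
  shows "Re a * Im b - Im a * Re b \<noteq> 0"
proof
  assume e: "Re a * Im b - Im a * Re b = 0"
  define q where "q = Re a * Re a + Im a * Im a"
  have q: "q \<noteq> 0" using assms(1) by (metis complex_eq_iff q_def sum_squares_eq_zero_iff zero_complex.sel)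
  have "Re b * q = (Re a * Re b + Im a * Im b) * Re a" "Im b * q = (Re a * Re b + Im a * Im b) * Im a"
    unfolding q_def using e by algebra+
  then have "b = ((Re a * Re b + Im a * Im b) / q) *\<^sub>R a"
    using q by (simp add: complex_eq_iff nonzero_eq_divide_eq)
  then show False using assms(2) by blast
qed

text \<open>The centre is the midpoint of \<open>x\<close> and its image.\<close>

lemma hturn_center_mem:
  assumes "hyp_convex M" "x \<in> M" "mv (hturn c) x \<in> M"
  shows "c \<in> M"
proof (rule hyp_convexD[OF assms])
  define a where "a = lp (lift x) (lift c)"
  have a: "1 \<le> a" using lp_lift_ge_1[of x c] by (simp add: a_def)
  show "0 \<le> 1 / (2 * a)" "0 \<le> 1 / (2 * a)" using a by auto
  show "lift c = (1 / (2 * a)) *\<^sub>R lift x + (1 / (2 * a)) *\<^sub>R lift (mv (hturn c) x)"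
    using a by (simp add: hturn_def scaleR_add_right[symmetric] flip: a_def)
qed

lemma hyp_convex_Int: "hyp_convex K \<Longrightarrow> hyp_convex L \<Longrightarrow> hyp_convex (K \<inter> L)"
  by (auto simp: hyp_convex_def)

lemma hyp_convex_interior:
  assumes "hyp_convex M" "p \<in> M" "q \<in> M" "r \<in> M" "Im (cnj (kl q - kl p) * (kl r - kl p)) \<noteq> 0"
  shows "interior M \<noteq> {}"
proof -
  have "interior (kl ` M) \<noteq> {}"
    using assms by (intro noncollinear_interior[OF convex_kl_image]) auto
  then obtain k where k: "k \<in> interior (kl ` M)" by auto
  then obtain x where "k = kl x" using interior_subset by blast
  then show ?thesis using k interior_kl by blast
qed

text \<open>A small copy of the corner of \<open>K\<close> cut off by the almost straight boundary of \<open>L\<close> is close to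
  a triangle; comparing barycentric coordinates shows that it has no centre of symmetry.\<close>

lemma no_corner:
  assumes K: "body K" "orig \<in> K" and L: "body L" "normal_pos L" and sym: "sym_pair K L"
    and ind: "Re u1 * Im u2 - Im u1 * Re u2 \<noteq> 0"
    and cone: "\<And>k. k \<in> kl ` K \<Longrightarrow> \<exists>\<alpha> \<beta>. 0 \<le> \<alpha> \<and> 0 \<le> \<beta> \<and> k = \<alpha> *\<^sub>R u1 + \<beta> *\<^sub>R u2"
    and fill: "\<And>\<alpha> \<beta>. 0 < \<alpha> \<Longrightarrow> 0 < \<beta> \<Longrightarrow> \<exists>t>0. t *\<^sub>R (\<alpha> *\<^sub>R u1 + \<beta> *\<^sub>R u2) \<in> kl ` K"
  shows False
proof -
  define C where "C = kl ` K"
  have C: "convex C" "0 \<in> C" using body_kl(1)[OF K(1)] orig_in_kl[OF K(2)] by (simp_all add: C_def)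
  define d where "d = Re u1 * Im u2 - Im u1 * Re u2"
  have d: "d \<noteq> 0" using ind by (simp add: d_def)
  \<comment> \<open>The functional with value 1 at both edges:
    \<open>\<nu> \<bullet> k \<le> \<epsilon>\<close> cuts off the small triangle with vertices 0,
    \<open>\<epsilon> *\<^sub>R u1\<close> and \<open>\<epsilon> *\<^sub>R u2\<close>.\<close>
  define \<nu> where "\<nu> = Complex ((Im u2 - Im u1) / d) ((Re u1 - Re u2) / d)"
  have nu: "\<nu> \<bullet> u1 = 1" "\<nu> \<bullet> u2 = 1"
    using d by (simp_all add: \<nu>_def inner_complex_def divide_simps) (simp_all add: d_def algebra_simps)
  define D where "D = cmod u1 + cmod u2"
  have u: "u1 \<noteq> 0" "u2 \<noteq> 0" using ind by auto
  have D: "0 < D" using u by (simp add: D_def add_pos_pos)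
  have nu0: "0 < cmod \<nu>" using nu(1) by auto
  \<comment> \<open>Chosen so that \<open>\<eta> * (3 * h)\<close> equals
    \<open>\<epsilon> / 5 / cmod \<nu>\<close>, where \<open>\<epsilon> / 5\<close> is the slack of
    points with \<open>\<nu> \<bullet> k \<le> 8/10 * \<epsilon>\<close>.\<close>
  define \<eta> where "\<eta> = 1 / (15 * cmod \<nu> * D)"
  have \<eta>: "0 < \<eta>" using nu0 D by (simp add: \<eta>_def)
  obtain \<rho> where \<rho>: "0 < \<rho>" "\<And>k. cmod k < \<rho> \<Longrightarrow> \<eta> * cmod k \<le> Im k \<Longrightarrow> k \<in> kl ` L"
    using L(2) \<eta> unfolding normal_pos_def by metis
  obtain t1 where t1: "0 < t1" "t1 *\<^sub>R ((7/10) *\<^sub>R u1 + (1/10) *\<^sub>R u2) \<in> C"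
    using fill[of "7/10" "1/10"] by (auto simp: C_def)
  obtain t2 where t2: "0 < t2" "t2 *\<^sub>R ((1/10) *\<^sub>R u1 + (7/10) *\<^sub>R u2) \<in> C"
    using fill[of "1/10" "7/10"] by (auto simp: C_def)
  \<comment> \<open>In this order: \<open>k1\<close> and \<open>k2\<close> lie in \<open>C\<close>;
    the hyperbolic distortion is small; the cutting line meets the plane; everything stays in the
    range of \<rho>.\<close>
  define \<epsilon> where "\<epsilon> = Min {t1, t2, 1 / (10 * D), cmod \<nu> / 2, \<rho> / (4 * D)}"
  have e: "0 < \<epsilon>" "\<epsilon> \<le> t1" "\<epsilon> \<le> t2" "\<epsilon> \<le> 1 / (10 * D)" "\<epsilon> \<le> cmod \<nu> / 2" "\<epsilon> \<le> \<rho> / (4 * D)"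
    using t1(1) t2(1) D nu0 \<rho>(1) by (simp_all add: \<epsilon>_def)
  define h where "h = \<epsilon> * D"
  have h: "0 < h" "h \<le> 1/10" "4 * h \<le> \<rho>" using e D by (simp_all add: h_def field_simps)
  have h2: "h\<^sup>2 \<le> 1/100" using power_mono[OF h(2), of 2] h(1) by (simp add: power2_eq_square)
  have small: "cmod (\<alpha> *\<^sub>R u1 + \<beta> *\<^sub>R u2) \<le> h" if "0 \<le> \<alpha>" "0 \<le> \<beta>" "\<alpha> \<le> \<epsilon>" "\<beta> \<le> \<epsilon>" for \<alpha> \<beta>
  proof -
    have "cmod (\<alpha> *\<^sub>R u1 + \<beta> *\<^sub>R u2) \<le> \<alpha> * cmod u1 + \<beta> * cmod u2"
      using norm_triangle_ineq[of "\<alpha> *\<^sub>R u1" "\<beta> *\<^sub>R u2"] that by simp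
    also have "\<dots> \<le> \<epsilon> * cmod u1 + \<epsilon> * cmod u2" using that by (intro add_mono mult_right_mono) auto
    finally show ?thesis by (simp add: h_def D_def distrib_left)
  qed
  \<comment> \<open>Points near two vertices of the triangle, kept away from the edges of the cone
    and from the cutting line, where membership in \<open>K\<close> or \<open>L'\<close> is not
    guaranteed.\<close>
  define k1 where "k1 = (\<epsilon> * (7/10)) *\<^sub>R u1 + (\<epsilon> * (1/10)) *\<^sub>R u2"
  define k2 where "k2 = (\<epsilon> * (1/10)) *\<^sub>R u1 + (\<epsilon> * (7/10)) *\<^sub>R u2"
  define Y where "Y = (\<epsilon> / 2) *\<^sub>R u1 + (\<epsilon> / 2) *\<^sub>R u2"
  have sm: "cmod k1 \<le> h" "cmod k2 \<le> h" "cmod Y \<le> h" 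
    unfolding k1_def k2_def Y_def using e(1) by (auto intro!: small)
  have shrink: "s *\<^sub>R k \<in> C" if "t *\<^sub>R k \<in> C" "0 < s" "s \<le> t" for s t k
  proof -
    have "(s / t) *\<^sub>R (t *\<^sub>R k) + (1 - s / t) *\<^sub>R 0 \<in> C"
      using that C by (intro convexD) auto
    then show ?thesis using that by simp
  qed
  have k1C: "k1 \<in> C" using shrink[OF t1(2) e(1,2)] by (simp add: k1_def scaleR_add_right)
  have k2C: "k2 \<in> C" using shrink[OF t2(2) e(1,3)] by (simp add: k2_def scaleR_add_right)
  define y where "y = kp Y"
  have Y1: "cmod Y < 1" using sm(3) h by simp
  have kly: "kl y = Y" using Y1 by (simp add: y_def)
  \<comment> \<open>\<open>(\<epsilon>, \<nu>)\<close> is the normal of the cutting line; dividing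
    by \<open>w\<close> makes its square -1, so that the boundary point of \<open>L\<close> can be
    moved to \<open>y\<close> with this normal.\<close>
  define w where "w = sqrt ((cmod \<nu>)\<^sup>2 - \<epsilon>\<^sup>2)"
  have "\<epsilon>\<^sup>2 < (cmod \<nu>)\<^sup>2" using e nu0 by (intro power_strict_mono) auto
  then have w: "0 < w" "w\<^sup>2 = (cmod \<nu>)\<^sup>2 - \<epsilon>\<^sup>2" by (simp_all add: w_def)
  have wn: "w \<le> cmod \<nu>" by (rule power2_le_imp_le) (simp_all add: w)
  define n where "n = (1 / w) *\<^sub>R (\<epsilon>, \<nu>)"
  have n1: "lp n n = -1" using w by (simp add: n_def lp_self) (simp add: field_simps power2_eq_square)
  have lpn: "lp (lift z) n = fst (lift z) * ((\<epsilon> - \<nu> \<bullet> kl z) / w)" for z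
    by (simp add: n_def lp_lift_kl inner_commute diff_divide_distrib right_diff_distrib)
  have ny: "lp (lift y) n = 0" using nu by (simp add: lpn kly Y_def inner_add_right)
  obtain A where A: "A \<in> SO" "A (1, 0) = lift y" "A (0, - \<i>) = n"
  proof -
    have "lp (0, - \<i>) (0, - \<i>) = -1" "lp (lift orig) (0, - \<i>) = 0" by (simp_all add: lp_def)
    from SO_flags[OF this n1 ny] that show ?thesis by (metis lift_orig)
  qed
  obtain B where B: "B \<in> SO" "\<And>x. mv A (mv B x) = x" "\<And>x. mv B (mv A x) = x" "\<And>X. A (B X) = X" "\<And>X. B (A X) = X"
    using mv_vimage[OF A(1)] by metis
  define L' where "L' = mv A ` L"
  have memL: "z \<in> L'" if "mv B z \<in> L" for z using that B(2) unfolding L'_def by (metis imageI)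
  have L'pos: "0 \<le> lp (lift z) n" if "z \<in> L'" for z
  proof -
    obtain z' where "z' \<in> L" "z = mv A z'" using \<open>z \<in> L'\<close> by (auto simp: L'_def)
    then have "lp (lift z) n = lp (lift z') (0, - \<i>)" using SO_lp[OF A(1)] by (simp add: A(1) flip: A(3))
    then show ?thesis using L(2) \<open>z' \<in> L\<close> by (simp add: normal_pos_def supp_def)
  qed
  \<comment> \<open>Moved back by \<open>B\<close>, such a point has modulus at most
    \<open>3 * h\<close> and a height over the support line large enough for the cone that
    \<open>L\<close> fills.\<close>
  have inL: "kp k \<in> L'" if k: "cmod k \<le> h" "\<nu> \<bullet> k \<le> 8/10 * \<epsilon>" for k
  proof (rule memL)
    define z where "z = kp k"
    have k1: "cmod k < 1" using k h by simp
    define a b where "a = 1 - (cmod k)\<^sup>2" and "b = 1 - (cmod Y)\<^sup>2"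
    have "(cmod k)\<^sup>2 \<le> h\<^sup>2" "(cmod Y)\<^sup>2 \<le> h\<^sup>2" using k(1) sm(3) by (auto intro: power_mono)
    then have ab: "99/100 \<le> a" "99/100 \<le> b" "a \<le> 1" "b \<le> 1" using h2 by (auto simp: a_def b_def)
    define T where "T = lp (lift z) (lift y)"
    have T1: "1 \<le> T" by (simp add: T_def lp_lift_ge_1)
    have lz: "lift z = (1 / sqrt a) *\<^sub>R (1, k)" by (simp add: z_def lift_kp k1 a_def inverse_eq_divide)
    have ly: "lift y = (1 / sqrt b) *\<^sub>R (1, Y)" by (simp add: y_def lift_kp Y1 b_def inverse_eq_divide)
    have Teq: "T = (1 - k \<bullet> Y) / (sqrt a * sqrt b)"
      unfolding T_def lz ly by (simp only: lp_scaleR lp_klein) simp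
    have T2: "T\<^sup>2 - 1 = ((1 - k \<bullet> Y)\<^sup>2 - a * b) / (a * b)"
      using ab by (simp add: Teq power_divide power_mult_distrib field_simps)
    have "(k \<bullet> Y)\<^sup>2 \<le> (cmod k)\<^sup>2 * (cmod Y)\<^sup>2"
      by (metis Cauchy_Schwarz_ineq power2_norm_eq_inner)
    moreover have "(cmod (k - Y))\<^sup>2 = (cmod k)\<^sup>2 - 2 * (k \<bullet> Y) + (cmod Y)\<^sup>2"
      by (simp add: power2_norm_eq_inner inner_diff_left inner_diff_right inner_commute)
    ultimately have "(1 - k \<bullet> Y)\<^sup>2 - a * b \<le> (cmod (k - Y))\<^sup>2"
      by (simp add: a_def b_def power2_eq_square algebra_simps)
    also have "\<dots> \<le> (2 * h)\<^sup>2"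
      using norm_triangle_ineq4[of k Y] k(1) sm(3) by (intro power_mono) auto
    finally have q: "(1 - k \<bullet> Y)\<^sup>2 - a * b \<le> 4 * h\<^sup>2" by (simp add: power_mult_distrib)
    have ab2: "1/2 \<le> a * b" using mult_mono[OF ab(1,2)] ab by simp
    have "T\<^sup>2 - 1 \<le> 4 * h\<^sup>2 / (a * b)" unfolding T2 using q ab2 by (intro divide_right_mono) auto
    also have "\<dots> \<le> 4 * h\<^sup>2 / (1/2)" using ab2 by (intro divide_left_mono) auto
    finally have T3: "T\<^sup>2 - 1 \<le> 8 * h\<^sup>2" by simp
    also have "8 * h\<^sup>2 \<le> (3 * h)\<^sup>2" by (simp add: power_mult_distrib)
    finally have T4: "sqrt (T\<^sup>2 - 1) \<le> 3 * h" using h by (intro real_le_lsqrt) (auto simp: T1 one_le_power)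
    define X where "X = B (lift z)"
    have lX: "lift (mv B z) = X" by (simp add: X_def B(1))
    have X1: "fst X = T"
    proof -
      have "lp X (1, 0) = lp (A X) (A (1, 0))" by (simp add: A(1))
      then show ?thesis unfolding A(2) by (simp add: X_def B(4) T_def) (simp add: lp_def X_def)
    qed
    have X2: "Im (snd X) = lp (lift z) n"
    proof -
      have "lp X (0, - \<i>) = lp (A X) (A (0, - \<i>))" by (simp add: A(1))
      then show ?thesis unfolding A(3) by (simp add: X_def B(4)) (simp add: lp_def inner_complex_def)
    qed
    have "lp X X = 1" unfolding lX[symmetric] by simp
    then have "(cmod (snd X))\<^sup>2 = T\<^sup>2 - 1" by (simp add: lp_self X1)
    then have X3: "cmod (snd X) = sqrt (T\<^sup>2 - 1)" by (metis abs_norm_cancel real_sqrt_abs)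
    have klB: "kl (mv B z) = snd X /\<^sub>R T" by (simp add: kl_def lX X1)
    have "cmod (kl (mv B z)) = sqrt (T\<^sup>2 - 1) / T" using T1 by (simp add: klB X3 divide_inverse)
    also have "\<dots> \<le> sqrt (T\<^sup>2 - 1)"
    proof -
      have "sqrt (T\<^sup>2 - 1) * 1 \<le> sqrt (T\<^sup>2 - 1) * T" using T1 by (intro mult_left_mono) (auto simp: one_le_power)
      then show ?thesis using T1 by (simp add: divide_le_eq)
    qed
    also note T4
    also have "3 * h < \<rho>" using h by simp
    finally have c1: "cmod (kl (mv B z)) < \<rho>" .
    have f: "fst (lift z) \<ge> 1" using ab by (simp add: z_def lift_kp k1 a_def[symmetric] field_simps)
    have "\<eta> * cmod (snd X) \<le> \<eta> * (3 * h)" unfolding X3 using T4 \<eta> by (intro mult_left_mono) auto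
    also have "\<dots> = (\<epsilon> / 5) / cmod \<nu>" using D nu0 by (simp add: \<eta>_def h_def field_simps)
    also have "\<dots> \<le> (\<epsilon> / 5) / w" using wn w e(1) mult_pos_pos[OF nu0 w(1)] by (intro divide_left_mono) auto
    also have "\<dots> \<le> (\<epsilon> - \<nu> \<bullet> k) / w" using k(2) w by (intro divide_right_mono) auto
    also have "\<dots> \<le> fst (lift z) * ((\<epsilon> - \<nu> \<bullet> k) / w)"
      using f k(2) w e(1) by (intro mult_le_cancel_right1[THEN iffD2]) (auto simp: divide_less_0_iff)
    also have "\<dots> = Im (snd X)" by (simp add: X2 lpn z_def k1)
    finally have "\<eta> * cmod (kl (mv B z)) \<le> Im (kl (mv B z))"
      using T1 by (simp add: klB divide_inverse mult.left_commute mult.commute)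
    then have "kl (mv B z) \<in> kl ` L" by (rule \<rho>(2)[OF c1])
    then show "mv B (kp k) \<in> L" by (auto simp: kl_inj z_def)
  qed
  have inM: "kp k \<in> K \<inter> L'" if "k \<in> C" "cmod k \<le> h" "\<nu> \<bullet> k \<le> 8/10 * \<epsilon>" for k
    using inL[OF that(2,3)] that(1) by (auto simp: C_def)
  define M where "M = K \<inter> L'"
  have nuk: "\<nu> \<bullet> k1 = 8/10 * \<epsilon>" "\<nu> \<bullet> k2 = 8/10 * \<epsilon>" using nu by (simp_all add: k1_def k2_def inner_add_right)
  have M012: "kp 0 \<in> M" "kp k1 \<in> M" "kp k2 \<in> M"
    unfolding M_def using C(2) k1C k2C sm nuk e(1) h by (auto intro!: inM[unfolded Int_iff, THEN conjunct1] inM[unfolded Int_iff, THEN conjunct2])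
  have M_conv: "hyp_convex M"
    unfolding M_def L'_def using K(1) L(1) A(1) by (intro hyp_convex_Int hyp_convex_mv) (auto simp: body_def)
  have klk: "kl (kp k1) = k1" "kl (kp k2) = k2" using sm h by simp_all
  have eq: "Im (cnj k1 * k2) = 48/100 * \<epsilon>\<^sup>2 * d"
    by (simp add: k1_def k2_def d_def power2_eq_square) (simp add: field_simps)
  have ne: "Im (cnj k1 * k2) \<noteq> 0" unfolding eq using e(1) d by simp
  have "interior M \<noteq> {}"
    using ne by (intro hyp_convex_interior[OF M_conv M012]) (simp add: klk)
  then obtain c where c: "\<And>x. x \<in> M \<Longrightarrow> mv (hturn c) x \<in> M"
    using sym_pairD[OF sym A(1)] unfolding M_def L'_def by metis
  have cM: "c \<in> M" using hturn_center_mem[OF M_conv M012(1) c[OF M012(1)]] .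
  define kc where "kc = kl c"
  have coneM: "\<exists>\<alpha> \<beta>. 0 \<le> \<alpha> \<and> 0 \<le> \<beta> \<and> kl z = \<alpha> *\<^sub>R u1 + \<beta> *\<^sub>R u2 \<and> \<alpha> + \<beta> \<le> \<epsilon>" if "z \<in> M" for z
  proof -
    have "kl z \<in> kl ` K" "z \<in> L'" using that by (auto simp: M_def)
    then obtain \<alpha> \<beta> where ab: "0 \<le> \<alpha>" "0 \<le> \<beta>" "kl z = \<alpha> *\<^sub>R u1 + \<beta> *\<^sub>R u2" using cone by blast
    have "0 \<le> (\<epsilon> - \<nu> \<bullet> kl z) / w"
      using L'pos[OF \<open>z \<in> L'\<close>] fst_lift_pos[of z] unfolding lpn by (meson mult_pos_neg not_less)
    then have "\<nu> \<bullet> kl z \<le> \<epsilon>" using w by (simp add: zero_le_divide_iff)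
    then show ?thesis using ab nu by (auto simp: inner_add_right)
  qed
  obtain \<alpha> \<beta> where ab: "0 \<le> \<alpha>" "0 \<le> \<beta>" "kc = \<alpha> *\<^sub>R u1 + \<beta> *\<^sub>R u2" "\<alpha> + \<beta> \<le> \<epsilon>"
    using coneM[OF cM] by (auto simp: kc_def)
  have kch: "cmod kc \<le> h" unfolding ab(3) using ab by (intro small) auto
  define a1 where "a1 = Complex (Im u2 / d) (- Re u2 / d)"
  define a2 where "a2 = Complex (- Im u1 / d) (Re u1 / d)"
  have dual: "a1 \<bullet> u1 = 1" "a1 \<bullet> u2 = 0" "a2 \<bullet> u1 = 0" "a2 \<bullet> u2 = 1"
    using d by (simp_all add: a1_def a2_def inner_complex_def divide_simps) (simp_all add: d_def algebra_simps)
  \<comment> \<open>If an affine function is nonnegative on \<open>M\<close>, its nonnegativity at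
    the mirror image bounds its value at a point by a multiple of its value at the centre. The
    multiple is 2 in the Euclidean plane and stays below 2.05 for
    \<open>h \<le> 1/10\<close>.\<close>
  have main: "f (1, k) \<le> 205/100 * f (1, kc)"
    if f: "linear f" "\<And>z. z \<in> M \<Longrightarrow> 0 \<le> f (1, kl z)" and k: "kp k \<in> M" "cmod k \<le> h" for f :: "vec \<Rightarrow> real" and k
  proof -
    have kk: "cmod k < 1" using k(2) h by simp
    define X where "X = lift (kp k)"
    define s where "s = fst X"
    have s: "0 < s" by (simp add: s_def X_def)
    have Xs: "X = s *\<^sub>R (1, k)" using lift_kl[of "kp k"] kk by (simp add: X_def s_def)
    define s' where "s' = fst (lift c)"
    have cs: "lift c = s' *\<^sub>R (1, kc)" using lift_kl[of c] by (simp add: kc_def s'_def)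
    have fl: "f (lift x) = fst (lift x) * f (1, kl x)" for x
      by (metis lift_kl linear_scale[OF f(1)] real_scaleR_def)
    have "0 \<le> f (lift (mv (hturn c) (kp k)))"
      unfolding fl by (intro mult_nonneg_nonneg f(2) c k(1) less_imp_le fst_lift_pos)
    also have "lift (mv (hturn c) (kp k)) = s *\<^sub>R ((2 * s'\<^sup>2 * (1 - k \<bullet> kc)) *\<^sub>R (1, kc) - (1, k))"
      unfolding lift_mv[OF hturn_SO] hturn_def cs X_def[symmetric] Xs lp_scaleR lp_klein
      by (simp add: power2_eq_square algebra_simps)
    finally have "0 \<le> s * ((2 * s'\<^sup>2 * (1 - k \<bullet> kc)) * f (1, kc) - f (1, k))"
      by (simp only: linear_scale[OF f(1)] linear_diff[OF f(1)] real_scaleR_def)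
    then have 1: "f (1, k) \<le> (2 * s'\<^sup>2 * (1 - k \<bullet> kc)) * f (1, kc)" using s by (simp add: zero_le_mult_iff)
    have "\<bar>k \<bullet> kc\<bar> \<le> cmod k * cmod kc" by (rule Cauchy_Schwarz_ineq2)
    also have "\<dots> \<le> h * h" using k(2) kch h by (intro mult_mono) auto
    finally have 2: "1 - k \<bullet> kc \<le> 101/100" "0 \<le> 1 - k \<bullet> kc" using h2 by (auto simp: power2_eq_square)
    have "1 = s'\<^sup>2 * (1 - (cmod kc)\<^sup>2)"
      using lp_lift_self[of c, unfolded cs lp_scaleR lp_klein]
      unfolding power2_norm_eq_inner by (simp add: power2_eq_square mult.assoc)
    moreover have "99/100 \<le> 1 - (cmod kc)\<^sup>2" using power_mono[OF kch, of 2] h2 by simp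
    ultimately have 3: "s'\<^sup>2 * (99/100) \<le> 1" using mult_left_mono[of "99/100" "1 - (cmod kc)\<^sup>2" "s'\<^sup>2"] by simp
    have "2 * s'\<^sup>2 * (1 - k \<bullet> kc) \<le> 2 * (100/99) * (101/100)"
      using 2 3 by (intro mult_mono) auto
    also have "\<dots> \<le> 205/100" by simp
    finally have "(2 * s'\<^sup>2 * (1 - k \<bullet> kc)) * f (1, kc) \<le> 205/100 * f (1, kc)"
      using f(2)[OF cM] by (intro mult_right_mono) (auto simp: kc_def)
    with 1 show ?thesis by simp
  qed
  have lin: "linear (\<lambda>X::vec. a \<bullet> snd X)" "linear (\<lambda>X::vec. \<epsilon> * fst X - \<nu> \<bullet> snd X)" for a
    by (auto intro!: linearI simp: inner_add_right algebra_simps)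
  have "a1 \<bullet> snd (1::real, k1) \<le> 205/100 * (a1 \<bullet> snd (1::real, kc))"
    by (rule main[OF lin(1)]) (use coneM dual M012 sm in \<open>force simp: inner_add_right\<close>)+
  then have r1: "7/10 * \<epsilon> \<le> 205/100 * \<alpha>" using dual by (simp add: k1_def ab inner_add_right)
  have "a2 \<bullet> snd (1::real, k2) \<le> 205/100 * (a2 \<bullet> snd (1::real, kc))"
    by (rule main[OF lin(1)]) (use coneM dual M012 sm in \<open>force simp: inner_add_right\<close>)+
  then have r2: "7/10 * \<epsilon> \<le> 205/100 * \<beta>" using dual by (simp add: k2_def ab inner_add_right)
  have "\<epsilon> * fst (1::real, 0::complex) - \<nu> \<bullet> snd (1::real, 0::complex) \<le> 205/100 * (\<epsilon> * fst (1::real, kc) - \<nu> \<bullet> snd (1::real, kc))"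
    by (rule main[OF lin(2)]) (use coneM nu M012 h in \<open>force simp: inner_add_right\<close>)+
  then have r0: "\<epsilon> \<le> 205/100 * (\<epsilon> - \<alpha> - \<beta>)" using nu by (simp add: ab inner_add_right algebra_simps)
  \<comment> \<open>The barycentric coordinates of the centre add up to \<epsilon>, so adding the
    three bounds gives \<open>24/10 * \<epsilon> \<le> 205/100 * \<epsilon>\<close>.\<close>
  from r0 r1 r2 e(1) show False by (simp add: algebra_simps)
qed

text \<open>Two independent support normals at \<open>x\<close> produce a corner of
  \<open>K\<close>, which \<open>no_corner\<close> excludes by means of one smooth boundary point of
  \<open>L\<close>.\<close>

lemma all_smooth:
  assumes "body K" "body L" "sym_pair K L" "smooth_pt L y" "x \<in> frontier K"
  shows "smooth_pt K x"
proof (rule ccontr)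
  assume "\<not> smooth_pt K x"
  obtain A where A: "A \<in> SO" "mv A x = orig" "supp (mv A ` K) orig (0, - \<i>)" using to_orig[OF assms(1,5)] .
  define K' where "K' = mv A ` K"
  have K': "body K'" unfolding K'_def by (rule body_mv[OF assms(1) A(1)])
  have fr: "orig \<in> frontier K'"
    unfolding K'_def using assms(1,5) A(1,2) by (metis frontier_mv body_def imageI)
  have "\<not> smooth_pt K' orig"
  proof
    assume s: "smooth_pt K' orig"
    obtain B where B: "B \<in> SO" "\<And>x. mv B (mv A x) = x" using mv_vimage[OF A(1)] by metis
    from smooth_pt_mv[OF B(1) K' s] have "smooth_pt K x" by (simp add: K'_def image_image B(2) flip: A(2))
    then show False using \<open>\<not> smooth_pt K x\<close> by simp
  qed
  then obtain N N' where N: "supp K' orig N" "supp K' orig N'" "\<And>c. N' \<noteq> c *\<^sub>R N"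
    using fr by (auto simp: smooth_pt_def)
  define a1 a2 where "a1 = - snd N" and "a2 = - snd N'"
  have "Re a1 * Im a2 - Im a1 * Re a2 \<noteq> 0"
  proof (rule cross_nonzero)
    show "a1 \<noteq> 0" using supp_origD[OF N(1)] by (simp add: a1_def)
    fix c show "a2 \<noteq> c *\<^sub>R a1"
      using N(3)[of c] supp_origD[OF N(1)] supp_origD[OF N(2)] by (auto simp: a1_def a2_def prod_eq_iff)
  qed
  moreover have "0 \<in> kl ` K'" using frontier_subset_body[OF K' fr] by (rule orig_in_kl)
  ultimately obtain u1 u2 where u: "Re u1 * Im u2 - Im u1 * Re u2 \<noteq> 0"
    "\<And>k. k \<in> kl ` K' \<Longrightarrow> \<exists>\<alpha> \<beta>. 0 \<le> \<alpha> \<and> 0 \<le> \<beta> \<and> k = \<alpha> *\<^sub>R u1 + \<beta> *\<^sub>R u2"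
    "\<And>\<alpha> \<beta>. 0 < \<alpha> \<Longrightarrow> 0 < \<beta> \<Longrightarrow> \<exists>t>0. t *\<^sub>R (\<alpha> *\<^sub>R u1 + \<beta> *\<^sub>R u2) \<in> kl ` K'"
    using corner_cone[OF body_kl(1)[OF K'] _ body_kl(2)[OF K'], of a1 a2] supp_origD[OF N(1)] supp_origD[OF N(2)]
    unfolding a1_def a2_def by blast
  obtain B where B: "B \<in> SO" "normal_pos (mv B ` L)" using smooth_normalise[OF assms(2,4)] .
  show False
    by (rule no_corner[OF K' frontier_subset_body[OF K' fr] body_mv[OF assms(2) B(1)] B(2) _ u])
       (simp_all add: K'_def sym_pair_mv assms A B)
qed

text \<open>The boundary point nearest to an interior point is smooth, as \<open>K\<close> contains a disc touching the boundary there.\<close>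

lemma exists_smooth:
  assumes "body K"
  obtains x where "smooth_pt K x"
proof -
  obtain o' where o: "o' \<in> interior K" using assms by (auto simp: body_def)
  obtain A where A: "A \<in> SO" "mv A o' = orig" using SO_pairs[of o' o' orig orig] by (metis lp_lift_self)
  define K' where "K' = mv A ` K"
  have K': "body K'" unfolding K'_def by (rule body_mv[OF assms A(1)])
  define C where "C = kl ` K'"
  have "orig \<in> interior K'" using o A by (auto simp: K'_def interior_mv[OF A(1)] intro: image_eqI[where x = o'])
  then have 0: "0 \<in> interior C" using interior_kl[of orig K'] by (simp add: C_def)
  define S where "S = closure (ball 0 1 - C)"
  have "K' \<noteq> UNIV" using K' by (simp add: body_def)
  then obtain z where "z \<notin> K'" by auto
  then have z: "kl z \<in> ball 0 1 - C" using norm_kl[of z] by (auto simp: C_def kl_inj)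
  then have "kl z \<in> S" unfolding S_def by (rule subsetD[OF closure_subset])
  then obtain x where x: "x \<in> S" "\<And>y. y \<in> S \<Longrightarrow> dist 0 x \<le> dist 0 y"
    using distance_attains_inf[of S 0] by (metis S_def closed_closure empty_iff)
  have x1: "cmod x < 1" using x(2)[OF \<open>kl z \<in> S\<close>] norm_kl[of z] by simp
  have ballC: "k \<in> C" if "cmod k < cmod x" for k
  proof (rule ccontr)
    assume "k \<notin> C"
    then have "k \<in> ball 0 1 - C" using that x1 by simp
    then have "k \<in> S" unfolding S_def by (rule subsetD[OF closure_subset])
    then show False using x(2) that by fastforce
  qed
  have "S \<subseteq> closure (- C)" unfolding S_def by (intro closure_mono) auto
  then have xi: "x \<notin> interior C" using x(1) by (auto simp: closure_complement)
  then have x0: "x \<noteq> 0" using 0 by auto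
  have "kp x \<in> K'"
  proof -
    have cl: "closed K'" using K' by (simp add: body_def)
    have 1: "(\<lambda>n. (1 - inverse (real (Suc n))) *\<^sub>R x) \<longlonglongrightarrow> (1 - 0) *\<^sub>R x"
      by (intro tendsto_intros LIMSEQ_inverse_real_of_nat)
    have b: "0 \<le> 1 - inverse (real (Suc n))" "1 - inverse (real (Suc n)) < 1" for n by (auto simp: field_simps)
    have lt: "cmod ((1 - inverse (real (Suc n))) *\<^sub>R x) < cmod x" for n
      using b[of n] x0 by simp
    have m: "kp ((1 - inverse (real (Suc n))) *\<^sub>R x) \<in> K'" for n
      using ballC[OF lt[of n]] by (auto simp: C_def)
    have "(\<lambda>n. kp ((1 - inverse (real (Suc n))) *\<^sub>R x)) \<longlonglongrightarrow> kp x"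
      unfolding kp_def
    proof (rule tendsto_pt)
      show "(\<lambda>n. (1::real, (1 - inverse (real (Suc n))) *\<^sub>R x)) \<longlonglongrightarrow> (1, x)"
        using 1 by (intro tendsto_Pair tendsto_const) simp
      show "future (1, x)" using x1 by (rule future_klein)
      show "\<forall>\<^sub>F n in sequentially. future (1, (1 - inverse (real (Suc n))) *\<^sub>R x)"
        using lt x1 by (intro always_eventually allI future_klein) (meson less_trans)
    qed
    then show ?thesis by (rule closed_sequentially[OF cl m])
  qed
  moreover have "kp x \<notin> interior K'" using xi x1 by (simp add: interior_kl C_def)
  ultimately have fr: "kp x \<in> frontier K'" using K' by (simp add: frontier_def body_def)
  \<comment> \<open>The homogeneous normal of the tangent at \<open>x\<close> to the circle about 0.
    A support line of \<open>K'\<close> also supports the inscribed disc, so the equality case of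
    Cauchy-Schwarz applies.\<close>
  have mult: "\<exists>c. c \<noteq> 0 \<and> N = c *\<^sub>R ((cmod x)\<^sup>2, x)" if N: "supp K' (kp x) N" for N
  proof -
    have f: "fst N = x \<bullet> snd N"
      using N x1 fst_lift_pos[of "kp x"] by (simp add: supp_def lp_lift_kl del: fst_lift_pos)
    have nz: "snd N \<noteq> 0" using N f by (auto simp: supp_def prod_eq_iff)
    have ge: "k \<bullet> snd N \<le> x \<bullet> snd N" if "cmod k < cmod x" for k
    proof -
      have "kp k \<in> K'" using ballC[OF that] by (auto simp: C_def)
      then have "kl (kp k) \<bullet> snd N \<le> fst N" using N by (simp add: supp_def lp_lift_nonneg_iff)
      then show ?thesis using that x1 f by simp
    qed
    have "t * cmod x * cmod (snd N) \<le> x \<bullet> snd N" if "0 \<le> t" "t < 1" for t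
    proof -
      have "cmod ((t * cmod x / cmod (snd N)) *\<^sub>R snd N) < cmod x"
        using that x0 nz by simp
      from ge[OF this] have "t * cmod x / cmod (snd N) * (snd N \<bullet> snd N) \<le> x \<bullet> snd N" by simp
      moreover have "t * cmod x / cmod (snd N) * (snd N \<bullet> snd N) = t * cmod x * cmod (snd N)"
        using nz by (simp add: power2_eq_square flip: power2_norm_eq_inner)
      ultimately show ?thesis by simp
    qed
    then have *: "t * (cmod x * cmod (snd N)) \<le> x \<bullet> snd N" if "0 < t" "t < 1" for t
      using that by (simp add: mult.assoc)
    have "cmod x * cmod (snd N) \<le> x \<bullet> snd N" by (rule field_le_mult_one_interval) (use * in auto)
    then have "x \<bullet> snd N = cmod x * cmod (snd N)" using norm_cauchy_schwarz[of x "snd N"] by simp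
    then have "cmod x *\<^sub>R snd N = cmod (snd N) *\<^sub>R x" using norm_cauchy_schwarz_eq[of x "snd N"] by simp
    then have "snd N = (cmod (snd N) / cmod x) *\<^sub>R x" using x0
      by (metis divideR_right divide_inverse_commute norm_eq_zero scaleR_scaleR)
    moreover from this have "fst N = (cmod (snd N) / cmod x) * (cmod x)\<^sup>2"
      unfolding f by (metis inner_scaleR_right power2_norm_eq_inner)
    ultimately show ?thesis using nz x0
      by (intro exI[of _ "cmod (snd N) / cmod x"]) (auto simp: prod_eq_iff)
  qed
  have "smooth_pt K' (kp x)"
    unfolding smooth_pt_def
  proof (intro conjI fr allI impI)
    fix N N' assume "supp K' (kp x) N" "supp K' (kp x) N'"
    then obtain c c' where "c \<noteq> 0" "N = c *\<^sub>R ((cmod x)\<^sup>2, x)" "N' = c' *\<^sub>R ((cmod x)\<^sup>2, x)" using mult by metis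
    then show "\<exists>c. N' = c *\<^sub>R N" by (intro exI[of _ "c' / c"]) simp
  qed
  moreover obtain B where B: "B \<in> SO" "\<And>x. mv B (mv A x) = x" using mv_vimage[OF A(1)] by metis
  ultimately have "smooth_pt (mv B ` K') (mv B (kp x))" using smooth_pt_mv K' by blast
  then show ?thesis using that by (simp add: K'_def image_image B(2))
qed

section \<open>Caps\<close>

definition side :: "hyp_plane \<Rightarrow> hyp_plane \<Rightarrow> hyp_plane \<Rightarrow> real" where
  "side p p' z = det3 (lift p) (lift p') (lift z)"

text \<open>The closed disc with diameter \<open>p p'\<close>.\<close>

definition thales :: "hyp_plane \<Rightarrow> hyp_plane \<Rightarrow> hyp_plane set" where
  "thales p p' = {z. lp (lift z) (lift p) + lp (lift z) (lift p') \<le> 1 + lp (lift p) (lift p')}"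

text \<open>The cap lies on the negative side. The existence premise takes care of a straight
  boundary: there the cap is empty and \<open>K\<close> may meet the line of the chord far outside
  the disc.\<close>

definition flat_chord :: "hyp_plane set \<Rightarrow> hyp_plane \<Rightarrow> hyp_plane \<Rightarrow> bool" where
  "flat_chord K p p' \<longleftrightarrow> p \<in> K \<and> p' \<in> K \<and>
    ((\<exists>z\<in>K. side p p' z < 0) \<longrightarrow> (\<forall>z\<in>K. side p p' z \<le> 0 \<longrightarrow> z \<in> thales p p')) \<and>
    (\<forall>z\<in>thales p p'. 0 \<le> side p p' z \<longrightarrow> z \<in> K)"

lemma side_mv [simp]: "A \<in> SO \<Longrightarrow> side (mv A p) (mv A p') (mv A z) = side p p' z"
  by (simp add: side_def)

lemma thales_mv [simp]: "A \<in> SO \<Longrightarrow> mv A z \<in> thales (mv A p) (mv A p') \<longleftrightarrow> z \<in> thales p p'"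
  by (simp add: thales_def)

lemma side_swap: "side p' p z = - side p p' z"
  by (simp add: side_def det3_def algebra_simps)

lemma thales_swap: "thales p' p = thales p p'"
  by (simp add: thales_def lp_commute[of "lift p'" "lift p"] add.commute)

lemma flat_chord_mv:
  assumes "A \<in> SO" "flat_chord L q q'"
  shows "flat_chord (mv A ` L) (mv A q) (mv A q')"
proof -
  obtain B where B: "B \<in> SO" "\<And>x. mv A (mv B x) = x" "\<And>x. mv B (mv A x) = x" "\<And>S. mv A ` S = mv B -` S"
    using mv_vimage[OF assms(1)] by metis
  have "z \<in> mv A ` L" if "z \<in> thales (mv A q) (mv A q')" "0 \<le> side (mv A q) (mv A q') z" for z
  proof -
    have "mv B z \<in> L"
      using assms(2) that thales_mv[OF assms(1), of "mv B z" q q'] side_mv[OF assms(1), of q q' "mv B z"]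
      unfolding flat_chord_def B(2) by auto
    then show ?thesis using B(2) by (metis imageI)
  qed
  moreover have "z \<in> thales (mv A q) (mv A q')"
    if ex: "\<exists>z\<in>mv A ` L. side (mv A q) (mv A q') z < 0" and z: "z \<in> mv A ` L" "side (mv A q) (mv A q') z \<le> 0" for z
  proof -
    obtain w z' where "w \<in> L" "side q q' w < 0" "z' \<in> L" "z = mv A z'" "side q q' z' \<le> 0"
      using ex z assms(1) by auto
    then have "z' \<in> thales q q'" using assms(2) unfolding flat_chord_def by blast
    then show ?thesis using assms(1) \<open>z = mv A z'\<close> by simp
  qed
  ultimately show ?thesis using assms(2) unfolding flat_chord_def by blast
qed

lemma side_kl:
  "side p p' z = fst (lift p) * fst (lift p') * fst (lift z) * Im (cnj (kl p' - kl p) * (kl z - kl p))"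
proof -
  have d: "det3 (a *\<^sub>R (1, k)) (b *\<^sub>R (1, l)) (c *\<^sub>R (1, m)) = a * b * c * Im (cnj (l - k) * (m - k))" for a b c k l m
    by (simp add: det3_def algebra_simps)
  show ?thesis unfolding side_def
    by (subst (1 2 3) lift_kl) (simp only: d)
qed

lemma side_neg_iff: "side p p' z < 0 \<longleftrightarrow> Im (cnj (kl p' - kl p) * (kl z - kl p)) < 0"
  unfolding side_kl using fst_lift_pos[of p] fst_lift_pos[of p'] fst_lift_pos[of z]
  by (simp add: mult_less_0_iff zero_less_mult_iff del: fst_lift_pos)

text \<open>The midpoint is the normalised sum of the lifts; the factor is recorded because later
  estimates take products with this equation.\<close>

lemma midpoint_exists:
  obtains m where "mv (hturn m) p = p'" "mv (hturn m) p' = p"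
    "sqrt (2 * (1 + lp (lift p) (lift p'))) *\<^sub>R lift m = lift p + lift p'"
proof -
  define P where "P = lp (lift p) (lift p')"
  have P: "1 \<le> P" by (simp add: P_def lp_lift_ge_1)
  have f: "future (lift p + lift p')" using future_lift[of p', unfolded future_def] by (intro future_add future_lift) simp
  have n: "lp (lift p + lift p') (lift p + lift p') = 2 * (1 + P)"
    using lp_commute[of "lift p'" "lift p"] by (simp add: P_def)
  define m where "m = pt (lift p + lift p')"
  define r where "r = sqrt (2 * (1 + P))"
  have r: "0 < r" "r * r = 2 * (1 + P)" using P by (simp_all add: r_def)
  have m: "lift m = (lift p + lift p') /\<^sub>R r" by (simp only: m_def lift_pt[OF f] n r_def)
  have e: "(2 * (inverse r * (1 + P))) *\<^sub>R (X /\<^sub>R r) = X" for X :: vec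
  proof -
    have "2 * (inverse r * (1 + P)) * inverse r = 1" using r P by (simp add: field_simps)
    then show ?thesis by simp
  qed
  have P': "lp (lift p') (lift p) = P" by (simp add: P_def lp_commute)
  have "lp (lift p) (lift m) = inverse r * (1 + P)" "lp (lift p') (lift m) = inverse r * (1 + P)"
    by (simp_all add: m P' flip: P_def)
  then have "hturn m (lift p) = (2 * (inverse r * (1 + P))) *\<^sub>R lift m - lift p"
    "hturn m (lift p') = (2 * (inverse r * (1 + P))) *\<^sub>R lift m - lift p'"
    unfolding hturn_def by simp_all
  then have "hturn m (lift p) = lift p'" "hturn m (lift p') = lift p"
    unfolding m e by simp_all
  then have "mv (hturn m) p = p'" "mv (hturn m) p' = p" by (simp_all add: mv_def)
  moreover have "r *\<^sub>R lift m = lift p + lift p'" using r by (simp add: m)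
  ultimately show ?thesis by (intro that[of m]) (simp_all add: r_def P_def)
qed

text \<open>The two chords are glued together so that the caps lie on opposite sides. Their union
  is contained in the disc with the chord as diameter, so its centre is the midpoint of the chord.\<close>

lemma cap_congruence:
  assumes K: "body K" and L: "body L" and sym: "sym_pair K L"
    and F: "flat_chord K p p'" "flat_chord L q q'"
    and A: "A \<in> SO" "mv A q = p" "mv A q' = p'"
    and z: "side p p' z < 0"
  shows "z \<in> K \<longleftrightarrow> z \<in> mv A ` L"
proof (cases "\<exists>z0. side p p' z0 < 0 \<and> (z0 \<in> K \<or> z0 \<in> mv A ` L)")
  case False
  then show ?thesis using z by blast
next
  case True
  then obtain z0 where z0: "side p p' z0 < 0" "z0 \<in> K \<or> z0 \<in> mv A ` L" by blast
  define L1 where "L1 = mv A ` L"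
  have F1: "flat_chord L1 p p'" using flat_chord_mv[OF A(1) F(2)] by (simp add: L1_def A)
  define P where "P = lp (lift p) (lift p')"
  have P: "1 \<le> P" by (simp add: P_def lp_lift_ge_1)
  obtain m where m: "mv (hturn m) p = p'" "mv (hturn m) p' = p"
    "sqrt (2 * (1 + P)) *\<^sub>R lift m = lift p + lift p'" using midpoint_exists[of p p'] unfolding P_def by metis
  define s where "s = mv (hturn m)"
  have ss: "s (s x) = x" for x by (simp add: s_def)
  have side_s: "side p p' (s x) = - side p p' x" for x
    by (metis s_def m(1,2) side_mv[OF hturn_SO] side_swap)
  have thales_s: "s x \<in> thales p p' \<longleftrightarrow> x \<in> thales p p'" for x
    by (metis s_def m(1,2) thales_mv[OF hturn_SO] thales_swap)
  define L2 where "L2 = s ` L1"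
  have L2_iff: "x \<in> L2 \<longleftrightarrow> s x \<in> L1" for x unfolding L2_def using ss by (metis imageE imageI)
  define M where "M = K \<inter> L2"
  have pM: "p \<in> M" "p' \<in> M" using F(1) F1 by (simp_all add: M_def L2_iff s_def m flat_chord_def)
  \<comment> \<open>A cap point of \<open>K\<close> lies in the disc, and its half-turn image lies
    in the disc on the other side of the chord, which \<open>L1\<close> contains.\<close>
  have K_to: "x \<in> L2" if "x \<in> K" "side p p' x < 0" for x
    using F(1) F1 that unfolding flat_chord_def L2_iff by (metis le_less neg_0_le_iff_le side_s thales_s)
  have L_to: "s x \<in> K" if "x \<in> L1" "side p p' x < 0" for x
    using F(1) F1 that unfolding flat_chord_def by (metis le_less neg_0_le_iff_le side_s thales_s)
  obtain w where w: "w \<in> M" "side p p' w \<noteq> 0"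
  proof (cases "z0 \<in> K")
    case True
    then show ?thesis using that[of z0] z0 K_to by (auto simp: M_def)
  next
    case False
    then have "z0 \<in> L1" using z0 by (simp add: L1_def)
    then show ?thesis using that[of "s z0"] z0(1) L_to by (auto simp: M_def L2_iff ss side_s)
  qed
  have M_eq: "M = K \<inter> mv (hturn m \<circ> A) ` L"
    unfolding M_def L2_def L1_def s_def by (simp add: mv_comp A(1) image_comp)
  have SO: "hturn m \<circ> A \<in> SO" by (intro SO_comp A hturn_SO)
  have "hyp_convex M" unfolding M_eq using K L SO by (intro hyp_convex_Int hyp_convex_mv) (auto simp: body_def)
  then have "interior M \<noteq> {}"
    using w pM by (intro hyp_convex_interior[of M p p' w]) (auto simp: side_kl)
  then obtain c where c: "\<And>x. x \<in> M \<Longrightarrow> mv (hturn c) x \<in> M"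
    using sym_pairD[OF sym SO] unfolding M_eq by metis
  have M_thales: "x \<in> thales p p'" if "x \<in> M" for x
  proof (cases "z0 \<in> K")
    case True
    then have k: "x \<in> K \<Longrightarrow> side p p' x \<le> 0 \<Longrightarrow> x \<in> thales p p'" using F(1) z0 unfolding flat_chord_def by blast
    show ?thesis
    proof (cases "side p p' x \<le> 0")
      case True then show ?thesis using k that by (simp add: M_def)
    next
      case False
      then have "side p p' (s x) < 0" "s x \<in> L1" using that by (auto simp: side_s M_def L2_iff)
      then have "s x \<in> thales p p'" using F1 unfolding flat_chord_def by (meson less_imp_le)
      then show ?thesis by (simp add: thales_s)
    qed
  next
    case False
    then have "z0 \<in> L1" using z0 by (simp add: L1_def)
    then have l: "s x \<in> L1 \<Longrightarrow> side p p' (s x) \<le> 0 \<Longrightarrow> s x \<in> thales p p'" using F1 z0 unfolding flat_chord_def by blast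
    show ?thesis
    proof (cases "side p p' x < 0")
      case True
      moreover have "x \<in> K" using that by (simp add: M_def)
      ultimately show ?thesis using F(1) unfolding flat_chord_def by (meson less_imp_le)
    next
      case False
      then show ?thesis using l that by (simp add: side_s M_def L2_iff thales_s)
    qed
  qed
  \<comment> \<open>The mirror images of \<open>p\<close> and \<open>p'\<close> about
    \<open>c\<close> lie in the disc. Adding the two inequalities bounds \<open>a + b\<close>, i.e.
    the product of \<open>c\<close> with the midpoint \<open>m\<close>, from above, which leaves
    only \<open>c = m\<close>.\<close>
  define a b where "a = lp (lift p) (lift c)" and "b = lp (lift p') (lift c)"
  have ab: "1 \<le> a" "1 \<le> b" by (simp_all add: a_def b_def lp_lift_ge_1)
  have "mv (hturn c) p \<in> thales p p'" using M_thales c pM by blast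
  then have 1: "2 * a * a - 1 + (2 * a * b - P) \<le> 1 + P"
    by (simp add: thales_def hturn_def a_def b_def P_def lp_commute[of "lift c"])
  have "mv (hturn c) p' \<in> thales p p'" using M_thales c pM by blast
  then have 2: "2 * b * b - 1 + (2 * a * b - P) \<le> 1 + P"
    by (simp add: thales_def hturn_def a_def b_def P_def lp_commute[of "lift c"] lp_commute[of "lift p'" "lift p"] mult_ac)
  have "(a + b)\<^sup>2 \<le> 2 * (1 + P)" using 1 2 by (simp add: power2_eq_square algebra_simps)
  then have ab2: "a + b \<le> sqrt (2 * (1 + P))" by (rule real_le_rsqrt)
  have "sqrt (2 * (1 + P)) * lp (lift m) (lift c) = a + b"
    using arg_cong[OF m(3), of "\<lambda>X. lp X (lift c)"] by (simp add: a_def b_def)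
  then have "sqrt (2 * (1 + P)) * lp (lift m) (lift c) \<le> sqrt (2 * (1 + P)) * 1" using ab2 by simp
  moreover have "0 < sqrt (2 * (1 + P))" using P by simp
  ultimately have "lp (lift m) (lift c) \<le> 1" by (rule mult_left_le_imp_le)
  then have "c = m" using lp_lift_ge_1[of m c] lp_lift_eq_1[of m c] by simp
  then have sM: "s x \<in> M" if "x \<in> M" for x using c that by (simp add: s_def)
  show ?thesis
  proof
    assume "z \<in> K"
    then have "z \<in> M" using K_to z by (simp add: M_def)
    from sM[OF this] show "z \<in> mv A ` L" by (simp add: M_def L2_iff ss flip: L1_def)
  next
    assume "z \<in> mv A ` L"
    then have "z \<in> L1" by (simp add: L1_def)
    then have "s z \<in> M" using L_to z by (simp add: M_def L2_iff ss)
    from sM[OF this] show "z \<in> K" by (simp add: M_def ss)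
  qed
qed

section \<open>The boundary near a smooth point\<close>

text \<open>The lower boundary in the Klein chart. The margin between \<delta> and 4\<delta> leaves
  room for the discs over chords with end points in (-\<delta>, \<delta>);
  \<open>\<delta> \<le> 1/64\<close> keeps the distortion of angles and lengths small.\<close>

definition flat_graph :: "hyp_plane set \<Rightarrow> real \<Rightarrow> (real \<Rightarrow> real) \<Rightarrow> bool" where
  "flat_graph K \<delta> f \<longleftrightarrow> 0 < \<delta> \<and> \<delta> \<le> 1/64 \<and> f 0 = 0 \<and> (\<forall>s. \<bar>s\<bar> < 4 * \<delta> \<longrightarrow> 0 \<le> f s) \<and>
     (\<forall>s s'. \<bar>s\<bar> < 4 * \<delta> \<longrightarrow> \<bar>s'\<bar> < 4 * \<delta> \<longrightarrow> \<bar>f s - f s'\<bar> \<le> \<bar>s - s'\<bar> / 2) \<and>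
     (\<forall>s v. \<bar>s\<bar> < 4 * \<delta> \<longrightarrow> v < 4 * \<delta> \<longrightarrow> (Complex s v \<in> kl ` K \<longleftrightarrow> f s \<le> v))"

lemma kl_closed:
  assumes "closed K" "\<And>n. u n \<in> kl ` K" "u \<longlonglongrightarrow> k" "cmod k < 1"
  shows "k \<in> kl ` K"
proof -
  have "(\<lambda>n. kp (u n)) \<longlonglongrightarrow> kp k" unfolding kp_def
  proof (rule tendsto_pt)
    show "(\<lambda>n. (1::real, u n)) \<longlonglongrightarrow> (1, k)" using assms(3) by (intro tendsto_Pair tendsto_const)
    show "future (1, k)" using assms(4) by (rule future_klein)
    show "\<forall>\<^sub>F n in sequentially. future (1, u n)"
      using assms(2) by (intro always_eventually allI future_klein) (metis imageE norm_kl)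
  qed
  moreover have "kp (u n) \<in> K" for n using assms(2)[of n] by auto
  ultimately have "kp k \<in> K" using closed_sequentially[OF assms(1)] by metis
  then show ?thesis using assms(4) by (metis imageI kl_kp)
qed

lemma flat_graph_exists:
  assumes K: "body K" "normal_pos K"
  obtains \<delta> f where "flat_graph K \<delta> f"
proof -
  define C where "C = kl ` K"
  have conv: "convex C" using body_kl(1)[OF K(1)] by (simp add: C_def)
  have im: "0 \<le> Im k" if "k \<in> C" for k
    using supp_origD[of K "(0, - \<i>)"] K(2) that by (auto simp: inner_complex_def normal_pos_def C_def)
  obtain \<rho>0 where \<rho>0: "0 < \<rho>0" "\<And>k. cmod k < \<rho>0 \<Longrightarrow> 1/8 * cmod k \<le> Im k \<Longrightarrow> k \<in> C"
  proof -
    have "\<exists>\<rho>>0. \<forall>k. cmod k < \<rho> \<longrightarrow> 1/8 * cmod k \<le> Im k \<longrightarrow> k \<in> kl ` K"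
    proof -
      have "(0::real) < 1/8" by simp
      then show ?thesis using K(2) unfolding normal_pos_def by blast
    qed
    then show ?thesis using that unfolding C_def by blast
  qed
  define \<rho> where "\<rho> = min \<rho>0 (1/2)"
  have \<rho>: "0 < \<rho>" "\<rho> \<le> 1/2" "\<rho> \<le> \<rho>0" using \<rho>0 by (auto simp: \<rho>_def)
  \<comment> \<open>The modulus is at most \<open>\<bar>s\<bar> + v \<le> 5 * v\<close>, so the cone
    condition with 1/8 applies.\<close>
  have W: "Complex s v \<in> C" if "\<bar>s\<bar> / 4 \<le> v" "\<bar>s\<bar> + v < \<rho>" for s v
  proof (rule \<rho>0(2))
    have "cmod (Complex s v) \<le> \<bar>s\<bar> + v" using cmod_le[of "Complex s v"] that by simp
    then show "cmod (Complex s v) < \<rho>0" "1/8 * cmod (Complex s v) \<le> Im (Complex s v)" using that \<rho> by auto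
  qed
  define f where "f s = Inf {v. Complex s v \<in> C}" for s
  have bdd: "bdd_below {v. Complex s v \<in> C}" for s using im by (intro bdd_belowI[of _ 0]) force
  have f_le: "f s \<le> v" if "Complex s v \<in> C" for s v unfolding f_def using that bdd by (intro cInf_lower) auto
  have f_mem: "Complex s (f s) \<in> C \<and> 0 \<le> f s \<and> f s \<le> \<bar>s\<bar> / 4" if s: "\<bar>s\<bar> < \<rho> / 2" for s
  proof -
    have m: "Complex s (\<bar>s\<bar> / 4) \<in> C" using s by (intro W) auto
    then have ne: "{v. Complex s v \<in> C} \<noteq> {}" by auto
    have f0: "0 \<le> f s" unfolding f_def using ne im by (intro cInf_greatest) force+
    have f1: "f s \<le> \<bar>s\<bar> / 4" using f_le[OF m] .
    have "\<exists>v. Complex s v \<in> C \<and> v < f s + inverse (real (Suc n))" for n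
      using cInf_lessD[OF ne, of "f s + inverse (real (Suc n))"] unfolding f_def[symmetric] by auto
    then obtain v where v: "\<And>n. Complex s (v n) \<in> C" "\<And>n. v n < f s + inverse (real (Suc n))" by metis
    have "v \<longlonglongrightarrow> f s"
    proof (rule tendsto_sandwich)
      show "\<forall>\<^sub>F n in sequentially. f s \<le> v n" using f_le v by auto
      show "\<forall>\<^sub>F n in sequentially. v n \<le> f s + inverse (real (Suc n))" by (intro always_eventually allI less_imp_le v(2))
      show "(\<lambda>n. f s + inverse (real (Suc n))) \<longlonglongrightarrow> f s" using LIMSEQ_inverse_real_of_nat_add .
    qed simp
    then have "(\<lambda>n. Complex s (v n)) \<longlonglongrightarrow> Complex s (f s)" by (intro tendsto_Complex tendsto_const)
    moreover have "cmod (Complex s (f s)) < 1"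
      using cmod_le[of "Complex s (f s)"] f0 f1 s \<rho> by simp
    ultimately have "Complex s (f s) \<in> C" unfolding C_def
      using kl_closed[of K "\<lambda>n. Complex s (v n)"] v(1) K(1) by (auto simp: C_def body_def)
    then show ?thesis using f0 f1 by simp
  qed
  have mem_iff: "Complex s v \<in> C \<longleftrightarrow> f s \<le> v" if s: "\<bar>s\<bar> < \<rho> / 2" "v < \<rho> / 2" for s v
  proof
    assume v: "f s \<le> v"
    show "Complex s v \<in> C"
    proof (cases "\<bar>s\<bar> / 4 \<le> v")
      case True then show ?thesis using s by (intro W) auto
    next
      case False
      define t where "t = (v - f s) / (\<bar>s\<bar> / 4 - f s)"
      have t: "0 \<le> t" "t \<le> 1" using v False by (auto simp: t_def divide_le_eq_1)
      have "Complex s (\<bar>s\<bar> / 4) \<in> C" using s by (intro W) auto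
      then have "(1 - t) *\<^sub>R Complex s (f s) + t *\<^sub>R Complex s (\<bar>s\<bar> / 4) \<in> C"
        using t conv f_mem[OF s(1)] by (intro convexD) auto
      moreover have "t * (\<bar>s\<bar> / 4 - f s) = v - f s" using v False by (simp add: t_def)
      then have "(1 - t) *\<^sub>R Complex s (f s) + t *\<^sub>R Complex s (\<bar>s\<bar> / 4) = Complex s v"
        by (simp add: complex_eq_iff algebra_simps)
      ultimately show ?thesis by simp
    qed
  qed (rule f_le)
  have fconv: "f ((1 - t) * s + t * s') \<le> (1 - t) * f s + t * f s'"
    if "\<bar>s\<bar> < \<rho> / 2" "\<bar>s'\<bar> < \<rho> / 2" "0 \<le> t" "t \<le> 1" for s s' t
  proof -
    have "(1 - t) *\<^sub>R Complex s (f s) + t *\<^sub>R Complex s' (f s') \<in> C"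
      using f_mem that conv by (intro convexD) auto
    moreover have "(1 - t) *\<^sub>R Complex s (f s) + t *\<^sub>R Complex s' (f s') = Complex ((1 - t) * s + t * s') ((1 - t) * f s + t * f s')"
      by (simp add: complex_eq_iff)
    ultimately have "Complex ((1 - t) * s + t * s') ((1 - t) * f s + t * f s') \<in> C" by simp
    then show ?thesis by (rule f_le)
  qed
  define \<delta> where "\<delta> = \<rho> / 32"
  have d: "0 < \<delta>" "\<delta> \<le> 1/64" "\<rho> = 32 * \<delta>" using \<rho> by (auto simp: \<delta>_def)
  have slope: "f s' - f s \<le> \<bar>s' - s\<bar> / 2"
    if ss: "\<bar>s\<bar> < 4 * \<delta>" "\<bar>s'\<bar> < 4 * \<delta>" for s s'
  proof (cases "s = s'")
    case False
    \<comment> \<open>By convexity the rise from \<open>s\<close> to \<open>s'\<close> is compared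
      with that to the far point \<open>r\<close>, where \<open>f r \<le> 3 * \<delta>\<close> at a
      distance of at least \<open>8 * \<delta>\<close>: the slope is at most 3/8.\<close>
    define r where "r = (if s < s' then 12 * \<delta> else - (12 * \<delta>))"
    have r: "\<bar>r\<bar> < \<rho> / 2" "\<bar>r\<bar> = 12 * \<delta>" using d by (auto simp: r_def)
    define t where "t = (s' - s) / (r - s)"
    have rs: "\<bar>r - s\<bar> \<ge> 8 * \<delta>" "r \<noteq> s" using ss d by (auto simp: r_def)
    have t: "0 \<le> t \<and> t \<le> 1 \<and> t = \<bar>s' - s\<bar> / \<bar>r - s\<bar>"
    proof (cases "s < s'")
      case True
      then have "0 < s' - s" "0 < r - s" "s' - s \<le> r - s" using ss d by (auto simp: r_def)
      then show ?thesis by (simp add: t_def)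
    next
      case False
      then have "0 < s - s'" "0 < s - r" "s - s' \<le> s - r" using ss d \<open>s \<noteq> s'\<close> by (auto simp: r_def)
      moreover have "t = (s - s') / (s - r)" by (metis minus_diff_eq minus_divide_divide t_def)
      ultimately show ?thesis by (simp add: abs_minus_commute)
    qed
    then have t: "0 \<le> t" "t \<le> 1" "t = \<bar>s' - s\<bar> / \<bar>r - s\<bar>" by simp_all
    have "(1 - t) * s + t * r = s + t * (r - s)" by (simp add: algebra_simps)
    also have "\<dots> = s'" using rs by (simp add: t_def)
    finally have "f s' \<le> (1 - t) * f s + t * f r" using fconv[of s r t] ss d r t by simp
    moreover have "0 \<le> t * f s" using t(1) f_mem[of s] ss d by simp
    moreover have "t * f r \<le> t * (3 * \<delta>)" using f_mem[of r] r t(1) by (intro mult_left_mono) auto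
    ultimately have "f s' - f s \<le> t * (3 * \<delta>)" by (simp add: algebra_simps)
    also have "\<dots> = \<bar>s' - s\<bar> * (3 * \<delta>) / \<bar>r - s\<bar>" by (simp add: t(3))
    also have "\<dots> \<le> \<bar>s' - s\<bar> * (3 * \<delta>) / (8 * \<delta>)" using rs d by (intro divide_left_mono) auto
    also have "\<dots> \<le> \<bar>s' - s\<bar> / 2" using d by (simp add: field_simps)
    finally show ?thesis .
  qed simp
  show ?thesis
  proof (rule that[of \<delta> f])
    have "\<bar>f s - f s'\<bar> \<le> \<bar>s - s'\<bar> / 2" if "\<bar>s\<bar> < 4 * \<delta>" "\<bar>s'\<bar> < 4 * \<delta>" for s s'
      using slope[OF that] slope[OF that(2,1)] by (auto simp: abs_if split: if_splits)
    moreover have "f 0 = 0" using f_mem[of 0] \<rho> by simp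
    moreover have "0 \<le> f s" if "\<bar>s\<bar> < 4 * \<delta>" for s using f_mem[of s] that d by simp
    moreover have "Complex s v \<in> C \<longleftrightarrow> f s \<le> v" if "\<bar>s\<bar> < 4 * \<delta>" "v < 4 * \<delta>" for s v
      using mem_iff[of s v] that d by simp
    ultimately show "flat_graph K \<delta> f" using d by (simp add: flat_graph_def C_def)
  qed
qed

section \<open>Distances and angles in the Klein chart\<close>

lemma lp_lift_klein: "lp (lift x) (lift y) = fst (lift x) * fst (lift y) * (1 - kl x \<bullet> kl y)"
  by (subst lift_kl[of y]) (simp add: lp_lift_kl algebra_simps)

lemma fst_lift_sq: "(fst (lift x))\<^sup>2 * (1 - (cmod (kl x))\<^sup>2) = 1"
  using lp_lift_self[of x, unfolded lp_lift_klein] unfolding power2_norm_eq_inner by (simp add: power2_eq_square)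

text \<open>Up to a positive factor the premise is the Riemannian inner product in the Klein chart
  of the directions from \<open>p\<close> to \<open>z\<close> and from \<open>z\<close> to
  \<open>p'\<close>. By the law of cosines the conclusion says that the angle at \<open>z\<close> is
  not acute.\<close>

lemma klein_obtuse:
  assumes "0 \<le> (1 - (cmod (kl z))\<^sup>2) * ((kl z - kl p) \<bullet> (kl p' - kl z)) + ((kl z - kl p) \<bullet> kl z) * ((kl p' - kl z) \<bullet> kl z)"
  shows "lp (lift p) (lift z) * lp (lift z) (lift p') \<le> lp (lift p) (lift p')"
proof -
  let ?a = "fst (lift p)" and ?b = "fst (lift z)" and ?c = "fst (lift p')"
  have e: "(1 - kl p \<bullet> kl p') * (1 - (cmod (kl z))\<^sup>2) - (1 - kl p \<bullet> kl z) * (1 - kl z \<bullet> kl p') =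
    (1 - (cmod (kl z))\<^sup>2) * ((kl z - kl p) \<bullet> (kl p' - kl z)) + ((kl z - kl p) \<bullet> kl z) * ((kl p' - kl z) \<bullet> kl z)"
    unfolding power2_norm_eq_inner
    by (simp add: inner_diff_left inner_diff_right inner_commute[of "kl z" "kl p"] inner_commute[of "kl p'"] algebra_simps)
  have "lp (lift p) (lift z) * lp (lift z) (lift p') = ?a * ?c * (?b\<^sup>2 * ((1 - kl p \<bullet> kl z) * (1 - kl z \<bullet> kl p')))"
    by (simp add: lp_lift_klein power2_eq_square)
  also have "\<dots> \<le> ?a * ?c * (?b\<^sup>2 * ((1 - kl p \<bullet> kl p') * (1 - (cmod (kl z))\<^sup>2)))"
    using assms e by (intro mult_left_mono) (auto simp: less_imp_le)
  also have "\<dots> = ?a * ?c * (1 - kl p \<bullet> kl p') * (?b\<^sup>2 * (1 - (cmod (kl z))\<^sup>2))" by (simp only: mult_ac)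
  also have "\<dots> = lp (lift p) (lift p')" by (simp only: fst_lift_sq lp_lift_klein mult_1_right)
  finally show ?thesis .
qed

text \<open>Both compare the squared sinh of the distance with the Euclidean distance. They follow
  from one exact formula; the Gram determinant in it is dropped for the upper bound and absorbed by
  the height of \<open>p\<close> for the lower one.\<close>

lemma klein_dist_lower: "(cmod (kl z - kl p))\<^sup>2 \<le> (lp (lift z) (lift p))\<^sup>2 - 1"
  and klein_dist_upper: "(lp (lift z) (lift p))\<^sup>2 - 1 \<le> (fst (lift z))\<^sup>2 * (fst (lift p))\<^sup>2 * (cmod (kl z - kl p))\<^sup>2"
proof -
  let ?a = "fst (lift z)" and ?b = "fst (lift p)" and ?k = "kl z" and ?l = "kl p"
  have e: "(lp (lift z) (lift p))\<^sup>2 - 1 = ?a\<^sup>2 * ?b\<^sup>2 * ((1 - ?k \<bullet> ?l)\<^sup>2 - (1 - (cmod ?k)\<^sup>2) * (1 - (cmod ?l)\<^sup>2))"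
  proof -
    have "(?a\<^sup>2 * (1 - (cmod ?k)\<^sup>2)) * (?b\<^sup>2 * (1 - (cmod ?l)\<^sup>2)) = 1" by (simp only: fst_lift_sq mult_1_right)
    then have "?a\<^sup>2 * ?b\<^sup>2 * ((1 - (cmod ?k)\<^sup>2) * (1 - (cmod ?l)\<^sup>2)) = 1" by (simp only: mult_ac)
    moreover have "(lp (lift z) (lift p))\<^sup>2 = ?a\<^sup>2 * ?b\<^sup>2 * (1 - ?k \<bullet> ?l)\<^sup>2"
      by (simp only: lp_lift_klein power_mult_distrib)
    ultimately show ?thesis by (simp only: right_diff_distrib)
  qed
  have n: "(cmod (?k - ?l))\<^sup>2 = (cmod ?k)\<^sup>2 - 2 * (?k \<bullet> ?l) + (cmod ?l)\<^sup>2"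
    by (simp add: power2_norm_eq_inner inner_diff_left inner_diff_right inner_commute)
  have f: "(1 - ?k \<bullet> ?l)\<^sup>2 - (1 - (cmod ?k)\<^sup>2) * (1 - (cmod ?l)\<^sup>2) =
      (cmod (?k - ?l))\<^sup>2 - ((cmod ?k)\<^sup>2 * (cmod ?l)\<^sup>2 - (?k \<bullet> ?l)\<^sup>2)"
    unfolding n by (simp add: power2_eq_square algebra_simps)
  have cs: "(?k \<bullet> ?l)\<^sup>2 \<le> (cmod ?k)\<^sup>2 * (cmod ?l)\<^sup>2" by (metis Cauchy_Schwarz_ineq power2_norm_eq_inner)
  have "?a\<^sup>2 * ?b\<^sup>2 * ((1 - ?k \<bullet> ?l)\<^sup>2 - (1 - (cmod ?k)\<^sup>2) * (1 - (cmod ?l)\<^sup>2)) \<le> ?a\<^sup>2 * ?b\<^sup>2 * (cmod (?k - ?l))\<^sup>2"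
    unfolding f using cs by (intro mult_left_mono) auto
  then show "(lp (lift z) (lift p))\<^sup>2 - 1 \<le> ?a\<^sup>2 * ?b\<^sup>2 * (cmod (?k - ?l))\<^sup>2" by (simp only: e)
  have "(cmod ?k)\<^sup>2 * (cmod ?l)\<^sup>2 - (?k \<bullet> ?l)\<^sup>2 = (cmod (?k - ?l))\<^sup>2 * (cmod ?l)\<^sup>2 - ((?k - ?l) \<bullet> ?l)\<^sup>2"
    unfolding n inner_diff_left by (simp add: power2_eq_square power2_norm_eq_inner[symmetric, of ?l, unfolded power2_eq_square] algebra_simps)
  also have "\<dots> \<le> (cmod (?k - ?l))\<^sup>2 * (cmod ?l)\<^sup>2" by simp
  finally have "(cmod (?k - ?l))\<^sup>2 * (1 - (cmod ?l)\<^sup>2) \<le> (1 - ?k \<bullet> ?l)\<^sup>2 - (1 - (cmod ?k)\<^sup>2) * (1 - (cmod ?l)\<^sup>2)"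
    unfolding f by (simp add: algebra_simps)
  then have "?a\<^sup>2 * ?b\<^sup>2 * ((cmod (?k - ?l))\<^sup>2 * (1 - (cmod ?l)\<^sup>2)) \<le> (lp (lift z) (lift p))\<^sup>2 - 1"
    unfolding e by (intro mult_left_mono) auto
  also have "?a\<^sup>2 * ?b\<^sup>2 * ((cmod (?k - ?l))\<^sup>2 * (1 - (cmod ?l)\<^sup>2)) = ?a\<^sup>2 * (cmod (?k - ?l))\<^sup>2 * (?b\<^sup>2 * (1 - (cmod ?l)\<^sup>2))"
    by (simp only: mult_ac)
  also have "\<dots> = ?a\<^sup>2 * (cmod (?k - ?l))\<^sup>2" by (simp only: fst_lift_sq mult_1_right)
  finally have "?a\<^sup>2 * (cmod (?k - ?l))\<^sup>2 \<le> (lp (lift z) (lift p))\<^sup>2 - 1" .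
  moreover have "1 \<le> ?a\<^sup>2"
  proof -
    have "?a\<^sup>2 = 1 + ?a\<^sup>2 * (cmod ?k)\<^sup>2" using fst_lift_sq[of z] by (simp add: algebra_simps)
    then show ?thesis by (metis le_add_same_cancel1 mult_nonneg_nonneg zero_le_power2)
  qed
  ultimately show "(cmod (?k - ?l))\<^sup>2 \<le> (lp (lift z) (lift p))\<^sup>2 - 1"
    by (smt (verit) mult_le_cancel_right1 zero_le_power2)
qed

text \<open>Steps to the right of slope at most 1/2 satisfy
  \<open>3/4 * (Re a * Re b) \<le> a \<bullet> b\<close>, and for \<open>cmod k \<le> 1/8\<close>
  the correction by the metric is much smaller than that.\<close>

lemma slope_obtuse:
  fixes a b k :: complex
  assumes "0 \<le> Re a" "\<bar>Im a\<bar> \<le> Re a / 2" "0 \<le> Re b" "\<bar>Im b\<bar> \<le> Re b / 2" "cmod k \<le> 1/8"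
  shows "0 \<le> (1 - (cmod k)\<^sup>2) * (a \<bullet> b) + (a \<bullet> k) * (b \<bullet> k)"
proof -
  have "\<bar>Im a * Im b\<bar> \<le> (Re a / 2) * (Re b / 2)" unfolding abs_mult using assms by (intro mult_mono) auto
  then have ab: "3/4 * (Re a * Re b) \<le> a \<bullet> b" by (simp add: inner_complex_def)
  have k2: "(cmod k)\<^sup>2 \<le> 1/64" using power_mono[OF assms(5), of 2] by (simp add: power2_eq_square)
  have n: "cmod a \<le> 3/2 * Re a" "cmod b \<le> 3/2 * Re b" using cmod_le[of a] cmod_le[of b] assms by auto
  have "\<bar>a \<bullet> k\<bar> \<le> cmod a * cmod k" "\<bar>b \<bullet> k\<bar> \<le> cmod b * cmod k" by (rule Cauchy_Schwarz_ineq2)+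
  moreover have "cmod a * cmod k \<le> (3/2 * Re a) * (1/8)" "cmod b * cmod k \<le> (3/2 * Re b) * (1/8)"
    by (rule mult_mono; use n assms in simp)+
  ultimately have "\<bar>a \<bullet> k\<bar> \<le> 3/16 * Re a" "\<bar>b \<bullet> k\<bar> \<le> 3/16 * Re b" by auto
  then have "\<bar>(a \<bullet> k) * (b \<bullet> k)\<bar> \<le> (3/16 * Re a) * (3/16 * Re b)" unfolding abs_mult using assms by (intro mult_mono) auto
  moreover have "(63/64) * (3/4 * (Re a * Re b)) \<le> (1 - (cmod k)\<^sup>2) * (a \<bullet> b)"
    using k2 ab assms by (intro mult_mono) auto
  moreover have "0 \<le> Re a * Re b" using assms by simp
  ultimately show ?thesis by linarith
qed

text \<open>For \<open>u, v \<ge> 1\<close> one has \<open>u + v \<le> 1 + u * v\<close>.\<close>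

lemma thales_if_obtuse:
  assumes "lp (lift p) (lift z) * lp (lift z) (lift p') \<le> lp (lift p) (lift p')"
  shows "z \<in> thales p p'"
proof -
  have "0 \<le> (lp (lift z) (lift p) - 1) * (lp (lift z) (lift p') - 1)"
    using lp_lift_ge_1[of z] by simp
  then show ?thesis using assms by (simp add: thales_def lp_commute[of "lift p" "lift z"] algebra_simps)
qed

section \<open>Boundary arcs as graphs, and their chords\<close>

definition bpt :: "(real \<Rightarrow> real) \<Rightarrow> real \<Rightarrow> hyp_plane" where
  "bpt f s = kp (Complex s (f s))"

context
  fixes K :: "hyp_plane set" and \<delta> :: real and f :: "real \<Rightarrow> real"
  assumes K: "body K" and flat: "flat_graph K \<delta> f"
begin

lemma delta: "0 < \<delta>" "\<delta> \<le> 1/64"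
  using flat by (simp_all add: flat_graph_def)

lemma flat_lipschitz: "\<bar>s\<bar> < 4 * \<delta> \<Longrightarrow> \<bar>s'\<bar> < 4 * \<delta> \<Longrightarrow> \<bar>f s - f s'\<bar> \<le> \<bar>s - s'\<bar> / 2"
  using flat by (simp add: flat_graph_def)

lemma flat_slope:
  assumes "s \<le> s'" "\<bar>s\<bar> < 4 * \<delta>" "\<bar>s'\<bar> < 4 * \<delta>"
  shows "f s' - f s \<le> (s' - s) / 2" "f s - f s' \<le> (s' - s) / 2"
proof -
  have "\<bar>f s' - f s\<bar> \<le> (s' - s) / 2" using flat_lipschitz[OF assms(3,2)] assms(1) by simp
  from abs_le_D1[OF this] abs_le_D2[OF this]
  show "f s' - f s \<le> (s' - s) / 2" "f s - f s' \<le> (s' - s) / 2" by simp_all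
qed

lemma flat_bounds: "\<bar>s\<bar> < 4 * \<delta> \<Longrightarrow> 0 \<le> f s \<and> f s \<le> \<bar>s\<bar> / 2"
  using flat flat_lipschitz[of s 0] delta by (auto simp: flat_graph_def)

lemma flat_mem: "\<bar>s\<bar> < 4 * \<delta> \<Longrightarrow> v < 4 * \<delta> \<Longrightarrow> Complex s v \<in> kl ` K \<longleftrightarrow> f s \<le> v"
  using flat by (simp add: flat_graph_def)

lemma flat_not_below: "k \<in> kl ` K \<Longrightarrow> \<bar>Re k\<bar> < 4 * \<delta> \<Longrightarrow> f (Re k) \<le> Im k"
  using flat_mem[of "Re k" "Im k"] flat_bounds[of "Re k"] by (cases "Im k < 4 * \<delta>") auto

lemma cmod_graph: "\<bar>s\<bar> < 4 * \<delta> \<Longrightarrow> cmod (Complex s (f s)) < 6 * \<delta>"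
  using cmod_le[of "Complex s (f s)"] flat_bounds[of s] by simp

lemma kl_bpt [simp]: "\<bar>s\<bar> < 4 * \<delta> \<Longrightarrow> kl (bpt f s) = Complex s (f s)"
  unfolding bpt_def using cmod_graph[of s] delta by (intro kl_kp) simp

lemma bpt_mem: "\<bar>s\<bar> < 4 * \<delta> \<Longrightarrow> bpt f s \<in> K"
  using flat_mem[of s "f s"] flat_bounds[of s] kl_bpt[of s] by (auto simp: kl_inj bpt_def)

lemma bpt_frontier:
  assumes s: "\<bar>s\<bar> < 4 * \<delta>"
  shows "bpt f s \<in> frontier K"
proof -
  have "bpt f s \<notin> interior K"
  proof
    assume "bpt f s \<in> interior K"
    then have "Complex s (f s) \<in> interior (kl ` K)" using interior_kl s by auto
    then obtain e where e: "0 < e" "ball (Complex s (f s)) e \<subseteq> kl ` K" by (meson mem_interior)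
    have "Complex s (f s - e / 2) \<in> ball (Complex s (f s)) e" using e(1)
      by (simp add: dist_norm complex_diff cmod_def)
    then have "Complex s (f s - e / 2) \<in> kl ` K" using e by blast
    from flat_not_below[OF this] s e(1) show False by simp
  qed
  then show ?thesis using bpt_mem[OF s] K by (simp add: frontier_def body_def)
qed

lemma frontier_bpt:
  assumes z: "z \<in> frontier K" "\<bar>Re (kl z)\<bar> < 4 * \<delta>" "Im (kl z) < 4 * \<delta>"
  shows "z = bpt f (Re (kl z))"
proof -
  define s v where "s = Re (kl z)" and "v = Im (kl z)"
  have k: "kl z = Complex s v" by (simp add: s_def v_def)
  have zK: "z \<in> K" by (rule frontier_subset_body[OF K z(1)])
  then have ge: "f s \<le> v" using flat_not_below[of "kl z"] z(2) by (simp add: s_def v_def)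
  have "v = f s"
  proof (rule ccontr)
    assume "v \<noteq> f s"
    then have gt: "f s < v" using ge by simp
    define e where "e = Min {(v - f s) / 2, 4 * \<delta> - v, 4 * \<delta> - \<bar>s\<bar>}"
    have e0: "0 < e" using gt z(2,3) by (simp add: e_def s_def v_def)
    have e1: "e \<le> (v - f s) / 2" unfolding e_def by (rule Min_le) simp_all
    have e2: "e \<le> 4 * \<delta> - v" unfolding e_def by (rule Min_le) simp_all
    have e3: "e \<le> 4 * \<delta> - \<bar>s\<bar>" unfolding e_def by (rule Min_le) simp_all
    note e = e0 e1 e2 e3
    have "ball (kl z) e \<subseteq> kl ` K"
    proof
      fix k assume "k \<in> ball (kl z) e"
      then have n: "cmod (k - kl z) < e" by (simp add: dist_norm norm_minus_commute)
      then have re: "\<bar>Re k - s\<bar> < e" "\<bar>Im k - v\<bar> < e"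
        using abs_Re_le_cmod[of "k - kl z"] abs_Im_le_cmod[of "k - kl z"] by (simp_all add: s_def v_def)
      have s4: "\<bar>Re k\<bar> < 4 * \<delta>" "Im k < 4 * \<delta>" using re e by linarith+
      have "\<bar>f (Re k) - f s\<bar> \<le> \<bar>Re k - s\<bar> / 2" using s4 z(2) by (intro flat_lipschitz) (auto simp: s_def)
      then have "f (Re k) - f s \<le> \<bar>Re k - s\<bar> / 2" by (rule abs_le_D1)
      moreover have "\<bar>Re k - s\<bar> / 2 \<le> e / 2" using re(1) by simp
      ultimately have "f (Re k) - f s \<le> e / 2" by (rule order_trans)
      moreover have "v - e < Im k" using re(2) by (simp add: abs_less_iff)
      ultimately have "f (Re k) \<le> Im k" using e(1,2) by argo
      then show "k \<in> kl ` K" using flat_mem[OF s4] by simp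
    qed
    then have "kl z \<in> interior (kl ` K)" using e(1) by (meson mem_interior)
    then have "z \<in> interior K" using interior_kl by blast
    then show False using z(1) by (simp add: frontier_def)
  qed
  then show ?thesis using k by (metis bpt_def kp_kl s_def)
qed

lemma continuous_bpt: "continuous_on {-(4 * \<delta>)<..<4 * \<delta>} (bpt f)"
proof -
  have "continuous_on {-(4 * \<delta>)<..<4 * \<delta>} f"
    unfolding continuous_on_iff
  proof (intro ballI allI impI)
    fix s e :: real assume s: "s \<in> {-(4 * \<delta>)<..<4 * \<delta>}" and e: "0 < e"
    have "dist (f s') (f s) < e" if "s' \<in> {-(4 * \<delta>)<..<4 * \<delta>}" "dist s' s < e" for s'
    proof -
      have "\<bar>f s' - f s\<bar> \<le> \<bar>s' - s\<bar> / 2" using s that by (intro flat_lipschitz) auto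
      then show ?thesis using that(2) e by (simp add: dist_real_def)
    qed
    then show "\<exists>d>0. \<forall>s'\<in>{-(4 * \<delta>)<..<4 * \<delta>}. dist s' s < d \<longrightarrow> dist (f s') (f s) < e" using e by blast
  qed
  then show ?thesis unfolding bpt_def
  proof (intro continuous_intros continuous_on_Complex)
    fix s assume "s \<in> {-(4 * \<delta>)<..<4 * \<delta>}"
    then show "cmod (Complex s (f s)) < 1" using cmod_graph[of s] delta by (simp add: abs_less_iff)
  qed
qed

lemma side_bpt:
  assumes "\<bar>s\<bar> < 4 * \<delta>" "\<bar>s'\<bar> < 4 * \<delta>"
  shows "side (bpt f s) (bpt f s') z < 0 \<longleftrightarrow> (s' - s) * (Im (kl z) - f s) < (f s' - f s) * (Re (kl z) - s)"
proof -
  have "(f s - f s') * x = - ((f s' - f s) * x)" for x by (simp add: algebra_simps)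
  then show ?thesis using assms by (simp add: side_neg_iff)
qed

text \<open>The angle at the middle one of three successive boundary points is not acute. This makes
  the length of a chord strictly monotone in its end points.\<close>

lemma bpt_mult:
  assumes "s1 \<le> s2" "s2 \<le> s3" "\<bar>s1\<bar> < 4 * \<delta>" "\<bar>s3\<bar> < 4 * \<delta>"
  shows "lp (lift (bpt f s1)) (lift (bpt f s2)) * lp (lift (bpt f s2)) (lift (bpt f s3)) \<le> lp (lift (bpt f s1)) (lift (bpt f s3))"
proof (rule klein_obtuse)
  have s2: "\<bar>s2\<bar> < 4 * \<delta>" using assms by auto
  have "cmod (Complex s2 (f s2)) \<le> 1/8" using cmod_graph[OF s2] delta by simp
  then show "0 \<le> (1 - (cmod (kl (bpt f s2)))\<^sup>2) * ((kl (bpt f s2) - kl (bpt f s1)) \<bullet> (kl (bpt f s3) - kl (bpt f s2))) +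
      ((kl (bpt f s2) - kl (bpt f s1)) \<bullet> kl (bpt f s2)) * ((kl (bpt f s3) - kl (bpt f s2)) \<bullet> kl (bpt f s2))"
    using assms s2 flat_lipschitz[of s2 s1] flat_lipschitz[of s3 s2]
    by (intro slope_obtuse) (simp_all)
qed

text \<open>Otherwise the segment from \<open>z\<close> to the farther end of the chord would pass
  strictly below the nearer end, i.e. below the graph.\<close>

lemma bpt_between:
  assumes s: "s < s'" "\<bar>s\<bar> < 4 * \<delta>" "\<bar>s'\<bar> < 4 * \<delta>" and z: "z \<in> K" "side (bpt f s) (bpt f s') z < 0"
  shows "s < Re (kl z)" "Re (kl z) < s'"
proof -
  define u v where "u = Re (kl z)" and "v = Im (kl z)"
  have k: "kl z = Complex u v" by (simp add: u_def v_def)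
  have C: "convex (kl ` K)" by (rule body_kl(1)[OF K])
  have sd: "(s' - s) * (v - f s) < (f s' - f s) * (u - s)" using z(2) s by (simp add: side_bpt u_def v_def)
  have zK: "Complex u v \<in> kl ` K" using z(1) k by (metis imageI)
  have pK: "Complex r (f r) \<in> kl ` K" if "\<bar>r\<bar> < 4 * \<delta>" for r using bpt_mem[OF that] kl_bpt[OF that] by (metis imageI)
  show "Re (kl z) < s'"
  proof (rule ccontr)
    assume "\<not> ?thesis"
    then have u: "s' \<le> u" by (simp add: u_def)
    define t where "t = (s' - s) / (u - s)"
    have t: "0 \<le> t" "t \<le> 1" "t * (u - s) = s' - s" using u s by (auto simp: t_def)
    have "(1 - t) *\<^sub>R Complex s (f s) + t *\<^sub>R Complex u v \<in> kl ` K"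
      using t pK[OF s(2)] zK by (intro convexD[OF C]) auto
    moreover have "(1 - t) *\<^sub>R Complex s (f s) + t *\<^sub>R Complex u v = Complex s' (f s + t * (v - f s))"
      using t(3) by (simp add: complex_eq_iff algebra_simps)
    ultimately have "f s' \<le> f s + t * (v - f s)" using flat_not_below[of "Complex s' (f s + t * (v - f s))"] s by simp
    then have "(f s' - f s) * (u - s) \<le> t * (v - f s) * (u - s)" using u s by (intro mult_right_mono) auto
    also have "\<dots> = (s' - s) * (v - f s)" by (metis t(3) mult.commute mult.assoc)
    finally show False using sd by simp
  qed
  show "s < Re (kl z)"
  proof (rule ccontr)
    assume "\<not> ?thesis"
    then have u: "u \<le> s" by (simp add: u_def)
    define t where "t = (s' - s) / (s' - u)"
    have t: "0 \<le> t" "t \<le> 1" "t * (s' - u) = s' - s" using u s by (auto simp: t_def)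
    have "(1 - t) *\<^sub>R Complex s' (f s') + t *\<^sub>R Complex u v \<in> kl ` K"
      using t pK[OF s(3)] zK by (intro convexD[OF C]) auto
    moreover have "(1 - t) *\<^sub>R Complex s' (f s') + t *\<^sub>R Complex u v = Complex s (f s' + t * (v - f s'))"
      using t(3) by (simp add: complex_eq_iff algebra_simps)
    ultimately have "f s \<le> f s' + t * (v - f s')" using flat_not_below[of "Complex s (f s' + t * (v - f s'))"] s by simp
    then have "(f s - f s') * (s' - u) \<le> t * (v - f s') * (s' - u)" using u s by (intro mult_right_mono) auto
    also have "\<dots> = (s' - s) * (v - f s')" by (metis t(3) mult.commute mult.assoc)
    finally show False using sd by (simp add: algebra_simps)
  qed
qed

text \<open>Both halves are angle estimates: points below the chord see it under a non-acute angle,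
  and a point of the disc above the line of the chord cannot be below the graph.\<close>

lemma bpt_flat_chord:
  assumes s: "s < s'" "\<bar>s\<bar> < \<delta>" "\<bar>s'\<bar> < \<delta>"
  shows "flat_chord K (bpt f s) (bpt f s')"
proof -
  let ?p = "bpt f s" and ?q = "bpt f s'"
  have s4: "\<bar>s\<bar> < 4 * \<delta>" "\<bar>s'\<bar> < 4 * \<delta>" using s delta by linarith+
  have C: "convex (kl ` K)" by (rule body_kl(1)[OF K])
  define \<Lambda> where "\<Lambda> k = (s' - s) * (Im k - f s) - (f s' - f s) * (Re k - s)" for k
  have side1: "side ?p ?q z < 0 \<longleftrightarrow> \<Lambda> (kl z) < 0" for z using side_bpt[OF s4] by (simp add: \<Lambda>_def)
  have side2: "side ?p ?q z \<le> 0 \<longleftrightarrow> \<Lambda> (kl z) \<le> 0" for z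
  proof -
    have "side ?q ?p z < 0 \<longleftrightarrow> 0 < \<Lambda> (kl z)" using side_bpt[OF s4(2,1), of z] by (simp add: \<Lambda>_def algebra_simps)
    then show ?thesis using side_swap[of ?q ?p z] by linarith
  qed
  have comb: "\<Lambda> ((1 - t) *\<^sub>R k + t *\<^sub>R l) = (1 - t) * \<Lambda> k + t * \<Lambda> l" for t k l
    by (simp add: \<Lambda>_def algebra_simps)
  have sl: "\<bar>f s' - f s\<bar> \<le> (s' - s) / 2" using flat_lipschitz[OF s4(2,1)] s by simp
  have slm: "(f s' - f s) * x \<le> (s' - s) * (x / 2)" "- ((s' - s) * (x / 2)) \<le> (f s' - f s) * x" if "0 \<le> x" for x
  proof -
    have "f s' - f s \<le> (s' - s) / 2" "- ((s' - s) / 2) \<le> f s' - f s"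
      using flat_slope[OF less_imp_le[OF s(1)] s4] by linarith+
    then have "(f s' - f s) * x \<le> (s' - s) / 2 * x" "- ((s' - s) / 2) * x \<le> (f s' - f s) * x"
      using that by (simp_all only: mult_right_mono)
    then show "(f s' - f s) * x \<le> (s' - s) * (x / 2)" "- ((s' - s) * (x / 2)) \<le> (f s' - f s) * x" by simp_all
  qed
  have c1: "z \<in> thales ?p ?q" if z0: "z0 \<in> K" "side ?p ?q z0 < 0" and z: "z \<in> K" "side ?p ?q z \<le> 0" for z0 z
  proof -
    define u v where "u = Re (kl z)" and "v = Im (kl z)"
    have k: "kl z = Complex u v" by (simp add: u_def v_def)
    have L: "\<Lambda> (kl z) \<le> 0" "\<Lambda> (kl z0) < 0" using side1 side2 z0 z by auto
    have b0: "s < Re (kl z0)" "Re (kl z0) < s'" by (rule bpt_between[OF s(1) s4 z0])+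
    have zu: "s \<le> u \<and> u \<le> s'"
    proof (cases "side ?p ?q z < 0")
      case True
      then show ?thesis using bpt_between[OF s(1) s4 z(1)] by (simp add: u_def)
    next
      case False
      then have L0: "\<Lambda> (kl z) = 0" using side1 L(1) by force
      \<comment> \<open>\<open>z\<close> lies on the line of the chord. Outside the strip, the
        segment from \<open>z0\<close> to \<open>z\<close> would pass strictly below an end point of
        the chord.\<close>
      have key: "False" if t: "0 \<le> t" "t < 1" "(1 - t) * Re (kl z0) + t * u = r" and r: "r = s \<or> r = s'" for t r
      proof -
        define w where "w = (1 - t) *\<^sub>R kl z0 + t *\<^sub>R kl z"
        have "w \<in> kl ` K" unfolding w_def using t z0 z by (intro convexD[OF C]) auto
        moreover have Rw: "Re w = r" using t by (simp add: w_def u_def)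
        ultimately have "f r \<le> Im w" using flat_not_below[of w] r s4 by auto
        moreover have "\<Lambda> w < 0" unfolding w_def comb L0 using L(2) t by (simp add: mult_pos_neg)
        moreover have "\<Lambda> w = (s' - s) * (Im w - f r)" using r by (auto simp: \<Lambda>_def Rw algebra_simps)
        ultimately show False using s(1) by (simp add: mult_less_0_iff)
      qed
      show ?thesis
      proof (intro conjI; rule ccontr)
        assume "\<not> s \<le> u"
        moreover define t where "t = (Re (kl z0) - s) / (Re (kl z0) - u)"
        ultimately have "0 \<le> t" "t < 1" "t * (Re (kl z0) - u) = Re (kl z0) - s" using b0 by auto
        then show False using key[of t s] by (simp add: algebra_simps)
      next
        assume "\<not> u \<le> s'"
        moreover define t where "t = (s' - Re (kl z0)) / (u - Re (kl z0))"
        ultimately have "0 \<le> t" "t < 1" "t * (u - Re (kl z0)) = s' - Re (kl z0)" using b0 by auto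
        then show False using key[of t s'] by (simp add: algebra_simps)
      qed
    qed
    have u4: "\<bar>u\<bar> < 4 * \<delta>" "\<bar>u\<bar> < \<delta>" using zu s s4 by auto
    have fu: "f u \<le> v" using flat_not_below[of "kl z"] z(1) u4 by (simp add: u_def v_def)
    have l1: "f s - f u \<le> (u - s) / 2" "f s' - f u \<le> (s' - u) / 2"
      using flat_slope(2)[OF _ s4(1) u4(1)] flat_slope(1)[OF _ u4(1) s4(2)] zu by auto
    have "(s' - s) * (v - f s) \<le> (f s' - f s) * (u - s)" using L(1) by (simp add: \<Lambda>_def u_def v_def)
    also have "\<dots> \<le> (s' - s) * ((u - s) / 2)" using zu by (intro slm) simp
    finally have l2: "v - f s \<le> (u - s) / 2" using s(1) by (simp add: mult_le_cancel_left)
    have "- ((s' - s) * ((s' - u) / 2)) \<le> (f s' - f s) * (s' - u)" using zu by (intro slm) simp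
    also have "\<dots> \<le> (s' - s) * (f s' - v)" using L(1) by (simp add: \<Lambda>_def u_def v_def algebra_simps)
    finally have "(s' - s) * (- ((s' - u) / 2)) \<le> (s' - s) * (f s' - v)" by simp
    then have l3: "- ((s' - u) / 2) \<le> f s' - v" using s(1) by (simp only: mult_le_cancel_left_pos diff_gt_0_iff_gt)
    have "0 \<le> v" "v \<le> 4 * \<delta>" using flat_bounds[OF u4(1)] flat_bounds[OF s4(1)] fu l2 zu s by argo+
    then have "cmod (kl z) \<le> 1/8" using cmod_le[of "kl z"] u4(2) delta by (simp add: k)
    moreover have "\<bar>v - f s\<bar> \<le> (u - s) / 2" using fu l1 l2 by (intro abs_leI) argo+
    moreover have "\<bar>f s' - v\<bar> \<le> (s' - u) / 2" using fu l1 l3 by (intro abs_leI) argo+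
    ultimately show ?thesis
      using zu s4 by (intro thales_if_obtuse klein_obtuse slope_obtuse) (simp_all add: k)
  qed
  have c2: "z \<in> K" if z: "z \<in> thales ?p ?q" "0 \<le> side ?p ?q z" for z
  proof -
    define u v where "u = Re (kl z)" and "v = Im (kl z)"
    have k: "kl z = Complex u v" by (simp add: u_def v_def)
    have L: "0 \<le> \<Lambda> (kl z)" using side1[of z] z(2) by linarith
    define P where "P = lp (lift ?p) (lift ?q)"
    have zp: "lp (lift z) (lift ?p) + lp (lift z) (lift ?q) \<le> 1 + P" using z(1) by (simp add: thales_def P_def)
    then have "lp (lift z) (lift ?p) \<le> P" using lp_lift_ge_1[of z ?q] by linarith
    then have "(lp (lift z) (lift ?p))\<^sup>2 \<le> P\<^sup>2" using lp_lift_ge_1[of z ?p] by (intro power_mono) auto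
    then have n1: "(cmod (kl z - kl ?p))\<^sup>2 \<le> P\<^sup>2 - 1" using klein_dist_lower[of z ?p] by linarith
    have "(cmod (kl ?p - kl ?q))\<^sup>2 = (s' - s)\<^sup>2 + (f s' - f s)\<^sup>2"
      using s4 by (simp add: cmod_power2 power2_commute)
    also have "(f s' - f s)\<^sup>2 \<le> ((s' - s) / 2)\<^sup>2" using sl s(1) by (simp add: abs_le_square_iff[symmetric])
    also have "(s' - s)\<^sup>2 + ((s' - s) / 2)\<^sup>2 = 5/4 * (s' - s)\<^sup>2" by (simp add: power_divide)
    also have "(s' - s)\<^sup>2 \<le> (2 * \<delta>)\<^sup>2" using s by (intro power_mono) auto
    finally have n2: "(cmod (kl ?p - kl ?q))\<^sup>2 \<le> 5 * \<delta>\<^sup>2" by (simp add: power_mult_distrib)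
    have fl: "(fst (lift (bpt f r)))\<^sup>2 \<le> 1025/1000" if "\<bar>r\<bar> < \<delta>" for r
    proof -
      have r4: "\<bar>r\<bar> < 4 * \<delta>" using that delta by linarith
      have "cmod (kl (bpt f r)) \<le> 3/128"
        using cmod_le[of "Complex r (f r)"] flat_bounds[OF r4] that delta r4 by simp
      then have "(cmod (kl (bpt f r)))\<^sup>2 \<le> (3/128)\<^sup>2" by (intro power_mono) auto
      then have c: "1000/1025 \<le> 1 - (cmod (kl (bpt f r)))\<^sup>2" by (simp add: power2_eq_square)
      have "(fst (lift (bpt f r)))\<^sup>2 * (1000/1025) \<le> 1"
        using mult_left_mono[OF c, of "(fst (lift (bpt f r)))\<^sup>2"] unfolding fst_lift_sq by simp
      then show ?thesis by simp
    qed
    have "P\<^sup>2 - 1 \<le> (fst (lift ?p))\<^sup>2 * (fst (lift ?q))\<^sup>2 * (cmod (kl ?p - kl ?q))\<^sup>2"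
      unfolding P_def by (rule klein_dist_upper)
    also have "\<dots> \<le> (1025/1000 * (1025/1000)) * (5 * \<delta>\<^sup>2)"
      using fl[OF s(2)] fl[OF s(3)] n2 by (intro mult_mono) auto
    also have "\<dots> \<le> (5/2 * \<delta>)\<^sup>2" by (simp add: power_mult_distrib power_divide)
    finally have "(cmod (kl z - kl ?p))\<^sup>2 \<le> (5/2 * \<delta>)\<^sup>2" using n1 by linarith
    \<comment> \<open>As \<open>\<bar>s\<bar> < \<delta>\<close> and
      \<open>f s < \<delta> / 2\<close>, this puts \<open>z\<close> inside the range
      \<open>4 * \<delta>\<close> of the graph.\<close>
    then have n: "cmod (kl z - kl ?p) \<le> 5/2 * \<delta>" by (rule power2_le_imp_le) (use delta in simp)
    have uv: "\<bar>u - s\<bar> \<le> 5/2 * \<delta>" "\<bar>v - f s\<bar> \<le> 5/2 * \<delta>"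
      using abs_Re_le_cmod[of "kl z - kl ?p"] abs_Im_le_cmod[of "kl z - kl ?p"] n s4 by (simp_all add: k)
    have u4: "\<bar>u\<bar> < 4 * \<delta>" using uv(1) s(2) by linarith
    have v4: "v < 4 * \<delta>" using uv(2) flat_bounds[OF s4(1)] s(2) by linarith
    have "f u \<le> v"
    proof (rule ccontr)
      assume "\<not> f u \<le> v"
      then have lt: "v < f u" by simp
      have small: "cmod (kl ?p) \<le> 1/8" "cmod (kl ?q) \<le> 1/8"
        using cmod_graph[OF s4(1)] cmod_graph[OF s4(2)] delta s4 by simp_all
      \<comment> \<open>Over the chord, convexity contradicts the sign of \<Lambda>. Beyond an end
        point the angle there is not acute, and then membership in the disc forces \<open>z\<close>
        to be that end point.\<close>
      consider "s \<le> u" "u \<le> s'" | "s' < u" | "u < s" by linarith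
      then show False
      proof cases
        case 1
        define t where "t = (u - s) / (s' - s)"
        have t: "0 \<le> t" "t \<le> 1" "t * (s' - s) = u - s" using 1 s(1) by (auto simp: t_def)
        have "(1 - t) *\<^sub>R kl ?p + t *\<^sub>R kl ?q \<in> kl ` K"
          using t bpt_mem s4 by (intro convexD[OF C] imageI) auto
        moreover have "(1 - t) *\<^sub>R kl ?p + t *\<^sub>R kl ?q = Complex u (f s + t * (f s' - f s))"
          using t(3) s4 by (simp add: complex_eq_iff algebra_simps)
        ultimately have "f u \<le> f s + t * (f s' - f s)" using flat_not_below[of "Complex u (f s + t * (f s' - f s))"] u4 by simp
        then have "v - f s < t * (f s' - f s)" using lt by simp
        then have "(s' - s) * (v - f s) < (s' - s) * (t * (f s' - f s))" using s(1) by (intro mult_strict_left_mono) auto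
        also have "\<dots> = (f s' - f s) * (u - s)" unfolding t(3)[symmetric] by simp
        finally show False using L by (simp add: \<Lambda>_def u_def v_def)
      next
        case 2
        have a: "v - f s' \<le> (u - s') / 2" using flat_slope(1)[OF _ s4(2) u4] 2 lt by simp
        have "(s' - s) * (- ((u - s') / 2)) \<le> (f s' - f s) * (u - s')" using slm(2)[of "u - s'"] 2 by simp
        also have "\<dots> \<le> (s' - s) * (v - f s')" using L by (simp add: \<Lambda>_def u_def v_def algebra_simps)
        finally have b: "- ((u - s') / 2) \<le> v - f s'" using s(1) by (simp only: mult_le_cancel_left_pos diff_gt_0_iff_gt)
        have "lp (lift ?p) (lift ?q) * lp (lift ?q) (lift z) \<le> lp (lift ?p) (lift z)"
        proof (intro klein_obtuse slope_obtuse small(2))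
          have "\<bar>v - f s'\<bar> \<le> (u - s') / 2" using a b by (intro abs_leI) argo+
          then show "\<bar>Im (kl z - kl ?q)\<bar> \<le> Re (kl z - kl ?q) / 2" using s4 by (simp add: k)
        qed (use 2 s s4 sl in \<open>simp_all add: k\<close>)
        then have "P * lp (lift z) (lift ?q) \<le> 1 + P - lp (lift z) (lift ?q)"
          using zp by (simp add: P_def lp_commute[of _ "lift z"])
        then have "(P + 1) * (lp (lift z) (lift ?q) - 1) \<le> 0" by (simp add: algebra_simps)
        moreover have "1 < lp (lift z) (lift ?q)"
          using 2 s4 by (intro lp_lift_gt_1) (auto simp: u_def)
        moreover have "1 \<le> P" by (simp add: P_def lp_lift_ge_1)
        ultimately show False by (simp add: mult_le_0_iff)
      next
        case 3
        have a: "v - f s \<le> (s - u) / 2" using flat_slope(2)[OF _ u4 s4(1)] 3 lt by simp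
        have "(f s' - f s) * (s - u) \<le> (s' - s) * ((s - u) / 2)" using slm(1)[of "s - u"] 3 by simp
        moreover have "(s' - s) * (f s - v) \<le> (f s' - f s) * (s - u)" using L by (simp add: \<Lambda>_def u_def v_def algebra_simps)
        ultimately have "(s' - s) * (f s - v) \<le> (s' - s) * ((s - u) / 2)" by linarith
        then have b: "f s - v \<le> (s - u) / 2" using s(1) by (simp only: mult_le_cancel_left_pos diff_gt_0_iff_gt)
        have "lp (lift z) (lift ?p) * lp (lift ?p) (lift ?q) \<le> lp (lift z) (lift ?q)"
        proof (intro klein_obtuse slope_obtuse small(1))
          have "\<bar>f s - v\<bar> \<le> (s - u) / 2" using a b by (intro abs_leI) argo+
          then show "\<bar>Im (kl ?p - kl z)\<bar> \<le> Re (kl ?p - kl z) / 2" using s4 by (simp add: k)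
        qed (use 3 s s4 sl in \<open>simp_all add: k\<close>)
        then have "lp (lift z) (lift ?p) * P \<le> 1 + P - lp (lift z) (lift ?p)"
          using zp by (simp add: P_def)
        then have "(P + 1) * (lp (lift z) (lift ?p) - 1) \<le> 0" by (simp add: algebra_simps)
        moreover have "1 < lp (lift z) (lift ?p)"
          using 3 s4 by (intro lp_lift_gt_1) (auto simp: u_def)
        moreover have "1 \<le> P" by (simp add: P_def lp_lift_ge_1)
        ultimately show False by (simp add: mult_le_0_iff)
      qed
    qed
    then have "kl z \<in> kl ` K" using flat_mem[OF u4 v4] by (simp add: k)
    then show ?thesis by (auto simp: kl_inj)
  qed
  show ?thesis
    unfolding flat_chord_def using c1 c2 bpt_mem[OF s4(1)] bpt_mem[OF s4(2)] by blast
qed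

lemma frontier_cap_bpt:
  assumes s: "s < s'" "\<bar>s\<bar> < \<delta>" "\<bar>s'\<bar> < \<delta>" and z: "z \<in> frontier K" "side (bpt f s) (bpt f s') z < 0"
  obtains u where "s < u" "u < s'" "z = bpt f u"
proof -
  have s4: "\<bar>s\<bar> < 4 * \<delta>" "\<bar>s'\<bar> < 4 * \<delta>" using s delta by linarith+
  have zK: "z \<in> K" by (rule frontier_subset_body[OF K z(1)])
  define u where "u = Re (kl z)"
  have u: "s < u" "u < s'" using bpt_between[OF s(1) s4 zK z(2)] by (simp_all add: u_def)
  have "(s' - s) * (Im (kl z) - f s) < (f s' - f s) * (u - s)" using z(2) s4 by (simp add: side_bpt u_def)
  also have "\<dots> \<le> (s' - s) / 2 * (u - s)"
    using flat_slope(1)[OF less_imp_le[OF s(1)] s4] u by (intro mult_right_mono) auto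
  finally have "(s' - s) * (Im (kl z) - f s) < (s' - s) * ((u - s) / 2)" by simp
  then have "Im (kl z) - f s < (u - s) / 2" using s(1) by (simp only: mult_less_cancel_left_pos diff_gt_0_iff_gt)
  then have "Im (kl z) < 4 * \<delta>" using flat_bounds[OF s4(1)] u s by argo
  moreover have "\<bar>Re (kl z)\<bar> < 4 * \<delta>" using u s delta by (auto simp: u_def)
  ultimately have "z = bpt f u" unfolding u_def by (intro frontier_bpt z(1))
  then show ?thesis using that u by blast
qed

lemma bpt_inj: "\<bar>s\<bar> < 4 * \<delta> \<Longrightarrow> \<bar>s'\<bar> < 4 * \<delta> \<Longrightarrow> bpt f s = bpt f s' \<longleftrightarrow> s = s'"
  by (metis complex.inject kl_bpt)

lemma straight_cap:
  assumes s: "s < s'" "\<bar>s\<bar> < \<delta>" "\<bar>s'\<bar> < \<delta>" and none: "\<And>z. z \<in> K \<Longrightarrow> 0 \<le> side (bpt f s) (bpt f s') z"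
    and t: "0 \<le> t" "t \<le> 1"
  shows "kl (bpt f ((1 - t) * s + t * s')) = (1 - t) *\<^sub>R kl (bpt f s) + t *\<^sub>R kl (bpt f s')"
proof -
  have s4: "\<bar>s\<bar> < 4 * \<delta>" "\<bar>s'\<bar> < 4 * \<delta>" using s delta by linarith+
  define u where "u = (1 - t) * s + t * s'"
  have us: "u - s = t * (s' - s)" "s' - u = (1 - t) * (s' - s)" by (simp_all add: u_def algebra_simps)
  have "0 \<le> t * (s' - s)" "0 \<le> (1 - t) * (s' - s)" using t s by auto
  then have u4: "\<bar>u\<bar> < 4 * \<delta>" using s4 us by auto
  have "(1 - t) *\<^sub>R kl (bpt f s) + t *\<^sub>R kl (bpt f s') \<in> kl ` K"
    using t bpt_mem s4 by (intro convexD[OF body_kl(1)[OF K]] imageI) auto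
  moreover have "(1 - t) *\<^sub>R kl (bpt f s) + t *\<^sub>R kl (bpt f s') = Complex u ((1 - t) * f s + t * f s')"
    using s4 by (simp add: u_def complex_eq_iff)
  ultimately have "f u \<le> (1 - t) * f s + t * f s'"
    using flat_not_below[of "Complex u ((1 - t) * f s + t * f s')"] u4 by simp
  moreover have "(1 - t) * f s + t * f s' \<le> f u"
  proof -
    have "\<not> side (bpt f s) (bpt f s') (bpt f u) < 0" using none[OF bpt_mem[OF u4]] by simp
    then have "(f s' - f s) * (u - s) \<le> (s' - s) * (f u - f s)" using s4 u4 by (simp add: side_bpt)
    then have "(s' - s) * (t * (f s' - f s)) \<le> (s' - s) * (f u - f s)" by (simp add: us mult_ac)
    then have "t * (f s' - f s) \<le> f u - f s" using s(1) by (simp only: mult_le_cancel_left_pos diff_gt_0_iff_gt)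
    then show ?thesis by (simp add: algebra_simps)
  qed
  ultimately show ?thesis using s4 u4 by (simp add: complex_eq_iff flip: u_def)
qed

end

section \<open>Transport of boundary arcs by congruent caps\<close>

lemma strict_mono_if_inj:
  fixes h :: "real \<Rightarrow> real"
  assumes "continuous_on {a..b} h" "inj_on h {a..b}" "h a < h b" "a \<le> x" "x < y" "y \<le> b"
  shows "h x < h y"
proof -
  have ends: "h a < h z \<and> h z < h b" if "a < z" "z < b" for z
    using continuous_inj_imp_mono[OF that assms(1,2)] assms(3) by linarith
  have ay: "h a < h y"
    using ends[of y] assms by (cases "y = b") auto
  show ?thesis
  proof (cases "x = a")
    case False
    have "continuous_on {a..y} h" "inj_on h {a..y}"
      using continuous_on_subset[OF assms(1)] inj_on_subset[OF assms(2)] assms(6) by simp_all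
    then show ?thesis
      using continuous_inj_imp_mono[of a x y h] False assms ay by linarith
  qed (use ay in simp)
qed

lemma open_side: "open {z. side p p' z < 0}"
proof -
  have "continuous_on UNIV (\<lambda>z. side p p' z)"
    unfolding side_def det3_def by (intro continuous_intros)
  then show ?thesis by (intro open_Collect_less continuous_intros)
qed

lemma kl_combination:
  assumes "lift z = \<alpha> *\<^sub>R lift p + \<beta> *\<^sub>R lift p'" "0 \<le> \<alpha>" "0 \<le> \<beta>"
  obtains t where "0 \<le> t" "t \<le> 1" "kl z = (1 - t) *\<^sub>R kl p + t *\<^sub>R kl p'"
proof -
  define c where "c = fst (lift z)"
  have c: "0 < c" by (simp add: c_def)
  have e: "c = \<alpha> * fst (lift p) + \<beta> * fst (lift p')" using assms(1) by (simp add: c_def)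
  define t where "t = \<beta> * fst (lift p') / c"
  have n: "0 \<le> \<beta> * fst (lift p')" "0 \<le> \<alpha> * fst (lift p)" using assms by (simp_all add: less_imp_le)
  have t: "0 \<le> t" "t \<le> 1" "1 - t = \<alpha> * fst (lift p) / c" using c n e by (auto simp: t_def field_simps)
  have "snd (lift z) = (\<alpha> * fst (lift p)) *\<^sub>R kl p + (\<beta> * fst (lift p')) *\<^sub>R kl p'"
    using assms(1) lift_kl[of p] lift_kl[of p']
    by (metis (no_types, lifting) scaleR_scaleR snd_add snd_scaleR snd_conv)
  then have "kl z = (1 / c) *\<^sub>R ((\<alpha> * fst (lift p)) *\<^sub>R kl p + (\<beta> * fst (lift p')) *\<^sub>R kl p')"
    by (simp add: kl_def[of z] c_def[symmetric] inverse_eq_divide)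
  also have "\<dots> = (1 - t) *\<^sub>R kl p + t *\<^sub>R kl p'"
    unfolding t(3) unfolding t_def by (simp add: scaleR_add_right)
  finally show ?thesis using that t by blast
qed

lemma lift_combination:
  assumes "kl z = (1 - t) *\<^sub>R kl p + t *\<^sub>R kl p'" "0 \<le> t" "t \<le> 1"
  obtains \<alpha> \<beta> where "lift z = \<alpha> *\<^sub>R lift p + \<beta> *\<^sub>R lift p'" "0 \<le> \<alpha>" "0 \<le> \<beta>"
proof (rule that)
  let ?c = "fst (lift z)"
  have e: "(?c * a / fst (lift w)) *\<^sub>R lift w = (?c * a) *\<^sub>R (1, kl w)" for a w
    by (subst (2) lift_kl) (simp add: less_imp_neq[OF fst_lift_pos, THEN not_sym])
  show "lift z = (?c * (1 - t) / fst (lift p)) *\<^sub>R lift p + (?c * t / fst (lift p')) *\<^sub>R lift p'"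
    unfolding e by (subst lift_kl) (simp add: assms(1) scaleR_add_right algebra_simps)
  show "0 \<le> ?c * (1 - t) / fst (lift p)" "0 \<le> ?c * t / fst (lift p')"
    using assms by (simp_all add: less_imp_le)
qed

text \<open>On the open negative side both bodies coincide, so boundary points correspond there. An
  empty cap offers no such points; then both arcs are segments and linearity of the isometry is used
  instead.\<close>

lemma arc_transport:
  assumes K1: "body K1" "flat_graph K1 \<delta>1 f1" and K2: "body K2" "flat_graph K2 \<delta>2 f2"
    and s1: "s1 < s1'" "\<bar>s1\<bar> < \<delta>1" "\<bar>s1'\<bar> < \<delta>1"
    and s2: "s2 < s2'" "\<bar>s2\<bar> < \<delta>2" "\<bar>s2'\<bar> < \<delta>2"
    and A: "A \<in> SO" "mv A (bpt f1 s1) = bpt f2 s2" "mv A (bpt f1 s1') = bpt f2 s2'"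
    and cap: "\<And>z. side (bpt f2 s2) (bpt f2 s2') z < 0 \<Longrightarrow> z \<in> K2 \<longleftrightarrow> z \<in> mv A ` K1"
    and s: "s1 \<le> s" "s \<le> s1'"
  obtains u where "s2 \<le> u" "u \<le> s2'" "mv A (bpt f1 s) = bpt f2 u"
proof -
  note d1 = delta[OF K1] and d2 = delta[OF K2]
  have s14: "\<bar>s1\<bar> < 4 * \<delta>1" "\<bar>s1'\<bar> < 4 * \<delta>1" "\<bar>s\<bar> < 4 * \<delta>1" and s24: "\<bar>s2\<bar> < 4 * \<delta>2" "\<bar>s2'\<bar> < 4 * \<delta>2"
    using s s1 s2 d1 d2 by auto
  let ?p = "bpt f1 s1" and ?p' = "bpt f1 s1'" and ?q = "bpt f2 s2" and ?q' = "bpt f2 s2'"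
  have side_A: "side ?q ?q' (mv A z) = side ?p ?p' z" for z
    using side_mv[OF A(1), of ?p ?p' z] by (simp add: A)
  obtain B where B: "B \<in> SO" "\<And>x. mv A (mv B x) = x" "\<And>x. mv B (mv A x) = x"
    using mv_vimage[OF A(1)] by metis
  show ?thesis
  proof (cases "\<forall>z\<in>K2. 0 \<le> side ?q ?q' z")
    case True
    have none: "0 \<le> side ?p ?p' z" if "z \<in> K1" for z
    proof (rule ccontr)
      assume n: "\<not> ?thesis"
      then have "mv A z \<in> K2" using cap[of "mv A z"] that by (simp add: side_A)
      then show False using True n side_A[of z] by force
    qed
    define t where "t = (s - s1) / (s1' - s1)"
    have t: "0 \<le> t" "t \<le> 1" "t * (s1' - s1) = s - s1" using s s1 by (auto simp: t_def)
    have "(1 - t) * s1 + t * s1' = s" using t(3) by (simp add: algebra_simps)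
    then have "kl (bpt f1 s) = (1 - t) *\<^sub>R kl ?p + t *\<^sub>R kl ?p'"
      using straight_cap[OF K1 s1 none t(1,2)] by simp
    then obtain \<alpha> \<beta> where ab: "lift (bpt f1 s) = \<alpha> *\<^sub>R lift ?p + \<beta> *\<^sub>R lift ?p'" "0 \<le> \<alpha>" "0 \<le> \<beta>"
      using lift_combination t(1,2) by metis
    have lin: "linear A" by (rule SO_linear[OF A(1)])
    have "lift (mv A (bpt f1 s)) = \<alpha> *\<^sub>R A (lift ?p) + \<beta> *\<^sub>R A (lift ?p')"
      using A(1) by (simp add: ab(1) linear_add[OF lin] linear_scale[OF lin])
    also have "\<dots> = \<alpha> *\<^sub>R lift ?q + \<beta> *\<^sub>R lift ?q'" by (metis A lift_mv)
    finally obtain t' where t': "0 \<le> t'" "t' \<le> 1" "kl (mv A (bpt f1 s)) = (1 - t') *\<^sub>R kl ?q + t' *\<^sub>R kl ?q'"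
      using kl_combination ab(2,3) by metis
    define u where "u = (1 - t') * s2 + t' * s2'"
    have us: "u - s2 = t' * (s2' - s2)" "s2' - u = (1 - t') * (s2' - s2)" by (simp_all add: u_def algebra_simps)
    have "0 \<le> u - s2" "0 \<le> s2' - u" unfolding us using t' s2 by auto
    moreover have "kl (mv A (bpt f1 s)) = kl (bpt f2 u)"
      using straight_cap[OF K2 s2 _ t'(1,2)] True by (simp add: t'(3) u_def)
    ultimately show ?thesis using that[of u] by (simp add: kl_inj)
  next
    case False
    then obtain w0 where w0: "w0 \<in> K2" "side ?q ?q' w0 < 0" by force
    define z0 where "z0 = mv B w0"
    have "w0 \<in> mv A ` K1" using cap[OF w0(2)] w0(1) by simp
    then have z0: "z0 \<in> K1" "side ?p ?p' z0 < 0"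
      using side_A[of z0] w0(2) by (auto simp: z0_def B)
    show ?thesis
    proof (cases "s = s1 \<or> s = s1'")
      case True
      then show ?thesis using that[of s2] that[of s2'] A(2,3) s2(1) by fastforce
    next
      case False
      then have ss: "s1 < s" "s < s1'" using s by auto
      define x where "x = bpt f1 s"
      \<comment> \<open>Once one point \<open>z0\<close> of \<open>K1\<close> lies strictly below
        the chord, so does every inner point of the arc: the segment from an end point to
        \<open>z0\<close> lies below the chord and above the graph.\<close>
      have neg: "side ?p ?p' x < 0"
      proof -
        define \<Lambda> where "\<Lambda> k = (s1' - s1) * (Im k - f1 s1) - (f1 s1' - f1 s1) * (Re k - s1)" for k
        have side1: "side ?p ?p' z < 0 \<longleftrightarrow> \<Lambda> (kl z) < 0" for z using side_bpt[OF K1 s14(1,2)] by (simp add: \<Lambda>_def)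
        have comb: "\<Lambda> ((1 - t) *\<^sub>R k + t *\<^sub>R l) = (1 - t) * \<Lambda> k + t * \<Lambda> l" for t k l
          by (simp add: \<Lambda>_def algebra_simps)
        have L0: "\<Lambda> (kl ?p) = 0" "\<Lambda> (kl ?p') = 0"
          using kl_bpt[OF K1 s14(1)] kl_bpt[OF K1 s14(2)] by (simp_all add: \<Lambda>_def)
        have b0: "s1 < Re (kl z0)" "Re (kl z0) < s1'" by (rule bpt_between[OF K1 s1(1) s14(1,2) z0])+
        have C: "convex (kl ` K1)" by (rule body_kl(1)[OF K1(1)])
        have key: ?thesis if t: "0 < t" "t \<le> 1" "(1 - t) * Re (kl e) + t * Re (kl z0) = s" and e: "e \<in> K1" "\<Lambda> (kl e) = 0" for t e
        proof -
          define w where "w = (1 - t) *\<^sub>R kl e + t *\<^sub>R kl z0"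
          have "w \<in> kl ` K1" unfolding w_def using t z0(1) e(1) by (intro convexD[OF C]) auto
          moreover have Rw: "Re w = s" using t by (simp add: w_def)
          ultimately have le: "f1 s \<le> Im w" using flat_not_below[OF K1, of w] s14 by auto
          have "\<Lambda> w < 0" unfolding w_def comb e(2) using side1 z0(2) t by (simp add: mult_pos_neg)
          moreover have "\<Lambda> (kl x) \<le> \<Lambda> w"
            using kl_bpt[OF K1 s14(3)] le s1(1) by (simp add: \<Lambda>_def Rw x_def mult_left_mono)
          ultimately show ?thesis using side1 by simp
        qed
        show ?thesis
        proof (cases "s \<le> Re (kl z0)")
          case True
          define t where "t = (s - s1) / (Re (kl z0) - s1)"
          have "0 < t" "t \<le> 1" "t * (Re (kl z0) - s1) = s - s1" using True ss b0 by (auto simp: t_def)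
          then show ?thesis using key[of t ?p] bpt_mem[OF K1 s14(1)] L0 kl_bpt[OF K1 s14(1)] by (simp add: algebra_simps)
        next
          case False
          define t where "t = (s1' - s) / (s1' - Re (kl z0))"
          have "0 < t" "t \<le> 1" "t * (s1' - Re (kl z0)) = s1' - s" using False ss b0 by (auto simp: t_def)
          then show ?thesis using key[of t ?p'] bpt_mem[OF K1 s14(2)] L0 kl_bpt[OF K1 s14(2)] by (simp add: algebra_simps)
        qed
      qed
      define U where "U = {z. side ?q ?q' z < 0}"
      have wU: "mv A x \<in> U" using neg by (simp add: U_def side_A)
      have xf: "x \<in> frontier K1" unfolding x_def by (rule bpt_frontier[OF K1 s14(3)])
      have w: "mv A x \<in> frontier (mv A ` K1)"
        using xf K1(1) A(1) by (simp add: frontier_mv body_def)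
      have "mv A x \<in> K2" using cap[of "mv A x"] wU frontier_subset_body[OF K1(1) xf] by (auto simp: U_def)
      moreover have "mv A x \<notin> interior K2"
      proof
        assume i: "mv A x \<in> interior K2"
        have "interior K2 \<inter> U \<subseteq> interior (mv A ` K1)"
        proof (rule interior_maximal)
          show "interior K2 \<inter> U \<subseteq> mv A ` K1" using cap interior_subset[of K2] by (auto simp: U_def)
          show "open (interior K2 \<inter> U)" unfolding U_def by (intro open_Int open_interior open_side)
        qed
        then show False using i wU w by (auto simp: frontier_def)
      qed
      ultimately have "mv A x \<in> frontier K2" using K2(1) by (simp add: frontier_def body_def)
      then obtain u where "s2 < u" "u < s2'" "mv A x = bpt f2 u"
        using frontier_cap_bpt[OF K2 s2] wU unfolding U_def by blast
      then show ?thesis using that[of u] by (simp add: x_def)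
    qed
  qed
qed

section \<open>Chains of equal chords along a boundary arc\<close>

context
  fixes K L :: "hyp_plane set" and \<delta> \<epsilon> :: real and f g :: "real \<Rightarrow> real"
  assumes K: "body K" "flat_graph K \<delta> f" and L: "body L" "flat_graph L \<epsilon> g" and sym: "sym_pair K L"
begin

abbreviation P2 where "P2 s s' \<equiv> lp (lift (bpt f s)) (lift (bpt f s'))"

lemma P2_mono:
  assumes "-(4 * \<delta>) < a" "a \<le> s" "s \<le> s'" "s' \<le> b" "b < 4 * \<delta>"
  shows "P2 s s' \<le> P2 a b"
proof -
  have 1: "P2 a s' * P2 s' b \<le> P2 a b" using assms by (intro bpt_mult[OF K]) auto
  have 2: "P2 a s * P2 s s' \<le> P2 a s'" using assms by (intro bpt_mult[OF K]) auto
  have "P2 a s' * 1 \<le> P2 a s' * P2 s' b"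
    using lp_lift_ge_1[of "bpt f a" "bpt f s'"] by (intro mult_left_mono lp_lift_ge_1) auto
  moreover have "1 * P2 s s' \<le> P2 a s * P2 s s'"
    using lp_lift_ge_1[of "bpt f s" "bpt f s'"] by (intro mult_right_mono lp_lift_ge_1) auto
  ultimately show ?thesis using 1 2 by linarith
qed

lemma P2_strict: "\<bar>s\<bar> < 4 * \<delta> \<Longrightarrow> \<bar>s'\<bar> < 4 * \<delta> \<Longrightarrow> s \<noteq> s' \<Longrightarrow> 1 < P2 s s'"
  using bpt_inj[OF K] by (intro lp_lift_gt_1) auto

lemma chord_of_length:
  assumes "1 < c" "c \<le> lp (lift (bpt g 0)) (lift (bpt g (\<epsilon> / 2)))"
  obtains t where "0 < t" "t < \<epsilon>" "lp (lift (bpt g 0)) (lift (bpt g t)) = c"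
proof -
  have e: "0 < \<epsilon>" using delta[OF L] by simp
  have "continuous_on {0..\<epsilon> / 2} (\<lambda>t. lp (lift (bpt g 0)) (lift (bpt g t)))"
    using e by (intro continuous_intros continuous_on_subset[OF continuous_bpt[OF L]]) auto
  then obtain t where "0 \<le> t" "t \<le> \<epsilon> / 2" "lp (lift (bpt g 0)) (lift (bpt g t)) = c"
    using IVT'[of "\<lambda>t. lp (lift (bpt g 0)) (lift (bpt g t))" 0 c "\<epsilon> / 2"] assms e by auto
  moreover have "t \<noteq> 0" using calculation(3) assms(1) by auto
  ultimately show ?thesis using that[of t] e by simp
qed

text \<open>\<open>cap_congruence\<close> compares \<open>K\<close> with \<open>L\<close> only, so
  the two chords of \<open>K\<close> are compared through a chord of \<open>L\<close> of the same
  length; the last premise guarantees that \<open>L\<close> has one.\<close>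

lemma chord_transport:
  assumes s1: "s1 < s1'" "\<bar>s1\<bar> < \<delta>" "\<bar>s1'\<bar> < \<delta>" and s2: "s2 < s2'" "\<bar>s2\<bar> < \<delta>" "\<bar>s2'\<bar> < \<delta>"
    and eq: "P2 s1 s1' = P2 s2 s2'" and le: "P2 s1 s1' \<le> lp (lift (bpt g 0)) (lift (bpt g (\<epsilon> / 2)))"
  obtains A where "A \<in> SO" "\<And>s. s1 \<le> s \<Longrightarrow> s \<le> s1' \<Longrightarrow> \<exists>u. s2 \<le> u \<and> u \<le> s2' \<and> mv A (bpt f s) = bpt f u"
    "mv A (bpt f s1) = bpt f s2" "mv A (bpt f s1') = bpt f s2'"
proof -
  have d: "0 < \<delta>" "0 < \<epsilon>" using delta[OF K] delta[OF L] by simp_all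
  have "1 < P2 s1 s1'" using s1 d by (intro P2_strict) auto
  then obtain t where t: "0 < t" "t < \<epsilon>" "lp (lift (bpt g 0)) (lift (bpt g t)) = P2 s1 s1'"
    using chord_of_length[OF _ le] by blast
  have FL: "flat_chord L (bpt g 0) (bpt g t)" using t d by (intro bpt_flat_chord[OF L]) auto
  have F1: "flat_chord K (bpt f s1) (bpt f s1')" "flat_chord K (bpt f s2) (bpt f s2')"
    using s1 s2 by (auto intro!: bpt_flat_chord[OF K])
  obtain B1 where B1: "B1 \<in> SO" "mv B1 (bpt g 0) = bpt f s1" "mv B1 (bpt g t) = bpt f s1'"
    using SO_pairs[OF t(3)] .
  obtain B2 where B2: "B2 \<in> SO" "mv B2 (bpt g 0) = bpt f s2" "mv B2 (bpt g t) = bpt f s2'"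
    using SO_pairs[OF t(3)[unfolded eq]] .
  obtain C where C: "C \<in> SO" "\<And>x. mv B1 (mv C x) = x" "\<And>x. mv C (mv B1 x) = x" using mv_vimage[OF B1(1)] by metis
  obtain D where D: "D \<in> SO" "\<And>x. mv B2 (mv D x) = x" "\<And>x. mv D (mv B2 x) = x" using mv_vimage[OF B2(1)] by metis
  define A where "A = B2 \<circ> C"
  have A: "A \<in> SO" "mv A x = mv B2 (mv C x)" for x using SO_comp[OF B2(1) C(1)] mv_comp[OF B2(1) C(1)] by (simp_all add: A_def)
  have Ap: "mv A (bpt f s1) = bpt f s2" "mv A (bpt f s1') = bpt f s2'" by (metis A(2) B1(2,3) B2(2,3) C(3))+
  have cap: "z \<in> K \<longleftrightarrow> z \<in> mv A ` K" if z: "side (bpt f s2) (bpt f s2') z < 0" for z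
  proof -
    define y where "y = mv B1 (mv D z)"
    have Ay: "mv A y = z" by (simp add: A y_def C D)
    have "side (bpt f s1) (bpt f s1') y = side (bpt f s2) (bpt f s2') z"
      using side_mv[OF A(1), of "bpt f s1" "bpt f s1'" y] by (simp add: Ap Ay)
    then have y: "side (bpt f s1) (bpt f s1') y < 0" using z by simp
    have "z \<in> K \<longleftrightarrow> z \<in> mv B2 ` L" by (rule cap_congruence[OF K(1) L(1) sym F1(2) FL B2 z])
    also have "\<dots> \<longleftrightarrow> mv D z \<in> L" by (metis D(2,3) imageE imageI)
    also have "\<dots> \<longleftrightarrow> y \<in> mv B1 ` L" unfolding y_def by (metis C(3) imageE imageI)
    also have "\<dots> \<longleftrightarrow> y \<in> K" by (rule cap_congruence[OF K(1) L(1) sym F1(1) FL B1 y, symmetric])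
    also have "\<dots> \<longleftrightarrow> z \<in> mv A ` K"
    proof
      assume "z \<in> mv A ` K"
      then obtain x where "x \<in> K" "mv A x = mv A y" unfolding Ay by auto
      then show "y \<in> K" using bij_is_inj[OF mv_bij[OF A(1)]] by (metis injD)
    qed (metis Ay imageI)
    finally show ?thesis .
  qed
  show ?thesis
  proof (rule that[OF A(1) _ Ap])
    fix s assume "s1 \<le> s" "s \<le> s1'"
    from arc_transport[OF K K s1 s2 A(1) Ap cap this]
    show "\<exists>u. s2 \<le> u \<and> u \<le> s2' \<and> mv A (bpt f s) = bpt f u" by metis
  qed
qed

text \<open>An isometry pushes the chord over [-\<eta>, \<eta>/2] to one starting at \<sigma>. Its
  iterates at -\<eta> form a chain along the arc whose links all have the length of the first one;
  they lie in a plane whose normal is a fixed vector of the isometry, and every point of the arc is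
  within one link of the chain.\<close>

lemma chain_step:
  assumes \<eta>: "0 < \<eta>" "\<eta> < \<delta>" and small: "P2 (- \<eta>) \<eta> \<le> lp (lift (bpt g 0)) (lift (bpt g (\<epsilon> / 2)))"
    and \<sigma>: "- \<eta> < \<sigma>" "\<sigma> < \<eta> / 2" "P2 (- \<eta>) (\<eta> / 2) < P2 \<sigma> \<eta>"
  obtains N where "norm N = 1"
    "\<And>s. - \<eta> \<le> s \<Longrightarrow> s \<le> \<eta> / 2 \<Longrightarrow> \<exists>r. - \<eta> \<le> r \<and> r \<le> \<eta> \<and> P2 r s \<le> P2 (- \<eta>) \<sigma> \<and>
      lp (lift (bpt f r)) N = lp (lift (bpt f (- \<eta>))) N"
proof -
  define c where "c = P2 (- \<eta>) (\<eta> / 2)"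
  have "P2 (- \<eta>) \<sigma> * P2 \<sigma> (\<eta> / 2) \<le> c" unfolding c_def using \<eta> \<sigma> by (intro bpt_mult[OF K]) auto
  moreover have q1: "1 < P2 (- \<eta>) \<sigma>" using \<eta> \<sigma> by (intro P2_strict) auto
  moreover have "1 \<le> P2 \<sigma> (\<eta> / 2)" by (rule lp_lift_ge_1)
  ultimately have lt: "P2 \<sigma> (\<eta> / 2) < c" by (smt (verit) mult_less_cancel_right1)
  \<comment> \<open>The chord from \<sigma> is too short at \<eta>/2 and too long at \<eta>; in
    between it has the length of the original chord.\<close>
  have "continuous_on {\<eta> / 2..\<eta>} (\<lambda>t. P2 \<sigma> t)"
    using \<eta> by (intro continuous_intros continuous_on_subset[OF continuous_bpt[OF K]]) auto
  then obtain t where t: "\<eta> / 2 \<le> t" "t \<le> \<eta>" "P2 \<sigma> t = c"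
    using IVT'[of "\<lambda>t. P2 \<sigma> t" "\<eta> / 2" c \<eta>] lt \<sigma>(3) \<eta>(1) by (auto simp: c_def)
  have "P2 (- \<eta>) (\<eta> / 2) \<le> lp (lift (bpt g 0)) (lift (bpt g (\<epsilon> / 2)))"
    using P2_mono[of "- \<eta>" "- \<eta>" "\<eta> / 2" \<eta>] \<eta> small by simp
  then obtain A where A: "A \<in> SO" "\<And>s. - \<eta> \<le> s \<Longrightarrow> s \<le> \<eta> / 2 \<Longrightarrow> \<exists>u. \<sigma> \<le> u \<and> u \<le> t \<and> mv A (bpt f s) = bpt f u"
    "mv A (bpt f (- \<eta>)) = bpt f \<sigma>" "mv A (bpt f (\<eta> / 2)) = bpt f t"
  proof -
    have "- \<eta> < \<eta> / 2" "\<bar>- \<eta>\<bar> < \<delta>" "\<bar>\<eta> / 2\<bar> < \<delta>" "\<sigma> < t" "\<bar>\<sigma>\<bar> < \<delta>" "\<bar>t\<bar> < \<delta>"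
      using \<eta> \<sigma> t by (simp_all add: abs_less_iff)
    moreover have "P2 (- \<eta>) (\<eta> / 2) = P2 \<sigma> t" using t(3) by (simp add: c_def)
    ultimately show ?thesis using chord_transport that \<open>P2 (- \<eta>) (\<eta> / 2) \<le> _\<close> by blast
  qed
  define h where "h s = Re (kl (mv A (bpt f s)))" for s
  have small4: "\<bar>u\<bar> < 4 * \<delta>" if "- \<eta> \<le> u" "u \<le> \<eta>" for u using that \<eta> by auto
  have h: "\<sigma> \<le> h s" "h s \<le> t" "mv A (bpt f s) = bpt f (h s)" if "- \<eta> \<le> s" "s \<le> \<eta> / 2" for s
  proof -
    obtain u where u: "\<sigma> \<le> u" "u \<le> t" "mv A (bpt f s) = bpt f u" using A(2)[OF \<open>- \<eta> \<le> s\<close> \<open>s \<le> \<eta> / 2\<close>] by blast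
    then have "h s = u" using kl_bpt[OF K, of u] small4[of u] \<sigma> t by (simp add: h_def)
    then show "\<sigma> \<le> h s" "h s \<le> t" "mv A (bpt f s) = bpt f (h s)" using u by simp_all
  qed
  have h_ends: "h (- \<eta>) = \<sigma>" "h (\<eta> / 2) = t"
    using kl_bpt[OF K, of \<sigma>] kl_bpt[OF K, of t] small4[of \<sigma>] small4[of t] \<sigma> t \<eta> by (simp_all add: h_def A(3,4))
  have h_cont: "continuous_on {- \<eta>..\<eta> / 2} h"
    unfolding h_def using \<eta>
    by (intro continuous_intros continuous_on_compose2[OF continuous_mv[OF A(1), of UNIV]]
        continuous_on_subset[OF continuous_bpt[OF K]]) auto
  have h_inj: "inj_on h {- \<eta>..\<eta> / 2}"
  proof (rule inj_onI)
    fix x y assume xy: "x \<in> {- \<eta>..\<eta> / 2}" "y \<in> {- \<eta>..\<eta> / 2}" "h x = h y"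
    then have "mv A (bpt f x) = mv A (bpt f y)" using h(3)[of x] h(3)[of y] by simp
    then have "bpt f x = bpt f y" using bij_is_inj[OF mv_bij[OF A(1)]] by (metis injD)
    then show "x = y" using bpt_inj[OF K, of x y] small4[of x] small4[of y] xy \<eta> by auto
  qed
  have h_mono: "h x < h y" if "- \<eta> \<le> x" "x < y" "y \<le> \<eta> / 2" for x y
    using strict_mono_if_inj[OF h_cont h_inj _ that] h_ends \<sigma> t by simp
  define r where "r k = (h ^^ k) (- \<eta>)" for k
  have r0: "r 0 = - \<eta>" and rS: "r (Suc k) = h (r k)" for k by (simp_all add: r_def)
  have step: "r k < r (Suc k) \<and> - \<eta> \<le> r k \<and> r (Suc k) \<le> \<eta> \<and> P2 (r k) (r (Suc k)) = P2 (- \<eta>) \<sigma>"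
    if "\<And>j. j \<le> k \<Longrightarrow> r j \<le> \<eta> / 2" for k
    using that
  proof (induction k)
    case 0
    then show ?case using h_ends \<sigma> \<eta> by (simp add: rS r0)
  next
    case (Suc k)
    then have IH: "r k < r (Suc k)" "- \<eta> \<le> r k" "r (Suc k) \<le> \<eta>" "P2 (r k) (r (Suc k)) = P2 (- \<eta>) \<sigma>" by auto
    have le: "r k \<le> \<eta> / 2" "r (Suc k) \<le> \<eta> / 2" using Suc.prems by auto
    have "r (Suc k) < r (Suc (Suc k))" using h_mono[OF IH(2,1) le(2)] by (simp add: rS)
    moreover have "r (Suc (Suc k)) \<le> \<eta>" using h(2)[of "r (Suc k)"] IH le(2) t(2) by (simp add: rS[of "Suc k"])
    moreover have "P2 (r (Suc k)) (r (Suc (Suc k))) = P2 (r k) (r (Suc k))"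
      using h(3)[of "r k"] h(3)[of "r (Suc k)"] IH le SO_lp[OF A(1), of "lift (bpt f (r k))" "lift (bpt f (r (Suc k)))"]
      unfolding lift_mv[OF A(1), symmetric] by (simp add: rS)
    ultimately show ?case using IH by simp
  qed
  obtain N0 where N0: "N0 \<noteq> 0" "A N0 = N0" using SO_fixed[OF A(1)] .
  define N where "N = N0 /\<^sub>R norm N0"
  have AN: "A N = N" unfolding N_def using N0(2) linear_scale[OF SO_linear[OF A(1)]] by simp
  have planar: "lp (lift (bpt f (r k))) N = lp (lift (bpt f (- \<eta>))) N" if "\<And>j. j < k \<Longrightarrow> r j \<le> \<eta> / 2" for k
    using that
  proof (induction k)
    case (Suc k)
    then have le: "r k \<le> \<eta> / 2" by simp
    have "- \<eta> \<le> r k" using step[of k] Suc.prems by simp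
    then have "lift (bpt f (r (Suc k))) = A (lift (bpt f (r k)))" using h(3)[of "r k"] le lift_mv[OF A(1)] by (metis rS)
    then have "lp (lift (bpt f (r (Suc k)))) N = lp (lift (bpt f (r k))) N" using SO_lp[OF A(1)] AN by metis
    then show ?case using Suc by simp
  qed (simp add: r0)
  show ?thesis
  proof (rule that[of N])
    show "norm N = 1" using N0(1) by (simp add: N_def)
    fix s assume s: "- \<eta> \<le> s" "s \<le> \<eta> / 2"
    \<comment> \<open>A chain that never passes \<open>s\<close> would converge, and its links, all
      of the same positive length, would shrink to a point.\<close>
    have "\<exists>k. (\<forall>j\<le>k. r j \<le> \<eta> / 2) \<and> r k \<le> s \<and> s \<le> r (Suc k)"
    proof (rule ccontr)
      assume no: "\<not> ?thesis"
      have rs: "r k \<le> s" for k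
      proof (induction k rule: less_induct)
        case (less k)
        show ?case
        proof (cases k)
          case (Suc m)
          have "r j \<le> \<eta> / 2" if "j \<le> m" for j using less[of j] that Suc s by simp
          then show ?thesis using no less[of m] Suc by force
        qed (use r0 s in simp)
      qed
      then have st: "r k < r (Suc k) \<and> - \<eta> \<le> r k \<and> r (Suc k) \<le> \<eta> \<and> P2 (r k) (r (Suc k)) = P2 (- \<eta>) \<sigma>" for k
        using step[of k] s by (meson order_trans)
      then have "incseq r" by (intro incseq_SucI) (simp add: less_imp_le)
      then obtain l where l: "r \<longlonglongrightarrow> l" "\<And>i. r i \<le> l" using incseq_convergent[of r s] rs by metis
      have "l \<le> s" using l(1) rs by (intro LIMSEQ_le_const2) auto
      moreover have "- \<eta> \<le> l" using l(2)[of 0] r0 by simp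
      ultimately have l4: "l \<in> {-(4 * \<delta>)<..<4 * \<delta>}" using s \<eta> by auto
      have cont: "continuous (at l) (bpt f)"
        using continuous_bpt[OF K] l4 by (simp add: continuous_on_eq_continuous_at)
      have "(\<lambda>k. bpt f (r k)) \<longlonglongrightarrow> bpt f l" "(\<lambda>k. bpt f (r (Suc k))) \<longlonglongrightarrow> bpt f l"
        using cont l(1) LIMSEQ_Suc[OF l(1)] by (auto intro: isCont_tendsto_compose)
      then have "(\<lambda>k. P2 (r k) (r (Suc k))) \<longlonglongrightarrow> lp (lift (bpt f l)) (lift (bpt f l))"
        by (intro tendsto_intros)
      then have "(\<lambda>k. P2 (- \<eta>) \<sigma>) \<longlonglongrightarrow> 1" using st by simp
      then have "P2 (- \<eta>) \<sigma> = 1" by (simp add: LIMSEQ_const_iff)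
      then show False using q1 by simp
    qed
    then obtain k where k: "\<And>j. j \<le> k \<Longrightarrow> r j \<le> \<eta> / 2" "r k \<le> s" "s \<le> r (Suc k)" by blast
    have st: "r k < r (Suc k)" "- \<eta> \<le> r k" "r (Suc k) \<le> \<eta>" "P2 (r k) (r (Suc k)) = P2 (- \<eta>) \<sigma>"
      using step[of k] k(1) by auto
    have "P2 (r k) s \<le> P2 (- \<eta>) \<sigma>"
      using P2_mono[of "r k" "r k" s "r (Suc k)"] k st \<eta> by simp
    then show "\<exists>r. - \<eta> \<le> r \<and> r \<le> \<eta> \<and> P2 r s \<le> P2 (- \<eta>) \<sigma> \<and> lp (lift (bpt f r)) N = lp (lift (bpt f (- \<eta>))) N"
      using planar[of k] k(1) st by (intro exI[of _ "r k"]) auto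
  qed
qed

text \<open>The links of the chains are made arbitrarily short; the unit normals have an
  accumulation point, and the chain points next to a fixed arc point converge to it.\<close>

lemma planar_near_orig:
  obtains N \<eta> where "N \<noteq> 0" "0 < \<eta>" "\<eta> < \<delta>"
    "\<And>s. \<bar>s\<bar> < \<eta> \<Longrightarrow> lp (lift (bpt f s)) N = lp (lift orig) N"
proof -
  define c where "c = lp (lift (bpt g 0)) (lift (bpt g (\<epsilon> / 2)))"
  have e: "0 < \<epsilon>" using delta[OF L] by simp
  have d: "0 < \<delta>" using delta[OF K] by simp
  have c: "1 < c" unfolding c_def using bpt_inj[OF L, of 0 "\<epsilon> / 2"] e by (intro lp_lift_gt_1) auto
  have cont: "continuous (at s) (bpt f)" if "\<bar>s\<bar> < 4 * \<delta>" for s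
    using continuous_bpt[OF K] that by (simp add: continuous_on_eq_continuous_at abs_less_iff)
  have c0: "isCont (bpt f) 0" using cont[of 0] d by simp
  have lim0: "((\<lambda>x. P2 (- x) x) \<longlongrightarrow> P2 0 0) (at_right 0)"
  proof (intro tendsto_intros)
    have "(uminus \<longlongrightarrow> - 0) (at_right (0::real))" by (intro tendsto_intros)
    then show "((\<lambda>x. bpt f (- x)) \<longlongrightarrow> bpt f 0) (at_right 0)"
      using isCont_tendsto_compose[OF c0, of uminus] by simp
    have "((\<lambda>x. x) \<longlongrightarrow> 0) (at_right (0::real))" by (intro tendsto_intros)
    then show "((\<lambda>x. bpt f x) \<longlongrightarrow> bpt f 0) (at_right 0)"
      using isCont_tendsto_compose[OF c0, of "\<lambda>x. x"] by simp
  qed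
  have "eventually (\<lambda>x. P2 (- x) x < c) (at_right 0)"
    using order_tendstoD(2)[OF lim0, of c] c by simp
  moreover have "eventually (\<lambda>x. x < \<delta>) (at_right 0)" using d by (rule eventually_at_right_real[THEN eventually_mono]) auto
  moreover have "eventually (\<lambda>x::real. 0 < x) (at_right 0)" by (rule eventually_at_right_less)
  ultimately have "eventually (\<lambda>x. P2 (- x) x < c \<and> x < \<delta> \<and> 0 < x) (at_right 0)" by eventually_elim auto
  then obtain \<eta> where \<eta>: "P2 (- \<eta>) \<eta> < c" "\<eta> < \<delta>" "0 < \<eta>"
    using eventually_happens'[of "at_right (0::real)"] by (metis (mono_tags, lifting) trivial_limit_at_right_real)
  have lt: "P2 (- \<eta>) (\<eta> / 2) < P2 (- \<eta>) \<eta>"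
  proof -
    have "P2 (- \<eta>) (\<eta> / 2) * P2 (\<eta> / 2) \<eta> \<le> P2 (- \<eta>) \<eta>" using \<eta> by (intro bpt_mult[OF K]) auto
    moreover have "1 < P2 (\<eta> / 2) \<eta>" using \<eta> by (intro P2_strict) auto
    moreover have "1 \<le> P2 (- \<eta>) (\<eta> / 2)" by (rule lp_lift_ge_1)
    ultimately show ?thesis by (smt (verit) mult_less_cancel_left1)
  qed
  \<comment> \<open>Start points tending to -\<eta>; the first \<open>n0\<close> of them are
    skipped, so that \<open>chain_step\<close> applies to the remaining ones.\<close>
  define \<sigma> where "\<sigma> n = - \<eta> + \<eta> * inverse (real (Suc n))" for n
  have \<sigma>_lim: "\<sigma> \<longlonglongrightarrow> - \<eta>"
  proof -
    have "(\<lambda>n. - \<eta> + \<eta> * inverse (real (Suc n))) \<longlonglongrightarrow> - \<eta> + \<eta> * 0"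
      by (intro tendsto_intros LIMSEQ_inverse_real_of_nat)
    then show ?thesis by (simp add: \<sigma>_def[abs_def])
  qed
  have ce: "isCont (bpt f) (- \<eta>)" using cont[of "- \<eta>"] \<eta> by simp
  have b\<sigma>: "(\<lambda>n. bpt f (\<sigma> n)) \<longlonglongrightarrow> bpt f (- \<eta>)" by (rule isCont_tendsto_compose[OF ce \<sigma>_lim])
  have "(\<lambda>n. P2 (\<sigma> n) \<eta>) \<longlonglongrightarrow> P2 (- \<eta>) \<eta>" by (intro tendsto_intros b\<sigma>)
  then have ev1: "eventually (\<lambda>n. P2 (- \<eta>) (\<eta> / 2) < P2 (\<sigma> n) \<eta>) sequentially"
    using lt by (rule order_tendstoD(1))
  have ev2: "eventually (\<lambda>n. \<sigma> n < \<eta> / 2) sequentially"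
    using \<sigma>_lim by (rule order_tendstoD(2)) (use \<eta> in simp)
  obtain n0 where n0: "\<And>n. n0 \<le> n \<Longrightarrow> P2 (- \<eta>) (\<eta> / 2) < P2 (\<sigma> n) \<eta> \<and> \<sigma> n < \<eta> / 2"
    using eventually_conj[OF ev1 ev2] unfolding eventually_sequentially by blast
  define \<tau> where "\<tau> n = \<sigma> (n + n0)" for n
  have tau: "- \<eta> < \<tau> n" "\<tau> n < \<eta> / 2" "P2 (- \<eta>) (\<eta> / 2) < P2 (\<tau> n) \<eta>" for n
    using n0[of "n + n0"] \<eta> by (simp_all add: \<tau>_def) (simp add: \<sigma>_def)
  have "\<exists>N. norm N = 1 \<and> (\<forall>s. - \<eta> \<le> s \<longrightarrow> s \<le> \<eta> / 2 \<longrightarrow> (\<exists>r. - \<eta> \<le> r \<and> r \<le> \<eta> \<and> P2 r s \<le> P2 (- \<eta>) (\<tau> n) \<and>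
      lp (lift (bpt f r)) N = lp (lift (bpt f (- \<eta>))) N))" for n
    using chain_step[OF \<eta>(3,2) less_imp_le[OF \<eta>(1)[unfolded c_def]] tau[of n]] by (metis (no_types, lifting))
  then obtain N where N: "\<And>n. norm (N n) = 1" "\<And>n s. - \<eta> \<le> s \<Longrightarrow> s \<le> \<eta> / 2 \<Longrightarrow> \<exists>r. - \<eta> \<le> r \<and> r \<le> \<eta> \<and> P2 r s \<le> P2 (- \<eta>) (\<tau> n) \<and>
      lp (lift (bpt f r)) (N n) = lp (lift (bpt f (- \<eta>))) (N n)" by metis
  have "compact (sphere (0::vec) 1)" by simp
  then obtain M \<phi> where M: "M \<in> sphere 0 1" "strict_mono \<phi>" "(N \<circ> \<phi>) \<longlonglongrightarrow> M"
    using N(1) unfolding compact_def by (metis mem_sphere_0)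
  have flatN: "lp (lift (bpt f s)) M = lp (lift (bpt f (- \<eta>))) M" if s: "- \<eta> \<le> s" "s \<le> \<eta> / 2" for s
  proof -
    obtain r where r: "\<And>n. - \<eta> \<le> r n \<and> r n \<le> \<eta> \<and> P2 (r n) s \<le> P2 (- \<eta>) (\<tau> n) \<and>
      lp (lift (bpt f (r n))) (N n) = lp (lift (bpt f (- \<eta>))) (N n)" using N(2)[OF s] by metis
    have "\<forall>n. (r \<circ> \<phi>) n \<in> {- \<eta>..\<eta>}" using r by simp
    then obtain l \<psi> where l: "l \<in> {- \<eta>..\<eta>}" "strict_mono \<psi>" "((r \<circ> \<phi>) \<circ> \<psi>) \<longlonglongrightarrow> l"
      using compact_Icc[of "- \<eta>" \<eta>] unfolding compact_def by blast
    define \<omega> where "\<omega> = \<phi> \<circ> \<psi>"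
    have chi: "strict_mono \<omega>" unfolding \<omega>_def using M(2) l(2) by (rule strict_mono_o)
    have rl: "(\<lambda>n. r (\<omega> n)) \<longlonglongrightarrow> l" using l(3) by (simp add: \<omega>_def comp_def)
    have Nl: "(\<lambda>n. N (\<omega> n)) \<longlonglongrightarrow> M" using LIMSEQ_subseq_LIMSEQ[OF M(3) l(2)] by (simp add: \<omega>_def comp_def)
    have "(\<lambda>n. \<sigma> (n + n0)) \<longlonglongrightarrow> - \<eta>" using \<sigma>_lim by (rule LIMSEQ_ignore_initial_segment)
    then have "\<tau> \<longlonglongrightarrow> - \<eta>" by (simp add: \<tau>_def[abs_def])
    then have tl: "(\<lambda>n. \<tau> (\<omega> n)) \<longlonglongrightarrow> - \<eta>" using LIMSEQ_subseq_LIMSEQ[OF _ chi] by (auto simp: comp_def)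
    have cl: "isCont (bpt f) l" using cont[of l] l(1) \<eta> by auto
    have br: "(\<lambda>n. bpt f (r (\<omega> n))) \<longlonglongrightarrow> bpt f l" by (rule isCont_tendsto_compose[OF cl rl])
    have bt: "(\<lambda>n. bpt f (\<tau> (\<omega> n))) \<longlonglongrightarrow> bpt f (- \<eta>)" by (rule isCont_tendsto_compose[OF ce tl])
    \<comment> \<open>The right-hand side is 1, so the limit of the chain points is the arc point
      over \<open>s\<close> itself.\<close>
    have "P2 l s \<le> P2 (- \<eta>) (- \<eta>)"
    proof (rule LIMSEQ_le)
      show "(\<lambda>n. P2 (r (\<omega> n)) s) \<longlonglongrightarrow> P2 l s" by (intro tendsto_intros br)
      show "(\<lambda>n. P2 (- \<eta>) (\<tau> (\<omega> n))) \<longlonglongrightarrow> P2 (- \<eta>) (- \<eta>)" by (intro tendsto_intros bt)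
    qed (use r in blast)
    then have "bpt f l = bpt f s" using lp_lift_ge_1[of "bpt f l" "bpt f s"] by (simp flip: lp_lift_eq_1)
    have "(\<lambda>n. lp (lift (bpt f (r (\<omega> n)))) (N (\<omega> n))) \<longlonglongrightarrow> lp (lift (bpt f l)) M" by (intro tendsto_intros br Nl)
    moreover have "(\<lambda>n. lp (lift (bpt f (- \<eta>))) (N (\<omega> n))) \<longlonglongrightarrow> lp (lift (bpt f (- \<eta>))) M" by (intro tendsto_intros Nl)
    ultimately have "lp (lift (bpt f l)) M = lp (lift (bpt f (- \<eta>))) M" using r LIMSEQ_unique by simp
    then show ?thesis using \<open>bpt f l = bpt f s\<close> by simp
  qed
  have b0: "bpt f 0 = orig" using K(2) by (simp add: bpt_def flat_graph_def zero_complex.code)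
  show ?thesis
  proof (rule that[of M "\<eta> / 2"])
    show "M \<noteq> 0" using M(1) by auto
    fix s assume "\<bar>s\<bar> < \<eta> / 2"
    then have "lp (lift (bpt f s)) M = lp (lift (bpt f (- \<eta>))) M" by (intro flatN) auto
    moreover have "lp (lift (bpt f 0)) M = lp (lift (bpt f (- \<eta>))) M" using \<eta> by (intro flatN) auto
    ultimately show "lp (lift (bpt f s)) M = lp (lift orig) M" by (simp add: b0)
  qed (use \<eta> in auto)
qed

end

section \<open>The boundary is locally a plane section of the hyperboloid\<close>

text \<open>The Euclidean cross product of the coordinate triples; replacing \<open>N\<close> by
  \<open>(fst N, - snd N)\<close> turns \<open>lp\<close> into the Euclidean inner product.\<close>

definition crossv :: "vec \<Rightarrow> vec \<Rightarrow> vec" where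
  "crossv X Y = (Re (snd X) * Im (snd Y) - Im (snd X) * Re (snd Y),
     Complex (Im (snd X) * fst Y - fst X * Im (snd Y)) (fst X * Re (snd Y) - Re (snd X) * fst Y))"

lemma crossv_parallel:
  assumes "crossv X W = 0" "W \<noteq> 0"
  obtains \<mu> where "X = \<mu> *\<^sub>R W"
proof -
  obtain x x1 x2 where X: "X = (x, Complex x1 x2)" by (metis complex.exhaust surj_pair)
  obtain w w1 w2 where W: "W = (w, Complex w1 w2)" by (metis complex.exhaust surj_pair)
  define q where "q = w * w + w1 * w1 + w2 * w2"
  have "q \<noteq> 0"
  proof
    assume "q = 0"
    then have "w * w = 0" "w1 * w1 = 0" "w2 * w2 = 0"
      using zero_le_square[of w] zero_le_square[of w1] zero_le_square[of w2] unfolding q_def by linarith+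
    then show False using assms(2) by (simp add: W complex_eq_iff prod_eq_iff)
  qed
  moreover have "x1 * w2 = x2 * w1" "x2 * w = x * w2" "x * w1 = x1 * w"
    using assms(1) by (auto simp: crossv_def X W complex_eq_iff prod_eq_iff)
  then have "x * q = (x * w + x1 * w1 + x2 * w2) * w" "x1 * q = (x * w + x1 * w1 + x2 * w2) * w1"
    "x2 * q = (x * w + x1 * w1 + x2 * w2) * w2" unfolding q_def by algebra+
  ultimately have "X = ((x * w + x1 * w1 + x2 * w2) / q) *\<^sub>R W"
    by (simp add: X W complex_eq_iff prod_eq_iff nonzero_eq_divide_eq)
  then show ?thesis by (rule that)
qed

lemma crossv_crossv:
  assumes "lp D N = 0" "lp D N' = 0"
  shows "crossv D (crossv (fst N, - snd N) (fst N', - snd N')) = 0"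
proof -
  obtain d d1 d2 where D: "D = (d, Complex d1 d2)" by (metis complex.exhaust surj_pair)
  obtain n n1 n2 where N: "N = (n, Complex n1 n2)" by (metis complex.exhaust surj_pair)
  obtain m m1 m2 where M: "N' = (m, Complex m1 m2)" by (metis complex.exhaust surj_pair)
  have e: "d * n - d1 * n1 - d2 * n2 = 0" "d * m - d1 * m1 - d2 * m2 = 0"
    using assms by (simp_all add: lp_def D N M inner_complex_def)
  show ?thesis
    unfolding crossv_def D N M prod_eq_iff complex_eq_iff
    apply simp
    using e by algebra
qed

text \<open>A straight line of the ambient space meets the hyperboloid in at most two
  points.\<close>

lemma not_collinear:
  assumes "lift z = lift x + \<mu> *\<^sub>R (lift y - lift x)" "x \<noteq> y"
  shows "z = x \<or> z = y"
proof -
  define P where "P = lp (lift x) (lift y)"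
  have "1 = lp (lift z) (lift z)" by simp
  also have "\<dots> = 1 + 2 * (\<mu> * (1 - \<mu>)) * (P - 1)"
    unfolding assms(1) using lp_commute[of "lift y" "lift x"] by (simp add: P_def algebra_simps)
  finally have "\<mu> * (1 - \<mu>) * (P - 1) = 0" by simp
  moreover have "P \<noteq> 1" using assms(2) by (simp add: P_def lp_lift_eq_1)
  ultimately have "\<mu> = 0 \<or> \<mu> = 1" by auto
  then show ?thesis using assms(1) by (auto simp: lift_inj)
qed

text \<open>Three distinct points of the hyperboloid are not collinear, hence span a unique affine
  plane.\<close>

lemma plane_unique:
  assumes "a \<noteq> b" "a \<noteq> c" "b \<noteq> c" "N \<noteq> 0"
    and "lp (lift b) N = lp (lift a) N" "lp (lift c) N = lp (lift a) N"
    and "lp (lift b) N' = lp (lift a) N'" "lp (lift c) N' = lp (lift a) N'"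
  obtains \<mu> where "N' = \<mu> *\<^sub>R N"
proof -
  define W where "W = crossv (fst N, - snd N) (fst N', - snd N')"
  have W: "W = 0"
  proof (rule ccontr)
    assume "W \<noteq> 0"
    have "crossv (lift b - lift a) W = 0" "crossv (lift c - lift a) W = 0"
      unfolding W_def by (intro crossv_crossv; simp add: assms)+
    then obtain \<beta> \<gamma> where bc: "lift b - lift a = \<beta> *\<^sub>R W" "lift c - lift a = \<gamma> *\<^sub>R W"
      using crossv_parallel[OF _ \<open>W \<noteq> 0\<close>] by metis
    have "\<beta> \<noteq> 0" using bc(1) assms(1) by (auto simp: lift_inj)
    then have "lift c = lift a + (\<gamma> / \<beta>) *\<^sub>R (lift b - lift a)" using bc by (simp add: algebra_simps)
    then show False using not_collinear assms(1-3) by metis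
  qed
  have "crossv (fst N', - snd N') (fst N, - snd N) = 0"
    using W by (auto simp: W_def crossv_def prod_eq_iff complex_eq_iff algebra_simps)
  moreover have "(fst N, - snd N) \<noteq> 0" using assms(4) by (auto simp: prod_eq_iff)
  ultimately obtain \<mu> where "(fst N', - snd N') = \<mu> *\<^sub>R (fst N, - snd N)" using crossv_parallel by blast
  then have "N' = \<mu> *\<^sub>R N" by (simp add: prod_eq_iff)
  then show ?thesis by (rule that)
qed

text \<open>The equivalence gives more than containment of the arc in the plane: near
  \<open>x\<close> the boundary is the full plane section. The normal matters only up to a nonzero
  factor, see \<open>germ_scaleR\<close>.\<close>

definition germ :: "hyp_plane set \<Rightarrow> hyp_plane \<Rightarrow> vec \<Rightarrow> bool" where
  "germ K x N \<longleftrightarrow> x \<in> frontier K \<and> N \<noteq> 0 \<and>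
    (\<exists>W. open W \<and> x \<in> W \<and> (\<forall>z\<in>W. z \<in> frontier K \<longleftrightarrow> lp (lift z) N = lp (lift x) N))"

lemma SO_nonzero: "A \<in> SO \<Longrightarrow> N \<noteq> 0 \<Longrightarrow> A N \<noteq> 0"
  by (metis mv_vimage linear_0 SO_linear)

lemma germ_mv:
  assumes A: "A \<in> SO" and K: "body K" and g: "germ K x N"
  shows "germ (mv A ` K) (mv A x) (A N)"
proof -
  obtain W where W: "open W" "x \<in> W" "\<And>z. z \<in> W \<Longrightarrow> z \<in> frontier K \<longleftrightarrow> lp (lift z) N = lp (lift x) N"
    using g unfolding germ_def by blast
  have f: "frontier (mv A ` K) = mv A ` frontier K" using A K by (simp add: frontier_mv body_def)
  have inj: "inj (mv A)" by (rule bij_is_inj[OF mv_bij[OF A]])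
  show ?thesis
    unfolding germ_def f
  proof (intro conjI exI[of _ "mv A ` W"] ballI)
    show "mv A x \<in> mv A ` frontier K" using g by (simp add: germ_def)
    show "A N \<noteq> 0" by (rule SO_nonzero[OF A]) (use g in \<open>simp add: germ_def\<close>)
    show "open (mv A ` W)" by (intro open_mv A W)
    show "mv A x \<in> mv A ` W" using W by simp
    fix z assume "z \<in> mv A ` W"
    then obtain w where w: "w \<in> W" "z = mv A w" by auto
    show "z \<in> mv A ` frontier K \<longleftrightarrow> lp (lift z) (A N) = lp (lift (mv A x)) (A N)"
      using W(3)[OF w(1)] A by (simp add: w(2) inj_image_mem_iff[OF inj])
  qed
qed

lemma germ_scaleR: "germ K x N \<Longrightarrow> c \<noteq> 0 \<Longrightarrow> germ K x (c *\<^sub>R N)"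
  unfolding germ_def by simp

lemma bpt_zero: "flat_graph K \<delta> f \<Longrightarrow> bpt f 0 = orig"
  by (simp add: bpt_def flat_graph_def flip: zero_complex_def) (metis complex.collapse zero_complex.simps)

lemma path_in_open:
  assumes "body K" "flat_graph K \<delta> f" "open U" "orig \<in> U"
  obtains \<eta> where "0 < \<eta>" "\<eta> < \<delta>" "\<And>s. \<bar>s\<bar> \<le> \<eta> \<Longrightarrow> bpt f s \<in> U"
proof -
  have d: "0 < \<delta>" using delta[OF assms(1,2)] by simp
  have "isCont (bpt f) 0"
    using continuous_bpt[OF assms(1,2)] d by (simp add: continuous_on_eq_continuous_at)
  then have "eventually (\<lambda>s. bpt f s \<in> U) (at 0)"
    using assms(3,4) bpt_zero[OF assms(2)] by (intro topological_tendstoD) (auto simp: isCont_def)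
  then obtain e where e: "0 < e" "\<And>s. s \<noteq> 0 \<Longrightarrow> dist s 0 < e \<Longrightarrow> bpt f s \<in> U"
    unfolding eventually_at by auto
  show ?thesis
  proof (rule that[of "min (e / 2) (\<delta> / 2)"])
    fix s :: real assume s: "\<bar>s\<bar> \<le> min (e / 2) (\<delta> / 2)"
    show "bpt f s \<in> U"
      using e(2)[of s] s e(1) bpt_zero[OF assms(2)] assms(4) by (cases "s = 0") auto
  qed (use e d in auto)
qed

lemma three_frontier_points:
  assumes K: "body K" "smooth_pt K x" and U: "open U" "x \<in> U"
  obtains a b c where "a \<in> frontier K \<inter> U" "b \<in> frontier K \<inter> U" "c \<in> frontier K \<inter> U" "a \<noteq> b" "a \<noteq> c" "b \<noteq> c"
proof -
  obtain A where A: "A \<in> SO" "mv A x = orig" "normal_pos (mv A ` K)" using smooth_normalise[OF K] .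
  have K': "body (mv A ` K)" by (rule body_mv[OF K(1) A(1)])
  obtain \<delta> f where f: "flat_graph (mv A ` K) \<delta> f" using flat_graph_exists[OF K' A(3)] .
  obtain B where B: "B \<in> SO" "\<And>x. mv A (mv B x) = x" "\<And>x. mv B (mv A x) = x" using mv_vimage[OF A(1)] by metis
  have "orig \<in> mv A ` U" using U(2) A(2) by (metis imageI)
  then obtain \<eta> where \<eta>: "0 < \<eta>" "\<eta> < \<delta>" "\<And>s. \<bar>s\<bar> \<le> \<eta> \<Longrightarrow> bpt f s \<in> mv A ` U"
    using path_in_open[OF K' f open_mv[OF A(1) U(1)]] by blast
  have m: "mv B (bpt f s) \<in> frontier K \<inter> U" if "\<bar>s\<bar> \<le> \<eta>" for s
  proof -
    have "bpt f s \<in> frontier (mv A ` K)" using that \<eta> by (intro bpt_frontier[OF K' f]) auto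
    then have "bpt f s \<in> mv A ` frontier K" using A(1) K(1) by (simp add: frontier_mv body_def)
    then obtain y where y: "y \<in> frontier K" "bpt f s = mv A y" by auto
    have "bpt f s \<in> mv A ` U" using \<eta>(3) that by blast
    then obtain w where "w \<in> U" "bpt f s = mv A w" by auto
    then have "mv B (bpt f s) \<in> U" by (simp add: B(3))
    then show ?thesis using y by (simp add: B(3))
  qed
  have ne: "mv B (bpt f s) \<noteq> mv B (bpt f s')" if "\<bar>s\<bar> \<le> \<eta>" "\<bar>s'\<bar> \<le> \<eta>" "s \<noteq> s'" for s s'
  proof
    assume "mv B (bpt f s) = mv B (bpt f s')"
    then have "bpt f s = bpt f s'" by (metis B(2))
    moreover have "\<bar>s\<bar> < 4 * \<delta>" "\<bar>s'\<bar> < 4 * \<delta>" using that \<eta> by auto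
    ultimately show False using bpt_inj[OF K' f] that(3) by blast
  qed
  show ?thesis
    by (rule that[of "mv B (bpt f 0)" "mv B (bpt f (\<eta> / 2))" "mv B (bpt f \<eta>)"]; (intro m ne)?) (use \<eta> in auto)
qed

text \<open>On a plane section through the origin, the coordinate orthogonal to the normal of the plane is locally injective.\<close>

lemma plane_in_frontier:
  assumes K: "body K" "flat_graph K \<delta> f" and U: "open U" "orig \<in> U"
    and N: "N \<noteq> 0" "\<And>z. z \<in> frontier K \<Longrightarrow> z \<in> U \<Longrightarrow> lp (lift z) N = lp (lift orig) N"
  obtains W where "open W" "orig \<in> W" "\<And>z. z \<in> W \<Longrightarrow> lp (lift z) N = lp (lift orig) N \<Longrightarrow> z \<in> frontier K"
proof -
  define n where "n = snd N"
  define \<nu> where "\<nu> z = n \<bullet> snd (lift z)" for z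
  define \<omega> where "\<omega> z = (\<i> * n) \<bullet> snd (lift z)" for z
  have plane: "lp (lift z) N = lp (lift orig) N \<longleftrightarrow> fst N * (fst (lift z) - 1) = \<nu> z" for z
    by (auto simp: lp_def \<nu>_def n_def inner_commute algebra_simps)
  have pathU: "\<exists>\<eta>. 0 < \<eta> \<and> \<eta> < \<delta> \<and> (\<forall>s. \<bar>s\<bar> \<le> \<eta> \<longrightarrow> bpt f s \<in> V)" if "open V" "orig \<in> V" for V
    using path_in_open[OF K that] by metis
  have fr: "bpt f s \<in> frontier K" if "\<bar>s\<bar> < \<delta>" for s using that by (intro bpt_frontier[OF K]) auto
  \<comment> \<open>A horizontal plane through the origin meets the hyperboloid only there, while
    the arc has further points in \<open>U\<close>.\<close>
  have n0: "n \<noteq> 0"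
  proof
    assume n0: "n = 0"
    obtain \<eta> where \<eta>: "0 < \<eta>" "\<eta> < \<delta>" "\<And>s. \<bar>s\<bar> \<le> \<eta> \<Longrightarrow> bpt f s \<in> U" using pathU[OF U] by blast
    have "lp (lift (bpt f \<eta>)) N = lp (lift orig) N" using \<eta> fr[of \<eta>] by (intro N(2)) auto
    then have "fst N * (fst (lift (bpt f \<eta>)) - 1) = 0" unfolding plane by (simp add: \<nu>_def n0)
    moreover have "fst N \<noteq> 0" using N(1) n0 by (auto simp: n_def prod_eq_iff)
    ultimately have "lp (lift (bpt f \<eta>)) (lift orig) = 1" by (simp add: lp_def)
    then have "bpt f \<eta> = bpt f 0" using bpt_zero[OF K(2)] lp_lift_eq_1 by metis
    moreover have "\<bar>\<eta>\<bar> < 4 * \<delta>" "\<bar>0\<bar> < 4 * \<delta>" using \<eta> by auto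
    ultimately show False using bpt_inj[OF K] \<eta>(1) by blast
  qed
  define q where "q = (cmod n)\<^sup>2"
  have q: "0 < q" using n0 by (simp add: q_def)
  define V where "V = {z. \<bar>fst N * \<nu> z\<bar> < q}"
  have contv: "continuous_on UNIV \<nu>" "continuous_on UNIV \<omega>" unfolding \<nu>_def \<omega>_def by (intro continuous_intros)+
  have V: "open V" "orig \<in> V" 
    unfolding V_def using q by (auto intro!: open_Collect_less continuous_intros contv simp: \<nu>_def)
  have nsq: "q * (cmod \<xi>)\<^sup>2 = (n \<bullet> \<xi>)\<^sup>2 + ((\<i> * n) \<bullet> \<xi>)\<^sup>2" for \<xi>
    unfolding q_def cmod_power2 by (simp add: inner_complex_def power2_eq_square algebra_simps)
  \<comment> \<open>Eliminating \<nu> from the plane equation and the equation of the hyperboloid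
    leaves a product of the difference of heights with a factor that is positive on
    \<open>V\<close>.\<close>
  have inj: "x = y" if xy: "x \<in> V" "y \<in> V" "lp (lift x) N = lp (lift orig) N" "lp (lift y) N = lp (lift orig) N" "\<omega> x = \<omega> y" for x y
  proof -
    have e: "fst N * (fst (lift x) - fst (lift y)) = \<nu> x - \<nu> y" using xy(3,4) unfolding plane by (simp add: algebra_simps)
    have sq: "(fst (lift z))\<^sup>2 = 1 + (cmod (snd (lift z)))\<^sup>2" for z using lp_lift_self[of z] by (simp add: lp_self)
    have "q * ((fst (lift x))\<^sup>2 - (fst (lift y))\<^sup>2) = (\<nu> x)\<^sup>2 - (\<nu> y)\<^sup>2"
      using nsq[of "snd (lift x)"] nsq[of "snd (lift y)"] xy(5) unfolding sq by (simp add: \<nu>_def \<omega>_def algebra_simps)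
    then have d: "(fst (lift x) - fst (lift y)) * (q * (fst (lift x) + fst (lift y)) - fst N * (\<nu> x + \<nu> y)) = 0"
      using e by algebra
    have ge: "1 \<le> fst (lift z)" for z using lp_lift_ge_1[of z orig] by (simp add: lp_def)
    have "fst N * (\<nu> x + \<nu> y) < 2 * q" using xy(1,2) by (simp add: V_def algebra_simps abs_less_iff)
    also have "\<dots> \<le> q * (fst (lift x) + fst (lift y))" using mult_left_mono[of 2 "fst (lift x) + fst (lift y)" q] q ge[of x] ge[of y] by simp
    finally have eq0: "fst (lift x) = fst (lift y)" using d by simp
    then have eqn: "\<nu> x = \<nu> y" using e by simp
    have "q * (cmod (snd (lift x) - snd (lift y)))\<^sup>2 = 0"
      unfolding nsq using eqn xy(5) by (simp add: \<nu>_def \<omega>_def inner_diff_right)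
    then have "snd (lift x) = snd (lift y)" using q by simp
    then show ?thesis using eq0 by (simp add: prod_eq_iff flip: lift_inj)
  qed
  have "open (U \<inter> V)" "orig \<in> U \<inter> V" using U V by auto
  then obtain \<eta> where \<eta>: "0 < \<eta>" "\<eta> < \<delta>" "\<And>s. \<bar>s\<bar> \<le> \<eta> \<Longrightarrow> bpt f s \<in> U \<inter> V" using pathU by blast
  have on: "bpt f s \<in> frontier K \<and> bpt f s \<in> V \<and> lp (lift (bpt f s)) N = lp (lift orig) N" if "\<bar>s\<bar> \<le> \<eta>" for s
    using \<eta>(2) \<eta>(3)[OF that] fr[of s] N(2)[of "bpt f s"] that by auto
  define h where "h s = \<omega> (bpt f s)" for s
  have hc: "continuous_on {- \<eta>..\<eta>} h"
    unfolding h_def using \<eta>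
    by (intro continuous_on_compose2[OF contv(2)] continuous_on_subset[OF continuous_bpt[OF K]]) auto
  have hi: "inj_on h {- \<eta>..\<eta>}"
  proof (rule inj_onI)
    fix s s' assume s: "s \<in> {- \<eta>..\<eta>}" "s' \<in> {- \<eta>..\<eta>}" "h s = h s'"
    then have "bpt f s = bpt f s'" using on[of s] on[of s'] by (intro inj) (auto simp: h_def)
    moreover have "\<bar>s\<bar> < 4 * \<delta>" "\<bar>s'\<bar> < 4 * \<delta>" using s \<eta> by auto
    ultimately show "s = s'" using bpt_inj[OF K] by blast
  qed
  have h0: "h 0 = 0" using bpt_zero[OF K(2)] by (simp add: h_def \<omega>_def)
  have mono: "(h (- \<eta>) < h 0 \<and> h 0 < h \<eta>) \<or> (h \<eta> < h 0 \<and> h 0 < h (- \<eta>))"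
    using continuous_inj_imp_mono[of "- \<eta>" 0 \<eta> h] hc hi \<eta>(1) by simp
  \<comment> \<open>The image of the arc under \<omega> is an interval with 0 inside, so a point of
    the section near the origin shares its \<omega> with an arc point and hence equals it.\<close>
  define lo hi' where "lo = min (h (- \<eta>)) (h \<eta>)" and "hi' = max (h (- \<eta>)) (h \<eta>)"
  have lohi: "lo < 0" "0 < hi'" using mono h0 by (auto simp: lo_def hi'_def)
  have conn: "connected (h ` {- \<eta>..\<eta>})" by (intro connected_continuous_image hc) simp
  have img: "v \<in> h ` {- \<eta>..\<eta>}" if "lo \<le> v" "v \<le> hi'" for v
  proof -
    have "lo \<in> h ` {- \<eta>..\<eta>}" "hi' \<in> h ` {- \<eta>..\<eta>}" using \<eta>(1) by (auto simp: lo_def hi'_def min_def max_def)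
    then show ?thesis using conn that unfolding is_interval_connected_1[symmetric] is_interval_1 by blast
  qed
  show ?thesis
  proof (rule that[of "V \<inter> {z. lo < \<omega> z} \<inter> {z. \<omega> z < hi'}"])
    show "open (V \<inter> {z. lo < \<omega> z} \<inter> {z. \<omega> z < hi'})"
      by (intro open_Int V open_Collect_less continuous_intros contv)
    show "orig \<in> V \<inter> {z. lo < \<omega> z} \<inter> {z. \<omega> z < hi'}" using V lohi by (simp add: \<omega>_def)
    fix z assume z: "z \<in> V \<inter> {z. lo < \<omega> z} \<inter> {z. \<omega> z < hi'}" "lp (lift z) N = lp (lift orig) N"
    have "\<omega> z \<in> h ` {- \<eta>..\<eta>}" using z(1) by (intro img) auto
    then obtain s where s: "s \<in> {- \<eta>..\<eta>}" "\<omega> z = h s" by blast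
    then have s': "\<bar>s\<bar> \<le> \<eta>" by (simp add: abs_le_iff)
    have "z = bpt f s" using on[OF s'] s z by (intro inj) (auto simp: h_def)
    then show "z \<in> frontier K" using on[OF s'] by simp
  qed
qed

lemma all_smooth': "body K \<Longrightarrow> body L \<Longrightarrow> sym_pair K L \<Longrightarrow> x \<in> frontier K \<Longrightarrow> smooth_pt K x"
  using exists_smooth all_smooth by metis

lemma germ_exists:
  assumes K: "body K" and L: "body L" and sym: "sym_pair K L" and x: "x \<in> frontier K"
  obtains N where "germ K x N"
proof -
  have sm: "smooth_pt K x" by (rule all_smooth'[OF K L sym x])
  obtain y where y: "smooth_pt L y" using exists_smooth[OF L] .
  obtain A where A: "A \<in> SO" "mv A x = orig" "normal_pos (mv A ` K)" using smooth_normalise[OF K sm] .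
  obtain B where B: "B \<in> SO" "mv B y = orig" "normal_pos (mv B ` L)" using smooth_normalise[OF L y] .
  define K' where "K' = mv A ` K"
  have bK: "body K'" and bL: "body (mv B ` L)" unfolding K'_def using body_mv K L A(1) B(1) by auto
  obtain \<delta> f where f: "flat_graph K' \<delta> f" using flat_graph_exists[OF bK] A(3) unfolding K'_def by blast
  obtain \<epsilon> g where g: "flat_graph (mv B ` L) \<epsilon> g" using flat_graph_exists[OF bL B(3)] .
  have sym': "sym_pair K' (mv B ` L)" unfolding K'_def by (intro sym_pair_mv sym A B)
  obtain N \<eta> where N: "N \<noteq> 0" "0 < \<eta>" "\<eta> < \<delta>" "\<And>s. \<bar>s\<bar> < \<eta> \<Longrightarrow> lp (lift (bpt f s)) N = lp (lift orig) N"
    using planar_near_orig[OF bK f bL g sym'] by blast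
  define U where "U = {z. \<bar>Re (kl z)\<bar> < \<eta>} \<inter> {z. Im (kl z) < 4 * \<delta>}"
  have U: "open U" "orig \<in> U" unfolding U_def using N(2,3)
    by (auto intro!: open_Int open_Collect_less continuous_intros)
  have NU: "lp (lift z) N = lp (lift orig) N" if "z \<in> frontier K'" "z \<in> U" for z
  proof -
    have "z = bpt f (Re (kl z))" using that N(3) by (intro frontier_bpt[OF bK f]) (auto simp: U_def)
    then show ?thesis using N(4)[of "Re (kl z)"] that(2) by (simp add: U_def)
  qed
  obtain W where W: "open W" "orig \<in> W" "\<And>z. z \<in> W \<Longrightarrow> lp (lift z) N = lp (lift orig) N \<Longrightarrow> z \<in> frontier K'"
    using plane_in_frontier[OF bK f U N(1) NU] by blast
  have "orig \<in> frontier K'" using W by blast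
  have "z \<in> frontier K' \<longleftrightarrow> lp (lift z) N = lp (lift orig) N" if "z \<in> U \<inter> W" for z
    using NU[of z] W(3)[of z] that by blast
  then have "germ K' orig N" unfolding germ_def using N(1) W(1,2) U \<open>orig \<in> frontier K'\<close> by blast
  moreover obtain C where C: "C \<in> SO" "\<And>x. mv C (mv A x) = x" using mv_vimage[OF A(1)] by metis
  ultimately have "germ (mv C ` K') (mv C orig) (C N)" using germ_mv bK by blast
  moreover have "mv C ` K' = K" "mv C orig = x" by (simp_all add: K'_def image_image C(2) flip: A(2))
  ultimately show ?thesis using that by simp
qed

lemma small_chord:
  assumes K: "body K" "flat_graph K \<delta> f" and t: "0 < t1" "t1 < \<delta>" and c: "1 < c" "c \<le> lp (lift (bpt f 0)) (lift (bpt f t1))"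
  obtains t where "0 < t" "t \<le> t1" "lp (lift (bpt f 0)) (lift (bpt f t)) = c"
proof -
  have "continuous_on {0..t1} (\<lambda>t. lp (lift (bpt f 0)) (lift (bpt f t)))"
    using t by (intro continuous_intros continuous_on_subset[OF continuous_bpt[OF K]]) auto
  then obtain t where "0 \<le> t" "t \<le> t1" "lp (lift (bpt f 0)) (lift (bpt f t)) = c"
    using IVT'[of "\<lambda>t. lp (lift (bpt f 0)) (lift (bpt f t))" 0 c t1] c t by auto
  moreover have "t \<noteq> 0" using calculation(3) c(1) by auto
  ultimately show ?thesis using that[of t] by simp
qed

text \<open>Short caps at \<open>x\<close> and \<open>y\<close> over chords of equal length are
  congruent, so an arc of one boundary is moved into the plane of the other; three points then
  identify normal and level up to the common factor \<open>c\<close>.\<close>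

lemma germ_match:
  assumes K: "body K" and L: "body L" and sym: "sym_pair K L" and gK: "germ K x N" and gL: "germ L y N'"
  obtains A c where "A \<in> SO" "c \<noteq> 0" "A N' = c *\<^sub>R N" "lp (lift y) N' = c * lp (lift x) N"
proof -
  have smx: "smooth_pt K x" using all_smooth'[OF K L sym] gK by (simp add: germ_def)
  have smy: "smooth_pt L y" using all_smooth'[OF L K sym_pair_commute[OF sym]] gL by (simp add: germ_def)
  obtain A where A: "A \<in> SO" "mv A x = orig" "normal_pos (mv A ` K)" using smooth_normalise[OF K smx] .
  obtain B where B: "B \<in> SO" "mv B y = orig" "normal_pos (mv B ` L)" using smooth_normalise[OF L smy] .
  define K' L' where "K' = mv A ` K" and "L' = mv B ` L"
  have bK: "body K'" and bL: "body L'" unfolding K'_def L'_def using body_mv K L A(1) B(1) by auto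
  obtain \<delta> f where f: "flat_graph K' \<delta> f" using flat_graph_exists[OF bK] A(3) unfolding K'_def by blast
  obtain \<epsilon> g where g: "flat_graph L' \<epsilon> g" using flat_graph_exists[OF bL] B(3) unfolding L'_def by blast
  have sym': "sym_pair K' L'" unfolding K'_def L'_def by (intro sym_pair_mv sym A B)
  have "germ K' orig (A N)" using germ_mv[OF A(1) K gK] by (simp add: K'_def A)
  then obtain W where W: "open W" "orig \<in> W" "\<And>z. z \<in> W \<Longrightarrow> z \<in> frontier K' \<longleftrightarrow> lp (lift z) (A N) = lp (lift orig) (A N)"
    and AN: "A N \<noteq> 0" unfolding germ_def by blast
  have "germ L' orig (B N')" using germ_mv[OF B(1) L gL] by (simp add: L'_def B)
  then obtain W' where W': "open W'" "orig \<in> W'" "\<And>z. z \<in> W' \<Longrightarrow> z \<in> frontier L' \<longleftrightarrow> lp (lift z) (B N') = lp (lift orig) (B N')"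
    and BN: "B N' \<noteq> 0" unfolding germ_def by blast
  obtain s1 where s1: "0 < s1" "s1 < \<delta>" "\<And>s. \<bar>s\<bar> \<le> s1 \<Longrightarrow> bpt f s \<in> W" using path_in_open[OF bK f W(1,2)] by blast
  obtain t1 where t1: "0 < t1" "t1 < \<epsilon>" "\<And>s. \<bar>s\<bar> \<le> t1 \<Longrightarrow> bpt g s \<in> W'" using path_in_open[OF bL g W'(1,2)] by blast
  \<comment> \<open>A chord length attained on both arcs within the neighbourhoods described by the
    germs.\<close>
  define c where "c = min (lp (lift (bpt f 0)) (lift (bpt f s1))) (lp (lift (bpt g 0)) (lift (bpt g t1)))"
  have "bpt f 0 \<noteq> bpt f s1" "bpt g 0 \<noteq> bpt g t1"
    using bpt_inj[OF bK f, of 0 s1] bpt_inj[OF bL g, of 0 t1] s1 t1 by auto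
  then have c: "1 < c" by (simp add: c_def lp_lift_gt_1)
  obtain s where s: "0 < s" "s \<le> s1" "lp (lift (bpt f 0)) (lift (bpt f s)) = c"
    using small_chord[OF bK f s1(1,2) c] by (auto simp: c_def)
  obtain t where t: "0 < t" "t \<le> t1" "lp (lift (bpt g 0)) (lift (bpt g t)) = c"
    using small_chord[OF bL g t1(1,2) c] by (auto simp: c_def)
  have "lp (lift (bpt g 0)) (lift (bpt g t)) = lp (lift (bpt f 0)) (lift (bpt f s))" using s t by simp
  then obtain C where C: "C \<in> SO" "mv C (bpt g 0) = bpt f 0" "mv C (bpt g t) = bpt f s" by (rule SO_pairs)
  have rng: "0 < s" "\<bar>0\<bar> < \<delta>" "\<bar>s\<bar> < \<delta>" "0 < t" "\<bar>0\<bar> < \<epsilon>" "\<bar>t\<bar> < \<epsilon>" using s t s1 t1 by auto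
  have cap: "z \<in> K' \<longleftrightarrow> z \<in> mv C ` L'" if "side (bpt f 0) (bpt f s) z < 0" for z
    by (rule cap_congruence[OF bK bL sym' bpt_flat_chord[OF bK f rng(1-3)] bpt_flat_chord[OF bL g rng(4-6)] C that])
  have onK: "lp (lift (mv C (bpt g r))) (A N) = lp (lift orig) (A N)" if r: "0 \<le> r" "r \<le> t" for r
  proof -
    obtain u where u: "0 \<le> u" "u \<le> s" "mv C (bpt g r) = bpt f u"
      using arc_transport[OF bL g bK f rng(4-6) rng(1-3) C cap r] by blast
    have "bpt f u \<in> W" using u s by (intro s1(3)) auto
    moreover have "bpt f u \<in> frontier K'" using u s s1 by (intro bpt_frontier[OF bK f]) auto
    ultimately show ?thesis using W(3) u by metis
  qed
  have onL: "lp (lift (mv C (bpt g r))) (C (B N')) = lp (lift orig) (B N')" if "0 \<le> r" "r \<le> t" for r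
  proof -
    have "bpt g r \<in> W'" using that t by (intro t1(3)) auto
    moreover have "bpt g r \<in> frontier L'" using that t t1 by (intro bpt_frontier[OF bL g]) auto
    ultimately have "lp (lift (bpt g r)) (B N') = lp (lift orig) (B N')" using W'(3) by metis
    then show ?thesis using C(1) by simp
  qed
  have ne: "mv C (bpt g r) \<noteq> mv C (bpt g r')" if "0 \<le> r" "r \<le> t" "0 \<le> r'" "r' \<le> t" "r \<noteq> r'" for r r'
  proof
    assume "mv C (bpt g r) = mv C (bpt g r')"
    then have "bpt g r = bpt g r'" using bij_is_inj[OF mv_bij[OF C(1)]] by (metis injD)
    moreover have "\<bar>r\<bar> < 4 * \<epsilon>" "\<bar>r'\<bar> < 4 * \<epsilon>" using that t t1 by auto
    ultimately show False using bpt_inj[OF bL g] that(5) by blast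
  qed
  obtain \<mu> where \<mu>: "C (B N') = \<mu> *\<^sub>R A N"
    by (rule plane_unique[of "mv C (bpt g 0)" "mv C (bpt g (t / 2))" "mv C (bpt g t)" "A N" "C (B N')"])
       (use t AN onK onL ne in \<open>auto simp: less_imp_le\<close>)
  obtain D where D: "D \<in> SO" "\<And>X. D (A X) = X" using mv_vimage[OF A(1)] by metis
  have "D (C (B N')) = \<mu> *\<^sub>R N" unfolding \<mu> linear_scale[OF SO_linear[OF D(1)]] D(2) ..
  moreover have "\<mu> \<noteq> 0" using \<mu> SO_nonzero[OF C(1) BN] by auto
  moreover have "lp (lift y) N' = \<mu> * lp (lift x) N"
  proof -
    have "lp (lift y) N' = lp (B (lift y)) (B N')" using B(1) by simp
    also have "\<dots> = lp (lift orig) (B N')" using B(1) by (metis B(2) lift_mv)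
    also have "\<dots> = lp (lift (mv C (bpt g 0))) (\<mu> *\<^sub>R A N)" using onL[of 0] t \<mu> by simp
    also have "\<dots> = \<mu> * lp (lift orig) (A N)" using onK[of 0] t by simp
    also have "lp (lift orig) (A N) = lp (A (lift x)) (A N)" using A(1) by (metis A(2) lift_mv)
    also have "\<dots> = lp (lift x) N" using A(1) by simp
    finally show ?thesis .
  qed
  moreover have "D \<circ> (C \<circ> B) \<in> SO" by (intro SO_comp D C B)
  ultimately show ?thesis using that[of "D \<circ> (C \<circ> B)" \<mu>] by simp
qed

text \<open>The points of the section with germ \<open>N\<close> form an open and closed subset of
  it.\<close>

lemma full_plane:
  assumes K: "body K" and sm: "\<And>x. x \<in> frontier K \<Longrightarrow> smooth_pt K x" and ex: "\<And>x. x \<in> frontier K \<Longrightarrow> \<exists>N. germ K x N"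
    and g: "germ K x N" and conn: "connected {z. lp (lift z) N = lp (lift x) N}"
    and z: "lp (lift z) N = lp (lift x) N"
  shows "germ K z N"
proof -
  define CC where "CC = {z. lp (lift z) N = lp (lift x) N}"
  define S where "S = {z. z \<in> CC \<and> germ K z N}"
  have xS: "x \<in> S" using g by (simp add: S_def CC_def)
  have N0: "N \<noteq> 0" using g by (simp add: germ_def)
  have op: "\<exists>T. open T \<and> z \<in> T \<and> T \<inter> CC \<subseteq> S" if "z \<in> S" for z
  proof -
    obtain W where W: "open W" "z \<in> W" "\<And>w. w \<in> W \<Longrightarrow> w \<in> frontier K \<longleftrightarrow> lp (lift w) N = lp (lift z) N"
      using \<open>z \<in> S\<close> unfolding S_def germ_def by blast
    have "W \<inter> CC \<subseteq> S"
    proof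
      fix w assume w: "w \<in> W \<inter> CC"
      have e: "lp (lift w) N = lp (lift z) N" using w \<open>z \<in> S\<close> by (simp add: S_def CC_def)
      then have "germ K w N" unfolding germ_def using W w N0 by (intro conjI exI[of _ W]) auto
      then show "w \<in> S" using w by (simp add: S_def)
    qed
    then show ?thesis using W by blast
  qed
  have "openin (top_of_set CC) S"
    unfolding openin_subtopology_alt
  proof -
    define T where "T = \<Union>{T. open T \<and> T \<inter> CC \<subseteq> S}"
    have "open T" unfolding T_def by auto
    moreover have "S = CC \<inter> T" using op by (auto simp: T_def S_def)
    ultimately show "S \<in> (\<inter>) CC ` Collect (openin euclidean)" by auto
  qed
  moreover have "closedin (top_of_set CC) S"
    unfolding closedin_limpt
  proof (intro conjI allI impI)
    show "S \<subseteq> CC" by (auto simp: S_def)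
    fix z assume z: "z islimpt S \<and> z \<in> CC"
    have "S \<subseteq> frontier K" by (auto simp: S_def germ_def)
    then have zf: "z \<in> frontier K" using z frontier_closed closed_limpt islimpt_subset by blast
    obtain N' where N': "germ K z N'" using ex[OF zf] by blast
    then obtain W where W: "open W" "z \<in> W" "\<And>w. w \<in> W \<Longrightarrow> w \<in> frontier K \<longleftrightarrow> lp (lift w) N' = lp (lift z) N'" and N'0: "N' \<noteq> 0"
      unfolding germ_def by blast
    obtain w where w: "w \<in> S" "w \<in> W" using z W unfolding islimpt_def by blast
    then obtain W2 where W2: "open W2" "w \<in> W2" "\<And>v. v \<in> W2 \<Longrightarrow> v \<in> frontier K \<longleftrightarrow> lp (lift v) N = lp (lift w) N"
      unfolding S_def germ_def by blast
    have wf: "w \<in> frontier K" using w \<open>S \<subseteq> frontier K\<close> by blast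
    \<comment> \<open>Near \<open>w\<close> the boundary lies in the planes of both germs, so three
      of its points identify the normals.\<close>
    obtain a b c where abc: "a \<in> frontier K \<inter> (W \<inter> W2)" "b \<in> frontier K \<inter> (W \<inter> W2)" "c \<in> frontier K \<inter> (W \<inter> W2)" "a \<noteq> b" "a \<noteq> c" "b \<noteq> c"
    proof -
      have "open (W \<inter> W2)" "w \<in> W \<inter> W2" using W W2 w by auto
      from three_frontier_points[OF K sm[OF wf] this] that show ?thesis by blast
    qed
    have p1: "lp (lift v) N = lp (lift w) N" "lp (lift v) N' = lp (lift z) N'" if "v \<in> frontier K \<inter> (W \<inter> W2)" for v
      using W(3)[of v] W2(3)[of v] that by auto
    obtain \<mu> where \<mu>: "N = \<mu> *\<^sub>R N'"
      using plane_unique[OF abc(4-6) N'0, of N] p1[OF abc(1)] p1[OF abc(2)] p1[OF abc(3)] by metis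
    then have "\<mu> \<noteq> 0" using N0 by auto
    then have "germ K z N" using germ_scaleR[OF N'] \<mu> by simp
    then show "z \<in> S" using z by (simp add: S_def)
  qed
  ultimately have "S = CC" using conn xS unfolding CC_def[symmetric] connected_clopen by blast
  then have "z \<in> S" using z by (simp add: CC_def)
  then show ?thesis by (simp add: S_def)
qed

section \<open>Plane sections are connected\<close>

lemma plane_mv:
  assumes "A \<in> SO"
  shows "{z. lp (lift z) (A N) = t} = mv A ` {z. lp (lift z) N = t}"
proof -
  obtain B where B: "B \<in> SO" "\<And>x. mv A (mv B x) = x" "\<And>x. mv B (mv A x) = x" "\<And>S. mv A ` S = mv B -` S" "\<And>X. A (B X) = X" "\<And>X. B (A X) = X"
    using mv_vimage[OF assms] by metis
  have "lp (lift z) (A N) = lp (lift (mv B z)) N" for z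
    using SO_lp[OF B(1), of "lift z" "A N"] by (simp add: B(1,6))
  then show ?thesis unfolding B(4) by auto
qed

lemma orthogonal_point:
  assumes "lp n n = -1"
  obtains c where "lp (lift c) n = 0"
proof -
  define X where "X = (1, 0) + lp (1, 0) n *\<^sub>R n"
  have "lp X n = 0" using assms by (simp add: X_def)
  have one: "lp (1, 0) (1, 0) = 1" unfolding lp_def by simp
  have two: "lp n (1, 0) = lp (1, 0) n" by (rule lp_commute)
  have f: "lp X X = 1 + (lp (1, 0) n)\<^sup>2" "lp X (1, 0) = 1 + (lp (1, 0) n)\<^sup>2"
    unfolding X_def lp_add lp_scaleR one two assms by (simp_all add: power2_eq_square)
  have "0 < 1 + (lp (1, 0) n)\<^sup>2" by (simp add: add_pos_nonneg)
  then have "future X" using f by (intro futureI[of X "(1, 0)"]) (auto simp: future_def)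
  then obtain c where "0 < c" "lift (pt X) = c *\<^sub>R X" by (rule lift_pt_pos)
  then show ?thesis using that[of "pt X"] \<open>lp X n = 0\<close> by simp
qed

text \<open>The free sign \<open>k\<close> allows \<open>K\<close> and \<open>L\<close> to be placed
  on opposite sides of the same line.\<close>

lemma normalise_spacelike:
  assumes "lp N N < 0" "k\<^sup>2 = 1"
  obtains A c where "A \<in> SO" "0 < c" "A N = c *\<^sub>R (0, of_real k * \<i>)"
proof -
  define r where "r = sqrt (- lp N N)"
  have r: "0 < r" "r * r = - lp N N" using assms by (simp_all add: r_def)
  define n where "n = N /\<^sub>R r"
  have n: "lp n n = -1" using r assms(1) by (simp add: n_def field_simps)
  obtain c where c: "lp (lift c) n = 0" using orthogonal_point[OF n] .
  have "lp (0, of_real k * \<i>) (0, of_real k * \<i>) = -1" "lp (lift orig) (0, of_real k * \<i>) = 0"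
    using assms(2) by (simp_all add: lp_def inner_complex_def power2_eq_square)
  then obtain A where A: "A \<in> SO" "A n = (0, of_real k * \<i>)" using SO_flags[OF n c] by metis
  have "N = r *\<^sub>R n" using r by (simp add: n_def)
  then have "A N = r *\<^sub>R (0, of_real k * \<i>)" using A linear_scale[OF SO_linear[OF A(1)]] by metis
  then show ?thesis using that A r by blast
qed

lemma normalise_null:
  assumes "lp N N = 0" "N \<noteq> 0"
  obtains A c where "A \<in> SO" "c \<noteq> 0" "A N = c *\<^sub>R (1, 1)"
proof -
  have e: "(fst N)\<^sup>2 = (cmod (snd N))\<^sup>2" using assms(1) by (simp add: lp_self)
  have c: "fst N \<noteq> 0" using assms(2) e by (auto simp: prod_eq_iff)
  define u where "u = snd N /\<^sub>R fst N"
  have "cmod u = cmod (snd N) / \<bar>fst N\<bar>" by (simp add: u_def divide_inverse mult.commute)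
  also have "\<bar>fst N\<bar> = cmod (snd N)" using e by (metis abs_norm_cancel power2_eq_iff_nonneg abs_ge_zero norm_ge_zero power2_abs)
  finally have u: "cmod u = 1" using c e by auto
  \<comment> \<open>\<open>act w 0\<close> multiplies the space part by the square of
    \<open>w\<close>, so it rotates \<open>u\<close> to 1.\<close>
  define w where "w = csqrt (inverse u)"
  have w2: "w\<^sup>2 = inverse u" by (simp add: w_def)
  then have "(cmod w)\<^sup>2 = 1" using u by (metis norm_inverse norm_power inverse_1)
  then have w1: "cmod w = 1" by (simp add: power2_eq_1_iff) (smt (verit) norm_ge_zero)
  have A: "act w 0 \<in> SO" unfolding SO_def by (intro CollectI exI[of _ w] exI[of _ "0::complex"]) (use w1 in simp)
  have "u \<noteq> 0" using u by auto
  then have "act w 0 (1, u) = (1, 1)" using w1 w2 by (simp add: act_def)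
  moreover have "N = fst N *\<^sub>R (1, u)" using c by (simp add: u_def prod_eq_iff)
  ultimately have "act w 0 N = fst N *\<^sub>R (1, 1)" by (metis act_scaleR)
  then show ?thesis using that A c by blast
qed

lemma normalise_timelike:
  assumes "0 < lp N N"
  obtains A c where "A \<in> SO" "c \<noteq> 0" "A N = c *\<^sub>R (1, 0)"
proof -
  have "(cmod (snd N))\<^sup>2 < (fst N)\<^sup>2" using assms by (simp add: lp_self)
  then have lt: "cmod (snd N) < \<bar>fst N\<bar>" by (metis abs_norm_cancel abs_le_square_iff not_le)
  define s where "s = sgn (fst N)"
  have s: "s \<noteq> 0" "s * s = 1" using lt by (auto simp: s_def sgn_if)
  have f: "future (s *\<^sub>R N)" using lt by (auto simp: future_def s_def sgn_if)
  then obtain r where r: "0 < r" "lift (pt (s *\<^sub>R N)) = r *\<^sub>R (s *\<^sub>R N)" by (rule lift_pt_pos)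
  have "lp (lift (pt (s *\<^sub>R N))) (lift (pt (s *\<^sub>R N))) = lp (lift orig) (lift orig)" by (simp only: lp_lift_self)
  then obtain A where A: "A \<in> SO" "mv A (pt (s *\<^sub>R N)) = orig" by (rule SO_pairs)
  have "A (r *\<^sub>R (s *\<^sub>R N)) = (1, 0)" using A lift_mv[OF A(1)] r by (metis lift_orig)
  then have "(r * s) *\<^sub>R A N = (1, 0)" using linear_scale[OF SO_linear[OF A(1)]] by simp
  then have "A N = (1 / (r * s)) *\<^sub>R (1, 0)" using r s by (metis divide_inverse mult_1 scaleR_one scaleR_scaleR left_inverse mult_eq_0_iff less_irrefl)
  then show ?thesis using that A r s by (metis divide_eq_0_iff mult_eq_0_iff less_irrefl zero_neq_one)
qed

text \<open>The plane sections \<open>\<langle>X, (0, - \<i>)\<rangle> = t\<close> (equidistant curve) and \<open>\<langle>X, (1, 1)\<rangle> = t\<close> (horocycle), parametrised by \<open>s\<close>.\<close>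

definition hcycle :: "real \<Rightarrow> real \<Rightarrow> vec" where
  "hcycle t s = (sqrt (1 + s\<^sup>2 + t\<^sup>2), Complex s t)"

definition horoc :: "real \<Rightarrow> real \<Rightarrow> vec" where
  "horoc t s = (((1 + s\<^sup>2) / t + t) / 2, Complex (((1 + s\<^sup>2) / t - t) / 2) s)"

lemma hcycle_unit: "lp (hcycle t s) (hcycle t s) = 1" "future (hcycle t s)"
proof -
  have "0 \<le> 1 + s\<^sup>2 + t\<^sup>2" by (simp add: add_nonneg_nonneg)
  then show "lp (hcycle t s) (hcycle t s) = 1" by (simp add: hcycle_def lp_self cmod_power2)
  moreover have "0 \<le> lp (hcycle t s) (1, 0)" by (simp add: hcycle_def lp_def)
  moreover have "future (1, 0)" by (simp add: future_def)
  ultimately show "future (hcycle t s)" by (metis futureI zero_less_one)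
qed

lemma horoc_unit: "0 < t \<Longrightarrow> lp (horoc t s) (horoc t s) = 1" "0 < t \<Longrightarrow> future (horoc t s)"
proof -
  assume t: "0 < t"
  show "lp (horoc t s) (horoc t s) = 1"
  proof -
    define p where "p = (1 + s\<^sup>2) / t"
    have "p * t = 1 + s\<^sup>2" using t by (simp add: p_def)
    moreover have "((p + t) / 2)\<^sup>2 - (((p - t) / 2)\<^sup>2 + s\<^sup>2) = p * t - s\<^sup>2"
      by (simp add: power2_eq_square field_simps)
    ultimately show ?thesis unfolding lp_self horoc_def cmod_power2 p_def[symmetric] by simp
  qed
  moreover have "0 \<le> lp (horoc t s) (1, 0)" using t by (simp add: horoc_def lp_def)
  moreover have "future (1, 0)" by (simp add: future_def)
  ultimately show "future (horoc t s)" by (metis futureI zero_less_one)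
qed

lemma lift_hcycle: "lift (pt (hcycle t s)) = hcycle t s"
  by (simp add: lift_pt_unit hcycle_unit)

lemma lift_horoc: "0 < t \<Longrightarrow> lift (pt (horoc t s)) = horoc t s"
  by (simp add: lift_pt_unit horoc_unit)

lemma hypercycle_eq: "{z. lp (lift z) (0, - \<i>) = t} = range (\<lambda>s. pt (hcycle t s))"
proof (intro equalityI subsetI)
  fix z assume "z \<in> {z. lp (lift z) (0, - \<i>) = t}"
  then have t: "Im (snd (lift z)) = t" by (simp add: lp_def inner_complex_def)
  have "(fst (lift z))\<^sup>2 = 1 + (Re (snd (lift z)))\<^sup>2 + t\<^sup>2"
    using lp_lift_self[of z] by (simp add: lp_self cmod_power2 t)
  then have "fst (lift z) = sqrt (1 + (Re (snd (lift z)))\<^sup>2 + t\<^sup>2)"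
    by (metis fst_lift_pos less_imp_le real_sqrt_unique)
  then have "lift z = hcycle t (Re (snd (lift z)))" using t by (simp add: hcycle_def prod_eq_iff complex_eq_iff)
  from arg_cong[OF this, of pt] have "z = pt (hcycle t (Re (snd (lift z))))" by (simp only: pt_lift)
  then show "z \<in> range (\<lambda>s. pt (hcycle t s))" by blast
qed (auto simp: lift_hcycle, simp add: hcycle_def lp_def inner_complex_def)

lemma horocycle_eq:
  assumes "0 < t"
  shows "{z. lp (lift z) (1, 1) = t} = range (\<lambda>s. pt (horoc t s))"
proof (intro equalityI subsetI)
  fix z assume "z \<in> {z. lp (lift z) (1, 1) = t}"
  then have t: "fst (lift z) - Re (snd (lift z)) = t" by (simp add: lp_def inner_complex_def)
  have "(fst (lift z))\<^sup>2 - (Re (snd (lift z)))\<^sup>2 = 1 + (Im (snd (lift z)))\<^sup>2"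
    using lp_lift_self[of z] by (simp add: lp_self cmod_power2)
  then have "(fst (lift z) + Re (snd (lift z))) * t = 1 + (Im (snd (lift z)))\<^sup>2"
    unfolding t[symmetric] by (simp add: power2_eq_square algebra_simps)
  then have "fst (lift z) + Re (snd (lift z)) = (1 + (Im (snd (lift z)))\<^sup>2) / t" using assms by (simp add: field_simps)
  then have "lift z = horoc t (Im (snd (lift z)))" using t by (simp add: horoc_def prod_eq_iff complex_eq_iff)
  from arg_cong[OF this, of pt] have "z = pt (horoc t (Im (snd (lift z))))" by (simp only: pt_lift)
  then show "z \<in> range (\<lambda>s. pt (horoc t s))" by blast
qed (auto simp: lift_horoc assms, simp add: horoc_def lp_def inner_complex_def diff_divide_distrib add_divide_distrib)

lemma connected_hypercycle: "connected {z. lp (lift z) (0, - \<i>) = t}"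
  unfolding hypercycle_eq hcycle_def
  by (intro connected_continuous_image continuous_intros continuous_on_Complex)
     (use hcycle_unit[unfolded hcycle_def] in auto)

lemma connected_horocycle: "connected {z. lp (lift z) (1, 1) = t}"
proof (cases "0 < t")
  case True
  show ?thesis unfolding horocycle_eq[OF True] horoc_def
    by (intro connected_continuous_image continuous_intros continuous_on_Complex)
       (use horoc_unit[OF True, unfolded horoc_def] True in auto)
next
  case False
  have "0 < lp (lift z) (1, 1)" for z by (intro future_lp_pos2) (auto simp: zero_prod_def)
  then have "{z. lp (lift z) (1, 1) = t} = {}" using False by force
  then show ?thesis by simp
qed

lemma fst_lift_kl_circle: "fst (lift z) = t \<longleftrightarrow> 1 \<le> t \<and> cmod (kl z) = sqrt (1 - 1 / t\<^sup>2)"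
proof -
  have e: "(fst (lift z))\<^sup>2 * (1 - (cmod (kl z))\<^sup>2) = 1" by (rule fst_lift_sq)
  have ge: "1 \<le> fst (lift z)" using lp_lift_ge_1[of z orig] by (simp add: lp_def)
  have k: "(cmod (kl z))\<^sup>2 = 1 - 1 / (fst (lift z))\<^sup>2" using e ge by (simp add: field_simps)
  show ?thesis
  proof
    assume "fst (lift z) = t"
    then show "1 \<le> t \<and> cmod (kl z) = sqrt (1 - 1 / t\<^sup>2)" using k ge by (metis norm_ge_zero real_sqrt_unique)
  next
    assume t: "1 \<le> t \<and> cmod (kl z) = sqrt (1 - 1 / t\<^sup>2)"
    then have "(cmod (kl z))\<^sup>2 = 1 - 1 / t\<^sup>2" by (simp add: one_le_power)
    then have "(fst (lift z))\<^sup>2 = t\<^sup>2" using k by simp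
    then show "fst (lift z) = t" using t ge by (simp add: power2_eq_iff_nonneg)
  qed
qed

lemma connected_circle: "connected {z. lp (lift z) (1, 0) = t}"
proof (cases "1 \<le> t")
  case True
  define R where "R = sqrt (1 - 1 / t\<^sup>2)"
  have R: "R < 1" using True by (simp add: R_def)
  have "{z. lp (lift z) (1, 0) = t} = kp ` sphere 0 R"
  proof (intro equalityI subsetI)
    fix z assume "z \<in> {z. lp (lift z) (1, 0) = t}"
    then have "kl z \<in> sphere 0 R" using fst_lift_kl_circle[of z t] by (simp add: lp_def R_def)
    then show "z \<in> kp ` sphere 0 R" by (metis imageI kp_kl)
  next
    fix z assume "z \<in> kp ` sphere 0 R"
    then have "cmod (kl z) = R" using R by auto
    then show "z \<in> {z. lp (lift z) (1, 0) = t}" using fst_lift_kl_circle[of z t] True by (simp add: lp_def R_def)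
  qed
  moreover have "connected (sphere (0::complex) R)" by (intro connected_sphere) simp
  then have "connected (kp ` sphere 0 R)"
    using R by (intro connected_continuous_image continuous_intros) auto
  ultimately show ?thesis by simp
next
  case False
  have "1 \<le> fst (lift z)" for z using lp_lift_ge_1[of z orig] by (simp add: lp_def)
  then have "{z. lp (lift z) (1, 0) = t} = {}" using False by (force simp: lp_def)
  then show ?thesis by simp
qed

lemma connected_plane:
  assumes "N \<noteq> 0"
  shows "connected {z. lp (lift z) N = t}"
proof -
  have *: ?thesis if A: "A \<in> SO" "c \<noteq> 0" "A N = c *\<^sub>R M" and M: "\<And>t. connected {z. lp (lift z) M = t}" for A c M
  proof -
    obtain B where B: "B \<in> SO" "\<And>X. B (A X) = X" using mv_vimage[OF A(1)] by metis
    have "{z. lp (lift z) N = t} = {z. lp (lift z) (B (A N)) = t}" by (simp add: B)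
    also have "\<dots> = mv B ` {z. lp (lift z) (c *\<^sub>R M) = t}" unfolding plane_mv[OF B(1)] A(3) ..
    also have "{z. lp (lift z) (c *\<^sub>R M) = t} = {z. lp (lift z) M = t / c}" using A(2) by (auto simp: field_simps)
    finally show ?thesis using connected_continuous_image[OF continuous_mv[OF B(1)] M] by simp
  qed
  consider "0 < lp N N" | "lp N N = 0" | "lp N N < 0" by linarith
  then show ?thesis
  proof cases
    case 1 then show ?thesis using normalise_timelike[OF 1] * connected_circle by metis
  next
    case 2 then show ?thesis using normalise_null[OF 2 assms] * connected_horocycle by metis
  next
    case 3
    obtain A c where A: "A \<in> SO" "0 < c" "A N = c *\<^sub>R (0, of_real (- 1) * \<i>)" using normalise_spacelike[OF 3, of "- 1"] by auto
    show ?thesis by (rule *[OF A(1) _ _ connected_hypercycle, of c]) (use A in auto)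
  qed
qed

lemma plane_germ:
  assumes "body K" "body L" "sym_pair K L" "germ K x N" "lp (lift z) N = lp (lift x) N"
  shows "germ K z N"
proof -
  have "N \<noteq> 0" using assms(4) by (simp add: germ_def)
  then show ?thesis
    using full_plane[OF assms(1) _ _ assms(4) connected_plane assms(5)]
      all_smooth'[OF assms(1-3)] germ_exists[OF assms(1-3)] by blast
qed

section \<open>The side of a plane section on which the body lies\<close>

lemma segment_crosses:
  assumes K: "hyp_convex K" and o: "o' \<in> interior K" and z: "z \<in> K"
    and sgn: "(lp (lift o') N - t) * (lp (lift z) N - t) < 0"
  shows "\<exists>w\<in>interior K. lp (lift w) N = t"
proof -
  define p where "p u = kp ((1 - u) *\<^sub>R kl o' + u *\<^sub>R kl z)" for u
  have lt: "cmod ((1 - u) *\<^sub>R kl o' + u *\<^sub>R kl z) < 1" if "0 \<le> u" "u \<le> 1" for u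
    using convexD[OF convex_ball, of "kl o'" 0 1 "kl z" "1 - u" u] norm_kl that by simp
  define g where "g u = lp (lift (p u)) N - t" for u
  have gc: "continuous_on {0..1} g" unfolding g_def p_def using lt by (intro continuous_intros) auto
  have g01: "g 0 = lp (lift o') N - t" "g 1 = lp (lift z) N - t" by (simp_all add: g_def p_def)
  have "connected (g ` {0..1})" by (intro connected_continuous_image gc) simp
  then have ivl: "v \<in> g ` {0..1}" if "a \<in> g ` {0..1}" "b \<in> g ` {0..1}" "a \<le> v" "v \<le> b" for a b v
    using that unfolding is_interval_connected_1[symmetric] is_interval_1 by blast
  have "g 0 \<in> g ` {0..1}" "g 1 \<in> g ` {0..1}" by auto
  moreover have "(g 0 \<le> 0 \<and> 0 \<le> g 1) \<or> (g 1 \<le> 0 \<and> 0 \<le> g 0)"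
    using sgn unfolding g01 mult_less_0_iff by linarith
  ultimately have "0 \<in> g ` {0..1}" using ivl by blast
  then obtain u where u: "0 \<le> u" "u \<le> 1" "g u = 0" by auto
  have "u \<noteq> 0" "u \<noteq> 1" using u(3) g01 sgn by auto
  have 1: "kl o' \<in> interior (kl ` K)" using o by (metis interior_kl kp_kl norm_kl)
  have 2: "kl z \<in> closure (kl ` K)" using z by (intro subsetD[OF closure_subset]) simp
  have 3: "(1 - u) *\<^sub>R kl o' + u *\<^sub>R kl z \<in> open_segment (kl o') (kl z)"
  proof -
    have "kl o' \<noteq> kl z" using sgn by (auto simp: kl_inj mult_less_0_iff)
    then show ?thesis unfolding in_segment using u \<open>u \<noteq> 0\<close> \<open>u \<noteq> 1\<close> by (intro conjI exI[of _ u]) auto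
  qed
  have "(1 - u) *\<^sub>R kl o' + u *\<^sub>R kl z \<in> interior (kl ` K)"
    by (rule subsetD[OF in_interior_closure_convex_segment[OF convex_kl_image[OF K] 1 2] 3])
  then have "p u \<in> interior K" using lt[OF u(1,2)] by (simp add: p_def interior_kl)
  moreover have "lp (lift (p u)) N = t" using u(3) by (simp add: g_def)
  ultimately show ?thesis by blast
qed

text \<open>A segment from an interior point to a point of \<open>K\<close> is interior except
  possibly at its end, so it cannot cross a section consisting of boundary points.\<close>

lemma interior_side:
  assumes K: "body K" and fr: "{z. lp (lift z) N = t} \<subseteq> frontier K"
  shows "(\<forall>z\<in>K. t \<le> lp (lift z) N) \<or> (\<forall>z\<in>K. lp (lift z) N \<le> t)"
proof -
  obtain o' where o: "o' \<in> interior K" using K by (auto simp: body_def)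
  have ne: "lp (lift w) N \<noteq> t" if "w \<in> interior K" for w using fr that by (auto simp: frontier_def)
  have key: "\<not> (lp (lift o') N - t) * (lp (lift z) N - t) < 0" if "z \<in> K" for z
    using segment_crosses[OF _ o that, of N t] K ne unfolding body_def by blast
  consider "lp (lift o') N < t" | "t < lp (lift o') N" using ne[OF o] by linarith
  then show ?thesis
  proof cases
    case 1
    then have "lp (lift z) N \<le> t" if "z \<in> K" for z using key[OF that] by (auto simp: mult_less_0_iff)
    then show ?thesis by blast
  next
    case 2
    then have "t \<le> lp (lift z) N" if "z \<in> K" for z using key[OF that] by (auto simp: mult_less_0_iff)
    then show ?thesis by blast
  qed
qed

text \<open>At the midpoint of two points of the section the value is \<open>2 * t / r\<close> with
  \<open>r > 2\<close>, which is less than \<open>t\<close> when \<open>t\<close> is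
  positive.\<close>

lemma convex_side_sign:
  assumes K: "hyp_convex K" and pq: "p \<in> K" "q \<in> K" "p \<noteq> q" "lp (lift p) N = t" "lp (lift q) N = t"
    and side: "\<And>z. z \<in> K \<Longrightarrow> t \<le> lp (lift z) N"
  shows "t \<le> 0"
proof (rule ccontr)
  assume t: "\<not> t \<le> 0"
  define P where "P = lp (lift p) (lift q)"
  have P: "1 < P" using pq(3) by (simp add: P_def lp_lift_gt_1)
  obtain m where m: "sqrt (2 * (1 + P)) *\<^sub>R lift m = lift p + lift q" using midpoint_exists[of p q] by (auto simp: P_def)
  define r where "r = sqrt (2 * (1 + P))"
  have r: "2 < r" unfolding r_def using P by (intro real_less_rsqrt) simp
  have "lift m = (1 / r) *\<^sub>R lift p + (1 / r) *\<^sub>R lift q"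
    using r by (simp add: m[folded r_def, symmetric] flip: scaleR_add_right)
  then have "m \<in> K" using hyp_convexD[OF K pq(1,2), of "1 / r" "1 / r" m] r by simp
  then have "t \<le> lp (lift m) N" by (rule side)
  then have "t * r \<le> r * lp (lift m) N" using r by (simp add: mult.commute)
  also have "\<dots> = 2 * t" using arg_cong[OF m, of "\<lambda>X. lp X N"] pq by (simp add: r_def)
  finally show False using t r by (simp add: mult.commute)
qed

section \<open>Circles\<close>

lemma mv_cball:
  assumes "A \<in> SO"
  shows "mv A ` cball c r = cball (mv A c) r"
proof -
  obtain B where B: "B \<in> SO" "\<And>x. mv A (mv B x) = x" "\<And>x. mv B (mv A x) = x" "\<And>S. mv A ` S = mv B -` S"
    using mv_vimage[OF assms] by metis
  have "dist c (mv B z) = dist (mv A c) z" for z using dist_mv[OF assms, of c "mv B z"] by (simp add: B)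
  then show ?thesis unfolding B(4) by auto
qed

text \<open>Diametrically opposite points of the circle fill the disc by convexity; a point of
  \<open>K\<close> outside would turn a point of the circle into an interior point.\<close>

lemma body_circle:
  assumes K: "body K" and t: "1 < t" and fr: "{z. fst (lift z) = t} \<subseteq> frontier K"
  shows "K = cball orig (arcosh t)"
proof -
  define R where "R = sqrt (1 - 1 / t\<^sup>2)"
  have t2: "1 < t\<^sup>2" using t by (simp add: one_less_power)
  then have "0 < 1 / t\<^sup>2" "1 / t\<^sup>2 < 1" using t by simp_all
  then have R: "0 < R" "R < 1" by (simp_all add: R_def)
  define C where "C = kl ` K"
  have C: "convex C" using K by (simp add: C_def body_def convex_kl_image)
  have circ: "kp k \<in> frontier K" "k \<in> C" if "cmod k = R" for k
  proof -
    have "cmod k < 1" using that R by simp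
    then have "fst (lift (kp k)) = t" using fst_lift_kl_circle[of "kp k" t] t that by (simp add: R_def)
    then show "kp k \<in> frontier K" using fr by auto
    then have "kp k \<in> K" using K frontier_subset_body by blast
    then show "k \<in> C" using \<open>cmod k < 1\<close> by (metis C_def imageI kl_kp)
  qed
  have inner: "k \<in> C" if "cmod k < R" for k
  proof -
    define u where "u = (if k = 0 then 1 else k /\<^sub>R cmod k)"
    have u: "cmod u = 1" "k = cmod k *\<^sub>R u" by (auto simp: u_def)
    define l where "l = (1 + cmod k / R) / 2"
    have "cmod k / R < 1" "0 \<le> cmod k / R" using that R by simp_all
    then have l: "0 \<le> l" "l \<le> 1" by (simp_all add: l_def)
    have "l *\<^sub>R (R *\<^sub>R u) + (1 - l) *\<^sub>R (- R *\<^sub>R u) \<in> C"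
      using l u R by (intro convexD[OF C] circ(2)) auto
    moreover have "l *\<^sub>R (R *\<^sub>R u) + (1 - l) *\<^sub>R (- R *\<^sub>R u) = ((2 * l - 1) * R) *\<^sub>R u"
      by (simp add: scaleR_conv_of_real algebra_simps)
    moreover have "2 * l - 1 = cmod k / R" unfolding l_def by argo
    moreover from this have "(2 * l - 1) * R = cmod k" using R by simp
    ultimately show ?thesis using u(2) by metis
  qed
  have outer: "cmod k \<le> R" if "k \<in> C" for k
  proof (rule ccontr)
    assume n: "\<not> cmod k \<le> R"
    have "ball 0 R \<subseteq> C" using inner by auto
    then have 1: "0 \<in> interior C" using R by (meson centre_in_ball interior_maximal open_ball subsetD)
    have 2: "k \<in> closure C" by (rule subsetD[OF closure_subset that])
    have 3: "(R / cmod k) *\<^sub>R k \<in> open_segment 0 k"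
    proof -
      have "0 < cmod k" using n R by linarith
      then have "0 < R / cmod k" "R / cmod k < 1" using n R by (simp_all add: divide_less_eq_1)
      moreover have "0 \<noteq> k" using n R by auto
      ultimately show ?thesis by (auto simp: in_segment intro!: exI[of _ "R / cmod k"])
    qed
    have i: "(R / cmod k) *\<^sub>R k \<in> interior C"
      by (rule subsetD[OF in_interior_closure_convex_segment[OF C 1 2] 3])
    have "cmod ((R / cmod k) *\<^sub>R k) = R" using n R by auto
    then have "kp ((R / cmod k) *\<^sub>R k) \<in> frontier K" "cmod ((R / cmod k) *\<^sub>R k) < 1" using circ R by auto
    then show False using i by (simp add: frontier_def interior_kl C_def)
  qed
  have CR: "k \<in> C \<longleftrightarrow> cmod k \<le> R" for k using inner circ outer by (meson not_le order_le_less)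
  have le: "cmod (kl z) \<le> R \<longleftrightarrow> fst (lift z) \<le> t" for z
  proof -
    define a where "a = fst (lift z)"
    have a: "1 \<le> a" using lp_lift_ge_1[of z orig] by (simp add: lp_def a_def)
    have e: "(cmod (kl z))\<^sup>2 = 1 - 1 / a\<^sup>2" using fst_lift_sq[of z] a by (simp add: a_def field_simps)
    have "cmod (kl z) \<le> R \<longleftrightarrow> (cmod (kl z))\<^sup>2 \<le> R\<^sup>2" using R by (simp add: abs_le_square_iff[symmetric])
    also have "R\<^sup>2 = 1 - 1 / t\<^sup>2" using \<open>1 / t\<^sup>2 < 1\<close> by (simp add: R_def)
    also have "(cmod (kl z))\<^sup>2 \<le> 1 - 1 / t\<^sup>2 \<longleftrightarrow> a\<^sup>2 \<le> t\<^sup>2" unfolding e using a less_trans[OF zero_less_one t2] by (simp add: field_simps divide_le_eq_1_pos)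
    also have "\<dots> \<longleftrightarrow> a \<le> t" using a t by (simp add: abs_le_square_iff[symmetric])
    finally show ?thesis by (simp add: a_def)
  qed
  have "z \<in> K \<longleftrightarrow> z \<in> cball orig (arcosh t)" for z
  proof -
    have "z \<in> K \<longleftrightarrow> fst (lift z) \<le> t" using CR[of "kl z"] le by (auto simp: C_def kl_inj)
    also have "fst (lift z) = lp (lift orig) (lift z)" by (simp add: lp_def)
    also have "lp (lift orig) (lift z) \<le> t \<longleftrightarrow> cosh (dist orig z) \<le> cosh (arcosh t)" unfolding cosh_dist using t by simp
    also have "\<dots> \<longleftrightarrow> dist orig z \<le> arcosh t" using t by (intro cosh_real_nonneg_le_iff) auto
    finally show ?thesis by simp
  qed
  then show ?thesis by blast
qed

text \<open>The radius is expressed by data of the germ that \<open>germ_match\<close> transfers, so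
  both bodies receive the same radius.\<close>

lemma timelike_disc:
  assumes K: "body K" and L: "body L" and sym: "sym_pair K L" and g: "germ K x N" and N: "0 < lp N N"
  obtains c where "K = cball c (arcosh (\<bar>lp (lift x) N\<bar> / sqrt (lp N N)))" "1 < \<bar>lp (lift x) N\<bar> / sqrt (lp N N)"
proof -
  obtain A s where A: "A \<in> SO" "s \<noteq> 0" "A N = s *\<^sub>R (1, 0)" using normalise_timelike[OF N] .
  obtain B where B: "B \<in> SO" "\<And>x. mv B (mv A x) = x" using mv_vimage[OF A(1)] by metis
  define K' x' where "K' = mv A ` K" and "x' = mv A x"
  have bK: "body K'" unfolding K'_def by (rule body_mv[OF K A(1)])
  have sym': "sym_pair K' L" using sym_pair_mv[OF sym A(1) SO_id] by (simp add: K'_def)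
  have g': "germ K' x' (A N)" unfolding K'_def x'_def by (rule germ_mv[OF A(1) K g])
  define t where "t = fst (lift x')"
  have pl: "lp (lift z) (A N) = s * fst (lift z)" for z by (simp add: A(3) lp_def)
  have fr: "{z. fst (lift z) = t} \<subseteq> frontier K'"
  proof
    fix z assume "z \<in> {z. fst (lift z) = t}"
    then have "lp (lift z) (A N) = lp (lift x') (A N)" by (simp add: pl t_def)
    then show "z \<in> frontier K'" using plane_germ[OF bK L sym' g'] by (simp add: germ_def)
  qed
  have t1: "1 \<le> t" using lp_lift_ge_1[of x' orig] by (simp add: lp_def t_def)
  \<comment> \<open>For \<open>t = 1\<close> the section is a single point, but a germ has several
    boundary points nearby.\<close>
  have "t \<noteq> 1"
  proof
    assume t: "t = 1"
    obtain W where W: "open W" "x' \<in> W" "\<And>z. z \<in> W \<Longrightarrow> z \<in> frontier K' \<longleftrightarrow> lp (lift z) (A N) = lp (lift x') (A N)"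
      using g' unfolding germ_def by blast
    have xf: "x' \<in> frontier K'" using g' by (simp add: germ_def)
    obtain a b where ab: "a \<in> frontier K' \<inter> W" "b \<in> frontier K' \<inter> W" "a \<noteq> b"
      using three_frontier_points[OF bK all_smooth'[OF bK L sym' xf] W(1,2)] by metis
    have "z = orig" if "z \<in> frontier K' \<inter> W" for z
    proof -
      have "s * fst (lift z) = s * t" using W(3)[of z] that by (simp add: pl t_def)
      then have "lp (lift z) (lift orig) = 1" using A(2) t by (simp add: lp_def)
      then show ?thesis by (simp only: lp_lift_eq_1)
    qed
    then show False using ab by metis
  qed
  then have t2: "1 < t" using t1 by simp
  have "K' = cball orig (arcosh t)" by (rule body_circle[OF bK t2 fr])
  then have "mv B ` K' = cball (mv B orig) (arcosh t)" using mv_cball[OF B(1)] by simp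
  then have "K = cball (mv B orig) (arcosh t)" by (simp add: K'_def image_image B(2))
  moreover have "\<bar>lp (lift x) N\<bar> / sqrt (lp N N) = t"
  proof -
    have "lp (lift x) N = lp (lift x') (A N)" using A(1) by (simp add: x'_def)
    then have 1: "lp (lift x) N = s * t" by (simp add: pl t_def)
    have "lp N N = lp (A N) (A N)" using A(1) by simp
    also have "\<dots> = s\<^sup>2" unfolding A(3) by (simp add: lp_def power2_eq_square)
    finally have "sqrt (lp N N) = \<bar>s\<bar>" by simp
    then show ?thesis using 1 A(2) t2 by (simp add: abs_mult)
  qed
  ultimately show ?thesis using that[of "mv B orig"] t2 by simp
qed

section \<open>Ideal points\<close>

definition incone :: "hyp_plane set \<Rightarrow> vec \<Rightarrow> bool" where
  "incone K X \<longleftrightarrow> future X \<and> pt X \<in> K"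

text \<open>\<open>E\<close> is a recession direction of the cone over \<open>K\<close>; for a null
  vector this means that the rays from points of \<open>K\<close> towards the ideal point
  \<open>E\<close> stay in \<open>K\<close>.\<close>

definition ideal :: "hyp_plane set \<Rightarrow> vec \<Rightarrow> bool" where
  "ideal K E \<longleftrightarrow> (\<forall>z\<in>K. \<forall>s\<ge>0. incone K (lift z + s *\<^sub>R E))"

lemma incone_lift [simp]: "incone K (lift z) \<longleftrightarrow> z \<in> K"
  by (simp add: incone_def)

lemma incone_scaleR: "incone K X \<Longrightarrow> 0 < c \<Longrightarrow> incone K (c *\<^sub>R X)"
  by (simp add: incone_def future_scaleR pt_scaleR)

lemma incone_eq:
  assumes "incone K X"
  obtains c z where "0 < c" "z \<in> K" "X = c *\<^sub>R lift z"
proof -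
  obtain d where "0 < d" "lift (pt X) = d *\<^sub>R X" using assms lift_pt_pos unfolding incone_def by blast
  then show ?thesis using that[of "1 / d" "pt X"] assms by (simp add: incone_def)
qed

lemma incone_add:
  assumes "hyp_convex K" "incone K X" "incone K Y"
  shows "incone K (X + Y)"
proof -
  obtain c x where x: "0 < c" "x \<in> K" "X = c *\<^sub>R lift x" using incone_eq[OF assms(2)] .
  obtain d y where y: "0 < d" "y \<in> K" "Y = d *\<^sub>R lift y" using incone_eq[OF assms(3)] .
  have "pt (X + Y) \<in> K" unfolding x(3) y(3) using x y by (intro hyp_convex_pt[OF assms(1)]) auto
  moreover have "future (X + Y)" using assms(2,3) by (intro future_add) (auto simp: incone_def future_def)
  ultimately show ?thesis by (simp add: incone_def)
qed

lemma ideal_incone: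
  assumes "ideal K E" "incone K X" "0 \<le> s"
  shows "incone K (X + s *\<^sub>R E)"
proof -
  obtain c x where x: "0 < c" "x \<in> K" "X = c *\<^sub>R lift x" using incone_eq[OF assms(2)] .
  have "incone K (lift x + (s / c) *\<^sub>R E)" using assms(1,3) x by (simp add: ideal_def)
  from incone_scaleR[OF this x(1)] show ?thesis using x by (simp add: scaleR_add_right)
qed

lemma idealI:
  assumes "closed K" "hyp_convex K" and E: "cmod (snd E) \<le> fst E"
    and u: "\<And>n. u n \<in> K" "\<And>n. 0 < r n" "(\<lambda>n. r n *\<^sub>R lift (u n)) \<longlonglongrightarrow> E"
  shows "ideal K E"
  unfolding ideal_def
proof (intro ballI allI impI)
  fix z and s :: real assume z: "z \<in> K" and s: "0 \<le> s"
  have inc: "incone K (lift z + s *\<^sub>R (r n *\<^sub>R lift (u n)))" for n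
  proof (cases "s = 0")
    case False
    then have "incone K ((s * r n) *\<^sub>R lift (u n))" using s u by (intro incone_scaleR) auto
    then show ?thesis using incone_add[OF assms(2)] z by simp
  qed (use z in simp)
  have fut: "future (lift z + s *\<^sub>R E)"
    using E s by (intro future_add) (auto intro: mult_left_mono)
  have "(\<lambda>n. pt (lift z + s *\<^sub>R (r n *\<^sub>R lift (u n)))) \<longlonglongrightarrow> pt (lift z + s *\<^sub>R E)"
    using inc fut by (intro tendsto_pt tendsto_add tendsto_const tendsto_scaleR u(3)) (auto simp: incone_def)
  then have "pt (lift z + s *\<^sub>R E) \<in> K"
    by (rule closed_sequentially[OF assms(1), rotated]) (use inc in \<open>simp add: incone_def\<close>)
  then show "incone K (lift z + s *\<^sub>R E)" using fut by (simp add: incone_def)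
qed

lemma ideal_mv:
  assumes A: "A \<in> SO" and "ideal K E"
  shows "ideal (mv A ` K) (A E)"
  unfolding ideal_def
proof (intro ballI allI impI)
  fix z and s :: real assume "z \<in> mv A ` K" and s: "0 \<le> s"
  then obtain w where w: "w \<in> K" "z = mv A w" by auto
  have i: "incone K (lift w + s *\<^sub>R E)" using assms(2) w s by (simp add: ideal_def)
  have lin: "linear A" by (rule SO_linear[OF A])
  have e: "lift z + s *\<^sub>R A E = A (lift w + s *\<^sub>R E)"
    using A by (simp add: w linear_add[OF lin] linear_scale[OF lin])
  obtain c v where c: "0 < c" "v \<in> K" "lift w + s *\<^sub>R E = c *\<^sub>R lift v" using incone_eq[OF i] .
  have "A (lift w + s *\<^sub>R E) = c *\<^sub>R lift (mv A v)" unfolding c(3) using A by (simp add: linear_scale[OF lin])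
  then show "incone (mv A ` K) (lift z + s *\<^sub>R A E)"
    unfolding e using c by (simp add: incone_scaleR)
qed

lemma ideal_Int: "ideal K E \<Longrightarrow> ideal L E \<Longrightarrow> ideal (K \<inter> L) E"
  by (auto simp: ideal_def incone_def)

text \<open>The values 1 and -1 of \<open>e\<close> are the two ends of the curve; each is a limit
  of points of the curve scaled by \<open>inverse (real (Suc n))\<close>.\<close>

lemma ideal_hypercycle:
  assumes K: "closed K" "hyp_convex K" and sub: "{z. lp (lift z) (0, of_real k * \<i>) = t} \<subseteq> K" and k: "k\<^sup>2 = 1" and e: "e\<^sup>2 = 1"
  shows "ideal K (1, of_real e)"
proof (rule idealI[OF K])
  define r where "r n = inverse (real (Suc n))" for n
  have rm: "r n * real (Suc n) = 1" for n by (simp add: r_def)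
  define v where "v n = hcycle (- k * t) (e * real (Suc n))" for n
  have kk: "k * k = 1" "e * e = 1" using k e by (simp_all add: power2_eq_square)
  show "pt (v n) \<in> K" for n
  proof -
    have "lp (v n) (0, of_real k * \<i>) = (k * k) * t" by (simp add: v_def hcycle_def lp_def inner_complex_def)
    then show ?thesis using sub kk by (auto simp: v_def lift_hcycle)
  qed
  show "0 < r n" for n by (simp add: r_def)
  have r0: "r \<longlonglongrightarrow> 0" unfolding r_def by (rule LIMSEQ_inverse_real_of_nat)
  have eq: "r n *\<^sub>R lift (pt (v n)) = (sqrt ((r n)\<^sup>2 * (1 + t\<^sup>2) + 1), Complex e (r n * (- k * t)))" for n
  proof -
    have "r n * sqrt (1 + (e * real (Suc n))\<^sup>2 + (- k * t)\<^sup>2) = sqrt ((r n)\<^sup>2 * (1 + (e * real (Suc n))\<^sup>2 + (- k * t)\<^sup>2))"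
      by (simp add: real_sqrt_mult r_def)
    also have "(r n)\<^sup>2 * (1 + (e * real (Suc n))\<^sup>2 + (- k * t)\<^sup>2) = (r n)\<^sup>2 * (1 + t\<^sup>2) + (r n * real (Suc n))\<^sup>2"
      using k e by (simp add: power_mult_distrib distrib_left del: of_nat_Suc)
    also have "(r n * real (Suc n))\<^sup>2 = 1" unfolding rm by simp
    finally have 1: "r n * sqrt (1 + (e * real (Suc n))\<^sup>2 + (- k * t)\<^sup>2) = sqrt ((r n)\<^sup>2 * (1 + t\<^sup>2) + 1)" .
    have 2: "r n * (e * real (Suc n)) = e" using rm[of n] by (simp only: mult_ac)
    show ?thesis unfolding v_def lift_hcycle unfolding hcycle_def prod_eq_iff complex_eq_iff using 1 2 by simp
  qed
  have "(\<lambda>n. (sqrt ((r n)\<^sup>2 * (1 + t\<^sup>2) + 1), Complex e (r n * (- k * t)))) \<longlonglongrightarrow> (sqrt (0\<^sup>2 * (1 + t\<^sup>2) + 1), Complex e (0 * (- k * t)))"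
    by (intro tendsto_intros tendsto_Complex r0)
  then show "(\<lambda>n. r n *\<^sub>R lift (pt (v n))) \<longlonglongrightarrow> (1, of_real e)"
    unfolding eq by (simp add: complex_of_real_def)
  show "cmod (snd (1, of_real e)) \<le> fst (1::real, of_real e :: complex)"
    using e by (simp add: power2_eq_1_iff) auto
qed

lemma ideal_horocycle:
  assumes K: "closed K" "hyp_convex K" and sub: "{z. lp (lift z) (1, 1) = t} \<subseteq> K" and t: "0 < t"
  shows "ideal K (1, 1)"
proof (rule idealI[OF K])
  define r where "r n = inverse (real (Suc n))" for n
  have rm: "r n * real (Suc n) = 1" and rp: "0 < r n" for n by (simp_all add: r_def)
  show "pt (horoc t (real (Suc n))) \<in> K" for n using sub horocycle_eq[OF t] by blast
  show "0 < 2 * t * (r n)\<^sup>2" for n using t zero_less_power[OF rp[of n], of 2] by simp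
  have r0: "r \<longlonglongrightarrow> 0" unfolding r_def by (rule LIMSEQ_inverse_real_of_nat)
  have eq: "(2 * t * (r n)\<^sup>2) *\<^sub>R lift (pt (horoc t (real (Suc n)))) =
    ((r n)\<^sup>2 + 1 + t\<^sup>2 * (r n)\<^sup>2, Complex ((r n)\<^sup>2 + 1 - t\<^sup>2 * (r n)\<^sup>2) (2 * t * r n))" for n
  proof -
    define m where "m = real (Suc n)"
    have rm': "r n * m = 1" using rm by (simp add: m_def)
    have a: "2 * t * (r n)\<^sup>2 * (((1 + m\<^sup>2) / t + t) / 2) = (r n)\<^sup>2 + (r n * m)\<^sup>2 + t\<^sup>2 * (r n)\<^sup>2"
      using t by (simp add: field_simps power2_eq_square)
    have b: "2 * t * (r n)\<^sup>2 * (((1 + m\<^sup>2) / t - t) / 2) = (r n)\<^sup>2 + (r n * m)\<^sup>2 - t\<^sup>2 * (r n)\<^sup>2"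
      using t by (simp add: field_simps power2_eq_square)
    have c: "2 * t * (r n)\<^sup>2 * m = 2 * t * r n * (r n * m)" by (simp add: power2_eq_square)
    show ?thesis unfolding lift_horoc[OF t] unfolding m_def[symmetric] horoc_def prod_eq_iff complex_eq_iff
      using a b c unfolding rm' by simp
  qed
  have "(\<lambda>n. ((r n)\<^sup>2 + 1 + t\<^sup>2 * (r n)\<^sup>2, Complex ((r n)\<^sup>2 + 1 - t\<^sup>2 * (r n)\<^sup>2) (2 * t * r n))) \<longlonglongrightarrow>
     (0\<^sup>2 + 1 + t\<^sup>2 * 0\<^sup>2, Complex (0\<^sup>2 + 1 - t\<^sup>2 * 0\<^sup>2) (2 * t * 0))"
    by (intro tendsto_intros tendsto_Complex r0)
  then show "(\<lambda>n. (2 * t * (r n)\<^sup>2) *\<^sub>R lift (pt (horoc t (real (Suc n))))) \<longlonglongrightarrow> (1, 1)"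
    unfolding eq by (simp add: one_complex.code)
qed simp

text \<open>The half-turn fixes \<open>lift c\<close>, so it maps the ray from the centre towards
  \<open>E\<close> to the ray towards the mirror image of \<open>E\<close>.\<close>

lemma hturn_ideal:
  assumes "ideal M E" "c \<in> M" and sM: "\<And>x. x \<in> M \<Longrightarrow> mv (hturn c) x \<in> M" and s: "0 \<le> s"
  shows "incone M (lift c + s *\<^sub>R hturn c E)"
proof -
  have "incone M (lift c + s *\<^sub>R E)" using assms by (simp add: ideal_def)
  then obtain k v where k: "0 < k" "v \<in> M" "lift c + s *\<^sub>R E = k *\<^sub>R lift v" by (rule incone_eq)
  have lin: "linear (hturn c)" by (rule SO_linear[OF hturn_SO])
  have "hturn c (lift c + s *\<^sub>R E) = k *\<^sub>R lift (mv (hturn c) v)" unfolding k(3) by (simp add: linear_scale[OF lin])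
  moreover have "hturn c (lift c + s *\<^sub>R E) = lift c + s *\<^sub>R hturn c E"
    by (simp add: linear_add[OF lin] linear_scale[OF lin]) (simp add: hturn_def scaleR_2)
  moreover have "incone M (k *\<^sub>R lift (mv (hturn c) v))" by (rule incone_scaleR) (use sM k in \<open>simp_all del: lift_mv\<close>)
  ultimately show ?thesis by metis
qed

text \<open>Along the ray the product with \<open>N\<close> changes linearly in \<open>s\<close>,
  whereas the norm grows like the square root of \<open>s\<close>; a lower bound at the normalised
  points thus forces a nonnegative rate.\<close>

lemma ray_bound:
  assumes inc: "\<And>s. 0 \<le> s \<Longrightarrow> incone M (lift c + s *\<^sub>R V)" and side: "\<And>z. z \<in> M \<Longrightarrow> t \<le> lp (lift z) N"
    and V: "lp V V = 0" "0 \<le> lp (lift c) V"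
  shows "0 \<le> lp V N"
proof (rule ccontr)
  assume n: "\<not> ?thesis"
  define a b e T where "a = \<bar>lp (lift c) N\<bar>" and "b = - lp V N" and "e = lp (lift c) V" and "T = \<bar>t\<bar>"
  have b: "0 < b" and e: "0 \<le> e" and T: "0 \<le> T" and a: "0 \<le> a" using n V by (simp_all add: b_def e_def T_def a_def)
  have main: "s * b \<le> a + T * sqrt (1 + 2 * s * e)" if s: "0 \<le> s" for s
  proof -
    define X where "X = lift c + s *\<^sub>R V"
    have X: "future X" "pt X \<in> M" using inc[OF s] by (simp_all add: incone_def X_def)
    have XX: "lp X X = 1 + 2 * s * e"
      using V(1) lp_commute[of V "lift c"] by (simp add: X_def e_def algebra_simps)
    define q where "q = sqrt (1 + 2 * s * e)"
    have q: "0 < q" using s e by (simp add: q_def add_pos_nonneg)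
    have "t \<le> lp (lift (pt X)) N" by (rule side[OF X(2)])
    also have "\<dots> = lp X N / q" by (simp add: lift_pt[OF X(1)] XX q_def field_simps)
    finally have "t * q \<le> lp X N" using q by (simp add: field_simps)
    also have "\<dots> \<le> a - s * b" by (simp add: X_def a_def b_def)
    finally have "s * b \<le> a + (- t) * q" by simp
    also have "\<dots> \<le> a + T * q" using q by (intro add_left_mono mult_right_mono) (auto simp: T_def)
    finally show ?thesis by (simp add: q_def)
  qed
  \<comment> \<open>The second summand makes \<open>a\<close> at most half of \<open>s * b\<close>;
    the third makes the other half exceed the square root term.\<close>
  define s where "s = 1 + 2 * a / b + 4 * T\<^sup>2 * (1 + 2 * e) / b\<^sup>2"
  have s1: "1 \<le> s" "0 \<le> s" using a b e T by (simp_all add: s_def)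
  have sb: "2 * a \<le> s * b"
  proof -
    have "2 * a / b \<le> s" using b e T by (simp add: s_def)
    then show ?thesis using b by (simp add: divide_le_eq)
  qed
  have sT: "4 * T\<^sup>2 * (1 + 2 * e) < s * b\<^sup>2"
  proof -
    have "4 * T\<^sup>2 * (1 + 2 * e) / b\<^sup>2 < s" using a b by (simp add: s_def add_pos_nonneg)
    then show ?thesis using b by (simp add: divide_less_eq)
  qed
  have "s * b / 2 \<le> T * sqrt (1 + 2 * s * e)" using main[OF s1(2)] sb by (simp add: field_simps)
  then have "(s * b / 2)\<^sup>2 \<le> (T * sqrt (1 + 2 * s * e))\<^sup>2" using s1 b by (intro power_mono) auto
  also have "\<dots> = T\<^sup>2 * (1 + 2 * s * e)" using s1 e by (simp add: power_mult_distrib)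
  also have "\<dots> \<le> T\<^sup>2 * (s * (1 + 2 * e))" using s1 e by (intro mult_left_mono) (auto simp: algebra_simps)
  finally have "s * (s * b\<^sup>2) \<le> s * (4 * T\<^sup>2 * (1 + 2 * e))" by (simp add: power_divide power_mult_distrib power2_eq_square algebra_simps)
  then have "s * b\<^sup>2 \<le> 4 * T\<^sup>2 * (1 + 2 * e)" using s1(1) by (simp only: mult_le_cancel_left_pos)
  then show False using sT by simp
qed

text \<open>The positive product with \<open>E\<close> shows that the mirror image is an ideal point
  different from \<open>E\<close>.\<close>

lemma hturn_null:
  assumes "lp E E = 0" "E = (1, 1)"
  shows "lp (hturn c E) (hturn c E) = 0" "0 \<le> lp (lift c) (hturn c E)" "0 < lp (hturn c E) E"
proof -
  have p: "0 < lp (lift c) E" unfolding assms(2) by (intro future_lp_pos2) (auto simp: zero_prod_def)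
  show "lp (hturn c E) (hturn c E) = 0" using assms(1) by simp
  show "0 \<le> lp (lift c) (hturn c E)" using p lp_commute[of E "lift c"] by (simp add: hturn_def)
  have "lp (hturn c E) E = 2 * lp (lift c) E * lp (lift c) E" using assms(1) lp_commute[of E "lift c"] by (simp add: hturn_def)
  then show "0 < lp (hturn c E) E" using p by simp
qed

section \<open>Horocyclic coordinates\<close>

definition nv :: vec where
  "nv = (1, 1)"

definition sv :: "real \<Rightarrow> vec" where
  "sv k = (0, Complex 0 k)"

lemma sv_eq: "(0, of_real k * \<i>) = sv k"
  by (simp add: sv_def complex_eq_iff)

lemma lp_nv [simp]: "lp nv nv = 0" "lp nv (sv k) = 0" "lp (sv k) nv = 0"
  by (simp_all add: lp_def sv_def nv_def inner_complex_def)

lemma lp_sv_minus: "lp X (sv (- k)) = - lp X (sv k)"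
  by (simp add: lp_def sv_def inner_complex_def)

lemma lp_lift_nv_pos [simp]: "0 < lp (lift z) nv"
  unfolding nv_def by (intro future_lp_pos2) (auto simp: zero_prod_def)

text \<open>The ideal point \<open>x\<close> on the boundary of the upper half-plane, scaled so that
  its product with \<open>nv\<close> is 1.\<close>

definition para :: "real \<Rightarrow> real \<Rightarrow> vec" where
  "para k x = ((1 + x\<^sup>2) / 2, Complex ((x\<^sup>2 - 1) / 2) (- k * x))"

text \<open>The point with upper half-plane coordinates \<open>(x, y)\<close>, the ideal point \<open>nv\<close> being at infinity;
  the sign \<open>k\<close> is the orientation of the \<open>x\<close>-axis.\<close>

definition hp :: "real \<Rightarrow> real \<Rightarrow> real \<Rightarrow> vec" where
  "hp k x y = (1 / y) *\<^sub>R para k x + (y / 2) *\<^sub>R nv"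

lemma para_lp [simp]: "k\<^sup>2 = 1 \<Longrightarrow> lp (para k x) (para k x) = 0" "lp (para k x) nv = 1" "lp nv (para k x) = 1"
proof -
  assume "k\<^sup>2 = 1"
  then have "(k * x)\<^sup>2 = x\<^sup>2" by (simp add: power_mult_distrib)
  then show "lp (para k x) (para k x) = 0"
    unfolding para_def lp_self cmod_power2 by (simp add: power2_eq_square field_simps)
qed (simp_all add: para_def nv_def lp_def inner_complex_def field_simps)

lemma para_sv: "k\<^sup>2 = 1 \<Longrightarrow> lp (para k x) (sv k) = x"
  by (simp add: para_def lp_def sv_def inner_complex_def power2_eq_square)

lemma para_affine: "para k x = para k 0 - x *\<^sub>R sv k + (x\<^sup>2 / 2) *\<^sub>R nv"
  by (simp add: para_def nv_def sv_def prod_eq_iff complex_eq_iff add_divide_distrib diff_divide_distrib)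

context
  fixes k :: real
  assumes k: "k\<^sup>2 = 1"
begin

lemma lp_hp: "lp (hp k x y) nv = 1 / y" "lp (hp k x y) (sv k) = x / y"
  by (simp_all add: hp_def para_sv k)

lemma hp_unit:
  assumes "0 < y"
  shows "lp (hp k x y) (hp k x y) = 1" "future (hp k x y)"
proof -
  show u: "lp (hp k x y) (hp k x y) = 1" using assms k by (simp add: hp_def field_simps)
  have "0 \<le> lp (hp k x y) (1, 0)" using assms by (simp add: hp_def para_def nv_def lp_def)
  moreover have "future (1, 0)" by (simp add: future_def)
  ultimately show "future (hp k x y)" by (metis futureI u zero_less_one)
qed

lemma lift_hp: "0 < y \<Longrightarrow> lift (pt (hp k x y)) = hp k x y"
  by (simp add: lift_pt_unit hp_unit)

lemma lift_eq_hp: "lift z = hp k (lp (lift z) (sv k) / lp (lift z) nv) (1 / lp (lift z) nv)"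
proof -
  obtain a b c where z: "lift z = (a, Complex b c)" by (metis complex.exhaust surj_pair)
  have u: "a\<^sup>2 - b\<^sup>2 - c\<^sup>2 = 1" using lp_lift_self[of z] unfolding z lp_self by (simp add: cmod_power2)
  define d where "d = a - b"
  have d: "0 < d" using lp_lift_nv_pos[of z] by (simp add: z d_def nv_def lp_def inner_complex_def)
  have 1: "lp (lift z) nv = d" by (simp add: z d_def nv_def lp_def inner_complex_def)
  have 2: "lp (lift z) (sv k) = - k * c" by (simp add: z sv_def lp_def inner_complex_def)
  have kk: "k * (k * c) = c" using k by (simp add: power2_eq_square flip: mult.assoc)
  define x where "x = - k * c / d"
  have dx: "d * x = - k * c" using d by (simp add: x_def)
  then have "(d * x)\<^sup>2 = c\<^sup>2" using k by (simp add: power_mult_distrib)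
  moreover have "d * (a + b) = a\<^sup>2 - b\<^sup>2" by (simp add: d_def power2_eq_square algebra_simps)
  ultimately have "d * (a + b) = d * (d * x\<^sup>2 + 1 / d)" using u d by (simp add: power2_eq_square algebra_simps)
  then have s: "a + b = d * x\<^sup>2 + 1 / d" using d by simp
  have "d * (k * x) = - c" using dx kk by (metis mult.left_commute mult_minus_left mult_minus_right)
  moreover have "a = (d + d * x\<^sup>2 + 1 / d) / 2" "b = (d * x\<^sup>2 - d + 1 / d) / 2" using s by (simp_all add: d_def)
  ultimately show ?thesis unfolding 1 2 x_def[symmetric] unfolding z
    by (simp add: hp_def para_def nv_def prod_eq_iff complex_eq_iff) (simp add: algebra_simps add_divide_distrib diff_divide_distrib)
qed

lemma z_eq_hp: "z = pt (hp k (lp (lift z) (sv k) / lp (lift z) nv) (1 / lp (lift z) nv))"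
  using lift_eq_hp by (metis pt_lift)

lemma hp_up:
  assumes K: "ideal K nv" and m: "pt (hp k x y) \<in> K" and y: "0 < y" "y \<le> y'"
  shows "pt (hp k x y') \<in> K"
proof -
  have "incone K (hp k x y)" using m y hp_unit by (simp add: incone_def)
  then have "incone K ((y / y') *\<^sub>R hp k x y)" using y by (intro incone_scaleR) auto
  moreover have "0 \<le> y' / 2 - (y / y') * (y / 2)"
  proof -
    have "(y / y') * (y / 2) \<le> 1 * (y' / 2)" using y by (intro mult_mono) auto
    then show ?thesis by simp
  qed
  ultimately have "incone K ((y / y') *\<^sub>R hp k x y + (y' / 2 - (y / y') * (y / 2)) *\<^sub>R nv)"
    using ideal_incone[OF K] by blast
  moreover have "(y / y') *\<^sub>R hp k x y + (y' / 2 - (y / y') * (y / 2)) *\<^sub>R nv = hp k x y'"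
    using y by (simp add: hp_def scaleR_add_right scaleR_diff_left)
  ultimately show ?thesis by (simp add: incone_def)
qed

text \<open>The sum of squares is a crude bound for the squared height of the geodesic joining the
  two points; everything above that geodesic belongs to \<open>K\<close> because \<open>nv\<close>
  is an ideal point.\<close>

lemma hp_between:
  assumes K: "hyp_convex K" "ideal K nv" and m: "pt (hp k a ya) \<in> K" "pt (hp k b yb) \<in> K"
    and y: "0 < ya" "0 < yb" "0 < y" "(a - b)\<^sup>2 + ya\<^sup>2 + yb\<^sup>2 \<le> y\<^sup>2" and x: "a \<le> x" "x \<le> b"
  shows "pt (hp k x y) \<in> K"
proof (cases "a = b")
  case True
  then have "ya\<^sup>2 \<le> y\<^sup>2" using y(4) zero_le_power2[of yb] zero_le_power2[of "a - b"] by linarith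
  then have "ya \<le> y" using y by (simp add: power2_le_iff_abs_le abs_le_square_iff[symmetric])
  then show ?thesis using hp_up[OF K(2) m(1) y(1)] True x by simp
next
  case False
  define l where "l = (x - a) / (b - a)"
  have ab: "0 < b - a" using False x by simp
  have "l * (b - a) = x - a" using ab by (simp add: l_def)
  then have "x = (1 - l) * a + l * b" by (simp add: algebra_simps)
  moreover have "0 \<le> l" "l \<le> 1" using ab x by (simp_all add: l_def)
  ultimately have l: "0 \<le> l" "l \<le> 1" "x = (1 - l) * a + l * b" by auto
  define w where "w = (1 - l) *\<^sub>R (ya *\<^sub>R hp k a ya) + l *\<^sub>R (yb *\<^sub>R hp k b yb)"
  have ia: "incone K (ya *\<^sub>R hp k a ya)" and ib: "incone K (yb *\<^sub>R hp k b yb)"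
    by (rule incone_scaleR; use m y hp_unit in \<open>simp add: incone_def\<close>)+
  have iw: "incone K w"
  proof (cases "l = 0 \<or> l = 1")
    case False
    then show ?thesis unfolding w_def using l by (intro incone_add[OF K(1)] incone_scaleR ia ib) auto
  qed (use ia ib in \<open>auto simp: w_def\<close>)
  \<comment> \<open>The bracket is half the squared height of the geodesic over \<open>x\<close>;
    the surplus \<open>g\<close> is added as a multiple of \<open>nv\<close>.\<close>
  define g where "g = y\<^sup>2 / 2 - (l * (1 - l) * (a - b)\<^sup>2 / 2 + (1 - l) * (ya\<^sup>2 / 2) + l * (yb\<^sup>2 / 2))"
  have g: "0 \<le> g"
  proof -
    have "l * (1 - l) \<le> 1 * 1" using l by (intro mult_mono) auto
    then have "l * (1 - l) * (a - b)\<^sup>2 \<le> 1 * (a - b)\<^sup>2" by (intro mult_right_mono) auto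
    moreover have "(1 - l) * (ya\<^sup>2 / 2) \<le> 1 * (ya\<^sup>2 / 2)" "l * (yb\<^sup>2 / 2) \<le> 1 * (yb\<^sup>2 / 2)"
      using l by (intro mult_right_mono; simp)+
    ultimately show ?thesis unfolding g_def using y(4) by argo
  qed
  have p: "para k x = (1 - l) *\<^sub>R para k a + l *\<^sub>R para k b - (l * (1 - l) * (a - b)\<^sup>2 / 2) *\<^sub>R nv"
    unfolding para_def nv_def l(3) prod_eq_iff complex_eq_iff
    by (simp add: power2_eq_square) (simp add: field_simps)
  have e: "y *\<^sub>R hp k x y = para k x + (y\<^sup>2 / 2) *\<^sub>R nv" if "y \<noteq> 0" for x y
    using that by (simp add: hp_def scaleR_add_right power2_eq_square)
  have "w + g *\<^sub>R nv = y *\<^sub>R hp k x y"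
    using y by (simp only: e w_def g_def p)
      (simp add: prod_eq_iff complex_eq_iff algebra_simps)
  moreover have "incone K (w + g *\<^sub>R nv)" by (rule ideal_incone[OF K(2) iw g])
  ultimately have "incone K (y *\<^sub>R hp k x y)" by simp
  then show ?thesis using pt_scaleR[OF hp_unit(2)[OF y(3)] y(3)] by (simp add: incone_def)
qed

end

section \<open>Horocycles\<close>

lemma horoball:
  assumes K: "body K" and fr: "{z. lp (lift z) nv = t} \<subseteq> frontier K" and t: "0 < t"
  shows "ideal K nv" "\<And>z. z \<in> K \<Longrightarrow> lp (lift z) nv \<le> t" "\<And>z. lp (lift z) nv \<le> t \<Longrightarrow> z \<in> K"
proof -
  have k: "(1::real)\<^sup>2 = 1" by simp
  have sub: "{z. lp (lift z) nv = t} \<subseteq> K" using fr frontier_subset_body[OF K] by blast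
  have Kc: "closed K" "hyp_convex K" using K by (auto simp: body_def)
  show i: "ideal K nv" using ideal_horocycle[OF Kc _ t] sub by (simp add: nv_def)
  define p where "p x = pt (hp 1 x (1 / t))" for x
  have p: "lp (lift (p x)) nv = t" "lp (lift (p x)) (sv 1) = x * t" for x
    using t by (simp_all add: p_def lift_hp[OF k] lp_hp[OF k])
  have pK: "p x \<in> K" for x using p sub by blast
  have ne: "p 0 \<noteq> p 1" using p(2)[of 0] p(2)[of 1] t by auto
  have "\<not> (\<forall>z\<in>K. t \<le> lp (lift z) nv)"
    using convex_side_sign[OF Kc(2) pK pK ne p(1) p(1)] t by auto
  then show "lp (lift z) nv \<le> t" if "z \<in> K" for z using interior_side[OF K fr] that by blast
  show "z \<in> K" if "lp (lift z) nv \<le> t" for z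
  proof -
    have "1 / t \<le> 1 / lp (lift z) nv" using that t by (simp add: frac_le)
    then show ?thesis
      using hp_up[OF k i pK[unfolded p_def]] t z_eq_hp[OF k, of z] by (metis zero_less_divide_1_iff)
  qed
qed

text \<open>As the levels match, both bodies can be moved to the same horoball, so the intersection
  is this horoball with its only ideal point \<open>nv\<close>.\<close>

lemma no_null_germ:
  assumes K: "body K" and L: "body L" and sym: "sym_pair K L" and g: "germ K x N" and N: "lp N N = 0"
  shows False
proof -
  obtain y where "smooth_pt L y" using exists_smooth[OF L] .
  then have "y \<in> frontier L" by (simp add: smooth_pt_def)
  then obtain N' where gL: "germ L y N'" using germ_exists[OF L K sym_pair_commute[OF sym]] by blast
  have "N \<noteq> 0" using g by (simp add: germ_def)
  obtain D n where D: "D \<in> SO" "n \<noteq> 0" "D N = n *\<^sub>R nv" using normalise_null[OF N \<open>N \<noteq> 0\<close>] unfolding nv_def .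
  define K1 x1 where "K1 = mv D ` K" and "x1 = mv D x"
  have K1: "body K1" unfolding K1_def by (rule body_mv[OF K D(1)])
  have sym1: "sym_pair K1 L" using sym_pair_mv[OF sym D(1) SO_id] by (simp add: K1_def)
  have g1: "germ K1 x1 nv" using germ_scaleR[OF germ_mv[OF D(1) K g], of "1 / n"] D by (simp add: K1_def x1_def)
  define t where "t = lp (lift x1) nv"
  obtain A c where A: "A \<in> SO" "c \<noteq> 0" "A N' = c *\<^sub>R nv" "lp (lift y) N' = c * lp (lift x1) nv"
    using germ_match[OF K1 L sym1 g1 gL] .
  define L1 y1 where "L1 = mv A ` L" and "y1 = mv A y"
  have L1: "body L1" unfolding L1_def by (rule body_mv[OF L A(1)])
  have sym2: "sym_pair K1 L1" using sym_pair_mv[OF sym1 SO_id A(1)] by (simp add: L1_def)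
  have g2: "germ L1 y1 nv" using germ_scaleR[OF germ_mv[OF A(1) L gL], of "1 / c"] A by (simp add: L1_def y1_def)
  have "lp (lift y1) (A N') = lp (lift y) N'" using A(1) by (simp add: y1_def)
  then have ty: "lp (lift y1) nv = t" using A by (simp add: t_def)
  have t: "0 < t" by (simp add: t_def)
  have frK: "{z. lp (lift z) nv = t} \<subseteq> frontier K1"
    using plane_germ[OF K1 L1 sym2 g1] by (auto simp: t_def germ_def)
  have frL: "{z. lp (lift z) nv = t} \<subseteq> frontier L1"
    using plane_germ[OF L1 K1 sym_pair_commute[OF sym2] g2] by (auto simp: ty germ_def)
  have M: "K1 = {z. lp (lift z) nv \<le> t}" "L1 = {z. lp (lift z) nv \<le> t}"
    using horoball[OF K1 frK t] horoball[OF L1 frL t] by blast+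
  have "interior (K1 \<inter> mv id ` L1) \<noteq> {}" using K1 unfolding M by (simp add: body_def M)
  then obtain s where s: "\<And>x. x \<in> K1 \<inter> mv id ` L1 \<Longrightarrow> mv (hturn s) x \<in> K1 \<inter> mv id ` L1"
    using sym_pairD[OF sym2 SO_id] by metis
  have s': "mv (hturn s) x \<in> K1" if "x \<in> K1" for x using s[of x] that by (simp add: M)
  have "K1 \<noteq> {}" using K1 by (auto simp: body_def)
  then have "s \<in> K1" using hturn_center_mem[OF _ _ s'] K1 by (auto simp: body_def)
  then have "incone K1 (lift s + r *\<^sub>R hturn s nv)" if "0 \<le> r" for r
    using hturn_ideal[OF horoball(1)[OF K1 frK t] _ s' that] by simp
  \<comment> \<open>On a horoball the product with \<open>nv\<close> is bounded above, so
    \<open>ray_bound\<close> is applied to \<open>- nv\<close>.\<close>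
  moreover have "- t \<le> lp (lift z) (- nv)" if "z \<in> K1" for z
    using that by (simp add: M)
  ultimately have "0 \<le> lp (hturn s nv) (- nv)"
    using ray_bound[of K1 s "hturn s nv" "- t" "- nv"] hturn_null[of nv s] by (simp add: nv_def[symmetric])
  then show False using hturn_null(3)[of nv s] by (simp add: nv_def[symmetric])
qed

section \<open>Equidistant curves\<close>

text \<open>The sign \<open>e\<close> orients the normal so that the body lies on the upper side;
  convexity then makes the level at most 0, with 0 for straight lines.\<close>

lemma norm_side:
  assumes K: "body K" and L: "body L" and sym: "sym_pair K L" and g: "germ K x N" and N: "lp N N < 0" and k: "k\<^sup>2 = 1"
  obtains A t where "A \<in> SO" "t \<le> 0" "{z. lp (lift z) (sv k) = t} \<subseteq> frontier (mv A ` K)"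
    "\<And>z. z \<in> mv A ` K \<Longrightarrow> t \<le> lp (lift z) (sv k)" "t = 0 \<longleftrightarrow> lp (lift x) N = 0"
proof -
  have fr: "{z. lp (lift z) N = lp (lift x) N} \<subseteq> frontier K"
    using plane_germ[OF K L sym g] by (auto simp: germ_def)
  obtain e where e: "e\<^sup>2 = 1" "\<And>z. z \<in> K \<Longrightarrow> e * lp (lift x) N \<le> e * lp (lift z) N"
    using interior_side[OF K fr] by (metis mult_1 mult_minus1 neg_le_iff_le one_power2 power2_minus)
  have e0: "e \<noteq> 0" using e(1) by auto
  have "lp (e *\<^sub>R N) (e *\<^sub>R N) = e\<^sup>2 * lp N N" by (simp add: power2_eq_square)
  then have "lp (e *\<^sub>R N) (e *\<^sub>R N) < 0" using N e by (simp only: mult_1)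
  then obtain A c where A: "A \<in> SO" "0 < c" "A (e *\<^sub>R N) = c *\<^sub>R sv k"
    using normalise_spacelike[of "e *\<^sub>R N" k] k unfolding sv_eq by metis
  obtain B where B: "B \<in> SO" "\<And>x. mv A (mv B x) = x" "\<And>x. mv B (mv A x) = x" "\<And>X. B (A X) = X"
    using mv_vimage[OF A(1)] by metis
  define t where "t = e * lp (lift x) N / c"
  have tr: "e * lp (lift (mv B z)) N = c * lp (lift z) (sv k)" for z
  proof -
    have "e * lp (lift (mv B z)) N = lp (B (lift z)) (B (A (e *\<^sub>R N)))" using B(1) by (simp add: B(4))
    also have "\<dots> = c * lp (lift z) (sv k)" using B(1) by (simp add: A(3))
    finally show ?thesis .
  qed
  have fr': "{z. lp (lift z) (sv k) = t} \<subseteq> frontier (mv A ` K)"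
  proof
    fix z assume "z \<in> {z. lp (lift z) (sv k) = t}"
    then have "e * lp (lift (mv B z)) N = e * lp (lift x) N" using tr[of z] A(2) by (simp add: t_def)
    then have "mv B z \<in> frontier K" using fr e0 by auto
    then have "mv A (mv B z) \<in> mv A ` frontier K" by blast
    then show "z \<in> frontier (mv A ` K)" using A(1) K by (simp add: B(2) frontier_mv body_def)
  qed
  have side: "t \<le> lp (lift z) (sv k)" if "z \<in> mv A ` K" for z
  proof -
    have "mv B z \<in> K" using that B(3) by auto
    then have "e * lp (lift x) N \<le> c * lp (lift z) (sv k)" using e(2)[of "mv B z"] tr[of z] by simp
    then show ?thesis using A(2) by (simp add: t_def divide_le_eq mult.commute)
  qed
  have K': "body (mv A ` K)" by (rule body_mv[OF K A(1)])
  have "t \<le> 0"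
  proof -
    define p where "p s = pt (hcycle (- k * t) s)" for s
    have "lp (lift (p s)) (sv k) = k\<^sup>2 * t" for s
      unfolding p_def lift_hcycle by (simp add: hcycle_def sv_def lp_def inner_complex_def power2_eq_square)
    moreover have "Re (snd (lift (p s))) = s" for s unfolding p_def lift_hcycle by (simp add: hcycle_def)
    ultimately have p: "lp (lift (p s)) (sv k) = t" "Re (snd (lift (p s))) = s" for s using k by auto
    have pK: "p s \<in> mv A ` K" for s using p fr' frontier_subset_body[OF K'] by blast
    have "p 0 \<noteq> p 1" using p(2) by (metis zero_neq_one)
    then show ?thesis using convex_side_sign[OF _ pK pK _ p(1) p(1) side] K' by (simp add: body_def)
  qed
  moreover have "t = 0 \<longleftrightarrow> lp (lift x) N = 0" using A(2) e0 by (simp add: t_def)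
  ultimately show ?thesis using that A(1) fr' side by blast
qed

text \<open>The parabolic isometry about \<open>nv\<close>, a translation of the upper half-plane.
  \<open>K\<close> and \<open>L\<close> are measured along opposite orientations of the x-axis,
  which gives the translation the form \<open>r - x\<close> in \<open>parab_hp\<close>.\<close>

definition parab :: "real \<Rightarrow> vec \<Rightarrow> vec" where
  "parab r = act (1 - \<i> * of_real (r / 2)) (\<i> * of_real (r / 2))"

lemma parab_SO [simp]: "parab r \<in> SO"
proof -
  have "(cmod (1 - \<i> * of_real (r / 2)))\<^sup>2 - (cmod (\<i> * of_real (r / 2)))\<^sup>2 = 1" by (simp add: cmod_power2 norm_mult power_divide)
  then show ?thesis unfolding parab_def SO_def by blast
qed

lemma parab_nv [simp]: "parab r nv = nv"
  by (simp add: parab_def act_def nv_def cmod_power2 norm_mult norm_divide prod_eq_iff complex_eq_iff) (simp add: power2_eq_square algebra_simps)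

lemma parab_sv: "parab r (sv 1) = sv 1 + r *\<^sub>R nv"
  by (simp add: parab_def act_def sv_def nv_def cmod_power2 norm_mult norm_divide prod_eq_iff complex_eq_iff) (simp add: power2_eq_square algebra_simps)

lemma parab_para: "parab r (para 1 x) = para (-1) (r - x)"
  by (simp add: parab_def act_def para_def cmod_power2 norm_mult norm_divide prod_eq_iff complex_eq_iff) (simp add: power2_eq_square field_simps)

lemma parab_hp: "parab r (hp 1 x y) = hp (-1) (r - x) y"
  unfolding hp_def
  by (simp add: linear_add[OF SO_linear] linear_scale[OF SO_linear] parab_para)

text \<open>A point between the curve and its axis is a multiple of a point of the curve plus
  nonnegative multiples of both ideal end points.\<close>

lemma hcap:
  assumes K: "hyp_convex K" "ideal K nv" "ideal K (1, -1)" and sub: "{z. lp (lift z) (sv k) = t} \<subseteq> K" and k: "k\<^sup>2 = 1"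
    and z: "t < lp (lift z) (sv k)" "lp (lift z) (sv k) < 0"
  shows "z \<in> K"
proof -
  define w where "w = lp (lift z) (sv k)"
  define a where "a = w / t"
  have t: "t < 0" using z by simp
  then have a: "0 < a" "a < 1" using z by (simp_all add: a_def w_def zero_less_divide_iff divide_less_eq_1)
  have at: "a * t = w" using t by (simp add: a_def)
  obtain z0 z1 z2 where l: "lift z = (z0, Complex z1 z2)" by (metis complex.exhaust surj_pair)
  have z2: "z2 = - k * w" using k by (simp add: w_def l sv_def lp_def inner_complex_def power2_eq_square flip: mult.assoc)
  have kw: "(k * w)\<^sup>2 = w\<^sup>2" using k by (simp add: power_mult_distrib)
  have z0: "z0 = sqrt (1 + z1\<^sup>2 + w\<^sup>2)"
  proof -
    have "z0\<^sup>2 = 1 + z1\<^sup>2 + w\<^sup>2" using lp_lift_self[of z] unfolding l lp_self by (simp add: cmod_power2 z2 kw)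
    moreover have "0 < z0" using fst_lift_pos[of z] by (simp add: l)
    ultimately show ?thesis by (metis less_imp_le real_sqrt_unique)
  qed
  \<comment> \<open>Scaled by \<open>a\<close>, the point \<open>Z\<close> has the space coordinates
    of \<open>z\<close>; its height falls short by \<open>d\<close>, which the two end points supply
    in equal shares.\<close>
  define Z where "Z = pt (hcycle (- k * t) (z1 / a))"
  have "lp (lift Z) (sv k) = k\<^sup>2 * t" unfolding Z_def lift_hcycle by (simp add: hcycle_def sv_def lp_def inner_complex_def power2_eq_square)
  then have "Z \<in> K" using sub k by auto
  then have iZ: "incone K (a *\<^sub>R lift Z)" using a by (intro incone_scaleR) auto
  define d where "d = z0 - sqrt (a\<^sup>2 + z1\<^sup>2 + w\<^sup>2)"
  have "a\<^sup>2 \<le> 1" using a by (simp add: power_le_one)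
  then have d: "0 \<le> d / 2" by (simp add: d_def z0)
  have "a * sqrt (1 + (z1 / a)\<^sup>2 + (k * t)\<^sup>2) = sqrt (a\<^sup>2 * (1 + (z1 / a)\<^sup>2 + (k * t)\<^sup>2))"
    using a by (simp add: real_sqrt_mult)
  also have "a\<^sup>2 * (1 + (z1 / a)\<^sup>2 + (k * t)\<^sup>2) = a\<^sup>2 + (a * (z1 / a))\<^sup>2 + (k * (a * t))\<^sup>2"
    by (simp only: power_mult_distrib distrib_left mult_1_right mult.left_commute)
  also have "\<dots> = a\<^sup>2 + z1\<^sup>2 + w\<^sup>2" using a kw by (simp add: at)
  finally have f: "a * sqrt (1 + (z1 / a)\<^sup>2 + (k * t)\<^sup>2) = sqrt (a\<^sup>2 + z1\<^sup>2 + w\<^sup>2)" .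
  have "lift z = a *\<^sub>R lift Z + (d / 2) *\<^sub>R nv + (d / 2) *\<^sub>R (1, -1)"
    unfolding Z_def lift_hcycle l z2 unfolding hcycle_def using a f at[symmetric] by (simp add: prod_eq_iff complex_eq_iff nv_def d_def)
  moreover have "incone K (a *\<^sub>R lift Z + (d / 2) *\<^sub>R nv + (d / 2) *\<^sub>R (1, -1))"
    by (intro ideal_incone[OF K(3)] ideal_incone[OF K(2)] iZ d)
  ultimately show ?thesis by (metis incone_lift)
qed

text \<open>The half-planes beyond the two axes are moved apart, so that the bodies overlap only in
  their bulges; the only direction compatible with both sides is then that of \<open>nv\<close>,
  which leaves no place for its mirror image.\<close>

lemma no_cap_pair:
  assumes K: "body K" and L: "body L" and sym: "sym_pair K L" and s: "s < 0" and t: "t < 0"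
    and frK: "{z. lp (lift z) (sv (-1)) = s} \<subseteq> frontier K" and frL: "{z. lp (lift z) (sv 1) = t} \<subseteq> frontier L"
    and sK: "\<And>z. z \<in> K \<Longrightarrow> s \<le> lp (lift z) (sv (-1))" and sL: "\<And>z. z \<in> L \<Longrightarrow> t \<le> lp (lift z) (sv 1)"
  shows False
proof -
  define m where "m = max s t"
  have m: "s \<le> m" "t \<le> m" "m < 0" using s t by (auto simp: m_def)
  define b :: real where "b = -1"
  have cK: "closed K" "hyp_convex K" and cL: "closed L" "hyp_convex L" using K L by (auto simp: body_def)
  have subK: "{z. lp (lift z) (sv (-1)) = s} \<subseteq> K" and subL: "{z. lp (lift z) (sv 1) = t} \<subseteq> L"
    using frK frL frontier_subset_body[OF K] frontier_subset_body[OF L] by blast+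
  have iK: "ideal K nv" "ideal K (1, -1)"
    using ideal_hypercycle[OF cK, of "-1" s 1] ideal_hypercycle[OF cK, of "-1" s "-1"] subK unfolding sv_eq by (simp_all add: nv_def)
  have iL: "ideal L nv" "ideal L (1, -1)"
    using ideal_hypercycle[OF cL, of 1 t 1] ideal_hypercycle[OF cL, of 1 t "-1"] subL unfolding sv_eq by (simp_all add: nv_def)
  obtain B where B: "B \<in> SO" "\<And>x. mv (parab b) (mv B x) = x" "\<And>X. B (parab b X) = X" "\<And>S. mv (parab b) ` S = mv B -` S"
    using mv_vimage[OF parab_SO] by metis
  have tr: "lp (lift (mv B z)) (sv 1) = lp (lift z) (sv 1 + b *\<^sub>R nv)" for z
  proof -
    have "lp (lift (mv B z)) (sv 1) = lp (B (lift z)) (B (parab b (sv 1)))" using B(1) by (simp add: B(3))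
    then show ?thesis using B(1) by (simp add: parab_sv)
  qed
  define M where "M = K \<inter> mv (parab b) ` L"
  have Miff: "z \<in> M \<longleftrightarrow> z \<in> K \<and> mv B z \<in> L" for z by (simp add: M_def B(4))
  \<comment> \<open>The part of the strip between the axes that is covered by both bulges; the
    witness below lies on the line halfway between the axes.\<close>
  define U where "U = {z. m < lp (lift z) (sv (-1)) \<and> lp (lift z) (sv (-1)) < 0 \<and>
    m < lp (lift z) (sv 1 + b *\<^sub>R nv) \<and> lp (lift z) (sv 1 + b *\<^sub>R nv) < 0}"
  have UM: "U \<subseteq> M"
  proof
    fix z assume z: "z \<in> U"
    have "z \<in> K" using hcap[OF cK(2) iK subK, of z] z m by (simp add: U_def)
    moreover have "mv B z \<in> L" using hcap[OF cL(2) iL subL, of "mv B z"] z m unfolding tr by (simp add: U_def)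
    ultimately show "z \<in> M" by (simp add: Miff)
  qed
  have "open U" unfolding U_def by (intro open_Collect_conj open_Collect_less continuous_intros)
  moreover have "pt (hp (-1) (-1/2) (1 / (- m))) \<in> U"
  proof -
    have k: "(-1::real)\<^sup>2 = 1" by simp
    define z where "z = pt (hp (-1) (-1/2) (1 / (- m)))"
    have y: "0 < 1 / (- m)" using m by simp
    have 1: "lp (lift z) nv = - m" "lp (lift z) (sv (-1)) = m / 2"
      using lp_hp[OF k, of "-1/2" "1 / (- m)"] y by (simp_all add: z_def lift_hp[OF k])
    then have "lp (lift z) (sv 1) = - (m / 2)" using lp_sv_minus[of "lift z" 1] by simp
    then show ?thesis using 1 m unfolding z_def[symmetric] U_def b_def by (simp)
  qed
  ultimately have int: "interior M \<noteq> {}" using UM by (metis empty_iff interior_maximal subsetD)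
  obtain c where c: "\<And>x. x \<in> M \<Longrightarrow> mv (hturn c) x \<in> M"
    using sym_pairD[OF sym parab_SO int[unfolded M_def]] unfolding M_def by metis
  have Mc: "hyp_convex M" unfolding M_def by (intro hyp_convex_Int cK hyp_convex_mv cL parab_SO)
  have "M \<noteq> {}" using int by auto
  then have cM: "c \<in> M" using hturn_center_mem[OF Mc _ c] by blast
  have iM: "ideal M nv" unfolding M_def using ideal_Int[OF iK(1)] ideal_mv[OF parab_SO iL(1), of b] by simp
  have inc: "incone M (lift c + r *\<^sub>R hturn c nv)" if "0 \<le> r" for r
    using hturn_ideal[OF iM cM c that] by simp
  have null: "lp (hturn c nv) (hturn c nv) = 0" "0 \<le> lp (lift c) (hturn c nv)" "0 < lp (hturn c nv) nv"
    using hturn_null[of nv c] by (simp_all add: nv_def[symmetric])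
  have sideL: "t \<le> lp (lift z) (sv 1 + b *\<^sub>R nv)" if "z \<in> M" for z
    using sL[of "mv B z"] that unfolding Miff tr by simp
  have sideK: "s \<le> lp (lift z) (sv (-1))" if "z \<in> M" for z using sK[of z] that by (simp add: Miff)
  have "0 \<le> lp (hturn c nv) (sv (-1))" by (rule ray_bound[OF inc sideK null(1,2)])
  moreover have "0 \<le> lp (hturn c nv) (sv 1 + b *\<^sub>R nv)" by (rule ray_bound[OF inc sideL null(1,2)])
  \<comment> \<open>Adding the inequalities cancels the opposite normals and leaves the multiple of
    \<open>nv\<close>, with \<open>b\<close> negative.\<close>
  ultimately have "0 \<le> b * lp (hturn c nv) nv" using lp_sv_minus[of "hturn c nv" 1] by (simp)
  then show False using null(3) by (simp add: b_def)
qed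

section \<open>Half-planes and bodies bounded by lines\<close>

text \<open>Finitely many components, expressed by representatives: this form passes directly to
  images, and \<open>dichotomy\<close> works with the coordinates of the representatives.\<close>

definition fin :: "hyp_plane set \<Rightarrow> bool" where
  "fin K \<longleftrightarrow> (\<exists>F\<subseteq>frontier K. finite F \<and>
    (\<forall>w\<in>frontier K. \<exists>v\<in>F. \<exists>T\<subseteq>frontier K. connected T \<and> w \<in> T \<and> v \<in> T))"

lemma fin_components:
  assumes "finite (components (frontier K))"
  shows "fin K"
proof -
  define r where "r C = (SOME v. v \<in> C)" for C :: "hyp_plane set"
  have r: "r C \<in> C" if "C \<in> components (frontier K)" for C
    unfolding r_def using in_components_nonempty[OF that] by (simp add: some_in_eq)
  define F where "F = r ` components (frontier K)"
  have "F \<subseteq> frontier K" using r in_components_subset unfolding F_def by blast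
  moreover have "\<exists>v\<in>F. \<exists>T\<subseteq>frontier K. connected T \<and> w \<in> T \<and> v \<in> T" if w: "w \<in> frontier K" for w
  proof -
    obtain C where C: "C \<in> components (frontier K)" "w \<in> C" using w by (metis Union_components UnionE)
    have "r C \<in> F" using C by (simp add: F_def)
    then show ?thesis using C r[OF C(1)] in_components_subset[OF C(1)] in_components_connected[OF C(1)] by blast
  qed
  moreover have "finite F" using assms by (simp add: F_def)
  ultimately show ?thesis unfolding fin_def by blast
qed

lemma fin_mv:
  assumes "fin K" "closed K" and A: "A \<in> SO"
  shows "fin (mv A ` K)"
proof -
  obtain F where F: "F \<subseteq> frontier K" "finite F"
    "\<And>w. w \<in> frontier K \<Longrightarrow> \<exists>v\<in>F. \<exists>T\<subseteq>frontier K. connected T \<and> w \<in> T \<and> v \<in> T"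
    using assms(1) unfolding fin_def by metis
  have fr: "frontier (mv A ` K) = mv A ` frontier K" by (rule frontier_mv[OF A assms(2)])
  have "\<exists>v\<in>mv A ` F. \<exists>T\<subseteq>mv A ` frontier K. connected T \<and> w \<in> T \<and> v \<in> T" if w: "w \<in> mv A ` frontier K" for w
  proof -
    obtain u where u: "u \<in> frontier K" "w = mv A u" using w by blast
    obtain v T where "v \<in> F" "T \<subseteq> frontier K" "connected T" "u \<in> T" "v \<in> T" using F(3)[OF u(1)] by blast
    then show ?thesis using u(2)
      by (intro bexI[of _ "mv A v"] exI[of _ "mv A ` T"] conjI connected_continuous_image[OF continuous_mv[OF A]]) auto
  qed
  moreover have "mv A ` F \<subseteq> mv A ` frontier K" using F(1) by blast
  ultimately show ?thesis unfolding fin_def fr using F(2) by blast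
qed

section \<open>Vertical lines in bodies bounded by a line\<close>

definition xc :: "real \<Rightarrow> hyp_plane \<Rightarrow> real" where
  "xc k z = lp (lift z) (sv k) / lp (lift z) nv"

lemma continuous_on_xc: "continuous_on S (xc k)"
  unfolding xc_def by (intro continuous_intros) (metis lp_lift_nv_pos less_irrefl)

lemma xc_hp: "k\<^sup>2 = 1 \<Longrightarrow> 0 < y \<Longrightarrow> xc k (pt (hp k x y)) = x"
  by (simp add: xc_def lift_hp lp_hp)

lemma hp_exists:
  assumes "k\<^sup>2 = 1"
  obtains y where "0 < y" "z = pt (hp k (xc k z) y)"
  using that[of "1 / lp (lift z) nv"] z_eq_hp[OF assms, of z] by (simp add: xc_def)

lemma lp_lift_nv_nonzero [simp]: "lp (lift z) nv \<noteq> 0" "0 \<le> lp (lift z) nv"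
  by (rule less_imp_neq[THEN not_sym, OF lp_lift_nv_pos], rule less_imp_le[OF lp_lift_nv_pos])

lemma xc_sign: "0 \<le> xc k z \<longleftrightarrow> 0 \<le> lp (lift z) (sv k)" "xc k z = 0 \<longleftrightarrow> lp (lift z) (sv k) = 0"
  by (simp_all add: xc_def pos_le_divide_eq)

definition vline :: "real \<Rightarrow> hyp_plane set \<Rightarrow> real \<Rightarrow> bool" where
  "vline k K x \<longleftrightarrow> (\<forall>y>0. pt (hp k x y) \<in> K)"

locale half_body =
  fixes K :: "hyp_plane set" and k :: real
  assumes k: "k\<^sup>2 = 1" and body: "body K" and fr: "{z. lp (lift z) (sv k) = 0} \<subseteq> frontier K"
    and side: "\<And>z. z \<in> K \<Longrightarrow> 0 \<le> lp (lift z) (sv k)"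
begin

lemma closed: "closed K" and convex: "hyp_convex K"
  using body by (auto simp: body_def)

lemma line_subset: "{z. lp (lift z) (sv k) = 0} \<subseteq> K"
  using fr frontier_subset_body[OF body] by blast

lemma ideal: "ideal K nv"
  using ideal_hypercycle[OF closed convex, of k 0 1] line_subset k unfolding sv_eq by (simp add: nv_def)

lemma xc_nonneg: "z \<in> K \<Longrightarrow> 0 \<le> xc k z"
  by (simp add: xc_sign side)

lemma vline_zero: "0 < y \<Longrightarrow> pt (hp k 0 y) \<in> K"
  using line_subset by (auto simp: lift_hp[OF k] lp_hp[OF k])

lemma wide: obtains b where "b \<in> K" "0 < xc k b"
proof -
  obtain w where w: "w \<in> interior K" using body by (auto simp: body_def)
  have "xc k w \<noteq> 0" using w fr by (auto simp: xc_sign frontier_def)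
  moreover have "w \<in> K" using w interior_subset by blast
  ultimately show ?thesis using that xc_nonneg[of w] by force
qed

text \<open>A support line at \<open>u\<close> cannot leave the vertical line, which lies in
  \<open>K\<close> entirely; but then \<open>K\<close> has points on both sides of it, namely on the
  line over 0 and at \<open>b\<close>.\<close>

lemma no_touch:
  assumes x: "0 < x" and v: "vline k K x" and b: "b \<in> K" "x < xc k b" and u: "u \<in> frontier K" "xc k u = x"
  shows False
proof -
  obtain N where N: "supp K u N" using supp_exists[OF body u(1)] .
  have pos: "0 \<le> lp (lift z) N" if "z \<in> K" for z using N that by (simp add: supp_def)
  obtain yu where yu: "0 < yu" "u = pt (hp k x yu)" using hp_exists[OF k, of u] u(2) by metis
  define p q e where "p = lp (para k 0) N" and "q = - lp (sv k) N" and "e = lp nv N"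
  have lpN: "y * lp (lift (pt (hp k x y))) N = p + x * q + (x\<^sup>2 + y\<^sup>2) / 2 * e" if "0 < y" for x y
  proof -
    have "lp (lift (pt (hp k x y))) N = (1 / y) * lp (para k x) N + (y / 2) * e"
      using that by (simp add: lift_hp[OF k]) (simp add: hp_def e_def)
    moreover have "lp (para k x) N = p + x * q + x\<^sup>2 / 2 * e"
      by (subst para_affine) (simp add: p_def q_def e_def)
    ultimately show ?thesis using that by (simp add: field_simps power2_eq_square)
  qed
  define g where "g = p + x * q + x\<^sup>2 / 2 * e"
  have g: "0 \<le> g + y\<^sup>2 / 2 * e" if "0 < y" for y
  proof -
    have "0 \<le> y * lp (lift (pt (hp k x y))) N" using v that by (intro mult_nonneg_nonneg pos) (auto simp: vline_def)
    then show ?thesis unfolding lpN[OF that] by (simp add: g_def field_simps)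
  qed
  have "lp (lift (pt (hp k x yu))) N = 0" using N yu by (simp add: supp_def)
  then have g0: "g + yu\<^sup>2 / 2 * e = 0" using lpN[OF yu(1), of x] by (simp add: g_def field_simps)
  \<comment> \<open>\<open>g + y\<^sup>2 / 2 * e\<close> vanishes at \<open>yu\<close> and is
    nonnegative at twice and at half this height, so both of its coefficients are 0.\<close>
  have h1: "(2 * yu)\<^sup>2 / 2 * e = 4 * (yu\<^sup>2 / 2 * e)" and h2: "(yu / 2)\<^sup>2 / 2 * e = (yu\<^sup>2 / 2 * e) / 4"
    by (simp_all add: power_mult_distrib power_divide)
  have "0 < 2 * yu" "0 < yu / 2" using yu by simp_all
  then have "0 \<le> g + 4 * (yu\<^sup>2 / 2 * e)" "0 \<le> g + (yu\<^sup>2 / 2 * e) / 4" using g h1 h2 by metis+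
  then have "yu\<^sup>2 / 2 * e = 0" "g = 0" using g0 by argo+
  then have e: "e = 0" and pq: "p + x * q = 0" using yu by (simp_all add: g_def)
  have "0 \<le> 1 * lp (lift (pt (hp k 0 1))) N" using pos[OF vline_zero[of 1]] by simp
  then have p: "0 \<le> p" using lpN[of 1 0] e by simp
  obtain y where y: "0 < y" "b = pt (hp k (xc k b) y)" using hp_exists[OF k] .
  have "0 \<le> y * lp (lift b) N" using y(1) pos[OF b(1)] by simp
  then have "0 \<le> p + xc k b * q" using lpN[OF y(1), of "xc k b"] y e by simp
  then have "0 \<le> (xc k b - x) * q" using pq by (simp add: algebra_simps)
  then have "0 \<le> q" using b(2) by (simp add: zero_le_mult_iff)
  then have "0 \<le> x * q" using x by simp
  then have "p = 0" "x * q = 0" using p pq by linarith+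
  then have q: "q = 0" using x by simp
  have all: "lp (lift z) N = 0" for z
  proof -
    obtain y where y: "0 < y" "z = pt (hp k (xc k z) y)" using hp_exists[OF k] .
    then have "y * lp (lift z) N = 0" using lpN[OF y(1), of "xc k z"] \<open>p = 0\<close> q e by simp
    then show ?thesis using y by simp
  qed
  have "N = 0"
  proof (rule lp_nondegenerate)
    fix X assume "future X"
    then obtain d where "0 < d" "lift (pt X) = d *\<^sub>R X" using lift_pt_pos by blast
    then show "lp X N = 0" using all[of "pt X"] by simp
  qed
  then show False using N by (simp add: supp_def)
qed

lemma high:
  assumes "b \<in> K" "0 \<le> x" "x \<le> xc k b"
  obtains Y where "0 < Y" "\<And>y. Y \<le> y \<Longrightarrow> pt (hp k x y) \<in> K"
proof -
  obtain yb where yb: "0 < yb" "b = pt (hp k (xc k b) yb)" using hp_exists[OF k] .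
  define Y where "Y = 1 + ((0 - xc k b)\<^sup>2 + 1\<^sup>2 + yb\<^sup>2)"
  have Y: "1 \<le> Y" by (simp add: Y_def)
  have "pt (hp k x y) \<in> K" if "Y \<le> y" for y
  proof (rule hp_between[OF k convex ideal vline_zero[of 1], of "xc k b" yb])
    have "(0 - xc k b)\<^sup>2 + 1\<^sup>2 + yb\<^sup>2 \<le> y" using that by (simp add: Y_def)
    also have "y * 1 \<le> y * y" using that Y by (intro mult_left_mono) auto
    then have "y \<le> y\<^sup>2" by (simp add: power2_eq_square)
    finally show "(0 - xc k b)\<^sup>2 + 1\<^sup>2 + yb\<^sup>2 \<le> y\<^sup>2" .
  qed (use yb assms that Y in auto)
  then show ?thesis using that[of Y] Y by simp
qed

text \<open>Otherwise vertical lines contained in \<open>K\<close> accumulate at 0 and points are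
  missing between them. No connected part of the boundary crosses such a line, so a boundary
  component is enclosed between two of them closer to 0 than every representative with positive
  coordinate.\<close>

lemma dichotomy:
  assumes "fin K"
  shows "(\<exists>e>0. \<forall>x. 0 < x \<longrightarrow> x < e \<longrightarrow> \<not> vline k K x) \<or> (\<exists>e>0. \<forall>z. 0 \<le> xc k z \<longrightarrow> xc k z \<le> e \<longrightarrow> z \<in> K)"
proof (rule ccontr)
  assume n: "\<not> ?thesis"
  then have n1: "\<And>e. 0 < e \<Longrightarrow> \<exists>x. 0 < x \<and> x < e \<and> vline k K x" by blast
  from n have n2: "\<And>e. 0 < e \<Longrightarrow> \<exists>z. 0 \<le> xc k z \<and> xc k z \<le> e \<and> z \<notin> K" by blast
  obtain F where F: "finite F" "F \<subseteq> frontier K"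
    "\<And>w. w \<in> frontier K \<Longrightarrow> \<exists>v\<in>F. \<exists>T\<subseteq>frontier K. connected T \<and> w \<in> T \<and> v \<in> T"
    using assms unfolding fin_def by metis
  \<comment> \<open>No representative has a coordinate strictly between 0 and \<open>e\<close>; the
    1 keeps the set nonempty.\<close>
  define e where "e = Min (insert 1 {x \<in> xc k ` F. 0 < x})"
  have fin: "finite (insert 1 {x \<in> xc k ` F. 0 < x})" using F(1) by simp
  have e0: "0 < e" unfolding e_def using fin by (subst Min_gr_iff) auto
  have eF: "e \<le> xc k v" if "v \<in> F" "0 < xc k v" for v unfolding e_def using fin that by (intro Min_le) auto
  obtain x1 where x1: "0 < x1" "x1 < e" "vline k K x1" using n1[OF e0] by blast
  obtain x2 where x2: "0 < x2" "x2 < x1" "vline k K x2" using n1[OF x1(1)] by blast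
  have in_line: "z \<in> K" if "vline k K (xc k z)" for z
    using that hp_exists[OF k, of z] unfolding vline_def by metis
  have crosses: False if u: "T \<subseteq> frontier K" "connected T" "v \<in> T" "w \<in> T" "xc k v \<le> x" "x \<le> xc k w"
    and x: "0 < x" "vline k K x" "x < x1" for T u v w x
  proof -
    have "connected (xc k ` T)" using u(2) continuous_on_xc by (intro connected_continuous_image)
    then have "x \<in> xc k ` T" using u(3-6) by (meson connectedD_interval imageI)
    then obtain t' where t: "t' \<in> frontier K" "xc k t' = x" using u(1) by auto
    have "pt (hp k x1 1) \<in> K" using x1(3) by (simp add: vline_def)
    then show False using no_touch[OF x(1,2), of "pt (hp k x1 1)" t'] t x(3) by (simp add: xc_hp k)
  qed
  obtain z where z: "0 \<le> xc k z" "xc k z \<le> x2" "z \<notin> K" using n2[OF x2(1)] by blast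
  have "xc k z \<noteq> 0" using z(3) line_subset by (auto simp: xc_sign)
  then have z0: "0 < xc k z" using z by simp
  have "xc k z \<noteq> x2" using z(3) in_line x2(3) by metis
  then have z2: "xc k z < x2" using z by simp
  obtain yz where yz: "0 < yz" "z = pt (hp k (xc k z) yz)" using hp_exists[OF k] .
  have "pt (hp k x2 1) \<in> K" using x2(3) by (simp add: vline_def)
  then obtain Y where Y: "0 < Y" "\<And>y. Y \<le> y \<Longrightarrow> pt (hp k (xc k z) y) \<in> K"
    using high[of "pt (hp k x2 1)" "xc k z"] z by (metis xc_hp k zero_less_one)
  \<comment> \<open>The vertical line over the missing point reaches \<open>K\<close> high up, so it
    contains a boundary point with the same coordinate.\<close>
  define ray where "ray = (\<lambda>y. pt (hp k (xc k z) y)) ` {0<..}"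
  have "continuous_on {0<..} (\<lambda>y. pt (hp k (xc k z) y))"
    using hp_unit(2)[OF k] by (intro continuous_intros) (auto simp: hp_def intro!: continuous_intros)
  then have "connected ray" unfolding ray_def by (intro connected_continuous_image) auto
  moreover have "z \<in> ray" "pt (hp k (xc k z) Y) \<in> ray" using yz Y(1) by (auto simp: ray_def)
  ultimately obtain u where u: "u \<in> ray" "u \<in> frontier K"
    using connected_Int_frontier[of ray K] z(3) Y(2)[of Y] by blast
  have xu: "xc k u = xc k z" using u(1) by (auto simp: ray_def xc_hp k)
  obtain v T where v: "v \<in> F" "T \<subseteq> frontier K" "connected T" "u \<in> T" "v \<in> T" using F(3)[OF u(2)] by blast
  \<comment> \<open>Since \<open>x2 < e\<close>, the representative then has a coordinate of at most
    0, and the connected set joining it to \<open>u\<close> crosses the line over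
    \<open>x3\<close>.\<close>
  have "xc k v < x2"
    using crosses[OF v(2,3,4,5), of x2] x2 z2 xu by fastforce
  then have "xc k v \<le> 0" using eF[OF v(1)] x2 x1 by force
  obtain x3 where x3: "0 < x3" "x3 < xc k z" "vline k K x3" using n1[OF z0] by blast
  show False
    using crosses[OF v(2,3,5,4), of x3] x3 \<open>xc k v \<le> 0\<close> xu z2 x2 by fastforce
qed

end

text \<open>On the vertical line through its centre a half-turn inverts the heights.\<close>

lemma hturn_hp:
  assumes k: "k\<^sup>2 = 1" and c: "lift c = hp k x yc" and y: "0 < yc" "0 < y"
  shows "hturn c (hp k x y) = hp k x (yc\<^sup>2 / y)"
proof -
  have "lp (hp k x y) (lift c) = (y / yc + yc / y) / 2"
    unfolding c hp_def using y k by (simp add: field_simps)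
  then have "hturn c (hp k x y) = (y / yc + yc / y) *\<^sub>R hp k x yc - hp k x y"
    by (simp add: hturn_def c)
  also have "\<dots> = ((y / yc + yc / y) / yc - 1 / y) *\<^sub>R para k x + ((y / yc + yc / y) * (yc / 2) - y / 2) *\<^sub>R nv"
    by (simp add: hp_def algebra_simps scaleR_add_left add_divide_distrib)
  also have "(y / yc + yc / y) / yc - 1 / y = 1 / (yc\<^sup>2 / y)" using y by (simp add: field_simps power2_eq_square)
  also have "(y / yc + yc / y) * (yc / 2) - y / 2 = (yc\<^sup>2 / y) / 2" using y by (simp add: field_simps power2_eq_square)
  finally show ?thesis by (simp add: hp_def)
qed

text \<open>The vertical line through the centre lies in both bodies and excludes the first
  alternative of \<open>dichotomy\<close> for each. Hence the intersection is the whole strip, and a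
  point of its boundary is found whose mirror image is interior.\<close>

lemma no_line_pair:
  assumes K: "half_body K (-1)" and L: "half_body L 1" and sym: "sym_pair K L" and finK: "fin K" and finL: "fin L"
  shows False
proof -
  interpret K: half_body K "-1" by (rule K)
  interpret L: half_body L 1 by (rule L)
  obtain bK where bK: "bK \<in> K" "0 < xc (-1) bK" using K.wide .
  obtain bL where bL: "bL \<in> L" "0 < xc 1 bL" using L.wide .
  obtain eK where eK: "0 < eK" "(\<forall>x. 0 < x \<longrightarrow> x < eK \<longrightarrow> \<not> vline (-1) K x) \<or> (\<forall>z. 0 \<le> xc (-1) z \<longrightarrow> xc (-1) z \<le> eK \<longrightarrow> z \<in> K)"
    using K.dichotomy[OF finK] by blast
  obtain eL where eL: "0 < eL" "(\<forall>x. 0 < x \<longrightarrow> x < eL \<longrightarrow> \<not> vline 1 L x) \<or> (\<forall>z. 0 \<le> xc 1 z \<longrightarrow> xc 1 z \<le> eL \<longrightarrow> z \<in> L)"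
    using L.dichotomy[OF finL] by blast
  \<comment> \<open>The strip is narrower than both bodies and than both thresholds of
    \<open>dichotomy\<close>.\<close>
  define b where "b = min (min (xc (-1) bK) (xc 1 bL)) (min eK eL) / 2"
  have b: "0 < b" "b < xc (-1) bK" "b < xc 1 bL" "b < eK" "b < eL"
    using bK bL eK(1) eL(1) by (auto simp: b_def min_def)
  obtain B where B: "B \<in> SO" "\<And>x. mv (parab b) (mv B x) = x" "\<And>x. mv B (mv (parab b) x) = x" "\<And>X. B (parab b X) = X"
    "\<And>S. mv (parab b) ` S = mv B -` S"
    using mv_vimage[OF parab_SO] by metis
  define M where "M = K \<inter> mv (parab b) ` L"
  have Miff: "z \<in> M \<longleftrightarrow> z \<in> K \<and> mv B z \<in> L" for z by (simp add: M_def B(5))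
  have Bhp: "mv B (pt (hp (-1) x y)) = pt (hp 1 (b - x) y)" if "0 < y" for x y
  proof -
    have "mv (parab b) (pt (hp 1 (b - x) y)) = pt (hp (-1) x y)"
      using that by (simp add: lift_hp parab_hp mv_def)
    then show ?thesis using B(3) by metis
  qed
  have xB: "xc 1 (mv B z) = b - xc (-1) z" for z
  proof -
    obtain y where "0 < y" "z = pt (hp (-1) (xc (-1) z) y)" using hp_exists[OF K.k] .
    then show ?thesis by (metis Bhp xc_hp one_power2)
  qed
  have strip: "0 \<le> xc (-1) z" "xc (-1) z \<le> b" if "z \<in> M" for z
    using K.xc_nonneg[of z] L.xc_nonneg[of "mv B z"] that by (auto simp: Miff xB)
  have int: "interior M \<noteq> {}"
  proof -
    obtain yK where yK: "0 < yK" "bK = pt (hp (-1) (xc (-1) bK) yK)" using hp_exists[OF K.k] .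
    obtain yL where yL: "0 < yL" "bL = pt (hp 1 (xc 1 bL) yL)" using hp_exists[OF L.k] .
    \<comment> \<open>Above the height \<open>sqrt Y\<close> the criterion of
      \<open>hp_between\<close> holds for both bodies, so the strip belongs to both.\<close>
    define Y where "Y = (0 - xc (-1) bK)\<^sup>2 + 1\<^sup>2 + yK\<^sup>2 + ((0 - xc 1 bL)\<^sup>2 + 1\<^sup>2 + yL\<^sup>2)"
    have Y: "0 < Y" by (simp add: Y_def add_pos_nonneg add_nonneg_pos)
    define U where "U = {z. 0 < xc (-1) z \<and> xc (-1) z < b \<and> lp (lift z) nv * sqrt Y < 1}"
    have "z \<in> M" if z: "z \<in> U" for z
    proof -
      define y where "y = 1 / lp (lift z) nv"
      have y: "0 < y" "z = pt (hp (-1) (xc (-1) z) y)" using z_eq_hp[OF K.k, of z] by (simp_all add: y_def xc_def)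
      have "sqrt Y < y" using z by (simp add: U_def y_def field_simps)
      then have "Y < y\<^sup>2" using Y y by (metis real_sqrt_less_iff real_sqrt_unique less_imp_le)
      then have yy: "(0 - xc (-1) bK)\<^sup>2 + 1\<^sup>2 + yK\<^sup>2 \<le> y\<^sup>2" "(0 - xc 1 bL)\<^sup>2 + 1\<^sup>2 + yL\<^sup>2 \<le> y\<^sup>2"
        by (simp_all add: Y_def add_increasing add_increasing2 add_nonneg_nonneg)
           (smt (verit) zero_le_power2)+
      have "pt (hp (-1) (xc (-1) z) y) \<in> K"
        by (rule hp_between[OF K.k K.convex K.ideal K.vline_zero[of 1], of "xc (-1) bK" yK])
           (use bK(1) yK y(1) yy(1) z b in \<open>auto simp: U_def\<close>)
      moreover have "pt (hp 1 (b - xc (-1) z) y) \<in> L"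
        by (rule hp_between[OF L.k L.convex L.ideal L.vline_zero[of 1], of "xc 1 bL" yL])
           (use bL(1) yL y(1) yy(2) z b in \<open>auto simp: U_def\<close>)
      ultimately show ?thesis using y Bhp[OF y(1), of "xc (-1) z"] by (simp add: Miff)
    qed
    moreover have "open U" unfolding U_def by (intro open_Collect_conj open_Collect_less continuous_intros continuous_on_xc)
    moreover have "pt (hp (-1) (b / 2) (sqrt Y + 1)) \<in> U"
    proof -
      have p: "0 < sqrt Y + 1" using Y by (simp add: add_pos_nonneg)
      then show ?thesis using b(1) by (simp add: U_def xc_hp lift_hp lp_hp)
    qed
    ultimately show ?thesis by (metis empty_iff interior_maximal subsetI subsetD)
  qed
  obtain c where c: "\<And>x. x \<in> M \<Longrightarrow> mv (hturn c) x \<in> M"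
    using sym_pairD[OF sym parab_SO int[unfolded M_def]] unfolding M_def by metis
  have Mc: "hyp_convex M" unfolding M_def by (intro hyp_convex_Int K.convex hyp_convex_mv L.convex parab_SO)
  have "M \<noteq> {}" using int by auto
  then have cM: "c \<in> M" using hturn_center_mem[OF Mc _ c] by blast
  have iM: "ideal M nv" unfolding M_def using ideal_Int[OF K.ideal] ideal_mv[OF parab_SO L.ideal, of b] by simp
  define x where "x = xc (-1) c"
  obtain yc where yc: "0 < yc" "c = pt (hp (-1) x yc)" using hp_exists[OF K.k, of c] unfolding x_def .
  have lc: "lift c = hp (-1) x yc" using yc by (simp add: lift_hp)
  \<comment> \<open>Above \<open>c\<close> because \<open>nv\<close> is an ideal point of
    \<open>M\<close>, below \<open>c\<close> by the half-turn.\<close>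
  have vM: "pt (hp (-1) x y) \<in> M" if y: "0 < y" for y
  proof (cases "yc \<le> y")
    case True
    then show ?thesis using hp_up[OF K.k iM cM[unfolded yc(2)] yc(1)] by simp
  next
    case False
    have "yc * y \<le> yc * yc" using False yc by (intro mult_left_mono) auto
    then have "yc \<le> yc\<^sup>2 / y" using y by (simp add: le_divide_eq power2_eq_square)
    then have "pt (hp (-1) x (yc\<^sup>2 / y)) \<in> M" using hp_up[OF K.k iM cM[unfolded yc(2)] yc(1)] by simp
    then have "mv (hturn c) (pt (hp (-1) x (yc\<^sup>2 / y))) \<in> M" by (rule c)
    moreover have "hturn c (hp (-1) x (yc\<^sup>2 / y)) = hp (-1) x (yc\<^sup>2 / (yc\<^sup>2 / y))"
      using yc y by (intro hturn_hp[OF K.k lc]) auto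
    ultimately show ?thesis using y yc by (simp add: mv_def lift_hp)
  qed
  have xM: "0 \<le> x" "x \<le> b" using strip[OF cM] by (simp_all add: x_def)
  have lpN: "lp (lift z) (sv (-1)) = xc (-1) z * lp (lift z) nv" for z
    by (simp add: xc_def)
  \<comment> \<open>Multiplied by the product with \<open>nv\<close>, the coordinate becomes the
    linear functional given by \<open>sv (-1)\<close>, to which the formula of the half-turn
    applies.\<close>
  have tr: "xc (-1) (mv (hturn c) z) * lp (lift (mv (hturn c) z)) nv =
      2 * lp (lift z) (lift c) * (x / yc) - xc (-1) z * lp (lift z) nv" for z
    unfolding lpN[symmetric] by (simp add: hturn_def lp_hp lc)
  have tr': "lp (lift (mv (hturn c) z)) nv = 2 * lp (lift z) (lift c) * (1 / yc) - lp (lift z) nv" for z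
    by (simp add: hturn_def lp_hp lc)
  have trb: "(b - xc (-1) (mv (hturn c) z)) * lp (lift (mv (hturn c) z)) nv =
      2 * lp (lift z) (lift c) * ((b - x) / yc) - (b - xc (-1) z) * lp (lift z) nv" for z
    unfolding left_diff_distrib tr unfolding tr' using yc by (simp add: field_simps)
  obtain w where w: "w \<in> M" "0 < xc (-1) w" "xc (-1) w < b"
  proof -
    obtain w where w: "w \<in> interior M" using int by blast
    have sub: "interior M \<subseteq> interior K" unfolding M_def by (intro interior_mono) simp
    have "w \<in> M" using w interior_subset by blast
    moreover have "xc (-1) w \<noteq> 0" using w sub K.fr by (auto simp: xc_sign frontier_def)
    moreover have "xc (-1) w \<noteq> b"
    proof
      assume "xc (-1) w = b"
      then have "mv B w \<in> frontier L" using xB[of w] L.fr by (auto simp: xc_sign)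
      then have "mv (parab b) (mv B w) \<in> mv (parab b) ` frontier L" by blast
      then have "w \<in> frontier (mv (parab b) ` L)" by (simp add: B(2) frontier_mv L.closed)
      moreover have "interior M \<subseteq> interior (mv (parab b) ` L)" unfolding M_def by (intro interior_mono) simp
      ultimately show False using w by (auto simp: frontier_def)
    qed
    ultimately show ?thesis using that strip[of w] by force
  qed
  \<comment> \<open>A centre on the bounding line would throw the inner point \<open>w\<close> out
    of the strip.\<close>
  have "x \<noteq> 0"
  proof
    assume "x = 0"
    then have "xc (-1) (mv (hturn c) w) * lp (lift (mv (hturn c) w)) nv < 0" using w unfolding tr by simp
    moreover have "0 \<le> xc (-1) (mv (hturn c) w) * lp (lift (mv (hturn c) w)) nv"
      using strip(1)[OF c[OF w(1)]] by (intro mult_nonneg_nonneg) (simp_all del: lift_mv)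
    ultimately show False by linarith
  qed
  moreover have "x \<noteq> b"
  proof
    assume "x = b"
    then have "(b - xc (-1) (mv (hturn c) w)) * lp (lift (mv (hturn c) w)) nv < 0" using w unfolding trb by simp
    moreover have "0 \<le> (b - xc (-1) (mv (hturn c) w)) * lp (lift (mv (hturn c) w)) nv"
      using strip(2)[OF c[OF w(1)]] by (intro mult_nonneg_nonneg) (simp_all del: lift_mv)
    ultimately show False by linarith
  qed
  ultimately have x: "0 < x" "x < b" using xM by auto
  have "vline (-1) K x" using vM by (simp add: vline_def Miff)
  moreover have "vline 1 L (b - x)" using vM Bhp by (simp add: vline_def Miff)
  ultimately have all: "\<And>z. 0 \<le> xc (-1) z \<Longrightarrow> xc (-1) z \<le> eK \<Longrightarrow> z \<in> K" "\<And>z. 0 \<le> xc 1 z \<Longrightarrow> xc 1 z \<le> eL \<Longrightarrow> z \<in> L"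
    using eK(2) eL(2) x b by force+
  define U where "U = {z. 0 < xc (-1) z \<and> xc (-1) z < b}"
  have "open U" unfolding U_def by (intro open_Collect_conj open_Collect_less continuous_intros continuous_on_xc)
  have UM: "U \<subseteq> M" using all b by (auto simp: U_def Miff xB)
  \<comment> \<open>Makes \<open>b / y\<close> equal to \<open>(b - x) / yc\<close>, so that the
    mirror image of \<open>(0, y)\<close> stays to the left of \<open>b\<close>; it is to the right
    of 0 because \<open>x\<close> is positive.\<close>
  define y where "y = b * yc / (b - x)"
  have y: "0 < y" using b x yc by (simp add: y_def)
  define z where "z = pt (hp (-1) 0 y)"
  have z: "xc (-1) z = 0" "lp (lift z) nv = 1 / y" using y by (simp_all add: z_def xc_hp lift_hp lp_hp)
  define s where "s = mv (hturn c) z"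
  have pc: "1 \<le> lp (lift z) (lift c)" by (rule lp_lift_ge_1)
  have "0 < xc (-1) s * lp (lift s) nv" unfolding s_def tr using z(1) pc x yc by simp
  then have "0 < xc (-1) s" using lp_lift_nv_pos[of s] by (simp add: zero_less_mult_iff)
  moreover have "0 < (b - xc (-1) s) * lp (lift s) nv"
  proof -
    have "b * (1 / y) = 1 * ((b - x) / yc)" using b x yc by (simp add: y_def field_simps)
    also have "\<dots> < 2 * lp (lift z) (lift c) * ((b - x) / yc)" using pc x yc by (intro mult_strict_right_mono) auto
    finally show ?thesis unfolding s_def trb z by simp
  qed
  then have "xc (-1) s < b" using lp_lift_nv_pos[of s] by (simp add: zero_less_mult_iff)
  ultimately have "s \<in> U" by (simp add: U_def)
  then have "mv (hturn c) s \<in> mv (hturn c) ` U" by blast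
  then have "z \<in> mv (hturn c) ` U" by (simp add: s_def)
  moreover have "mv (hturn c) ` U \<subseteq> K" using c UM by (auto simp: Miff)
  ultimately have "z \<in> interior K" using open_mv[OF hturn_SO \<open>open U\<close>] by (meson interior_maximal subsetD)
  moreover have "z \<in> frontier K" using z(1) K.fr by (auto simp: xc_sign)
  ultimately show False by (simp add: frontier_def)
qed

section \<open>The equivalence\<close>

lemma straight_line_plane:
  assumes "lp N N < 0"
  shows "straight_line {z. lp (lift z) N = 0}"
proof -
  obtain A c where A: "A \<in> SO" "0 < c" "A N = c *\<^sub>R sv 1"
    using normalise_spacelike[OF assms, of 1] unfolding sv_eq by auto
  obtain B where B: "B \<in> SO" "\<And>x. mv A (mv B x) = x" "\<And>x. mv B (mv A x) = x" "\<And>X. A (B X) = X"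
    using mv_vimage[OF A(1)] by metis
  define g where "g s = pt (cosh s, of_real (sinh s))" for s :: real
  have g: "lift (g s) = (cosh s, of_real (sinh s))" for s :: real
  proof -
    have u: "lp (cosh s, of_real (sinh s)) (cosh s, of_real (sinh s)) = 1"
      using hyperbolic_pythagoras[of s] by (simp add: lp_self)
    have "0 \<le> lp (cosh s, of_real (sinh s)) (1, 0)" by (simp add: lp_def)
    moreover have "future (1, 0)" by (simp add: future_def)
    ultimately have "future (cosh s, of_real (sinh s))" by (metis futureI u zero_less_one)
    then show ?thesis unfolding g_def by (rule lift_pt_unit[OF _ u])
  qed
  have dg: "dist (g s) (g t) = \<bar>s - t\<bar>" for s t
  proof -
    have "cosh (dist (g s) (g t)) = cosh \<bar>s - t\<bar>"
      unfolding cosh_dist g by (simp add: lp_def cosh_diff inner_complex_def)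
    then show ?thesis by (metis arcosh_cosh_real abs_ge_zero zero_le_dist)
  qed
  have tr: "lp (lift (mv B w)) N = c * lp (lift w) (sv 1)" for w
  proof -
    have "lp (lift (mv B w)) N = lp (A (B (lift w))) (A N)" using A(1) B(1) by simp
    then show ?thesis by (simp add: B(4) A(3))
  qed
  have "{z. lp (lift z) N = 0} = range (\<lambda>s. mv B (g s))"
  proof (intro equalityI subsetI)
    fix z assume z: "z \<in> {z. lp (lift z) N = 0}"
    define w where "w = mv A z"
    have zw: "z = mv B w" by (simp add: w_def B(3))
    have "lp (lift w) (sv 1) = 0" using z tr[of w] A(2) by (simp add: zw)
    then obtain a b where w: "lift w = (a, of_real b)"
      by (cases "lift w"; cases "snd (lift w)") (auto simp: sv_def lp_def inner_complex_def complex_of_real_def)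
    have "a\<^sup>2 = b\<^sup>2 + 1" using lp_lift_self[of w] unfolding w lp_self by simp
    moreover have "0 < a" using fst_lift_pos[of w] by (simp add: w)
    ultimately have "a = sqrt (b\<^sup>2 + 1)" by (metis less_imp_le real_sqrt_unique)
    then have "lift w = lift (g (arsinh b))" unfolding w g by (simp add: cosh_arsinh_real)
    then show "z \<in> range (\<lambda>s. mv B (g s))" by (simp add: zw lift_inj)
  next
    fix z assume "z \<in> range (\<lambda>s. mv B (g s))"
    then obtain s where s: "z = mv B (g s)" by blast
    have "lp (lift (g s)) (sv 1) = 0" by (simp add: g sv_def lp_def inner_complex_def)
    then show "z \<in> {z. lp (lift z) N = 0}" by (simp add: s tr del: lift_mv)
  qed
  moreover have "dist (mv B (g s)) (mv B (g t)) = \<bar>s - t\<bar>" for s t using B(1) dg by simp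
  ultimately show ?thesis unfolding straight_line_def by (intro exI[of _ "\<lambda>s. mv B (g s)"]) auto
qed

text \<open>By \<open>germ_match\<close> every germ of \<open>K\<close> is that of a straight line,
  and such a line is open and closed in its component.\<close>

lemma line_components:
  assumes K: "body K" and L: "body L" and sym: "sym_pair K L" and gL: "germ L y N'"
    and N': "lp N' N' < 0" "lp (lift y) N' = 0" and C: "C \<in> components (frontier K)"
  shows "straight_line C"
proof -
  obtain z where z: "z \<in> C" using in_components_nonempty[OF C] by blast
  have "z \<in> frontier K" using z in_components_subset[OF C] by blast
  then obtain N where g: "germ K z N" using germ_exists[OF K L sym] by blast
  obtain A c where A: "A \<in> SO" "c \<noteq> 0" "A N' = c *\<^sub>R N" "lp (lift y) N' = c * lp (lift z) N"
    using germ_match[OF K L sym g gL] .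
  have "lp N' N' = lp (A N') (A N')" using A(1) by simp
  also have "\<dots> = c\<^sup>2 * lp N N" unfolding A(3) by (simp add: power2_eq_square)
  finally have N: "lp N N < 0" using N'(1) by (simp add: mult_less_0_iff)
  have zN: "lp (lift z) N = 0" using A N'(2) by simp
  define l where "l = {w. lp (lift w) N = 0}"
  have gl: "germ K w N" if "w \<in> l" for w using plane_germ[OF K L sym g, of w] that by (simp add: l_def zN)
  have "l \<subseteq> frontier K" using gl by (auto simp: germ_def)
  moreover have "connected l" unfolding l_def using g by (intro connected_plane) (simp add: germ_def)
  moreover have zl: "z \<in> l" by (simp add: l_def zN)
  ultimately have lC: "l \<subseteq> C" using z by (intro components_maximal[OF C]) auto
  have "closed l" unfolding l_def by (intro closed_Collect_eq continuous_intros)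
  then have "closedin (top_of_set C) (C \<inter> l)" by (rule closedin_closed_Int)
  moreover have "C \<inter> l = l" using lC by blast
  ultimately have cl: "closedin (top_of_set C) l" by simp
  have op: "openin (top_of_set C) l"
  proof (subst openin_subopen, intro ballI)
    fix w assume w: "w \<in> l"
    obtain W where W: "open W" "w \<in> W" "\<And>v. v \<in> W \<Longrightarrow> v \<in> frontier K \<longleftrightarrow> lp (lift v) N = lp (lift w) N"
      using gl[OF w] unfolding germ_def by blast
    have "C \<inter> W \<subseteq> l" using W(3) in_components_subset[OF C] w by (auto simp: l_def)
    moreover have "openin (top_of_set C) (C \<inter> W)" by (rule openin_open_Int[OF W(1)])
    ultimately show "\<exists>T. openin (top_of_set C) T \<and> w \<in> T \<and> T \<subseteq> l" using W(2) w lC by blast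
  qed
  have "l = C"
    using in_components_connected[OF C] op cl zl unfolding connected_clopen by blast
  then show ?thesis using straight_line_plane[OF N] by (simp add: l_def)
qed

lemma congruence_cball:
  assumes "congruence f"
  shows "f ` cball c r = cball (f c) r"
proof (intro equalityI subsetI)
  fix y assume y: "y \<in> cball (f c) r"
  obtain x where "y = f x" using assms unfolding congruence_def by blast
  then show "y \<in> f ` cball c r" using y assms by (auto simp: congruence_def)
qed (use assms in \<open>auto simp: congruence_def\<close>)

text \<open>The half-turn about the midpoint of the centres exchanges the two discs.\<close>

lemma cball_Int_centrally_symmetric: "centrally_symmetric (cball p r \<inter> cball q r)"
proof -
  obtain m where m: "mv (hturn m) p = q" "mv (hturn m) q = p" using midpoint_exists[of p q] .
  have "inj (mv (hturn m))" by (rule bij_is_inj[OF mv_bij[OF hturn_SO]])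
  then have "mv (hturn m) ` (cball p r \<inter> cball q r) = cball p r \<inter> cball q r"
    using m by (simp add: image_Int mv_cball Int_commute)
  then show ?thesis unfolding centrally_symmetric_iff by blast
qed

lemma timelike_case:
  assumes K: "body K" and L: "body L" and sym: "sym_pair K L" and gK: "germ K x N" and gL: "germ L y N'"
    and N: "0 < lp N N"
  shows "hyp_disc K \<and> hyp_disc L \<and> hyp_congruent K L"
proof -
  obtain A c where A: "A \<in> SO" "c \<noteq> 0" "A N' = c *\<^sub>R N" "lp (lift y) N' = c * lp (lift x) N"
    using germ_match[OF K L sym gK gL] .
  have "lp N' N' = lp (A N') (A N')" using A(1) by simp
  also have "\<dots> = c\<^sup>2 * lp N N" unfolding A(3) by (simp add: power2_eq_square)
  finally have N': "lp N' N' = c\<^sup>2 * lp N N" .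
  have "0 < lp N' N'" using N A(2) by (simp add: N')
  define t where "t = \<bar>lp (lift x) N\<bar> / sqrt (lp N N)"
  have t': "\<bar>lp (lift y) N'\<bar> / sqrt (lp N' N') = t"
    using A(2) by (simp add: t_def N' A(4) abs_mult real_sqrt_mult)
  obtain a where a: "K = cball a (arcosh t)" "1 < t" using timelike_disc[OF K L sym gK N] unfolding t_def .
  obtain b where b: "L = cball b (arcosh t)"
    using timelike_disc[OF L K sym_pair_commute[OF sym] gL \<open>0 < lp N' N'\<close>] unfolding t' .
  have "0 \<le> arcosh t" "arcosh t \<noteq> 0" using a(2) arcosh_eq_0_iff_real[of t] by simp_all
  then have r: "0 < arcosh t" by simp
  obtain D where D: "D \<in> SO" "mv D a = b" using SO_pairs[of a a b b] by (metis lp_lift_self)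
  have "mv D ` K = L" using D by (simp add: a b mv_cball)
  then have "hyp_congruent K L" unfolding hyp_congruent_def using congruence_mv[OF D(1)] by blast
  then show ?thesis unfolding hyp_disc_def using a b r by blast
qed

text \<open>The opposite normals give both bodies the ideal point \<open>nv\<close> while they lie
  on opposite sides. By \<open>germ_match\<close> the levels are both 0 or both negative.\<close>

lemma spacelike_case:
  assumes K: "body K" and L: "body L" and sym: "sym_pair K L" and gK: "germ K x N" and gL: "germ L y N'"
    and N: "lp N N < 0"
    and lines: "(\<forall>C\<in>components (frontier K) \<union> components (frontier L). straight_line C) \<Longrightarrow>
      finite (components (frontier K)) \<and> finite (components (frontier L))"
  shows False
proof -
  obtain A c where A: "A \<in> SO" "c \<noteq> 0" "A N' = c *\<^sub>R N" "lp (lift y) N' = c * lp (lift x) N"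
    using germ_match[OF K L sym gK gL] .
  have "lp N' N' = lp (A N') (A N')" using A(1) by simp
  also have "\<dots> = c\<^sup>2 * lp N N" unfolding A(3) by (simp add: power2_eq_square)
  finally have N': "lp N' N' < 0" using N A(2) by (simp add: mult_less_0_iff)
  obtain D s where D: "D \<in> SO" "s \<le> 0" "{z. lp (lift z) (sv (-1)) = s} \<subseteq> frontier (mv D ` K)"
    "\<And>z. z \<in> mv D ` K \<Longrightarrow> s \<le> lp (lift z) (sv (-1))" "s = 0 \<longleftrightarrow> lp (lift x) N = 0"
    using norm_side[OF K L sym gK N, of "-1"] by auto
  obtain G t where G: "G \<in> SO" "t \<le> 0" "{z. lp (lift z) (sv 1) = t} \<subseteq> frontier (mv G ` L)"
    "\<And>z. z \<in> mv G ` L \<Longrightarrow> t \<le> lp (lift z) (sv 1)" "t = 0 \<longleftrightarrow> lp (lift y) N' = 0"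
    using norm_side[OF L K sym_pair_commute[OF sym] gL N', of 1] by auto
  have st: "s = 0 \<longleftrightarrow> t = 0" using D(5) G(5) A(2,4) by simp
  note K1 = body_mv[OF K D(1)] and L1 = body_mv[OF L G(1)] and sym1 = sym_pair_mv[OF sym D(1) G(1)]
  show False
  proof (cases "s = 0")
    case True
    have xN: "lp (lift x) N = 0" "lp (lift y) N' = 0" using True st D(5) G(5) by simp_all
    have "finite (components (frontier K)) \<and> finite (components (frontier L))"
      using lines line_components[OF K L sym gL N' xN(2)]
        line_components[OF L K sym_pair_commute[OF sym] gK N xN(1)] by blast
    then have "fin (mv D ` K)" "fin (mv G ` L)"
      using K L D(1) G(1) by (simp_all add: fin_mv fin_components body_def)
    moreover have "half_body (mv D ` K) (-1)" "half_body (mv G ` L) 1"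
      using K1 L1 D(3,4) G(3,4) True st by (unfold_locales; simp)+
    ultimately show False using no_line_pair sym1 by blast
  next
    case False
    then show False using no_cap_pair[OF K1 L1 sym1 _ _ D(3) G(3) D(4) G(4)] D(2) G(2) st by force
  qed
qed

theorem theorem5:
  fixes K L :: "hyp_plane set"
  assumes "K \<noteq> UNIV" and "closed K" and "hyp_convex K" and "interior K \<noteq> {}"
    and "L \<noteq> UNIV" and "closed L" and "hyp_convex L" and "interior L \<noteq> {}"
    and "(\<forall>C \<in> components (frontier K) \<union> components (frontier L). straight_line C) \<longrightarrow>
      finite (components (frontier K)) \<and> finite (components (frontier L))"
  shows "(\<forall>\<phi> \<psi>. congruence \<phi> \<and> orientation_preserving \<phi> \<and>
        congruence \<psi> \<and> orientation_preserving \<psi> \<and>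
        interior (\<phi> ` K \<inter> \<psi> ` L) \<noteq> {} \<longrightarrow>
        centrally_symmetric (\<phi> ` K \<inter> \<psi> ` L))
    \<longleftrightarrow> hyp_disc K \<and> hyp_disc L \<and> hyp_congruent K L"
proof (intro iffI allI impI)
  assume "\<forall>\<phi> \<psi>. congruence \<phi> \<and> orientation_preserving \<phi> \<and>
        congruence \<psi> \<and> orientation_preserving \<psi> \<and>
        interior (\<phi> ` K \<inter> \<psi> ` L) \<noteq> {} \<longrightarrow>
        centrally_symmetric (\<phi> ` K \<inter> \<psi> ` L)"
  then have sym: "sym_pair K L" by (intro sym_pairI) blast
  have K: "body K" and L: "body L" using assms by (simp_all add: body_def)
  obtain x y where "smooth_pt K x" "smooth_pt L y" using exists_smooth[OF K] exists_smooth[OF L] by metis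
  then have "x \<in> frontier K" "y \<in> frontier L" by (simp_all add: smooth_pt_def)
  then obtain N N' where gK: "germ K x N" and gL: "germ L y N'"
    using germ_exists[OF K L sym] germ_exists[OF L K sym_pair_commute[OF sym]] by metis
  consider "lp N N < 0" | "lp N N = 0" | "0 < lp N N" by linarith
  then show "hyp_disc K \<and> hyp_disc L \<and> hyp_congruent K L"
  proof cases
    case 1
    show ?thesis using spacelike_case[OF K L sym gK gL 1] assms(9) by blast
  next
    case 2
    show ?thesis using no_null_germ[OF K L sym gK 2] by blast
  next
    case 3
    show ?thesis by (rule timelike_case[OF K L sym gK gL 3])
  qed
next
  fix \<phi> \<psi>
  assume *: "hyp_disc K \<and> hyp_disc L \<and> hyp_congruent K L"
    "congruence \<phi> \<and> orientation_preserving \<phi> \<and> congruence \<psi> \<and> orientation_preserving \<psi> \<and>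
      interior (\<phi> ` K \<inter> \<psi> ` L) \<noteq> {}"
  \<comment> \<open>Every congruence maps a disc to a disc of the same radius, so the images of
    \<open>K\<close> and \<open>L\<close> are again two discs of equal radius.\<close>
  then obtain c r f where "K = cball c r" "congruence f" "f ` K = L"
    unfolding hyp_disc_def hyp_congruent_def by blast
  then have "K = cball c r" "L = cball (f c) r" by (auto simp: congruence_cball)
  then show "centrally_symmetric (\<phi> ` K \<inter> \<psi> ` L)"
    using * by (simp add: congruence_cball cball_Int_centrally_symmetric)
qed

end
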